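(* Let $M=\mathbb{C}H^2$ be the complex hyperbolic plane. Let $p$ satisfy $2<p<4$ and let $q=r=2p$. Let $\eta$ be a point of the sphere at infinity of $M$. There exist a closed differential $1$-form $\omega$ and a function $u$ on $M$ such that, for every cone $V$ with vertex $\eta$ over a nonempty open subset of the sphere at infinity whose closure does not contain $\eta$, 1. $\omega\in\Omega^{1,r}(V)$ and $u\in\mathcal{R}^{q}(V)$; 2. $[du]\smile[\omega]=0$ in $H^{2,p}(V)$; 3. $[d(u^2)]\smile[\omega]\neq 0$ in $H^{2,p}(V)$.
   Context: For a Riemannian manifold $V$ and $p\geq1$, $\Omega^{k,p}(V)$ is the space of $L^p$ differential $k$-forms whose distributional exterior differential is $L^p$, and $H^{k,p}(V)$ is the degree $k$ cohomology of the complex $(\Omega^{*,p}(V),d)$. If $\frac1p=\frac1q+\frac1r$, the exterior product induces a well-defined cup-product $\smile: H^{k,q}(V)\times H^{\ell,r}(V)\to H^{k+\ell,p}(V)$. The Royden algebra $\mathcal{R}^q(V)$ is the algebra of bounded functions $u$ on $V$ with $du\in L^q$; $u\in\mathcal{R}^q(V)$ defines a class $[du]\in H^{1,q}(V)$. The cone with vertex $\eta$ over a subset $U$ of the sphere at infinity, $\eta\notin U$, is the union in $M$ of the complete geodesics with one endpoint $\eta$ and the other endpoint in $U$. *)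

theory Defs
  imports "HOL-Analysis.Analysis"
begin

subsection \<open>Smooth functions on an open set\<close>

primrec Ck_on :: "nat \<Rightarrow> 'a::euclidean_space set \<Rightarrow> ('a \<Rightarrow> real) \<Rightarrow> bool" where
  "Ck_on 0 S f \<longleftrightarrow> continuous_on S f"
| "Ck_on (Suc n) S f \<longleftrightarrow>
     (\<exists>f'. (\<forall>x\<in>S. (f has_derivative f' x) (at x)) \<and> (\<forall>v. Ck_on n S (\<lambda>x. f' x v)))"

definition smooth_on :: "'a::euclidean_space set \<Rightarrow> ('a \<Rightarrow> real) \<Rightarrow> bool" where
  "smooth_on S f \<longleftrightarrow> (\<forall>n. Ck_on n S f)"

definition test_function :: "'a::euclidean_space set \<Rightarrow> ('a \<Rightarrow> real) \<Rightarrow> bool" where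
  "test_function V \<phi> \<longleftrightarrow>
     smooth_on UNIV \<phi> \<and> compact (closure {x. \<phi> x \<noteq> 0}) \<and> closure {x. \<phi> x \<noteq> 0} \<subseteq> V"

subsection \<open>Differential forms\<close>

text \<open>The manifolds are open subsets \<open>V\<close> of a Euclidean space with a Riemannian metric. A
  \<open>k\<close>-form assigns to each point a function of the vectors \<open>v 0, \<dots>, v (k - 1)\<close>; the other
  entries of \<open>v :: nat \<Rightarrow> 'a\<close> are irrelevant, and so are the values at points outside \<open>V\<close>.\<close>

type_synonym 'a form = "'a \<Rightarrow> (nat \<Rightarrow> 'a) \<Rightarrow> real"

type_synonym 'a metric_tensor = "'a \<Rightarrow> 'a \<Rightarrow> 'a \<Rightarrow> real"

definition alternating :: "nat \<Rightarrow> ((nat \<Rightarrow> 'a::real_vector) \<Rightarrow> real) \<Rightarrow> bool" where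
  "alternating k f \<longleftrightarrow>
     (\<forall>v w. (\<forall>i<k. v i = w i) \<longrightarrow> f v = f w) \<and>
     (\<forall>v. \<forall>i<k. linear (\<lambda>a. f (v(i := a)))) \<and>
     (\<forall>v i j. i < j \<and> j < k \<and> v i = v j \<longrightarrow> f v = 0)"

definition function_form :: "('a \<Rightarrow> real) \<Rightarrow> 'a form" where
  "function_form u = (\<lambda>x v. u x)"

definition zero_form :: "'a form" where
  "zero_form = (\<lambda>x v. 0)"

definition wedge :: "nat \<Rightarrow> nat \<Rightarrow> 'a form \<Rightarrow> 'a form \<Rightarrow> 'a form" where
  "wedge k l \<alpha> \<beta> = (\<lambda>x v.
     (\<Sum>\<sigma> | \<sigma> permutes {..<k + l}.
        of_int (sign \<sigma>) * \<alpha> x (\<lambda>i. v (\<sigma> i)) * \<beta> x (\<lambda>j. v (\<sigma> (k + j))))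
     / (fact k * fact l))"

definition omit :: "nat \<Rightarrow> (nat \<Rightarrow> 'a) \<Rightarrow> nat \<Rightarrow> 'a" where
  "omit i v = (\<lambda>j. if j < i then v j else v (Suc j))"

text \<open>The usual formula for \<open>d\<omega> (v 0, \<dots>, v k)\<close> on constant vector fields, whose brackets vanish.\<close>

definition ext_deriv :: "nat \<Rightarrow> 'a::euclidean_space form \<Rightarrow> 'a form" where
  "ext_deriv k \<omega> = (\<lambda>x v.
     \<Sum>i\<le>k. (- 1) ^ i * frechet_derivative (\<lambda>y. \<omega> y (omit i v)) (at x) (v i))"

definition smooth_closed_form :: "'a::euclidean_space set \<Rightarrow> nat \<Rightarrow> 'a form \<Rightarrow> bool" where
  "smooth_closed_form S k \<omega> \<longleftrightarrow>
     (\<forall>x\<in>S. alternating k (\<omega> x)) \<and> (\<forall>v. smooth_on S (\<lambda>x. \<omega> x v)) \<and>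
     (\<forall>x\<in>S. \<forall>v. ext_deriv k \<omega> x v = 0)"

text \<open>\<open>d\<omega> = \<psi>\<close> in the sense of distributions: the formula of \<open>ext_deriv\<close> with distributional
  directional derivatives. As in the theory of distributions in a chart, functions are paired with
  test functions by means of Lebesgue measure; no metric is involved.\<close>

definition weak_ext_deriv :: "'a::euclidean_space set \<Rightarrow> nat \<Rightarrow> 'a form \<Rightarrow> 'a form \<Rightarrow> bool" where
  "weak_ext_deriv V k \<omega> \<psi> \<longleftrightarrow>
     (\<forall>\<phi> v. test_function V \<phi> \<longrightarrow>
        (LINT x|lebesgue_on V. \<psi> x v * \<phi> x) =
        - (\<Sum>i\<le>k. (- 1) ^ i *
             (LINT x|lebesgue_on V. \<omega> x (omit i v) * frechet_derivative \<phi> (at x) (v i))))"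

subsection \<open>\<open>L\<^sup>p\<close>-forms and \<open>L\<^sup>p\<close>-cohomology\<close>

text \<open>The norm of a \<open>k\<close>-form as a multilinear map. It differs from the Euclidean norm on exterior
  powers by factors bounded in terms of dimension and degree, so it defines the same spaces
  \<open>L\<^sup>p\<close>.\<close>

definition form_norm ::
    "('a \<Rightarrow> 'a \<Rightarrow> real) \<Rightarrow> nat \<Rightarrow> ((nat \<Rightarrow> 'a) \<Rightarrow> real) \<Rightarrow> real" where
  "form_norm b k f = (SUP v\<in>{v. \<forall>i<k. b (v i) (v i) \<le> 1}. \<bar>f v\<bar>)"

definition gram_det :: "('a::euclidean_space \<Rightarrow> 'a \<Rightarrow> real) \<Rightarrow> real" where
  "gram_det b = (\<Sum>\<pi> | \<pi> permutes Basis. of_int (sign \<pi>) * (\<Prod>e\<in>Basis. b e (\<pi> e)))"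

definition lp_forms ::
    "'a::euclidean_space metric_tensor \<Rightarrow> 'a set \<Rightarrow> nat \<Rightarrow> real \<Rightarrow> 'a form set" where
  "lp_forms g V k p = {\<omega>.
     (\<forall>x\<in>V. alternating k (\<omega> x)) \<and>
     (\<forall>v. (\<lambda>x. \<omega> x v) \<in> borel_measurable (lebesgue_on V)) \<and>
     (\<integral>\<^sup>+ x. ennreal (form_norm (g x) k (\<omega> x) powr p * sqrt (gram_det (g x))) \<partial>lebesgue_on V) < \<infinity>}"

text \<open>The space \<open>\<Omega>\<^sup>k\<^sup>,\<^sup>p(V)\<close>, its closed forms and its exact forms. Forms are not identified when they
  agree almost everywhere. In degree \<open>k > 0\<close> null forms are exact, being a differential of \<open>0\<close>, so
  this identification takes place in cohomology; in degree \<open>0\<close> it is made explicitly.\<close>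

definition lp_Omega ::
    "'a::euclidean_space metric_tensor \<Rightarrow> 'a set \<Rightarrow> nat \<Rightarrow> real \<Rightarrow> 'a form set" where
  "lp_Omega g V k p =
     {\<omega> \<in> lp_forms g V k p. \<exists>\<psi>\<in>lp_forms g V (Suc k) p. weak_ext_deriv V k \<omega> \<psi>}"

definition lp_closed ::
    "'a::euclidean_space metric_tensor \<Rightarrow> 'a set \<Rightarrow> nat \<Rightarrow> real \<Rightarrow> 'a form set" where
  "lp_closed g V k p = {\<omega> \<in> lp_Omega g V k p. weak_ext_deriv V k \<omega> zero_form}"

definition lp_exact ::
    "'a::euclidean_space metric_tensor \<Rightarrow> 'a set \<Rightarrow> nat \<Rightarrow> real \<Rightarrow> 'a form set" where
  "lp_exact g V k p = {\<omega> \<in> lp_Omega g V k p.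
     (case k of
        0 \<Rightarrow> \<forall>v. AE x in lebesgue_on V. \<omega> x v = 0
      | Suc m \<Rightarrow> \<exists>\<alpha>\<in>lp_Omega g V m p. weak_ext_deriv V m \<alpha> \<omega>)}"

definition cohomologous ::
    "'a::euclidean_space metric_tensor \<Rightarrow> 'a set \<Rightarrow> nat \<Rightarrow> real \<Rightarrow> ('a form \<times> 'a form) set" where
  "cohomologous g V k p = {(\<omega>, \<omega>').
     \<omega> \<in> lp_closed g V k p \<and> \<omega>' \<in> lp_closed g V k p \<and>
     (\<lambda>x v. \<omega>' x v - \<omega> x v) \<in> lp_exact g V k p}"

definition lp_cohomology ::
    "'a::euclidean_space metric_tensor \<Rightarrow> 'a set \<Rightarrow> nat \<Rightarrow> real \<Rightarrow> 'a form set set" where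
  "lp_cohomology g V k p = lp_closed g V k p // cohomologous g V k p"

definition lp_class ::
    "'a::euclidean_space metric_tensor \<Rightarrow> 'a set \<Rightarrow> nat \<Rightarrow> real \<Rightarrow> 'a form \<Rightarrow> 'a form set" where
  "lp_class g V k p \<omega> = cohomologous g V k p `` {\<omega>}"

text \<open>The cup product of a class in \<open>H\<^sup>k\<^sup>,\<^sup>q(V)\<close> and a class in \<open>H\<^sup>l\<^sup>,\<^sup>r(V)\<close>, where
  \<open>1 / p = 1 / q + 1 / r\<close>. The union is over equal sets.\<close>

definition cup_product ::
    "'a::euclidean_space metric_tensor \<Rightarrow> 'a set \<Rightarrow> nat \<Rightarrow> nat \<Rightarrow> real \<Rightarrow>
     'a form set \<Rightarrow> 'a form set \<Rightarrow> 'a form set" where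
  "cup_product g V k l p A B = (\<Union>\<alpha>\<in>A. \<Union>\<beta>\<in>B. lp_class g V (k + l) p (wedge k l \<alpha> \<beta>))"

definition royden_algebra ::
    "'a::euclidean_space metric_tensor \<Rightarrow> 'a set \<Rightarrow> real \<Rightarrow> ('a \<Rightarrow> real) set" where
  "royden_algebra g V q = {u.
     u \<in> borel_measurable (lebesgue_on V) \<and> bounded (u ` V) \<and>
     (\<exists>\<psi>\<in>lp_forms g V 1 q. weak_ext_deriv V 0 (function_form u) \<psi>)}"

definition royden_differential ::
    "'a::euclidean_space metric_tensor \<Rightarrow> 'a set \<Rightarrow> real \<Rightarrow> ('a \<Rightarrow> real) \<Rightarrow> 'a form" where
  "royden_differential g V q u =
     (SOME \<psi>. \<psi> \<in> lp_forms g V 1 q \<and> weak_ext_deriv V 0 (function_form u) \<psi>)"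

subsection \<open>Geodesics\<close>

text \<open>\<open>g (\<nabla>\<^sub>u v, w)\<close> for constant vector fields \<open>u\<close>, \<open>v\<close>, \<open>w\<close>, given by the Koszul formula.\<close>

definition levi_civita :: "'a::euclidean_space metric_tensor \<Rightarrow> 'a \<Rightarrow> 'a \<Rightarrow> 'a \<Rightarrow> 'a \<Rightarrow> real" where
  "levi_civita g x u v w =
     (frechet_derivative (\<lambda>y. g y v w) (at x) u
      + frechet_derivative (\<lambda>y. g y u w) (at x) v
      - frechet_derivative (\<lambda>y. g y u v) (at x) w) / 2"

definition complete_geodesic ::
    "'a::euclidean_space metric_tensor \<Rightarrow> 'a set \<Rightarrow> (real \<Rightarrow> 'a) \<Rightarrow> bool" where
  "complete_geodesic g S \<gamma> \<longleftrightarrow> (\<exists>\<gamma>' \<gamma>''. \<forall>t.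
     \<gamma> t \<in> S \<and>
     (\<gamma> has_vector_derivative \<gamma>' t) (at t) \<and>
     (\<gamma>' has_vector_derivative \<gamma>'' t) (at t) \<and>
     (\<forall>w. g (\<gamma> t) (\<gamma>'' t) w + levi_civita g (\<gamma> t) (\<gamma>' t) (\<gamma>' t) w = 0))"

subsection \<open>The complex hyperbolic plane\<close>

text \<open>The ball model: the open unit ball of \<open>\<complex>\<^sup>2\<close> with the Bergman metric, normalised to have
  sectional curvature between \<open>- 4\<close> and \<open>- 1\<close>. The sphere at infinity is the unit sphere.\<close>

type_synonym C2 = "complex \<times> complex"

definition hermitian :: "C2 \<Rightarrow> C2 \<Rightarrow> complex" where
  "hermitian z w = fst z * cnj (fst w) + snd z * cnj (snd w)"

definition CH2 :: "C2 set" where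
  "CH2 = ball 0 1"

definition CH2_infinity :: "C2 set" where
  "CH2_infinity = sphere 0 1"

definition CH2_metric :: "C2 metric_tensor" where
  "CH2_metric z v w =
     Re ((1 - hermitian z z) * hermitian v w + hermitian v z * hermitian z w)
     / (1 - (norm z)\<^sup>2)\<^sup>2"

definition CH2_cone :: "C2 \<Rightarrow> C2 set \<Rightarrow> C2 set" where
  "CH2_cone \<eta> U = \<Union> {range \<gamma> | \<gamma>. complete_geodesic CH2_metric CH2 \<gamma> \<and>
     (\<gamma> \<longlongrightarrow> \<eta>) at_bot \<and> (\<exists>\<xi>\<in>U. (\<gamma> \<longlongrightarrow> \<xi>) at_top)}"

end

theory Submission
  imports Defs
begin

text \<open>The vertex is moved to infinity. In the affine coordinates \<open>w = wc\<close> and \<open>n = nc\<close> the ball becomes the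
  Siegel domain \<open>\<rho> = 2 Re n - 1 - |w|\<^sup>2 > 0\<close>, and the geodesics issuing from \<open>\<eta>\<close> are the curves along which
  only \<open>\<rho>\<close> changes; \<open>w\<close> and \<open>s = Im n\<close> are coordinates of their other endpoints, which form a Heisenberg
  group. So a cone is a product of a bounded open set of values \<open>(w, s)\<close> with the half-line \<open>\<rho> > 0\<close>
  (\<open>cone_eq\<close>, \<open>cone_bounded\<close>, \<open>cone_contains_cylinder\<close>). With \<open>w = x + \<i> y\<close> put \<open>u = x exp (- \<rho>)\<close> and
  \<open>\<omega> = dv\<close> for \<open>v = y exp (- \<rho>)\<close>, called \<open>wfun\<close>. Only the behaviour at \<open>\<rho> = 0\<close> matters; the exponential makes everything
  small at the vertex.

  Let \<open>D = 1 - |z|\<^sup>2\<close>. A horizontal vector of unit length has Euclidean size \<open>D\<^sup>1\<^sup>/\<^sup>2\<close>, unit vectors in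
  the complementary directions have size \<open>D\<close>, and the volume density is \<open>D\<^sup>-\<^sup>3\<close>. Hence a form of norm
  \<open>O(D\<^sup>e)\<close> is in \<open>L\<^sup>p\<close> as soon as \<open>e p > 2\<close> (\<open>LpI_decay\<close>). A \<open>1\<close>-form that is smooth up to the sphere has
  \<open>e = 1 / 2\<close>, so \<open>du\<close> and \<open>\<omega>\<close> are in \<open>L\<^sup>q\<close> for \<open>q > 4\<close>. One that vanishes on horizontal vectors has
  \<open>e = 1\<close>. The form \<open>\<alpha>\<^sub>0 = (u dv - v du) / 2 - d(s exp (- 2 \<rho>) / 2)\<close>, essentially the contact form of the
  Heisenberg group, is of this kind, and \<open>d\<alpha>\<^sub>0 = du \<and> \<omega>\<close>. So \<open>[du] \<smile> [\<omega>] = 0\<close> for \<open>p > 2\<close>.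

  Suppose \<open>d(u\<^sup>2) \<and> \<omega> = d\<alpha>\<close> with \<open>\<alpha>\<close> in \<open>L\<^sup>p\<close>. Then \<open>\<beta> = \<alpha> - 2 u \<alpha>\<^sub>0\<close> is in \<open>L\<^sup>p\<close> and \<open>d\<beta> = - 2 du \<and> \<alpha>\<^sub>0\<close>. Let
  \<open>X\<close>, \<open>Y\<close>, \<open>T\<close> be the left-invariant fields of the Heisenberg group, acting at constant \<open>\<rho>\<close>, with
  \<open>[X, Y] = 4 T\<close>. Then \<open>d\<beta>(X, T) = exp (- 3 \<rho>) / 2\<close> and \<open>d\<beta>(X, Y) = 0\<close>. For a bump function \<open>b\<close> of \<open>(w, s)\<close>,
  \<open>d\<beta>\<close> is paired with the bivector field \<open>b X \<and> T + c X \<and> Y\<close>, where \<open>c = - Xb / 4\<close>: after integration by parts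
  the terms in \<open>\<beta>(T)\<close> cancel (\<open>weak_pairing\<close>, \<open>tested_pairing\<close>). Over the slab \<open>\<epsilon> \<le> \<rho> \<le> 2 \<epsilon>\<close> the pairing
  is at least a constant times \<open>\<epsilon>\<close> (\<open>tested_lower\<close>). It is bounded by the integrals of \<open>|\<beta>(X)|\<close> and
  \<open>|\<beta>(Y)|\<close>, that is, of \<open>\<epsilon>\<^sup>-\<^sup>1\<^sup>/\<^sup>2 |\<beta>|\<close>, while the integral of \<open>|\<beta>|\<^sup>p D\<^sup>-\<^sup>3\<close> is finite; by Young's
  inequality the pairing is \<open>O(\<epsilon>\<^sup>1\<^sup>+\<^sup>k)\<close> with \<open>k > 0\<close> if \<open>p < 4\<close> (\<open>remainder_upper\<close>). For small \<open>\<epsilon>\<close> this is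
  a contradiction (\<open>nonvanishing\<close>).

  The classes are defined by distributional derivatives and by arbitrary representatives. That the
  cup-product of \<open>[du]\<close> and \<open>[\<omega>]\<close> is the class of \<open>du \<and> \<omega>\<close> (\<open>cup_product_eq\<close>) rests on the Leibniz rule for
  weakly differentiable factors, proved by mollification (\<open>weak_leibniz_components\<close>).\<close>

section \<open>Smooth functions\<close>

abbreviation fd :: "('a::real_normed_vector \<Rightarrow> real) \<Rightarrow> 'a \<Rightarrow> 'a \<Rightarrow> real" where
  "fd f x \<equiv> frechet_derivative f (at x)"

lemma fd_has_derivative: "f differentiable at x \<Longrightarrow> (f has_derivative fd f x) (at x)"
  by (simp add: frechet_derivative_works)

lemma fd_eq: "(f has_derivative f') (at x) \<Longrightarrow> fd f x = f'"
  by (metis frechet_derivative_at)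

lemma fd_linear: "f differentiable at x \<Longrightarrow> linear (fd f x)"
  by (metis fd_has_derivative has_derivative_linear)

lemma has_derivative_cong_open:
  assumes "open S" "x \<in> S" "\<And>y. y \<in> S \<Longrightarrow> f y = g y"
  shows "(f has_derivative F) (at x) \<longleftrightarrow> (g has_derivative F) (at x)"
proof
  assume "(f has_derivative F) (at x)"
  then show "(g has_derivative F) (at x)"
    by (rule has_derivative_transform_within_open[OF _ assms(1,2)]) (rule assms(3))
next
  assume "(g has_derivative F) (at x)"
  then show "(f has_derivative F) (at x)"
    by (rule has_derivative_transform_within_open[OF _ assms(1,2)]) (rule assms(3)[symmetric])
qed

lemma fd_cong_open:
  assumes "open S" "x \<in> S" "\<And>y. y \<in> S \<Longrightarrow> f y = g y"
  shows "fd f x = fd g x"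
  unfolding frechet_derivative_def using has_derivative_cong_open[OF assms] by simp

lemma Ck_on_cong:
  assumes "open S" "\<And>x. x \<in> S \<Longrightarrow> f x = g x"
  shows "Ck_on n S f = Ck_on n S g"
  using assms(2)
proof (induction n arbitrary: f g)
  case 0
  then show ?case by (simp cong: continuous_on_cong)
next
  case (Suc n)
  have "(f has_derivative F) (at x) \<longleftrightarrow> (g has_derivative F) (at x)" if "x \<in> S" for F x
    by (rule has_derivative_cong_open[OF assms(1) that]) (rule Suc.prems)
  then show ?case by simp
qed

lemma Ck_on_Suc:
  assumes "open S"
  shows "Ck_on (Suc n) S f \<longleftrightarrow>
    (\<forall>x\<in>S. f differentiable at x) \<and> (\<forall>v. Ck_on n S (\<lambda>x. fd f x v))"
proof
    assume "Ck_on (Suc n) S f"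
    then obtain f' where f': "\<forall>x\<in>S. (f has_derivative f' x) (at x)" "\<forall>v. Ck_on n S (\<lambda>x. f' x v)"
      by auto
    have "Ck_on n S (\<lambda>x. fd f x v)" for v
    proof -
      have "fd f x v = f' x v" if "x \<in> S" for x using f'(1) that fd_eq by metis
      then show ?thesis using f'(2) Ck_on_cong[OF assms, of "\<lambda>x. fd f x v" "\<lambda>x. f' x v"] by blast
    qed
    then show "(\<forall>x\<in>S. f differentiable at x) \<and> (\<forall>v. Ck_on n S (\<lambda>x. fd f x v))"
      using f' differentiableI by blast
  next
    assume "(\<forall>x\<in>S. f differentiable at x) \<and> (\<forall>v. Ck_on n S (\<lambda>x. fd f x v))"
    then show "Ck_on (Suc n) S f"
      using fd_has_derivative by (auto intro!: exI[of _ "fd f"])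
qed

lemma Ck_on_differentiable: "open S \<Longrightarrow> Ck_on (Suc n) S f \<Longrightarrow> x \<in> S \<Longrightarrow> f differentiable at x"
  by (simp only: Ck_on_Suc)

lemma Ck_on_fd: "open S \<Longrightarrow> Ck_on (Suc n) S f \<Longrightarrow> Ck_on n S (\<lambda>x. fd f x v)"
  by (simp only: Ck_on_Suc)

lemma Ck_on_lower: "open S \<Longrightarrow> Ck_on (Suc n) S f \<Longrightarrow> Ck_on n S f"
proof (induction n arbitrary: f)
  case 0
  then show ?case
    using Ck_on_differentiable continuous_at_imp_continuous_on differentiable_imp_continuous_within
    by (metis Ck_on.simps(1))
next
  case (Suc n)
  have "\<forall>v. Ck_on n S (\<lambda>x. fd f x v)" using Suc.IH[OF Suc.prems(1) Ck_on_fd[OF Suc.prems]] by blast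
  then show ?case using Ck_on_differentiable[OF Suc.prems] by (simp only: Ck_on_Suc[OF Suc.prems(1)]) blast
qed

lemma Ck_on_subset: "Ck_on n S f \<Longrightarrow> T \<subseteq> S \<Longrightarrow> Ck_on n T f"
proof (induction n arbitrary: f)
  case 0
  then show ?case using continuous_on_subset by auto
next
  case (Suc n)
  then obtain f' where "\<forall>x\<in>S. (f has_derivative f' x) (at x)" "\<forall>v. Ck_on n S (\<lambda>x. f' x v)" by auto
  with Suc show ?case by (auto intro!: exI[of _ f'])
qed

lemma Ck_on_Un:
  assumes "open S" "open T" "Ck_on n S f" "Ck_on n T f"
  shows "Ck_on n (S \<union> T) f"
  using assms(3,4)
proof (induction n arbitrary: f)
  case 0
  then show ?case using assms by (simp add: continuous_on_open_Un)
next
  case (Suc n)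
  have "open (S \<union> T)" using assms by blast
  then show ?case using Suc.IH[OF Ck_on_fd[OF assms(1) Suc.prems(1)] Ck_on_fd[OF assms(2) Suc.prems(2)]]
      Ck_on_differentiable[OF assms(1) Suc.prems(1)] Ck_on_differentiable[OF assms(2) Suc.prems(2)]
    by (simp only: Ck_on_Suc) blast
qed

lemma Ck_on_const: "Ck_on n S (\<lambda>x. c)"
  by (induction n arbitrary: c) (auto intro!: exI[of _ "\<lambda>x v. 0"])

lemma Ck_on_add: "Ck_on n S f \<Longrightarrow> Ck_on n S g \<Longrightarrow> Ck_on n S (\<lambda>x. f x + g x)"
proof (induction n arbitrary: f g)
  case 0
  then show ?case by (simp add: continuous_on_add)
next
  case (Suc n)
  then obtain f' g' where "\<forall>x\<in>S. (f has_derivative f' x) (at x)" "\<forall>v. Ck_on n S (\<lambda>x. f' x v)"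
     "\<forall>x\<in>S. (g has_derivative g' x) (at x)" "\<forall>v. Ck_on n S (\<lambda>x. g' x v)" by auto
  with Suc.IH show ?case
    by (auto intro!: exI[of _ "\<lambda>x v. f' x v + g' x v"] has_derivative_add)
qed

lemma Ck_on_mult:
  assumes "open S"
  shows "Ck_on n S f \<Longrightarrow> Ck_on n S g \<Longrightarrow> Ck_on n S (\<lambda>x. f x * g x)"
proof (induction n arbitrary: f g)
  case 0
  then show ?case by (simp add: continuous_on_mult)
next
  case (Suc n)
  then obtain f' g' where *: "\<forall>x\<in>S. (f has_derivative f' x) (at x)" "\<forall>v. Ck_on n S (\<lambda>x. f' x v)"
     "\<forall>x\<in>S. (g has_derivative g' x) (at x)" "\<forall>v. Ck_on n S (\<lambda>x. g' x v)" by auto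
  have "Ck_on n S f" "Ck_on n S g" using Suc.prems[THEN Ck_on_lower[OF assms]] .
  with * have "Ck_on n S (\<lambda>x. f x * g' x v + f' x v * g x)" for v
    by (intro Ck_on_add Suc.IH) auto
  then show ?case using *
    by (auto intro!: exI[of _ "\<lambda>x v. f x * g' x v + f' x v * g x"] has_derivative_mult)
qed

lemma Ck_on_linear: 
  assumes "linear f" shows "Ck_on n S (f :: 'a::euclidean_space \<Rightarrow> real)"
proof (cases n)
  case 0
  then show ?thesis using assms linear_continuous_on linear_conv_bounded_linear by auto
next
  case (Suc m)
  have "(f has_derivative f) (at x)" for x
    using assms linear_conv_bounded_linear bounded_linear_imp_has_derivative by blast
  then show ?thesis using Suc Ck_on_const by (auto intro!: exI[of _ "\<lambda>x. f"])
qed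

lemma Ck_on_compose:
  fixes h :: "real \<Rightarrow> real"
  assumes "open S" "open T" "f ` S \<subseteq> T"
  shows "Ck_on n T h \<Longrightarrow> Ck_on n S f \<Longrightarrow> Ck_on n S (\<lambda>x. h (f x))"
proof (induction n arbitrary: h)
  case 0
  then show ?case using assms by (auto intro: continuous_on_compose2)
next
  case (Suc n)
  have d: "((\<lambda>x. h (f x)) has_derivative (\<lambda>v. fd h (f x) 1 * fd f x v)) (at x)" if "x \<in> S" for x
  proof -
    have hf: "h differentiable at (f x)" and ff: "f differentiable at x"
      using Ck_on_differentiable[OF assms(2) Suc.prems(1)] Ck_on_differentiable[OF assms(1) Suc.prems(2)] that assms(3)
      by blast+
    have "((\<lambda>x. h (f x)) has_derivative (\<lambda>v. fd h (f x) (fd f x v))) (at x)"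
      using has_derivative_compose[OF fd_has_derivative[OF ff] fd_has_derivative[OF hf]] .
    moreover have "(\<lambda>v. fd h (f x) (fd f x v)) = (\<lambda>v. fd h (f x) 1 * fd f x v)"
    proof
      fix v show "fd h (f x) (fd f x v) = fd h (f x) 1 * fd f x v"
        using linear_cmul[OF fd_linear[OF hf], of "fd f x v" 1] by simp
    qed
    ultimately show ?thesis by simp
  qed
  have "Ck_on n S (\<lambda>x. fd h (f x) 1)"
    using Suc.IH[OF Ck_on_fd[OF assms(2) Suc.prems(1)] Ck_on_lower[OF assms(1) Suc.prems(2)]] .
  then have "Ck_on n S (\<lambda>x. fd h (f x) 1 * fd f x v)" for v
    by (rule Ck_on_mult[OF assms(1) _ Ck_on_fd[OF assms(1) Suc.prems(2)]])
  then show ?case using d by (auto intro!: exI[of _ "\<lambda>x v. fd h (f x) 1 * fd f x v"])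
qed

lemma smooth_on_cong: "open S \<Longrightarrow> (\<And>x. x \<in> S \<Longrightarrow> f x = g x) \<Longrightarrow> smooth_on S f = smooth_on S g"
  unfolding smooth_on_def by (metis Ck_on_cong)

lemma smooth_on_subset: "smooth_on S f \<Longrightarrow> T \<subseteq> S \<Longrightarrow> smooth_on T f"
  unfolding smooth_on_def by (blast intro: Ck_on_subset)

lemma smooth_on_Un: "open S \<Longrightarrow> open T \<Longrightarrow> smooth_on S f \<Longrightarrow> smooth_on T f \<Longrightarrow> smooth_on (S \<union> T) f"
  unfolding smooth_on_def by (blast intro: Ck_on_Un)

lemma smooth_on_const: "smooth_on S (\<lambda>x. c)"
  unfolding smooth_on_def using Ck_on_const by blast

lemma smooth_on_add: "smooth_on S f \<Longrightarrow> smooth_on S g \<Longrightarrow> smooth_on S (\<lambda>x. f x + g x)"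
  unfolding smooth_on_def by (blast intro: Ck_on_add)

lemma smooth_on_mult: "open S \<Longrightarrow> smooth_on S f \<Longrightarrow> smooth_on S g \<Longrightarrow> smooth_on S (\<lambda>x. f x * g x)"
  unfolding smooth_on_def by (blast intro: Ck_on_mult)

lemma smooth_on_cmul: "open S \<Longrightarrow> smooth_on S f \<Longrightarrow> smooth_on S (\<lambda>x. c * f x)"
  by (intro smooth_on_mult smooth_on_const)

lemma smooth_on_minus: "open S \<Longrightarrow> smooth_on S f \<Longrightarrow> smooth_on S (\<lambda>x. - f x)"
  using smooth_on_cmul[of S f "-1"] by simp

lemma smooth_on_diff: "open S \<Longrightarrow> smooth_on S f \<Longrightarrow> smooth_on S g \<Longrightarrow> smooth_on S (\<lambda>x. f x - g x)"
  using smooth_on_add[of S f "\<lambda>x. - g x"] smooth_on_minus by auto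

lemma smooth_on_power: "open S \<Longrightarrow> smooth_on S f \<Longrightarrow> smooth_on S (\<lambda>x. f x ^ n)"
  by (induction n) (auto intro: smooth_on_const smooth_on_mult)

lemma smooth_on_sum:
  "finite I \<Longrightarrow> (\<And>i. i \<in> I \<Longrightarrow> smooth_on S (f i)) \<Longrightarrow> smooth_on S (\<lambda>x. \<Sum>i\<in>I. f i x)"
  by (induction I rule: finite_induct) (auto intro: smooth_on_const smooth_on_add)

lemma smooth_on_linear: "linear f \<Longrightarrow> smooth_on S f"
  unfolding smooth_on_def using Ck_on_linear by blast

lemma smooth_on_compose:
  "open S \<Longrightarrow> open T \<Longrightarrow> smooth_on T h \<Longrightarrow> smooth_on S f \<Longrightarrow> f ` S \<subseteq> T \<Longrightarrow> smooth_on S (\<lambda>x. h (f x))"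
  unfolding smooth_on_def by (blast intro: Ck_on_compose)

lemma smooth_on_differentiable: "open S \<Longrightarrow> smooth_on S f \<Longrightarrow> x \<in> S \<Longrightarrow> f differentiable at x"
  unfolding smooth_on_def by (metis Ck_on_differentiable)

lemma smooth_on_has_derivative:
  "open S \<Longrightarrow> smooth_on S f \<Longrightarrow> x \<in> S \<Longrightarrow> (f has_derivative fd f x) (at x)"
  by (rule fd_has_derivative[OF smooth_on_differentiable])

lemma smooth_on_fd: "open S \<Longrightarrow> smooth_on S f \<Longrightarrow> smooth_on S (\<lambda>x. fd f x v)"
  unfolding smooth_on_def by (blast intro: Ck_on_fd)

lemma smooth_on_continuous: "smooth_on S f \<Longrightarrow> continuous_on S f"
  unfolding smooth_on_def using Ck_on.simps(1) by blast

lemma DERIV_along_line: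
  fixes f :: "'a::euclidean_space \<Rightarrow> real"
  assumes "f differentiable at (a + s *\<^sub>R w)"
  shows "((\<lambda>s. f (a + s *\<^sub>R w)) has_real_derivative fd f (a + s *\<^sub>R w) w) (at s)"
proof -
  have "((\<lambda>s. f (a + s *\<^sub>R w)) has_derivative (\<lambda>r. fd f (a + s *\<^sub>R w) (r *\<^sub>R w))) (at s)"
    by (rule has_derivative_compose[where f = "\<lambda>s. a + s *\<^sub>R w" and g = f])
       (auto intro!: derivative_eq_intros fd_has_derivative assms)
  moreover have "fd f (a + s *\<^sub>R w) (r *\<^sub>R w) = fd f (a + s *\<^sub>R w) w * r" for r
    using linear_cmul[OF fd_linear[OF assms]] by simp
  ultimately show ?thesis by (simp add: has_field_derivative_def)
qed

text \<open>Schwarz: both mixed partials are limits of the same second difference quotient, by applying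
  the mean value theorem in either order.\<close>

lemma second_difference_mean_value:
  fixes f :: "'a::euclidean_space \<Rightarrow> real"
  assumes "open S" "smooth_on S f" "\<And>s t. 0 \<le> s \<Longrightarrow> s \<le> h \<Longrightarrow> 0 \<le> t \<Longrightarrow> t \<le> h \<Longrightarrow> x + s *\<^sub>R u + t *\<^sub>R v \<in> S" "h > 0"
  obtains s t where "0 \<le> s" "s \<le> h" "0 \<le> t" "t \<le> h"
    "f (x + h *\<^sub>R u + h *\<^sub>R v) - f (x + h *\<^sub>R u) - f (x + h *\<^sub>R v) + f x =
       h * h * fd (\<lambda>y. fd f y u) (x + s *\<^sub>R u + t *\<^sub>R v) v"
proof -
  define g where "g s = f (x + s *\<^sub>R u + h *\<^sub>R v) - f (x + s *\<^sub>R u)" for s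
  have df: "((\<lambda>s. f (a + s *\<^sub>R w)) has_real_derivative fd f (a + s *\<^sub>R w) w) (at s)"
    if "a + s *\<^sub>R w \<in> S" "smooth_on S f" for a s w and f :: "'a \<Rightarrow> real"
    by (rule DERIV_along_line[OF smooth_on_differentiable[OF assms(1) that(2,1)]])
  have "(g has_real_derivative fd f (x + s *\<^sub>R u + h *\<^sub>R v) u - fd f (x + s *\<^sub>R u) u) (at s)"
    if "0 \<le> s" "s \<le> h" for s
  proof -
    have "x + h *\<^sub>R v + s *\<^sub>R u \<in> S" "x + s *\<^sub>R u \<in> S"
      using assms(3)[of s h] assms(3)[of s 0] that assms(4) by (auto simp: algebra_simps)
    from df[OF this(1) assms(2)] df[OF this(2) assms(2)] show ?thesis
      unfolding g_def by (auto intro!: DERIV_diff simp: algebra_simps)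
  qed
  then have "\<exists>s. 0 < s \<and> s < h \<and> g h - g 0 = (h - 0) * (fd f (x + s *\<^sub>R u + h *\<^sub>R v) u - fd f (x + s *\<^sub>R u) u)"
    by (rule MVT2[OF assms(4)])
  then obtain s where s: "0 < s" "s < h" "g h - g 0 = h * (fd f (x + s *\<^sub>R u + h *\<^sub>R v) u - fd f (x + s *\<^sub>R u) u)"
    by auto
  have "((\<lambda>t. fd f (x + s *\<^sub>R u + t *\<^sub>R v) u) has_real_derivative 
      fd (\<lambda>y. fd f y u) (x + s *\<^sub>R u + t *\<^sub>R v) v) (at t)" if "0 \<le> t" "t \<le> h" for t
    by (rule df) (use assms(3)[of s t] that s smooth_on_fd[OF assms(1,2)] in auto)
  then have "\<exists>t. 0 < t \<and> t < h \<and> fd f (x + s *\<^sub>R u + h *\<^sub>R v) u - fd f (x + s *\<^sub>R u + 0 *\<^sub>R v) u = (h - 0) * fd (\<lambda>y. fd f y u) (x + s *\<^sub>R u + t *\<^sub>R v) v"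
    by (rule MVT2[OF assms(4)])
  then obtain t where t: "0 < t" "t < h" 
      "fd f (x + s *\<^sub>R u + h *\<^sub>R v) u - fd f (x + s *\<^sub>R u + 0 *\<^sub>R v) u = (h - 0) * fd (\<lambda>y. fd f y u) (x + s *\<^sub>R u + t *\<^sub>R v) v"
    by blast
  show ?thesis by (rule that[of s t]) (use s t in \<open>auto simp: g_def\<close>)
qed

lemma mixed_partials_commute:
  fixes f :: "'a::euclidean_space \<Rightarrow> real"
  assumes "open S" "smooth_on S f" "x \<in> S"
  shows "fd (\<lambda>y. fd f y u) x v = fd (\<lambda>y. fd f y v) x u"
proof (rule ccontr)
  let ?A = "\<lambda>y. fd (\<lambda>y. fd f y u) y v" and ?B = "\<lambda>y. fd (\<lambda>y. fd f y v) y u"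
  assume ne: "?A x \<noteq> ?B x"
  define e where "e = \<bar>?A x - ?B x\<bar> / 2"
  have e: "e > 0" using ne e_def by simp
  have cA: "continuous_on S ?A" and cB: "continuous_on S ?B"
    using assms smooth_on_fd smooth_on_continuous by blast+
  obtain d where d: "d > 0" "ball x d \<subseteq> S" using assms openE by blast
  obtain d1 where d1: "d1 > 0" "\<And>y. y \<in> S \<Longrightarrow> dist y x < d1 \<Longrightarrow> \<bar>?A y - ?A x\<bar> < e"
    using cA e assms(3) unfolding continuous_on_iff dist_real_def by blast
  obtain d2 where d2: "d2 > 0" "\<And>y. y \<in> S \<Longrightarrow> dist y x < d2 \<Longrightarrow> \<bar>?B y - ?B x\<bar> < e"
    using cB e assms(3) unfolding continuous_on_iff dist_real_def by blast
  define c where "c = min d (min d1 d2)"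
  define h where "h = c / (2 * (norm u + norm v + 1))"
  have c: "c > 0" using d d1 d2 c_def by simp
  have pos: "norm u + norm v + 1 > 0" by (smt (verit) norm_ge_zero)
  have h: "h > 0" unfolding h_def using c pos by simp
  have near: "dist (x + s *\<^sub>R u + t *\<^sub>R v) x < c" if "0 \<le> s" "s \<le> h" "0 \<le> t" "t \<le> h" for s t
  proof -
    have "dist (x + s *\<^sub>R u + t *\<^sub>R v) x \<le> norm (s *\<^sub>R u) + norm (t *\<^sub>R v)"
      by (metis dist_norm add.assoc add_diff_cancel_left' norm_triangle_ineq)
    also have "\<dots> \<le> h * norm u + h * norm v"
      using that by (auto intro!: add_mono mult_right_mono)
    also have "\<dots> \<le> h * (norm u + norm v + 1)" using h by (simp add: algebra_simps)
    also have "\<dots> = c / 2" unfolding h_def using pos by (simp only: times_divide_eq_left) (simp add: field_simps)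
    finally show ?thesis using c by simp
  qed
  have inS: "x + s *\<^sub>R u + t *\<^sub>R v \<in> S" if "0 \<le> s" "s \<le> h" "0 \<le> t" "t \<le> h" for s t
    using near[OF that] d c_def by (auto simp: dist_commute subset_iff)
  obtain s t where st: "0 \<le> s" "s \<le> h" "0 \<le> t" "t \<le> h"
    "f (x + h *\<^sub>R u + h *\<^sub>R v) - f (x + h *\<^sub>R u) - f (x + h *\<^sub>R v) + f x = h * h * ?A (x + s *\<^sub>R u + t *\<^sub>R v)"
    using second_difference_mean_value[OF assms(1,2) inS h] by blast
  have inS': "x + s *\<^sub>R v + t *\<^sub>R u \<in> S" if "0 \<le> s" "s \<le> h" "0 \<le> t" "t \<le> h" for s t
    using inS[of t s] that by (simp add: algebra_simps)
  obtain s' t' where st': "0 \<le> s'" "s' \<le> h" "0 \<le> t'" "t' \<le> h"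
    "f (x + h *\<^sub>R v + h *\<^sub>R u) - f (x + h *\<^sub>R v) - f (x + h *\<^sub>R u) + f x = h * h * ?B (x + s' *\<^sub>R v + t' *\<^sub>R u)"
    using second_difference_mean_value[OF assms(1,2) inS' h] by blast
  have "f (x + h *\<^sub>R v + h *\<^sub>R u) = f (x + h *\<^sub>R u + h *\<^sub>R v)" by (simp add: algebra_simps)
  then have "h * h * ?A (x + s *\<^sub>R u + t *\<^sub>R v) = h * h * ?B (x + s' *\<^sub>R v + t' *\<^sub>R u)"
    using st(5) st'(5) by linarith
  then have eq: "?A (x + s *\<^sub>R u + t *\<^sub>R v) = ?B (x + s' *\<^sub>R v + t' *\<^sub>R u)" using h by simp
  have "\<bar>?A (x + s *\<^sub>R u + t *\<^sub>R v) - ?A x\<bar> < e"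
    using d1(2) inS near st c_def by force
  moreover have "\<bar>?B (x + s' *\<^sub>R v + t' *\<^sub>R u) - ?B x\<bar> < e"
    using d2(2) inS[of t' s'] near[of t' s'] st' c_def by (force simp: algebra_simps)
  moreover have "\<bar>a0 - b0\<bar> < 2 * e" if "\<bar>a - a0\<bar> < e" "\<bar>a - b0\<bar> < e" for a a0 b0 :: real
    using that by linarith
  ultimately show False using eq e_def by fastforce
qed

subsection \<open>The exponential, the inverse and a flat function\<close>

lemma smooth_on_exp: "smooth_on UNIV (exp :: real \<Rightarrow> real)"
proof -
  have "Ck_on n UNIV (\<lambda>x. c * exp x :: real)" for n c
  proof (induction n arbitrary: c)
    case (Suc n)
    have "\<forall>x\<in>UNIV. ((\<lambda>x. c * exp x) has_derivative (\<lambda>v. (c * v) * exp x)) (at x)"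
      by (auto intro!: derivative_eq_intros simp: has_field_derivative_def)
    moreover have "\<forall>v. Ck_on n UNIV (\<lambda>x. (c * v) * exp x)" using Suc by blast
    ultimately show ?case unfolding Ck_on.simps by (intro exI[of _ "\<lambda>x v. (c * v) * exp x"]) blast
  qed (auto intro!: continuous_intros)
  from this[of _ 1] show ?thesis unfolding smooth_on_def by simp
qed

lemma DERIV_inverse_power_nat:
  "x \<noteq> 0 \<Longrightarrow> ((\<lambda>x. inverse x ^ k) has_real_derivative - real k * inverse x ^ Suc k) (at x)"
proof (cases k)
  case (Suc m)
  assume "x \<noteq> 0"
  from DERIV_power[OF DERIV_inverse[OF this, of UNIV], of k]
  have "((\<lambda>x. inverse x ^ k) has_real_derivative
     real k * (- (inverse x ^ Suc (Suc 0)) * inverse x ^ (k - Suc 0))) (at x)" by simp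
  moreover have "real k * (- (inverse x ^ Suc (Suc 0)) * inverse x ^ (k - Suc 0)) = - real k * inverse x ^ Suc k"
    using Suc by (simp add: algebra_simps)
  ultimately show ?thesis by (simp only:)
qed simp

lemma smooth_on_inverse: "smooth_on (- {0}) (inverse :: real \<Rightarrow> real)"
proof -
  have "Ck_on n (- {0}) (\<lambda>x. c * inverse x ^ k :: real)" for n c k
  proof (induction n arbitrary: c k)
    case (Suc n)
    have "((\<lambda>x. c * inverse x ^ k) has_derivative (\<lambda>v. (- c * real k * v) * inverse x ^ Suc k)) (at x)" if "x \<noteq> 0" for x :: real
    proof -
      have "((\<lambda>x. c * inverse x ^ k) has_real_derivative c * (- real k * inverse x ^ Suc k)) (at x)"
        by (intro DERIV_cmult DERIV_inverse_power_nat that)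
      moreover have "(*) (c * (- real k * inverse x ^ Suc k)) = (\<lambda>v. (- c * real k * v) * inverse x ^ Suc k)"
        by (simp add: fun_eq_iff mult_ac)
      ultimately show ?thesis unfolding has_field_derivative_def by simp
    qed
    moreover have "\<forall>v. Ck_on n (- {0}) (\<lambda>x. (- c * real k * v) * inverse x ^ Suc k)" using Suc by blast
    ultimately show ?case unfolding Ck_on.simps
      by (intro exI[of _ "\<lambda>x v. (- c * real k * v) * inverse x ^ Suc k"]) auto
  qed (auto intro!: continuous_intros)
  from this[of _ 1 1] show ?thesis unfolding smooth_on_def by simp
qed

definition flat_exp :: "real \<Rightarrow> real" where
  "flat_exp t = (if t > 0 then exp (- inverse t) else 0)"

lemma flat_exp_nonneg: "0 \<le> flat_exp t"
  and flat_exp_pos_iff: "0 < flat_exp t \<longleftrightarrow> 0 < t"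
  and flat_exp_le_1: "flat_exp t \<le> 1"
  by (auto simp: flat_exp_def)

lemma flat_exp_mono: "s \<le> t \<Longrightarrow> flat_exp s \<le> flat_exp t"
  by (auto simp: flat_exp_def)

text \<open>The functions \<open>t\<^sup>-\<^sup>k exp (- 1 / t)\<close>, extended by \<open>0\<close>, are closed under differentiation up to
  linear combinations; at \<open>0\<close> they are \<open>O(t\<^sup>2)\<close>.\<close>

lemma smooth_on_flat_exp: "smooth_on UNIV flat_exp"
proof -
  define G where "G k t = (if t > 0 then inverse t ^ k * exp (- inverse t) else 0)" for k and t :: real
  have bound: "\<bar>G k t\<bar> \<le> fact (k + 2) * t\<^sup>2" for k t
  proof (cases "t > 0")
    case True
    have "inverse t ^ (k + 2) / fact (k + 2) \<le> exp (inverse t)"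
    proof -
      have s: "(\<lambda>n. inverse t ^ n /\<^sub>R fact n) sums exp (inverse t)" by (rule exp_converges)
      have "sum (\<lambda>n. inverse t ^ n /\<^sub>R fact n) {k + 2} \<le> suminf (\<lambda>n. inverse t ^ n /\<^sub>R fact n)"
        using True sums_summable[OF s] by (intro sum_le_suminf) auto
      then show ?thesis using sums_unique[OF s] by (simp add: field_simps)
    qed
    then have "inverse t ^ (k + 2) \<le> fact (k + 2) * exp (inverse t)"
      by (simp add: divide_le_eq mult.commute)
    then have "inverse t ^ (k + 2) * exp (- inverse t) \<le> fact (k + 2)"
      using mult_right_mono[of "inverse t ^ (k + 2)" "fact (k + 2) * exp (inverse t)" "exp (- inverse t)"]
      by (simp only: mult.assoc exp_minus_inverse) simp
    then have "inverse t ^ (k + 2) * exp (- inverse t) * t\<^sup>2 \<le> fact (k + 2) * t\<^sup>2"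
      by (simp add: mult_right_mono)
    moreover have "inverse t ^ (k + 2) * exp (- inverse t) * t\<^sup>2 = G k t"
      using True by (simp add: G_def power_add field_simps power2_eq_square)
    moreover have "G k t \<ge> 0" using True by (simp add: G_def)
    ultimately show ?thesis by linarith
  qed (simp add: G_def)
  have der: "(G k has_derivative (\<lambda>v. v * (G (k + 2) t - real k * G (k + 1) t))) (at t)" for k t
  proof -
    consider "t > 0" | "t < 0" | "t = 0" by linarith
    then show ?thesis
    proof cases
      case 1
      have "((\<lambda>t. inverse t ^ k * exp (- inverse t)) has_derivative (\<lambda>v. v * (G (k + 2) t - real k * G (k + 1) t))) (at t)"
      proof -
        have "((\<lambda>t. exp (- inverse t)) has_real_derivative exp (- inverse t) * inverse t ^ 2) (at t)"
          using 1 DERIV_chain2[OF DERIV_exp DERIV_minus[OF DERIV_inverse[of t UNIV]]]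
          by (simp add: numeral_2_eq_2)
        from DERIV_mult[OF DERIV_inverse_power_nat[of t k] this] 1
        have "((\<lambda>t. inverse t ^ k * exp (- inverse t)) has_real_derivative
            - real k * inverse t ^ Suc k * exp (- inverse t) + exp (- inverse t) * inverse t ^ 2 * inverse t ^ k) (at t)" by simp
        moreover have "(*) (- real k * inverse t ^ Suc k * exp (- inverse t) + exp (- inverse t) * inverse t ^ 2 * inverse t ^ k) =
            (\<lambda>v. v * (G (k + 2) t - real k * G (k + 1) t))"
          using 1 by (simp add: fun_eq_iff G_def algebra_simps power2_eq_square)
        ultimately show ?thesis unfolding has_field_derivative_def by simp
      qed
      then show ?thesis
        by (rule has_derivative_transform_within_open[of _ _ _ _ "{0<..}"]) (use 1 in \<open>auto simp: G_def\<close>)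
    next
      case 2
      have "((\<lambda>t. 0) has_derivative (\<lambda>v. v * (G (k + 2) t - real k * G (k + 1) t))) (at t)"
        using 2 by (simp add: G_def)
      then show ?thesis
        by (rule has_derivative_transform_within_open[of _ _ _ _ "{..<0}"]) (use 2 in \<open>auto simp: G_def\<close>)
    next
      case 3
      have "((\<lambda>y. norm (G k y - G k 0) / norm (y - 0)) \<longlongrightarrow> 0) (at 0)"
      proof (rule tendsto_sandwich[of "\<lambda>_. 0" _ _ "\<lambda>y. fact (k + 2) * \<bar>y\<bar>"])
        show "\<forall>\<^sub>F y in at 0. norm (G k y - G k 0) / norm (y - 0) \<le> fact (k + 2) * \<bar>y\<bar>"
        proof (intro always_eventually allI)
          fix y
          have "norm (G k y - G k 0) \<le> fact (k + 2) * \<bar>y\<bar> * \<bar>y\<bar>"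
            using bound[of k y] by (simp add: G_def power2_eq_square mult.assoc del: fact_Suc)
          then show "norm (G k y - G k 0) / norm (y - 0) \<le> fact (k + 2) * \<bar>y\<bar>"
            by (cases "y = 0") (auto simp: divide_le_eq simp del: fact_Suc)
        qed
        show "((\<lambda>y. fact (k + 2) * \<bar>y\<bar>) \<longlongrightarrow> 0) (at (0::real))" by (auto intro!: tendsto_eq_intros)
      qed auto
      then have "(G k has_derivative (\<lambda>v. 0)) (at 0)"
        unfolding has_derivative_iff_norm by simp
      then show ?thesis using 3 by (simp add: G_def)
    qed
  qed
  have "Ck_on n UNIV (G k)" for n k
  proof (induction n arbitrary: k)
    case 0
    then show ?case by (auto intro!: continuous_at_imp_continuous_on has_derivative_continuous[OF der])
  next
    case (Suc n)
    have "Ck_on n UNIV (\<lambda>t. v * (G (k + 2) t + (- real k) * G (k + 1) t))" for v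
      using Suc by (intro Ck_on_mult Ck_on_add Ck_on_const) auto
    then show ?case using der by (auto intro!: exI[of _ "\<lambda>t v. v * (G (k + 2) t - real k * G (k + 1) t)"])
  qed
  moreover have "G 0 = flat_exp" by (auto simp: G_def flat_exp_def)
  ultimately show ?thesis unfolding smooth_on_def by metis
qed

subsection \<open>Test functions\<close>

lemma smooth_on_extend_zero:
  fixes f :: "'a::euclidean_space \<Rightarrow> real"
  assumes "open S" "smooth_on S f" "compact K" "K \<subseteq> S" "\<And>x. x \<in> S \<Longrightarrow> x \<notin> K \<Longrightarrow> f x = 0"
  shows "smooth_on UNIV (\<lambda>x. if x \<in> S then f x else 0)"
proof -
  let ?g = "\<lambda>x. if x \<in> S then f x else 0"
  have "smooth_on S ?g" using assms smooth_on_cong[of S ?g f] by simp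
  moreover have "open (- K)" using assms(3) by (simp add: compact_imp_closed open_Compl)
  moreover from this have "smooth_on (- K) ?g"
    using assms(5) smooth_on_cong[of "- K" ?g "\<lambda>x. 0"] smooth_on_const by auto
  moreover have "S \<union> - K = UNIV" using assms(4) by blast
  ultimately show ?thesis using smooth_on_Un[OF assms(1)] by metis
qed

lemma test_functionI:
  assumes "smooth_on UNIV f" "compact K" "K \<subseteq> V" "\<And>x. x \<notin> K \<Longrightarrow> f x = 0"
  shows "test_function V f"
proof -
  have "closure {x. f x \<noteq> 0} \<subseteq> K"
    by (rule closure_minimal) (use assms compact_imp_closed in auto)
  then show ?thesis unfolding test_function_def using assms
    using closed_Int_compact[OF closed_closure, of K "{x. f x \<noteq> 0}"] by (auto simp: Int_absorb2)
qed

lemma test_function_extend_zero: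
  fixes f :: "'a::euclidean_space \<Rightarrow> real"
  assumes "open S" "smooth_on S f" "compact K" "K \<subseteq> S" "K \<subseteq> V" "\<And>x. x \<in> S \<Longrightarrow> x \<notin> K \<Longrightarrow> f x = 0"
  shows "test_function V (\<lambda>x. if x \<in> S then f x else 0)"
  by (rule test_functionI[OF smooth_on_extend_zero[OF assms(1-4,6)] assms(3,5)]) (use assms in auto)

definition tsupp :: "('a::topological_space \<Rightarrow> real) \<Rightarrow> 'a set" where
  "tsupp f = closure {x. f x \<noteq> 0}"

lemma test_functionD:
  assumes "test_function V f"
  shows "smooth_on UNIV f" "compact (tsupp f)" "tsupp f \<subseteq> V"
  using assms unfolding test_function_def tsupp_def by auto

lemma tsupp_zero: "x \<notin> tsupp f \<Longrightarrow> f x = 0"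
  unfolding tsupp_def using closure_subset[of "{x. f x \<noteq> 0}"] by auto

lemma fd_tsupp_zero: 
  assumes "x \<notin> tsupp f" shows "fd f x = (\<lambda>v. 0)"
proof -
  have "fd f x = fd (\<lambda>x. 0) x"
    by (rule fd_cong_open[of "- tsupp f"]) (use assms tsupp_zero in \<open>auto simp: tsupp_def\<close>)
  then show ?thesis by (simp add: fd_eq[OF has_derivative_const])
qed

lemma test_function_fd:
  assumes "test_function V f" shows "test_function V (\<lambda>x. fd f x v)"
  using test_functionD[OF assms] fd_tsupp_zero smooth_on_fd[of UNIV]
  by (intro test_functionI[of _ "tsupp f"]) (auto simp: fun_eq_iff)

lemma test_function_mult:
  assumes "test_function V f" "smooth_on UNIV g" shows "test_function V (\<lambda>x. f x * g x)"
  using test_functionD[OF assms(1)] tsupp_zero[of _ f] assms(2)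
  by (intro test_functionI[of _ "tsupp f"]) (auto intro: smooth_on_mult)

section \<open>Integration by parts and mollification\<close>

lemma integrable_indicator_compact:
  "compact (K :: 'a::euclidean_space set) \<Longrightarrow> integrable lborel (indicator K :: 'a \<Rightarrow> real)"
  by (rule integrable_real_indicator[OF _ emeasure_bounded_finite[OF compact_imp_bounded]])
     (auto intro: borel_compact)

lemma integrable_compact_support:
  fixes f :: "'a::euclidean_space \<Rightarrow> real"
  assumes "continuous_on UNIV f" "compact K" "\<And>x. x \<notin> K \<Longrightarrow> f x = 0"
  shows "integrable lborel f"
proof -
  have "(\<lambda>x. indicator K x *\<^sub>R f x) = f" using assms(3) by (auto simp: indicator_def fun_eq_iff)
  then show ?thesis using borel_integrable_compact[OF assms(2) continuous_on_subset[OF assms(1)]] by simp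
qed

lemma bounded_compact_support:
  fixes f :: "'a::euclidean_space \<Rightarrow> real"
  assumes "continuous_on UNIV f" "compact K" "\<And>x. x \<notin> K \<Longrightarrow> f x = 0"
  obtains B where "B > 0" "\<And>x. \<bar>f x\<bar> \<le> B"
proof -
  have "bounded (f ` K)"
    using compact_continuous_image[OF continuous_on_subset[OF assms(1)] assms(2)] compact_imp_bounded by auto
  then obtain B where B: "B > 0" "\<forall>y\<in>f ` K. norm y \<le> B" unfolding bounded_pos by blast
  have "\<bar>f x\<bar> \<le> B" for x using B assms(3)[of x] by (cases "x \<in> K") auto
  then show ?thesis using B that by blast
qed

lemma uniformly_continuous_compact_support:
  fixes f :: "'a::euclidean_space \<Rightarrow> real"
  assumes "continuous_on UNIV f" "compact K" "\<And>x. x \<notin> K \<Longrightarrow> f x = 0" "e > 0"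
  obtains d where "d > 0" "\<And>x h. norm h < d \<Longrightarrow> \<bar>f (x + h) - f x\<bar> < e"
proof -
  let ?K = "{x + y | x y. x \<in> K \<and> y \<in> cball 0 1}"
  have "compact ?K" using compact_sums[OF assms(2) compact_cball] .
  then have "uniformly_continuous_on ?K f"
    using compact_uniformly_continuous continuous_on_subset[OF assms(1)] by blast
  then have "\<exists>d>0. \<forall>x\<in>?K. \<forall>y\<in>?K. dist y x < d \<longrightarrow> dist (f y) (f x) < e"
    unfolding uniformly_continuous_on_def using assms(4) by fast
  then obtain d where d: "d > 0" "\<forall>x\<in>?K. \<forall>y\<in>?K. dist y x < d \<longrightarrow> dist (f y) (f x) < e"
    by (elim exE conjE)
  have "\<bar>f (x + h) - f x\<bar> < e" if h: "norm h < min d 1" for x h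
  proof (cases "x \<in> K \<or> x + h \<in> K")
    case True
    have K: "y + z \<in> ?K" if "y \<in> K" "norm z \<le> 1" for y z
    proof -
      have "z \<in> cball 0 1" using that(2) by simp
      with that(1) show ?thesis by blast
    qed
    have "x \<in> ?K \<and> x + h \<in> ?K"
    proof (cases "x \<in> K")
      case True
      then show ?thesis using K[of x 0] K[of x h] h by simp
    next
      case False
      then have "x + h \<in> K" using \<open>x \<in> K \<or> x + h \<in> K\<close> by simp
      then show ?thesis using K[of "x + h" 0] K[of "x + h" "- h"] h by simp
    qed
    moreover have "dist (x + h) x < d" using h by (simp add: dist_norm)
    ultimately show ?thesis using d(2)[THEN bspec, of x, THEN bspec, of "x + h"] by (simp only: dist_real_def simp_thms)
  qed (use assms in auto)
  then show ?thesis using that[of "min d 1"] d(1) by auto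
qed

lemma test_function_continuous: "test_function V f \<Longrightarrow> continuous_on S f"
  using test_functionD(1) smooth_on_continuous continuous_on_subset by blast

lemma test_function_differentiable: "test_function V f \<Longrightarrow> f differentiable at x"
  using smooth_on_differentiable[OF open_UNIV test_functionD(1)] by blast

lemma test_function_bounded:
  assumes "test_function V (f :: 'a::euclidean_space \<Rightarrow> real)"
  obtains B where "B > 0" "\<And>x. \<bar>f x\<bar> \<le> B"
  by (rule bounded_compact_support[OF test_function_continuous[OF assms] test_functionD(2)[OF assms] tsupp_zero[of _ f]]) (use that in auto)

lemma mean_value_line:
  fixes f :: "'a::euclidean_space \<Rightarrow> real"
  assumes "\<And>x. f differentiable at x" "t > 0"
  obtains z where "0 < z" "z < t" "f (x + t *\<^sub>R v) - f x = t * fd f (x + z *\<^sub>R v) v"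
proof -
  have "\<exists>z. 0 < z \<and> z < t \<and> f (x + t *\<^sub>R v) - f (x + 0 *\<^sub>R v) = (t - 0) * fd f (x + z *\<^sub>R v) v"
    by (rule MVT2[OF assms(2)]) (rule DERIV_along_line[OF assms(1)])
  then show ?thesis using that by auto
qed

lemma lborel_integral_translate:
  fixes f :: "'a::euclidean_space \<Rightarrow> real"
  assumes "f \<in> borel_measurable borel"
  shows "(\<integral>x. f (x + c) \<partial>lborel) = (\<integral>x. f x \<partial>lborel)"
    "integrable lborel (\<lambda>x. f (x + c)) \<longleftrightarrow> integrable lborel f"
proof -
  have "(\<integral>x. f x \<partial>lborel) = (\<integral>x. f x \<partial>distr lborel borel ((+) c))" by (simp add: lborel_distr_plus)
  also have "\<dots> = (\<integral>x. f (c + x) \<partial>lborel)" by (rule integral_distr) (use assms in auto)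
  finally show "(\<integral>x. f (x + c) \<partial>lborel) = (\<integral>x. f x \<partial>lborel)" by (simp add: add.commute)
  have "integrable lborel f \<longleftrightarrow> integrable (distr lborel borel ((+) c)) f" by (simp add: lborel_distr_plus)
  also have "\<dots> \<longleftrightarrow> integrable lborel (\<lambda>x. f (c + x))" by (rule integrable_distr_eq) (use assms in auto)
  finally show "integrable lborel (\<lambda>x. f (x + c)) \<longleftrightarrow> integrable lborel f" by (simp add: add.commute)
qed

text \<open>The integral of a difference quotient vanishes by translation invariance, and the quotients
  converge boundedly.\<close>

lemma integral_fd_eq_0:
  fixes F :: "'a::euclidean_space \<Rightarrow> real"
  assumes F: "test_function V F"
  shows "(\<integral>x. fd F x v \<partial>lborel) = 0"
proof -
  obtain B where B: "B > 0" "\<And>x. \<bar>fd F x v\<bar> \<le> B" by (rule test_function_bounded[OF test_function_fd[OF F, of v]]) blast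
  obtain R where R: "R > 0" "\<And>x. x \<in> tsupp F \<Longrightarrow> norm x \<le> R"
    using compact_imp_bounded[OF test_functionD(2)[OF F]] unfolding bounded_pos by blast
  define s where "s n x = (F (x + inverse (real (Suc n)) *\<^sub>R v) - F x) * real (Suc n)" for n x
  have mF: "F \<in> borel_measurable borel" 
    using test_function_continuous[OF F, of UNIV] by (simp add: borel_measurable_continuous_onI)
  have iF: "integrable lborel F"
    by (rule integrable_compact_support[OF test_function_continuous[OF F] test_functionD(2)[OF F] tsupp_zero[of _ F]])
  have "(\<lambda>n. \<integral>x. s n x \<partial>lborel) \<longlonglongrightarrow> (\<integral>x. fd F x v \<partial>lborel)"
  proof (rule integral_dominated_convergence[where w = "\<lambda>x. B * indicator (cball 0 (R + norm v)) x"])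
    show "(\<lambda>x. fd F x v) \<in> borel_measurable lborel"
      using test_function_continuous[OF test_function_fd[OF F], of UNIV v] by (simp add: borel_measurable_continuous_onI)
    show "s n \<in> borel_measurable lborel" for n using mF unfolding s_def by measurable
    show "integrable lborel (\<lambda>x. B * indicator (cball 0 (R + norm v)) x :: real)"
      by (intro integrable_mult_right integrable_indicator_compact compact_cball)
    show "AE x in lborel. (\<lambda>n. s n x) \<longlonglongrightarrow> fd F x v"
    proof (rule AE_I2)
      fix x
      have "((\<lambda>t. F (x + t *\<^sub>R v)) has_real_derivative fd F (x + 0 *\<^sub>R v) v) (at 0)"
        by (rule DERIV_along_line[OF test_function_differentiable[OF F]])
      then have "((\<lambda>t. (F (x + t *\<^sub>R v) - F x) / t) \<longlongrightarrow> fd F x v) (at 0)"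
        by (simp add: DERIV_def)
      moreover have "filterlim (\<lambda>n. inverse (real (Suc n))) (at 0) sequentially"
        unfolding filterlim_at using LIMSEQ_inverse_real_of_nat by auto
      ultimately have "(\<lambda>n. (F (x + inverse (real (Suc n)) *\<^sub>R v) - F x) / inverse (real (Suc n))) \<longlonglongrightarrow> fd F x v"
        by (rule filterlim_compose)
      then show "(\<lambda>n. s n x) \<longlonglongrightarrow> fd F x v" by (simp add: s_def divide_inverse)
    qed
    show "AE x in lborel. norm (s n x) \<le> B * indicator (cball 0 (R + norm v)) x" for n
    proof (rule AE_I2)
      fix x
      let ?t = "inverse (real (Suc n))"
      have t: "0 < ?t" "?t \<le> 1" by (auto simp: field_simps)
      show "norm (s n x) \<le> B * indicator (cball 0 (R + norm v)) x"
      proof (cases "norm x \<le> R + norm v")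
        case True
        obtain z where z: "F (x + ?t *\<^sub>R v) - F x = ?t * fd F (x + z *\<^sub>R v) v"
          using mean_value_line[OF test_function_differentiable[OF F] t(1), of x v] by blast
        have "s n x = fd F (x + z *\<^sub>R v) v" unfolding s_def z by simp
        then show ?thesis using True B(2)[of "x + z *\<^sub>R v"] by (simp add: dist_norm)
      next
        case False
        have "norm (x + ?t *\<^sub>R v) \<ge> norm x - norm (?t *\<^sub>R v)" using norm_diff_ineq by blast
        moreover have "norm (?t *\<^sub>R v) \<le> norm v" using t mult_right_mono[OF t(2) norm_ge_zero[of v]] by simp
        ultimately have "x \<notin> tsupp F" "x + ?t *\<^sub>R v \<notin> tsupp F" using R(2)[of x] R(2)[of "x + ?t *\<^sub>R v"] False norm_ge_zero[of v] by linarith+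
        then show ?thesis using False tsupp_zero[of _ F] by (simp add: s_def)
      qed
    qed
  qed
  moreover have "(\<integral>x. s n x \<partial>lborel) = 0" for n
    unfolding s_def using lborel_integral_translate[OF mF, of "inverse (real (Suc n)) *\<^sub>R v"] iF by simp
  ultimately show ?thesis using LIMSEQ_unique[OF _ tendsto_const] by simp
qed

lemma lebesgue_integral_eq_lborel:
  fixes f :: "'a::euclidean_space \<Rightarrow> real"
  assumes "f \<in> borel_measurable borel"
  shows "(LINT x|lebesgue. f x) = (\<integral>x. f x \<partial>lborel)" "integrable lebesgue f \<longleftrightarrow> integrable lborel f"
  using integral_completion[of f lborel] integrable_completion[of f lborel] assms by auto

lemma lebesgue_on_integral:
  fixes f :: "'a::euclidean_space \<Rightarrow> real"
  assumes "V \<in> sets lebesgue"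
  shows "(LINT x|lebesgue_on V. f x) = (LINT x|lebesgue. indicator V x * f x)"
    "integrable (lebesgue_on V) f \<longleftrightarrow> integrable lebesgue (\<lambda>x. indicator V x * f x)"
  using integral_restrict_space[of V lebesgue f] integrable_restrict_space[of V lebesgue f] assms by auto

lemma integration_by_parts:
  fixes u :: "'a::euclidean_space \<Rightarrow> real"
  assumes V: "open V" and u: "smooth_on V u" and \<phi>: "test_function V \<phi>"
  shows "(LINT x|lebesgue_on V. fd u x v * \<phi> x) = - (LINT x|lebesgue_on V. u x * fd \<phi> x v)"
proof -
  have VL: "V \<in> sets lebesgue" using V by (simp add: borel_open)
  have ext: "test_function V (\<lambda>x. if x \<in> V then f x * g x else 0)" if "smooth_on V f" "test_function V g" for f g
    by (rule test_function_extend_zero[OF V _ test_functionD(2)[OF that(2)]])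
       (use test_functionD[OF that(2)] that V tsupp_zero[of _ g] in \<open>auto intro!: smooth_on_mult smooth_on_subset[of UNIV g]\<close>)
  define F where "F = (\<lambda>x. if x \<in> V then u x * \<phi> x else 0)"
  define A where "A = (\<lambda>x. if x \<in> V then fd u x v * \<phi> x else 0)"
  define B where "B = (\<lambda>x. if x \<in> V then u x * fd \<phi> x v else 0)"
  have tF: "test_function V F" and tA: "test_function V A" and tB: "test_function V B"
    unfolding F_def A_def B_def using ext[OF u \<phi>] ext[OF smooth_on_fd[OF V u] \<phi>] ext[OF u test_function_fd[OF \<phi>]] by auto
  have i: "integrable lborel f" "f \<in> borel_measurable borel" if "test_function V f" for f
    using integrable_compact_support[OF test_function_continuous[OF that] test_functionD(2)[OF that] tsupp_zero[of _ f]]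
      test_function_continuous[OF that, of UNIV] by (auto intro: borel_measurable_continuous_onI)
  have "fd F x v = A x + B x" for x
  proof (cases "x \<in> V")
    case True
    have "fd F x = fd (\<lambda>x. u x * \<phi> x) x" by (rule fd_cong_open[OF V True]) (simp add: F_def)
    also have "\<dots> = (\<lambda>v. u x * fd \<phi> x v + fd u x v * \<phi> x)"
      by (intro fd_eq has_derivative_mult fd_has_derivative test_function_differentiable[OF \<phi>] smooth_on_differentiable[OF V u True])
    finally show ?thesis using True by (simp add: A_def B_def)
  next
    case False
    then have "x \<notin> tsupp F" using test_functionD(3)[OF tF] by blast
    then show ?thesis using False by (simp add: fd_tsupp_zero A_def B_def)
  qed
  then have "(\<integral>x. A x + B x \<partial>lborel) = 0" using integral_fd_eq_0[OF tF, of v] by simp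
  then have "(\<integral>x. A x \<partial>lborel) = - (\<integral>x. B x \<partial>lborel)" using i[OF tA] i[OF tB] by simp
  moreover have "(LINT x|lebesgue_on V. fd u x v * \<phi> x) = (LINT x|lebesgue. A x)"
    unfolding lebesgue_on_integral[OF VL] A_def by (rule arg_cong[where f = "integral\<^sup>L lebesgue"]) (auto simp: indicator_def)
  moreover have "(LINT x|lebesgue_on V. u x * fd \<phi> x v) = (LINT x|lebesgue. B x)"
    unfolding lebesgue_on_integral[OF VL] B_def by (rule arg_cong[where f = "integral\<^sup>L lebesgue"]) (auto simp: indicator_def)
  ultimately show ?thesis using lebesgue_integral_eq_lborel i(2)[OF tA] i(2)[OF tB] by metis
qed

subsection \<open>Convolution with a test function\<close>

lemma test_function_uniform_derivative:
  fixes k :: "'a::euclidean_space \<Rightarrow> real"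
  assumes k: "test_function V k" and e: "e > 0"
  obtains d where "d > 0" "\<And>x h. norm h < d \<Longrightarrow> \<bar>k (x + h) - k x - fd k x h\<bar> \<le> e * norm h"
proof -
  let ?c = "e / DIM('a)"
  have "\<forall>b\<in>Basis. \<exists>d>0. \<forall>x h. norm h < d \<longrightarrow> \<bar>fd k (x + h) b - fd k x b\<bar> < ?c"
  proof
    fix b :: 'a
    have t: "test_function V (\<lambda>x. fd k x b)" by (rule test_function_fd[OF k])
    have "?c > 0" using e by simp
    from uniformly_continuous_compact_support[OF test_function_continuous[OF t] test_functionD(2)[OF t] tsupp_zero[of _ "\<lambda>x. fd k x b"] this]
    show "\<exists>d>0. \<forall>x h. norm h < d \<longrightarrow> \<bar>fd k (x + h) b - fd k x b\<bar> < ?c" by metis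
  qed
  then obtain d where d: "\<And>b. b \<in> Basis \<Longrightarrow> d b > 0"
     "\<And>b x h. b \<in> Basis \<Longrightarrow> norm h < d b \<Longrightarrow> \<bar>fd k (x + h) b - fd k x b\<bar> < ?c" by metis
  define D where "D = Min (d ` Basis)"
  have D: "D > 0" "\<And>b. b \<in> Basis \<Longrightarrow> D \<le> d b" unfolding D_def using d(1) by auto
  have lin: "linear (fd k x)" for x by (rule fd_linear[OF test_function_differentiable[OF k]])
  have "\<bar>k (x + h) - k x - fd k x h\<bar> \<le> e * norm h" if h: "norm h < D" for x h
  proof -
    obtain z where z: "0 < z" "z < 1" "k (x + 1 *\<^sub>R h) - k x = 1 * fd k (x + z *\<^sub>R h) h"
      using mean_value_line[OF test_function_differentiable[OF k] zero_less_one] by blast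
    have ex: "fd k y h = (\<Sum>b\<in>Basis. (h \<bullet> b) * fd k y b)" for y
    proof -
      have "fd k y h = fd k y (\<Sum>b\<in>Basis. (h \<bullet> b) *\<^sub>R b)" by (simp add: euclidean_representation)
      also have "\<dots> = (\<Sum>b\<in>Basis. fd k y ((h \<bullet> b) *\<^sub>R b))" by (rule linear_sum[OF lin])
      also have "\<dots> = (\<Sum>b\<in>Basis. (h \<bullet> b) * fd k y b)" by (simp add: linear_cmul[OF lin])
      finally show ?thesis .
    qed
    have zh: "norm (z *\<^sub>R h) < D"
    proof -
      have "norm (z *\<^sub>R h) \<le> norm h" using z by (simp add: mult_left_le_one_le)
      then show ?thesis using h by simp
    qed
    have "k (x + h) - k x - fd k x h = (\<Sum>b\<in>Basis. (h \<bullet> b) * (fd k (x + z *\<^sub>R h) b - fd k x b))"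
      using z(3) by (simp add: ex[of "x + z *\<^sub>R h"] ex[of x] sum_subtractf right_diff_distrib)
    also have "\<bar>\<dots>\<bar> \<le> (\<Sum>b\<in>(Basis::'a set). norm h * ?c)"
    proof (rule order_trans[OF sum_abs sum_mono])
      fix b :: 'a assume b: "b \<in> Basis"
      have "\<bar>fd k (x + z *\<^sub>R h) b - fd k x b\<bar> \<le> ?c" using d(2)[OF b, of "z *\<^sub>R h" x] D(2)[OF b] zh by linarith
      moreover have "\<bar>h \<bullet> b\<bar> \<le> norm h" using Basis_le_norm[OF b] .
      ultimately show "\<bar>(h \<bullet> b) * (fd k (x + z *\<^sub>R h) b - fd k x b)\<bar> \<le> norm h * ?c"
        unfolding abs_mult by (intro mult_mono) auto
    qed
    also have "\<dots> = e * norm h" by simp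
    finally show ?thesis .
  qed
  then show ?thesis using that D(1) by blast
qed

definition conv :: "('a::euclidean_space \<Rightarrow> real) \<Rightarrow> ('a \<Rightarrow> real) \<Rightarrow> 'a \<Rightarrow> real" where
  "conv g k x = (\<integral>y. g y * k (x - y) \<partial>lborel)"

lemma conv_integrable:
  fixes g k :: "'a::euclidean_space \<Rightarrow> real"
  assumes "integrable lborel g" "test_function V k"
  shows "integrable lborel (\<lambda>y. g y * k (x - y))"
proof -
  obtain B where B: "B > 0" "\<And>x. \<bar>k x\<bar> \<le> B" by (rule test_function_bounded[OF assms(2)]) blast
  have mk: "k \<in> borel_measurable borel"
    using test_function_continuous[OF assms(2), of UNIV] by (simp add: borel_measurable_continuous_onI)
  show ?thesis
  proof (rule Bochner_Integration.integrable_bound[of _ "\<lambda>y. B * g y"])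
    show "integrable lborel (\<lambda>y. B * g y)" using assms(1) by simp
    show "(\<lambda>y. g y * k (x - y)) \<in> borel_measurable lborel" using assms(1) mk by measurable
    show "AE y in lborel. norm (g y * k (x - y)) \<le> norm (B * g y)"
    proof (rule AE_I2)
      fix y
      have "\<bar>g y\<bar> * \<bar>k (x - y)\<bar> \<le> \<bar>g y\<bar> * B" by (rule mult_left_mono[OF B(2)]) simp
      then show "norm (g y * k (x - y)) \<le> norm (B * g y)" using B(1) by (simp add: abs_mult mult.commute)
    qed
  qed
qed

lemma conv_has_derivative:
  fixes g k :: "'a::euclidean_space \<Rightarrow> real"
  assumes g: "integrable lborel g" and k: "test_function V k"
  shows "(conv g k has_derivative (\<lambda>v. conv g (\<lambda>z. fd k z v) x)) (at x)"
  unfolding has_derivative_at_alt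
proof (intro conjI allI impI)
  have lin: "linear (fd k x)" for x by (rule fd_linear[OF test_function_differentiable[OF k]])
  have "linear (\<lambda>v. conv g (\<lambda>z. fd k z v) x)"
    by (rule linearI) (simp_all add: conv_def linear_add[OF lin] linear_cmul[OF lin] distrib_left mult.left_commute
        conv_integrable[OF g test_function_fd[OF k]])
  then show "bounded_linear (\<lambda>v. conv g (\<lambda>z. fd k z v) x)" using linear_conv_bounded_linear by blast
  fix e :: real assume e: "e > 0"
  define I where "I = (\<integral>y. \<bar>g y\<bar> \<partial>lborel)"
  have I: "I \<ge> 0" unfolding I_def by simp
  obtain d where d: "d > 0" "\<And>x h. norm h < d \<Longrightarrow> \<bar>k (x + h) - k x - fd k x h\<bar> \<le> (e / (I + 1)) * norm h"
    using test_function_uniform_derivative[OF k, of "e / (I + 1)"] e I by auto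
  have "norm (conv g k y - conv g k x - conv g (\<lambda>z. fd k z (y - x)) x) \<le> e * norm (y - x)" if "norm (y - x) < d" for y
  proof -
    define h where "h = y - x"
    have i: "integrable lborel (\<lambda>t. g t * (k (x - t + h) - k (x - t) - fd k (x - t) h))"
      using conv_integrable[OF g k, of "x + h"] conv_integrable[OF g k, of x] conv_integrable[OF g test_function_fd[OF k], of x h]
      by (simp add: right_diff_distrib algebra_simps)
    have "conv g k y - conv g k x - conv g (\<lambda>z. fd k z h) x
        = (\<integral>t. g t * k (y - t) - g t * k (x - t) - g t * fd k (x - t) h \<partial>lborel)"
      unfolding conv_def using conv_integrable[OF g k, of y] conv_integrable[OF g k, of x] conv_integrable[OF g test_function_fd[OF k], of x h]
      by simp
    also have "\<dots> = (\<integral>t. g t * (k (x - t + h) - k (x - t) - fd k (x - t) h) \<partial>lborel)"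
      by (simp add: h_def right_diff_distrib)
    also have "norm \<dots> \<le> (\<integral>t. \<bar>g t\<bar> * ((e / (I + 1)) * norm h) \<partial>lborel)"
    proof (rule Bochner_Integration.integral_norm_bound_integral[OF i])
      show "integrable lborel (\<lambda>t. \<bar>g t\<bar> * ((e / (I + 1)) * norm h))" using g by simp
      show "norm (g t * (k (x - t + h) - k (x - t) - fd k (x - t) h)) \<le> \<bar>g t\<bar> * ((e / (I + 1)) * norm h)" for t
        unfolding real_norm_def abs_mult by (rule mult_left_mono[OF d(2)]) (use that in \<open>auto simp: h_def\<close>)
    qed
    also have "\<dots> = I * ((e / (I + 1)) * norm h)" unfolding I_def by simp
    also have "\<dots> = (I / (I + 1)) * (e * norm h)" by simp
    also have "\<dots> \<le> 1 * (e * norm h)" using I e by (intro mult_right_mono) auto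
    finally show ?thesis by (simp add: h_def)
  qed
  then show "\<exists>d>0. \<forall>y. norm (y - x) < d \<longrightarrow> norm (conv g k y - conv g k x - conv g (\<lambda>z. fd k z (y - x)) x) \<le> e * norm (y - x)"
    using d(1) by blast
qed

lemma conv_smooth:
  fixes g k :: "'a::euclidean_space \<Rightarrow> real"
  assumes g: "integrable lborel g" and k: "test_function V k"
  shows "smooth_on UNIV (conv g k)"
proof -
  have "Ck_on n UNIV (conv g k)" if "test_function V k" for n k
    using that
  proof (induction n arbitrary: k)
    case 0
    then show ?case
      by (auto intro!: continuous_at_imp_continuous_on has_derivative_continuous[OF conv_has_derivative[OF g]])
  next
    case (Suc n)
    have "\<forall>v. Ck_on n UNIV (\<lambda>x. conv g (\<lambda>z. fd k z v) x)" using Suc.IH[OF test_function_fd[OF Suc.prems]] by blast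
    then show ?case unfolding Ck_on.simps
      by (intro exI[of _ "\<lambda>x v. conv g (\<lambda>z. fd k z v) x"]) (simp add: conv_has_derivative[OF g Suc.prems])
  qed
  then show ?thesis using k unfolding smooth_on_def by blast
qed

subsection \<open>A smooth approximate identity\<close>

definition bump :: "real \<Rightarrow> 'a::euclidean_space \<Rightarrow> real" where
  "bump h x = flat_exp (h\<^sup>2 - (norm x)\<^sup>2)"

definition mollifier :: "real \<Rightarrow> 'a::euclidean_space \<Rightarrow> real" where
  "mollifier h x = bump h x / (\<integral>y. bump h (y::'a) \<partial>lborel)"

lemma smooth_on_norm_square: "smooth_on S (\<lambda>x::'a::euclidean_space. (norm x)\<^sup>2)"
proof -
  have "smooth_on UNIV (\<lambda>x::'a. \<Sum>b\<in>Basis. (x \<bullet> b) * (x \<bullet> b))"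
    by (intro smooth_on_sum smooth_on_mult smooth_on_linear open_UNIV finite_Basis)
       (auto intro!: linearI simp: inner_add_left)
  moreover have "(\<lambda>x::'a. (norm x)\<^sup>2) = (\<lambda>x. \<Sum>b\<in>Basis. (x \<bullet> b) * (x \<bullet> b))"
    by (simp add: fun_eq_iff power2_norm_eq_inner) (rule allI, rule euclidean_inner)
  ultimately show ?thesis by (auto intro: smooth_on_subset)
qed

lemma bump_zero: "0 \<le> h \<Longrightarrow> x \<notin> cball 0 h \<Longrightarrow> bump h x = 0"
  using power_strict_mono[of h "norm x" 2] unfolding bump_def flat_exp_def by auto

lemma test_function_bump: "0 \<le> h \<Longrightarrow> cball 0 h \<subseteq> V \<Longrightarrow> test_function V (bump h :: 'a::euclidean_space \<Rightarrow> real)"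
proof (rule test_functionI[where K = "cball 0 h"])
  have "smooth_on UNIV (\<lambda>x::'a. flat_exp (h\<^sup>2 - (norm x)\<^sup>2))"
    by (rule smooth_on_compose[OF open_UNIV open_UNIV smooth_on_flat_exp])
       (auto intro!: smooth_on_diff smooth_on_const smooth_on_norm_square)
  then show "smooth_on UNIV (bump h :: 'a \<Rightarrow> real)" unfolding bump_def[abs_def] .
qed (auto simp: bump_zero)

lemma bump_mass_pos:
  assumes "h > 0" shows "0 < (\<integral>y. bump h (y::'a::euclidean_space) \<partial>lborel)"
proof -
  have t: "test_function UNIV (bump h :: 'a \<Rightarrow> real)" by (rule test_function_bump) (use assms in auto)
  have i: "integrable lborel (bump h :: 'a \<Rightarrow> real)"
    by (rule integrable_compact_support[OF test_function_continuous[OF t] compact_cball bump_zero[OF less_imp_le[OF assms]]])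
  have "(\<integral>y. bump h (y::'a) \<partial>lborel) \<noteq> 0"
  proof
    assume "(\<integral>y. bump h (y::'a) \<partial>lborel) = 0"
    then have "AE y in lborel. bump h (y::'a) = 0"
      using integral_nonneg_eq_0_iff_AE[OF i] bump_def flat_exp_nonneg by (metis (no_types, lifting) AE_I2)
    moreover have "bump h y \<noteq> 0" if "y \<in> ball 0 h" for y :: 'a
    proof -
      have "(norm y)\<^sup>2 < h\<^sup>2" using that assms by (intro power_strict_mono) auto
      then show ?thesis unfolding bump_def using flat_exp_pos_iff[of "h\<^sup>2 - (norm y)\<^sup>2"] by simp
    qed
    ultimately have "AE y in lborel. y \<notin> ball (0::'a) h" by (auto elim!: eventually_mono)
    then have "emeasure lborel (ball (0::'a) h) = 0"
      using AE_iff_measurable[of "ball (0::'a) h" lborel "\<lambda>y. y \<notin> ball 0 h"] by (simp add: ball_def)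
    then show False using content_ball_gt_0_iff[of "0::'a" h] assms unfolding measure_def by simp
  qed
  moreover have "0 \<le> (\<integral>y. bump h (y::'a) \<partial>lborel)" by (simp add: bump_def flat_exp_nonneg)
  ultimately show ?thesis by simp
qed

lemma mollifier_props:
  assumes "h > 0"
  shows "test_function UNIV (mollifier h :: 'a::euclidean_space \<Rightarrow> real)"
    "mollifier h (x :: 'a) \<ge> 0" "mollifier h (- x :: 'a) = mollifier h x"
    "x \<notin> cball 0 h \<Longrightarrow> mollifier h (x :: 'a) = 0"
    "(\<integral>y. mollifier h (y::'a) \<partial>lborel) = 1"
    "integrable lborel (mollifier h :: 'a \<Rightarrow> real)"
proof -
  let ?m = "\<integral>y. bump h (y::'a) \<partial>lborel"
  have m: "?m > 0" by (rule bump_mass_pos[OF assms])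
  have t: "test_function UNIV (bump h :: 'a \<Rightarrow> real)" by (rule test_function_bump) (use assms in auto)
  have eq: "mollifier h = (\<lambda>x::'a. bump h x * (1 / ?m))" by (simp add: mollifier_def fun_eq_iff)
  show t': "test_function UNIV (mollifier h :: 'a \<Rightarrow> real)"
    unfolding eq by (rule test_function_mult[OF t smooth_on_const])
  show "mollifier h x \<ge> 0" using m by (simp add: mollifier_def bump_def flat_exp_nonneg)
  show "mollifier h (- x :: 'a) = mollifier h x" by (simp add: mollifier_def bump_def)
  show z: "mollifier h x = 0" if "x \<notin> cball 0 h" for x :: 'a using bump_zero[OF _ that] assms by (simp add: mollifier_def)
  show "integrable lborel (mollifier h :: 'a \<Rightarrow> real)"
    by (rule integrable_compact_support[OF test_function_continuous[OF t'] compact_cball z])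
  show "(\<integral>y. mollifier h (y::'a) \<partial>lborel) = 1" using m by (simp add: mollifier_def)
qed

subsection \<open>Square-integrable functions\<close>

definition sq_int :: "('a::euclidean_space \<Rightarrow> real) \<Rightarrow> bool" where
  "sq_int f \<longleftrightarrow> f \<in> borel_measurable borel \<and> integrable lborel (\<lambda>x. (f x)\<^sup>2)"

lemma abs_mult_le_weighted: 
  fixes a b l :: real assumes "l > 0" shows "\<bar>a * b\<bar> \<le> l * a\<^sup>2 + b\<^sup>2 / l"
proof -
  have "0 \<le> (l * \<bar>a\<bar> - \<bar>b\<bar>)\<^sup>2" by simp
  also have "\<dots> = l * (l * a\<^sup>2 + b\<^sup>2 / l) - 2 * l * \<bar>a * b\<bar>"
    using assms by (simp add: power2_diff power_mult_distrib abs_mult power2_eq_square algebra_simps)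
  finally have "l * (2 * \<bar>a * b\<bar>) \<le> l * (l * a\<^sup>2 + b\<^sup>2 / l)" by (simp add: algebra_simps)
  then have "2 * \<bar>a * b\<bar> \<le> l * a\<^sup>2 + b\<^sup>2 / l" using assms by (simp only: mult_le_cancel_left_pos)
  then show ?thesis by (smt (verit) abs_ge_zero)
qed

lemma sq_int_mult_integrable:
  assumes "sq_int f" "sq_int g" shows "integrable lborel (\<lambda>x. f x * g x)"
proof (rule Bochner_Integration.integrable_bound[of _ "\<lambda>x. (f x)\<^sup>2 + (g x)\<^sup>2"])
  show "AE x in lborel. norm (f x * g x) \<le> norm ((f x)\<^sup>2 + (g x)\<^sup>2)"
    using abs_mult_le_weighted[of 1] by (auto simp: abs_mult)
qed (use assms in \<open>auto simp: sq_int_def\<close>)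

lemma sq_int_integral_bound:
  assumes "sq_int f" "sq_int g" "l > 0"
  shows "\<bar>\<integral>x. f x * g x \<partial>lborel\<bar> \<le> l * (\<integral>x. (f x)\<^sup>2 \<partial>lborel) + (\<integral>x. (g x)\<^sup>2 \<partial>lborel) / l"
proof -
  have "norm (\<integral>x. f x * g x \<partial>lborel) \<le> (\<integral>x. l * (f x)\<^sup>2 + (g x)\<^sup>2 / l \<partial>lborel)"
    by (rule Bochner_Integration.integral_norm_bound_integral[OF sq_int_mult_integrable[OF assms(1,2)]])
       (use assms abs_mult_le_weighted[OF assms(3)] in \<open>auto simp: sq_int_def\<close>)
  then show ?thesis using assms by (simp add: sq_int_def)
qed

lemma sq_int_translate: "sq_int f \<Longrightarrow> sq_int (\<lambda>x. f (x + t))"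
  "sq_int f \<Longrightarrow> (\<integral>x. (f (x + t))\<^sup>2 \<partial>lborel) = (\<integral>x. (f x)\<^sup>2 \<partial>lborel)"
  using lborel_integral_translate[of "\<lambda>x. (f x)\<^sup>2" t] by (auto simp: sq_int_def)

lemma sq_int_diff:
  assumes "sq_int f" "sq_int g" shows "sq_int (\<lambda>x. f x - g x)"
proof -
  have "integrable lborel (\<lambda>x. (f x)\<^sup>2 - 2 * (f x * g x) + (g x)\<^sup>2)"
    using assms sq_int_mult_integrable[OF assms] by (simp add: sq_int_def)
  then show ?thesis using assms by (auto simp: sq_int_def power2_diff algebra_simps)
qed

lemma sq_int_compact_support:
  assumes "continuous_on UNIV f" "compact K" "\<And>x. x \<notin> K \<Longrightarrow> f x = 0"
  shows "sq_int f"
  unfolding sq_int_def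
  by (intro conjI borel_measurable_continuous_onI[OF assms(1)] integrable_compact_support[OF _ assms(2)])
     (use assms in \<open>auto intro!: continuous_intros\<close>)

lemma sq_int_mult_bounded:
  assumes "sq_int f" "g \<in> borel_measurable borel" "\<And>x. \<bar>g x\<bar> \<le> B"
  shows "sq_int (\<lambda>x. f x * g x)"
  unfolding sq_int_def
proof
  show "(\<lambda>x. f x * g x) \<in> borel_measurable borel" using assms by (auto simp: sq_int_def)
  show "integrable lborel (\<lambda>x. (f x * g x)\<^sup>2)"
  proof (rule Bochner_Integration.integrable_bound[of _ "\<lambda>x. B\<^sup>2 * (f x)\<^sup>2"])
    have "(g x)\<^sup>2 \<le> B\<^sup>2" for x using assms(3)[of x] power_mono[of "\<bar>g x\<bar>" B 2] by simp
    then show "AE x in lborel. norm ((f x * g x)\<^sup>2) \<le> norm (B\<^sup>2 * (f x)\<^sup>2)"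
      by (intro AE_I2) (simp add: power_mult_distrib mult.commute[of "(f _)\<^sup>2"] mult_right_mono)
  qed (use assms in \<open>auto simp: sq_int_def\<close>)
qed

text \<open>Truncation in height and in space reduces to bounded functions on a ball, where pointwise
  convergence of continuous functions suffices.\<close>

lemma continuous_dense_sq_int:
  fixes g :: "'a::euclidean_space \<Rightarrow> real"
  assumes g: "sq_int g" and e: "e > 0"
  obtains c K where "continuous_on UNIV c" "compact K" "\<And>x. x \<notin> K \<Longrightarrow> c x = 0"
    "(\<integral>x. (g x - c x)\<^sup>2 \<partial>lborel) < e"
proof -
  define cl where "cl M t = max (- M) (min M t)" for M t :: real
  define cut where "cut n x = max 0 (min 1 (real n + 1 - norm x))" for n and x :: 'a
  have cl_bd: "\<bar>cl (real M) t\<bar> \<le> real M" for M t by (auto simp: cl_def)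
  have cl_le: "\<bar>cl (real M) t\<bar> \<le> \<bar>t\<bar>" for M t by (auto simp: cl_def)
  have cut: "0 \<le> cut n x" "cut n x \<le> 1" "x \<notin> cball 0 (real n + 1) \<Longrightarrow> cut n x = 0" "norm x \<le> real n \<Longrightarrow> cut n x = 1" for n x
    by (auto simp: cut_def)
  have ccut: "continuous_on UNIV (cut n)" for n unfolding cut_def by (intro continuous_intros)
  have mcut[measurable]: "cut n \<in> borel_measurable borel" for n by (rule borel_measurable_continuous_onI[OF ccut])
  have mg[measurable]: "g \<in> borel_measurable borel" using g by (simp add: sq_int_def)
  define tr where "tr n x = cl (real n) (g x) * cut n x" for n x
  have mtr[measurable]: "tr n \<in> borel_measurable borel" for n unfolding tr_def cl_def by measurable
  have "(\<lambda>n. \<integral>x. (g x - tr n x)\<^sup>2 \<partial>lborel) \<longlonglongrightarrow> (\<integral>x. 0 \<partial>(lborel::'a measure))"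
  proof (rule integral_dominated_convergence[where w = "\<lambda>x. 4 * (g x)\<^sup>2"])
    show "AE x in lborel. (\<lambda>n. (g x - tr n x)\<^sup>2) \<longlonglongrightarrow> 0"
    proof (rule AE_I2)
      fix x
      have "\<forall>\<^sub>F n in sequentially. real n \<ge> max (norm x) \<bar>g x\<bar>"
        using filterlim_real_sequentially unfolding filterlim_at_top by blast
      then have "\<forall>\<^sub>F n in sequentially. (g x - tr n x)\<^sup>2 = 0"
        by eventually_elim (auto simp: tr_def cl_def cut(4))
      then show "(\<lambda>n. (g x - tr n x)\<^sup>2) \<longlonglongrightarrow> 0" by (simp add: tendsto_eventually)
    qed
    show "AE x in lborel. norm ((g x - tr n x)\<^sup>2) \<le> 4 * (g x)\<^sup>2" for n
    proof (rule AE_I2)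
      fix x
      have "\<bar>tr n x\<bar> \<le> \<bar>g x\<bar> * 1" unfolding tr_def abs_mult using cut(1,2)[of n x] cl_le by (intro mult_mono) auto
      then have "\<bar>g x - tr n x\<bar> \<le> 2 * \<bar>g x\<bar>" by linarith
      then have "\<bar>g x - tr n x\<bar>\<^sup>2 \<le> (2 * \<bar>g x\<bar>)\<^sup>2" by (intro power_mono) auto
      then show "norm ((g x - tr n x)\<^sup>2) \<le> 4 * (g x)\<^sup>2" by (simp add: power_mult_distrib)
    qed
  qed (use g in \<open>auto simp: sq_int_def\<close>)
  then have "\<forall>\<^sub>F n in sequentially. (\<integral>x. (g x - tr n x)\<^sup>2 \<partial>lborel) < e / 4"
    using e by (intro order_tendstoD(2)) auto
  then obtain M where M: "(\<integral>x. (g x - tr M x)\<^sup>2 \<partial>lborel) < e / 4"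
    using eventually_happens' sequentially_bot by blast
  have "g \<in> lborel \<rightarrow>\<^sub>M borel" by simp
  then have "g \<in> borel_measurable lebesgue" by (rule measurable_completion)
  then have "g measurable_on UNIV"
    using measurable_on_iff_borel_measurable[of UNIV g] by (simp add: lebesgue_on_UNIV_eq)
  then obtain N G where NG: "negligible N" "\<And>n. continuous_on UNIV (G n)" "\<And>x. x \<notin> N \<Longrightarrow> (\<lambda>n. G n x) \<longlonglongrightarrow> g x"
    unfolding measurable_on_def by auto
  define c where "c n x = cl (real M) (G n x) * cut M x" for n x
  have cc: "continuous_on UNIV (c n)" for n unfolding c_def cl_def by (intro continuous_intros NG ccut)
  have c0: "c n x = 0" if "x \<notin> cball 0 (real M + 1)" for n x using cut(3)[OF that] by (simp add: c_def)
  have AEN: "AE x in lborel. x \<notin> N"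
  proof -
    have "N \<in> null_sets (completion lborel)" using NG(1) negligible_iff_null_sets by auto
    then have "AE x in completion lborel. x \<notin> N" by (rule AE_not_in)
    then show ?thesis by (simp add: AE_completion_iff)
  qed
  have "(\<lambda>n. \<integral>x. (tr M x - c n x)\<^sup>2 \<partial>lborel) \<longlonglongrightarrow> (\<integral>x. 0 \<partial>(lborel::'a measure))"
  proof (rule integral_dominated_convergence[where w = "\<lambda>x. (2 * real M)\<^sup>2 * indicator (cball 0 (real M + 1)) x"])
    show "AE x in lborel. (\<lambda>n. (tr M x - c n x)\<^sup>2) \<longlonglongrightarrow> 0"
      using AEN
    proof eventually_elim
      fix x assume "x \<notin> N"
      then have "(\<lambda>n. c n x) \<longlonglongrightarrow> tr M x" unfolding c_def tr_def cl_def by (intro tendsto_intros NG)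
      then have "(\<lambda>n. (tr M x - c n x)\<^sup>2) \<longlonglongrightarrow> (tr M x - tr M x)\<^sup>2" by (intro tendsto_intros)
      then show "(\<lambda>n. (tr M x - c n x)\<^sup>2) \<longlonglongrightarrow> 0" by simp
    qed
    show "AE x in lborel. norm ((tr M x - c n x)\<^sup>2) \<le> (2 * real M)\<^sup>2 * indicator (cball 0 (real M + 1)) x" for n
    proof (rule AE_I2)
      fix x
      have "\<bar>tr M x\<bar> \<le> real M * 1" "\<bar>c n x\<bar> \<le> real M * 1"
        unfolding tr_def c_def abs_mult using cut(1,2)[of M x] cl_bd by (intro mult_mono; auto)+
      then have "\<bar>tr M x - c n x\<bar> \<le> 2 * real M" by linarith
      then have "\<bar>tr M x - c n x\<bar>\<^sup>2 \<le> (2 * real M)\<^sup>2" by (intro power_mono) auto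
      then show "norm ((tr M x - c n x)\<^sup>2) \<le> (2 * real M)\<^sup>2 * indicator (cball 0 (real M + 1)) x"
        using cut(3)[of x M] by (auto simp: tr_def c_def indicator_def)
    qed
    show "integrable lborel (\<lambda>x. (2 * real M)\<^sup>2 * indicator (cball 0 (real M + 1)) x :: real)"
      by (intro integrable_mult_right integrable_indicator_compact compact_cball)
    show "(\<lambda>x. (tr M x - c n x)\<^sup>2) \<in> borel_measurable lborel" for n
      using borel_measurable_continuous_onI[OF cc, of n] by measurable
  qed simp
  then have "\<forall>\<^sub>F n in sequentially. (\<integral>x. (tr M x - c n x)\<^sup>2 \<partial>lborel) < e / 4"
    using e by (intro order_tendstoD(2)) auto
  then obtain n where n: "(\<integral>x. (tr M x - c n x)\<^sup>2 \<partial>lborel) < e / 4"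
    using eventually_happens' sequentially_bot by blast
  have sc: "sq_int (c n)" by (rule sq_int_compact_support[OF cc compact_cball c0])
  have st: "sq_int (tr M)"
  proof -
    have "integrable lborel (\<lambda>x. (tr M x)\<^sup>2)"
    proof (rule Bochner_Integration.integrable_bound[of _ "\<lambda>x. (g x)\<^sup>2"])
      have "\<bar>tr M x\<bar> \<le> \<bar>g x\<bar> * 1" for x unfolding tr_def abs_mult using cut(1,2)[of M x] cl_le by (intro mult_mono) auto
      then have "\<bar>tr M x\<bar>\<^sup>2 \<le> \<bar>g x\<bar>\<^sup>2" for x by (intro power_mono) auto
      then show "AE x in lborel. norm ((tr M x)\<^sup>2) \<le> norm ((g x)\<^sup>2)" by simp
    qed (use g in \<open>auto simp: sq_int_def\<close>)
    then show ?thesis by (simp add: sq_int_def)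
  qed
  have "(\<integral>x. (g x - c n x)\<^sup>2 \<partial>lborel) \<le> (\<integral>x. 2 * (g x - tr M x)\<^sup>2 + 2 * (tr M x - c n x)\<^sup>2 \<partial>lborel)"
  proof (rule integral_mono)
    fix x
    have "0 \<le> ((g x - tr M x) - (tr M x - c n x))\<^sup>2" by simp
    then show "(g x - c n x)\<^sup>2 \<le> 2 * (g x - tr M x)\<^sup>2 + 2 * (tr M x - c n x)\<^sup>2"
      by (simp add: power2_eq_square algebra_simps)
  qed (use sq_int_diff[OF g sc] sq_int_diff[OF g st] sq_int_diff[OF st sc] in \<open>auto simp: sq_int_def\<close>)
  also have "\<dots> = 2 * (\<integral>x. (g x - tr M x)\<^sup>2 \<partial>lborel) + 2 * (\<integral>x. (tr M x - c n x)\<^sup>2 \<partial>lborel)"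
    using sq_int_diff[OF g st] sq_int_diff[OF st sc] by (simp add: sq_int_def)
  also have "\<dots> < e" using M n by simp
  finally show ?thesis using that[OF cc compact_cball c0] by blast
qed

lemma sq_int_translation_continuous:
  fixes f g :: "'a::euclidean_space \<Rightarrow> real"
  assumes f: "sq_int f" and g: "sq_int g" and e: "e > 0"
  obtains d where "d > 0" "\<And>t. norm t < d \<Longrightarrow> \<bar>(\<integral>x. f x * g (x + t) \<partial>lborel) - (\<integral>x. f x * g x \<partial>lborel)\<bar> < e"
proof -
  define F where "F = (\<integral>x. (f x)\<^sup>2 \<partial>lborel)"
  have F: "F \<ge> 0" by (simp add: F_def)
  define l where "l = e / (12 * (F + 1))"
  have l: "l > 0" "l * F \<le> e / 12"
    using e F by (auto simp: l_def field_simps)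
  obtain c K where c: "continuous_on UNIV c" "compact K" "\<And>x. x \<notin> K \<Longrightarrow> c x = 0"
    "(\<integral>x. (g x - c x)\<^sup>2 \<partial>lborel) < l * e / 12"
    using continuous_dense_sq_int[OF g, of "l * e / 12"] l e by auto
  have sc: "sq_int c" by (rule sq_int_compact_support[OF c(1-3)])
  have sgc: "sq_int (\<lambda>x. g x - c x)" by (rule sq_int_diff[OF g sc])
  have r: "\<bar>\<integral>x. f x * (g (x + t) - c (x + t)) \<partial>lborel\<bar> \<le> e / 6" for t
  proof -
    have "\<bar>\<integral>x. f x * (g (x + t) - c (x + t)) \<partial>lborel\<bar> \<le> l * F + (\<integral>x. (g (x + t) - c (x + t))\<^sup>2 \<partial>lborel) / l"
      using sq_int_integral_bound[OF f sq_int_translate(1)[OF sgc, of t] l(1)] by (simp add: F_def)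
    also have "(\<integral>x. (g (x + t) - c (x + t))\<^sup>2 \<partial>lborel) = (\<integral>x. (g x - c x)\<^sup>2 \<partial>lborel)"
      using sq_int_translate(2)[OF sgc, of t] .
    also have "\<dots> / l \<le> e / 12" using c(4) l(1) by (simp add: field_simps)
    finally show ?thesis using l(2) by linarith
  qed
  let ?K = "{x + y | x y. x \<in> K \<and> y \<in> cball 0 1}"
  have K: "compact ?K" using compact_sums[OF c(2) compact_cball] .
  define m where "m = measure lborel ?K"
  have m: "m \<ge> 0" by (simp add: m_def)
  define \<epsilon> where "\<epsilon> = sqrt (l * e / (12 * (m + 1)))"
  have \<epsilon>: "\<epsilon> > 0" "\<epsilon>\<^sup>2 * m / l \<le> e / 12"
  proof -
    show "\<epsilon> > 0" unfolding \<epsilon>_def using l e m by simp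
    have "\<epsilon>\<^sup>2 = l * e / (12 * (m + 1))" unfolding \<epsilon>_def using l e m by simp
    then have "\<epsilon>\<^sup>2 * m / l = (e / 12) * (m / (m + 1))" using l by simp
    also have "\<dots> \<le> (e / 12) * 1" using m e by (intro mult_left_mono) auto
    finally show "\<epsilon>\<^sup>2 * m / l \<le> e / 12" by simp
  qed
  obtain d where d: "d > 0" "\<And>x h. norm h < d \<Longrightarrow> \<bar>c (x + h) - c x\<bar> < \<epsilon>"
    using uniformly_continuous_compact_support[of c K \<epsilon>] c(1-3) \<epsilon>(1) by metis
  have "\<bar>(\<integral>x. f x * g (x + t) \<partial>lborel) - (\<integral>x. f x * g x \<partial>lborel)\<bar> < e" if t: "norm t < min d 1" for t
  proof -
    have sct: "sq_int (\<lambda>x. c (x + t) - c x)" by (rule sq_int_diff[OF sq_int_translate(1)[OF sc] sc])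
    have "(\<integral>x. (c (x + t) - c x)\<^sup>2 \<partial>lborel) \<le> (\<integral>x. \<epsilon>\<^sup>2 * indicator ?K x \<partial>lborel)"
    proof (rule integral_mono)
      show "integrable lborel (\<lambda>x. \<epsilon>\<^sup>2 * indicator ?K x)"
        by (intro integrable_mult_right integrable_indicator_compact K)
      show "(c (x + t) - c x)\<^sup>2 \<le> \<epsilon>\<^sup>2 * indicator ?K x" for x
      proof (cases "x \<in> ?K")
        case True
        have "\<bar>c (x + t) - c x\<bar>\<^sup>2 \<le> \<epsilon>\<^sup>2" using d(2)[of t x] t by (intro power_mono) auto
        then show ?thesis using True by simp
      next
        case False
        have "x \<notin> K"
        proof
          assume "x \<in> K"
          moreover have "(0::'a) \<in> cball 0 1" by simp
          ultimately have "x + 0 \<in> ?K" by blast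
          then show False using False by simp
        qed
        moreover have "x + t \<notin> K"
        proof
          assume "x + t \<in> K"
          moreover have "- t \<in> cball 0 1" using t by simp
          ultimately have "x + t + (- t) \<in> ?K" by blast
          then show False using False by simp
        qed
        ultimately show ?thesis using c(3) by simp
      qed
    qed (use sct in \<open>simp add: sq_int_def\<close>)
    also have "\<dots> = \<epsilon>\<^sup>2 * m" by (simp add: m_def)
    finally have "(\<integral>x. (c (x + t) - c x)\<^sup>2 \<partial>lborel) / l \<le> \<epsilon>\<^sup>2 * m / l" using l(1) by (simp add: divide_right_mono)
    then have A: "\<bar>\<integral>x. f x * (c (x + t) - c x) \<partial>lborel\<bar> \<le> e / 6"
      using sq_int_integral_bound[OF f sct l(1)] \<epsilon>(2) l(2)[unfolded F_def] by linarith
    have i: "integrable lborel (\<lambda>x. f x * g (x + t))" "integrable lborel (\<lambda>x. f x * g x)"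
      "integrable lborel (\<lambda>x. f x * c (x + t))" "integrable lborel (\<lambda>x. f x * c x)"
      using sq_int_mult_integrable f g sc sq_int_translate(1) by auto
    have "(\<integral>x. f x * g (x + t) \<partial>lborel) - (\<integral>x. f x * g x \<partial>lborel) =
      (\<integral>x. f x * (g (x + t) - c (x + t)) \<partial>lborel) - (\<integral>x. f x * (g (x + 0) - c (x + 0)) \<partial>lborel)
      + (\<integral>x. f x * (c (x + t) - c x) \<partial>lborel)"
      using i by (simp add: right_diff_distrib)
    then show ?thesis using r[of t] r[of 0] A e by linarith
  qed
  then show ?thesis using that[of "min d 1"] d(1) by auto
qed

text \<open>Averaging against the approximate identity amounts, by Fubini, to averaging the correlation
  function \<open>t \<mapsto> \<integral> f(x) g(x + t) dx\<close> near \<open>0\<close>.\<close>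

lemma mollifier_pairing:
  fixes f g :: "'a::euclidean_space \<Rightarrow> real"
  assumes f: "sq_int f" and g: "sq_int g" and e: "e > 0"
  obtains d where "d > 0"
    "\<And>h. 0 < h \<Longrightarrow> h < d \<Longrightarrow> \<bar>(\<integral>x. f x * conv g (mollifier h) x \<partial>lborel) - (\<integral>x. f x * g x \<partial>lborel)\<bar> < e"
proof -
  define G where "G t = (\<integral>x. f x * g (x + t) \<partial>lborel)" for t
  have [measurable]: "f \<in> borel_measurable borel" "g \<in> borel_measurable borel" using f g by (auto simp: sq_int_def)
  obtain d where d: "d > 0" "\<And>t. norm t < d \<Longrightarrow> \<bar>G t - G 0\<bar> < e / 2"
    using sq_int_translation_continuous[OF f g, of "e / 2"] e unfolding G_def by auto
  have "\<bar>(\<integral>x. f x * conv g (mollifier h) x \<partial>lborel) - (\<integral>x. f x * g x \<partial>lborel)\<bar> < e" if h: "0 < h" "h < d" for h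
  proof -
    let ?m = "mollifier h :: 'a \<Rightarrow> real"
    note m = mollifier_props[OF h(1), where 'a = 'a]
    have [measurable]: "?m \<in> borel_measurable borel"
      using test_function_continuous[OF m(1), of UNIV] by (simp add: borel_measurable_continuous_onI)
    have [measurable]: "G \<in> borel_measurable borel" unfolding G_def by measurable
    define C where "C = (\<integral>x. (f x)\<^sup>2 \<partial>lborel) + (\<integral>x. (g x)\<^sup>2 \<partial>lborel)"
    have absC: "(\<integral>x. norm (f x * g (x + t)) \<partial>lborel) \<le> C" for t
    proof -
      have "(\<integral>x. norm (f x * g (x + t)) \<partial>lborel) \<le> (\<integral>x. (f x)\<^sup>2 + (g (x + t))\<^sup>2 \<partial>lborel)"
        using abs_mult_le_weighted[of 1] sq_int_mult_integrable[OF f sq_int_translate(1)[OF g, of t]] f sq_int_translate(1)[OF g, of t]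
        by (intro integral_mono) (auto simp: sq_int_def)
      then show ?thesis using f sq_int_translate[OF g, of t] by (simp add: sq_int_def C_def)
    qed
    have C: "C \<ge> 0" by (simp add: C_def)
    have "(\<integral>x. f x * conv g ?m x \<partial>lborel) = (\<integral>x. (\<integral>t. f x * (g (x + t) * ?m t) \<partial>lborel) \<partial>lborel)"
    proof (rule Bochner_Integration.integral_cong[OF refl])
      fix x
      have "conv g ?m x = (\<integral>y. g (y + x) * ?m (x - (y + x)) \<partial>lborel)"
        unfolding conv_def by (rule lborel_integral_translate(1)[symmetric]) measurable
      then have "conv g ?m x = (\<integral>y. g (x + y) * ?m y \<partial>lborel)" by (simp add: m(3) add.commute)
      then show "f x * conv g ?m x = (\<integral>t. f x * (g (x + t) * ?m t) \<partial>lborel)" by simp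
    qed
    also have "\<dots> = (\<integral>t. (\<integral>x. f x * (g (x + t) * ?m t) \<partial>lborel) \<partial>lborel)"
    proof (rule lborel_pair.Fubini_integral)
      have "integrable (lborel \<Otimes>\<^sub>M lborel) (\<lambda>(t, x). f x * (g (x + t) * ?m t))"
      proof (rule lborel_pair.Fubini_integrable)
        show "(\<lambda>(t, x). f x * (g (x + t) * ?m t)) \<in> borel_measurable (lborel \<Otimes>\<^sub>M lborel)" by measurable
        show "integrable lborel (\<lambda>t. \<integral>x. norm (case (t, x) of (t, x) \<Rightarrow> f x * (g (x + t) * ?m t)) \<partial>lborel)"
        proof (rule Bochner_Integration.integrable_bound[of _ "\<lambda>t. C * ?m t"])
          show "AE t in lborel. norm (\<integral>x. norm (case (t, x) of (t, x) \<Rightarrow> f x * (g (x + t) * ?m t)) \<partial>lborel) \<le> norm (C * ?m t)"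
          proof (rule AE_I2)
            fix t
            have "(\<integral>x. norm (f x * (g (x + t) * ?m t)) \<partial>lborel) = (\<integral>x. norm (f x * g (x + t)) \<partial>lborel) * ?m t"
              using m(2)[of t] by (simp add: abs_mult mult.assoc[symmetric])
            also have "\<dots> \<le> C * ?m t" using absC m(2) by (intro mult_right_mono)
            finally show "norm (\<integral>x. norm (case (t, x) of (t, x) \<Rightarrow> f x * (g (x + t) * ?m t)) \<partial>lborel) \<le> norm (C * ?m t)"
              using C m(2)[of t] by simp
          qed
          show "(\<lambda>t. \<integral>x. norm (case (t, x) of (t, x) \<Rightarrow> f x * (g (x + t) * ?m t)) \<partial>lborel) \<in> borel_measurable lborel"
            by measurable
        qed (use m(6) in simp)
        have "integrable lborel (\<lambda>x. (f x * g (x + t)) * ?m t)" for t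
          by (intro integrable_mult_left sq_int_mult_integrable[OF f sq_int_translate(1)[OF g]])
        then show "AE t in lborel. integrable lborel (\<lambda>x. case (t, x) of (t, x) \<Rightarrow> f x * (g (x + t) * ?m t))"
          by (simp add: mult.assoc)
      qed
      then show "integrable (lborel \<Otimes>\<^sub>M lborel) (\<lambda>(t, x). f x * (g (x + t) * ?m t))" .
    qed
    also have "\<dots> = (\<integral>t. G t * ?m t \<partial>lborel)" unfolding G_def by (simp add: mult.assoc[symmetric])
    finally have 1: "(\<integral>x. f x * conv g ?m x \<partial>lborel) = (\<integral>t. G t * ?m t \<partial>lborel)" .
    have Gb: "\<bar>G t\<bar> \<le> C" for t
      using order_trans[OF integral_norm_bound[of lborel "\<lambda>x. f x * g (x + t)"] absC[of t]] by (simp add: G_def)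
    have iG: "integrable lborel (\<lambda>t. G t * ?m t)"
      by (rule Bochner_Integration.integrable_bound[of _ "\<lambda>t. C * ?m t"])
         (use m(6) Gb m(2) C in \<open>auto simp: abs_mult intro!: mult_right_mono\<close>)
    have "(\<integral>t. G t * ?m t \<partial>lborel) - G 0 = (\<integral>t. (G t - G 0) * ?m t \<partial>lborel)"
      using iG m(5,6) by (simp add: left_diff_distrib)
    also have "norm \<dots> \<le> (\<integral>t. (e / 2) * ?m t \<partial>lborel)"
    proof (rule Bochner_Integration.integral_norm_bound_integral)
      show "integrable lborel (\<lambda>t. (G t - G 0) * ?m t)" using iG m(6) by (simp add: left_diff_distrib)
      show "norm ((G t - G 0) * ?m t) \<le> (e / 2) * ?m t" for t
      proof (cases "norm t \<le> h")
        case True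
        then have "\<bar>G t - G 0\<bar> \<le> e / 2" using d(2)[of t] h by simp
        then show ?thesis using mult_right_mono[OF _ m(2)[of t]] m(2)[of t] by (simp only: real_norm_def abs_mult abs_of_nonneg)
      next
        case False
        then show ?thesis using m(4)[of t] by simp
      qed
    qed (use m(6) in simp)
    also have "\<dots> = e / 2" using m(5) by simp
    finally have "\<bar>(\<integral>t. G t * ?m t \<partial>lborel) - G 0\<bar> \<le> e / 2" by simp
    then show ?thesis using 1 e by (simp add: G_def)
  qed
  then show ?thesis using that d(1) by blast
qed

subsection \<open>The weak Leibniz rule\<close>

definition L2_loc :: "'a::euclidean_space set \<Rightarrow> ('a \<Rightarrow> real) \<Rightarrow> bool" where
  "L2_loc V f \<longleftrightarrow> f \<in> borel_measurable (lebesgue_on V) \<and>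
     (\<forall>K. compact K \<longrightarrow> K \<subseteq> V \<longrightarrow> integrable lebesgue (\<lambda>x. indicator K x * (f x)\<^sup>2))"

lemma L2_loc_borel_version:
  fixes f :: "'a::euclidean_space \<Rightarrow> real"
  assumes V: "V \<in> sets lebesgue" and f: "L2_loc V f" and K: "compact K" "K \<subseteq> V"
  obtains f' where "sq_int f'" "integrable lborel f'" "\<And>x. x \<notin> K \<Longrightarrow> f' x = 0"
    "\<And>\<psi>. \<psi> \<in> borel_measurable borel \<Longrightarrow> (\<And>x. x \<notin> K \<Longrightarrow> \<psi> x = 0) \<Longrightarrow>
       (LINT x|lebesgue_on V. f x * \<psi> x) = (\<integral>x. f' x * \<psi> x \<partial>lborel)"
    "AE x in lebesgue. f' x = indicator K x * f x"
proof -
  have mK[measurable]: "K \<in> sets borel" using K(1) by (rule borel_compact)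
  have "(\<lambda>x. if x \<in> V then f x else 0) \<in> borel_measurable lebesgue"
    using f borel_measurable_if[OF V, of f] by (simp add: L2_loc_def)
  then obtain g where g: "g \<in> borel_measurable lborel" "AE x in lborel. (if x \<in> V then f x else 0) = g x"
    using completion_ex_borel_measurable_real by blast
  have [measurable]: "g \<in> borel_measurable borel" using g(1) by simp
  define f' where "f' x = indicator K x * g x" for x
  have [measurable]: "f' \<in> borel_measurable borel" unfolding f'_def by measurable
  have AE: "AE x in lborel. f' x = indicator K x * f x"
    using g(2) by eventually_elim (use K(2) in \<open>auto simp: f'_def indicator_def\<close>)
  have AEl: "AE x in lebesgue. f' x = indicator K x * f x" using AE by (rule AE_completion)
  have "integrable lebesgue (\<lambda>x. indicator K x * (f x)\<^sup>2)" using f K by (auto simp: L2_loc_def)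
  moreover have "integrable lebesgue (\<lambda>x. (f' x)\<^sup>2) \<longleftrightarrow> integrable lebesgue (\<lambda>x. indicator K x * (f x)\<^sup>2)"
  proof (rule integrable_cong_AE)
    show "(\<lambda>x. (f' x)\<^sup>2) \<in> borel_measurable lebesgue" 
      by (rule measurable_completion) simp
    show "(\<lambda>x. indicator K x * (f x)\<^sup>2) \<in> borel_measurable lebesgue"
      using calculation by (rule borel_measurable_integrable)
    show "AE x in lebesgue. (f' x)\<^sup>2 = indicator K x * (f x)\<^sup>2"
      using AEl by eventually_elim (auto simp: indicator_def)
  qed
  ultimately have "integrable lborel (\<lambda>x. (f' x)\<^sup>2)" using lebesgue_integral_eq_lborel(2)[of "\<lambda>x. (f' x)\<^sup>2"] by simp
  then have sq: "sq_int f'" by (simp add: sq_int_def)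
  have z: "f' x = 0" if "x \<notin> K" for x using that by (simp add: f'_def)
  have "integrable lborel (\<lambda>x. f' x * indicator K x)"
  proof (rule sq_int_mult_integrable[OF sq])
    have "(\<lambda>x::'a. (indicator K x :: real)\<^sup>2) = indicator K" by (auto simp: indicator_def fun_eq_iff)
    then show "sq_int (indicator K :: 'a \<Rightarrow> real)"
      using integrable_indicator_compact[OF K(1)] by (simp add: sq_int_def)
  qed
  moreover have "(\<lambda>x. f' x * indicator K x) = f'" using z by (auto simp: fun_eq_iff indicator_def)
  ultimately have i: "integrable lborel f'" by simp
  have int: "(LINT x|lebesgue_on V. f x * \<psi> x) = (\<integral>x. f' x * \<psi> x \<partial>lborel)"
    if [measurable]: "\<psi> \<in> borel_measurable borel" and \<psi>: "\<And>x. x \<notin> K \<Longrightarrow> \<psi> x = 0" for \<psi>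
  proof -
    have "(LINT x|lebesgue_on V. f x * \<psi> x) = (LINT x|lebesgue. indicator V x * (f x * \<psi> x))"
      by (rule lebesgue_on_integral(1)[OF V])
    also have "\<dots> = (LINT x|lebesgue. f' x * \<psi> x)"
    proof (rule integral_cong_AE)
      show m: "(\<lambda>x. f' x * \<psi> x) \<in> borel_measurable lebesgue" by (rule measurable_completion) simp
      have ae: "AE x in lebesgue. f' x * \<psi> x = indicator V x * (f x * \<psi> x)"
        using AEl by eventually_elim (use \<psi> K(2) in \<open>auto simp: indicator_def\<close>)
      show "AE x in lebesgue. indicator V x * (f x * \<psi> x) = f' x * \<psi> x"
        using ae by eventually_elim (rule sym)
      have "(\<lambda>x. (if x \<in> V then f x else 0) * \<psi> x) \<in> borel_measurable lebesgue"
        by (rule borel_measurable_times[OF \<open>(\<lambda>x. if x \<in> V then f x else 0) \<in> borel_measurable lebesgue\<close>])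
           (rule measurable_completion, simp)
      moreover have "(\<lambda>x. (if x \<in> V then f x else 0) * \<psi> x) = (\<lambda>x. indicator V x * (f x * \<psi> x))"
        by (auto simp: indicator_def)
      ultimately show "(\<lambda>x. indicator V x * (f x * \<psi> x)) \<in> borel_measurable lebesgue" by simp
    qed
    also have "\<dots> = (\<integral>x. f' x * \<psi> x \<partial>lborel)" by (rule lebesgue_integral_eq_lborel) simp
    finally show ?thesis .
  qed
  show ?thesis by (rule that[OF sq i z int AEl])
qed

lemma L2_loc_mult_integrable:
  fixes f g :: "'a::euclidean_space \<Rightarrow> real"
  assumes V: "V \<in> sets lebesgue" and f: "L2_loc V f" and g: "L2_loc V g" and \<psi>: "test_function V \<psi>"
  shows "integrable (lebesgue_on V) (\<lambda>x. f x * g x * \<psi> x)"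
proof -
  obtain B where B: "B > 0" "\<And>x. \<bar>\<psi> x\<bar> \<le> B" by (rule test_function_bounded[OF \<psi>]) blast
  let ?K = "tsupp \<psi>"
  note K = test_functionD(2,3)[OF \<psi>]
  have i: "integrable lebesgue (\<lambda>x. B * (indicator ?K x * (f x)\<^sup>2 + indicator ?K x * (g x)\<^sup>2))"
    using f g K by (auto simp: L2_loc_def)
  have m: "(\<lambda>x. if x \<in> V then h x else 0) \<in> borel_measurable lebesgue" if "L2_loc V h" for h
    using that borel_measurable_if[OF V, of h] by (simp add: L2_loc_def)
  have "\<psi> \<in> borel_measurable borel" using test_function_continuous[OF \<psi>, of UNIV] by (simp add: borel_measurable_continuous_onI)
  then have m\<psi>: "\<psi> \<in> borel_measurable lebesgue" by (intro measurable_completion) simp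
  have "integrable lebesgue (\<lambda>x. indicator V x * (f x * g x * \<psi> x))"
  proof (rule Bochner_Integration.integrable_bound[OF i])
    have "(\<lambda>x. (if x \<in> V then f x else 0) * (if x \<in> V then g x else 0) * \<psi> x) \<in> borel_measurable lebesgue"
      by (intro borel_measurable_times m f g m\<psi>)
    moreover have "(\<lambda>x. (if x \<in> V then f x else 0) * (if x \<in> V then g x else 0) * \<psi> x) = (\<lambda>x. indicator V x * (f x * g x * \<psi> x))"
      by (auto simp: indicator_def)
    ultimately show "(\<lambda>x. indicator V x * (f x * g x * \<psi> x)) \<in> borel_measurable lebesgue" by simp
    show "AE x in lebesgue. norm (indicator V x * (f x * g x * \<psi> x)) \<le> norm (B * (indicator ?K x * (f x)\<^sup>2 + indicator ?K x * (g x)\<^sup>2))"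
    proof (rule AE_I2)
      fix x
      show "norm (indicator V x * (f x * g x * \<psi> x)) \<le> norm (B * (indicator ?K x * (f x)\<^sup>2 + indicator ?K x * (g x)\<^sup>2))"
      proof (cases "x \<in> ?K")
        case True
        have "\<bar>f x * g x\<bar> * \<bar>\<psi> x\<bar> \<le> ((f x)\<^sup>2 + (g x)\<^sup>2) * B"
          using abs_mult_le_weighted[of 1 "f x" "g x"] B by (intro mult_mono) auto
        then show ?thesis using True K B(1) by (auto simp: abs_mult mult.commute)
      qed (simp add: tsupp_zero)
    qed
  qed
  then show ?thesis by (simp add: lebesgue_on_integral(2)[OF V])
qed

lemma L2_loc_continuous:
  fixes f :: "'a::euclidean_space \<Rightarrow> real"
  assumes "V \<in> sets lebesgue" "continuous_on V f"
  shows "L2_loc V f"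
  unfolding L2_loc_def
proof (intro conjI allI impI)
  show "f \<in> borel_measurable (lebesgue_on V)" by (rule continuous_imp_measurable_on_sets_lebesgue[OF assms(2,1)])
  fix K assume K: "compact K" "K \<subseteq> V"
  have "continuous_on K (\<lambda>x. (f x)\<^sup>2)" using continuous_on_subset[OF assms(2) K(2)] by (intro continuous_intros)
  from borel_integrable_compact[OF K(1) this] have i: "integrable lborel (\<lambda>x. indicator K x * (f x)\<^sup>2)" by simp
  then have "(\<lambda>x. indicator K x * (f x)\<^sup>2) \<in> borel_measurable borel"
    using borel_measurable_integrable by fastforce
  then show "integrable lebesgue (\<lambda>x. indicator K x * (f x)\<^sup>2)" using i lebesgue_integral_eq_lborel(2) by blast
qed

text \<open>\<open>d (\<gamma> \<beta>) = d \<gamma> \<and> \<beta>\<close> for a closed \<open>1\<close>-form \<open>\<beta>\<close>, evaluated on two constant fields. Both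
  factors are merely weakly differentiable, so the closedness of \<open>\<beta>\<close> is tested on \<open>\<phi>\<close> times a
  mollification of \<open>\<gamma>\<close>.\<close>

lemma weak_leibniz_components:
  fixes \<gamma> :: "'a::euclidean_space \<Rightarrow> real"
  assumes V: "open V" 
    and L2: "L2_loc V \<gamma>" "L2_loc V \<epsilon>0" "L2_loc V \<epsilon>1" "L2_loc V \<beta>0" "L2_loc V \<beta>1"
    and d0: "\<And>\<phi>. test_function V \<phi> \<Longrightarrow> (LINT x|lebesgue_on V. \<epsilon>0 x * \<phi> x) = - (LINT x|lebesgue_on V. \<gamma> x * fd \<phi> x v0)"
    and d1: "\<And>\<phi>. test_function V \<phi> \<Longrightarrow> (LINT x|lebesgue_on V. \<epsilon>1 x * \<phi> x) = - (LINT x|lebesgue_on V. \<gamma> x * fd \<phi> x v1)"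
    and cl: "\<And>\<phi>. test_function V \<phi> \<Longrightarrow> (LINT x|lebesgue_on V. \<beta>1 x * fd \<phi> x v0) = (LINT x|lebesgue_on V. \<beta>0 x * fd \<phi> x v1)"
    and \<phi>: "test_function V \<phi>"
  shows "(LINT x|lebesgue_on V. (\<epsilon>0 x * \<beta>1 x - \<epsilon>1 x * \<beta>0 x) * \<phi> x) =
    - ((LINT x|lebesgue_on V. \<gamma> x * \<beta>1 x * fd \<phi> x v0) - (LINT x|lebesgue_on V. \<gamma> x * \<beta>0 x * fd \<phi> x v1))"
proof -
  have VL: "V \<in> sets lebesgue" using V by (simp add: borel_open)
  let ?K = "tsupp \<phi>"
  note K = test_functionD(2,3)[OF \<phi>]
  obtain r where r: "r > 0" "(\<Union>x\<in>?K. cball x r) \<subseteq> V"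
    using compact_subset_open_imp_cball_epsilon_subset[OF K(1) V K(2)] by blast
  define K' where "K' = {x + y | x y. x \<in> ?K \<and> y \<in> cball 0 r}"
  have K': "compact K'" unfolding K'_def by (rule compact_sums[OF K(1) compact_cball])
  have near: "x + y \<in> K'" if "x \<in> ?K" "norm y \<le> r" for x y
    unfolding K'_def using that by force
  have KK: "?K \<subseteq> K'" using near[of _ 0] r by auto
  have K'V: "K' \<subseteq> V"
  proof
    fix z assume "z \<in> K'"
    then obtain x y where "x \<in> ?K" "y \<in> cball 0 r" "z = x + y" unfolding K'_def by blast
    then have "z \<in> cball x r" by (simp add: dist_norm)
    then show "z \<in> V" using r(2) \<open>x \<in> ?K\<close> by blast
  qed
  obtain g where g: "sq_int g" "integrable lborel g" "\<And>x. x \<notin> K' \<Longrightarrow> g x = 0"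
    "\<And>\<psi>. \<psi> \<in> borel_measurable borel \<Longrightarrow> (\<And>x. x \<notin> K' \<Longrightarrow> \<psi> x = 0) \<Longrightarrow> (LINT x|lebesgue_on V. \<gamma> x * \<psi> x) = (\<integral>x. g x * \<psi> x \<partial>lborel)"
    "AE x in lebesgue. g x = indicator K' x * \<gamma> x"
    by (rule L2_loc_borel_version[OF VL L2(1) K' K'V]) (rule that, simp_all)
  obtain e0 where e0: "sq_int e0" "integrable lborel e0" "\<And>x. x \<notin> K' \<Longrightarrow> e0 x = 0"
    "\<And>\<psi>. \<psi> \<in> borel_measurable borel \<Longrightarrow> (\<And>x. x \<notin> K' \<Longrightarrow> \<psi> x = 0) \<Longrightarrow> (LINT x|lebesgue_on V. \<epsilon>0 x * \<psi> x) = (\<integral>x. e0 x * \<psi> x \<partial>lborel)"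
    "AE x in lebesgue. e0 x = indicator K' x * \<epsilon>0 x"
    by (rule L2_loc_borel_version[OF VL L2(2) K' K'V]) (rule that, simp_all)
  obtain e1 where e1: "sq_int e1" "integrable lborel e1" "\<And>x. x \<notin> K' \<Longrightarrow> e1 x = 0"
    "\<And>\<psi>. \<psi> \<in> borel_measurable borel \<Longrightarrow> (\<And>x. x \<notin> K' \<Longrightarrow> \<psi> x = 0) \<Longrightarrow> (LINT x|lebesgue_on V. \<epsilon>1 x * \<psi> x) = (\<integral>x. e1 x * \<psi> x \<partial>lborel)"
    "AE x in lebesgue. e1 x = indicator K' x * \<epsilon>1 x"
    by (rule L2_loc_borel_version[OF VL L2(3) K' K'V]) (rule that, simp_all)
  obtain b0 where b0: "sq_int b0" "integrable lborel b0" "\<And>x. x \<notin> K' \<Longrightarrow> b0 x = 0"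
    "\<And>\<psi>. \<psi> \<in> borel_measurable borel \<Longrightarrow> (\<And>x. x \<notin> K' \<Longrightarrow> \<psi> x = 0) \<Longrightarrow> (LINT x|lebesgue_on V. \<beta>0 x * \<psi> x) = (\<integral>x. b0 x * \<psi> x \<partial>lborel)"
    "AE x in lebesgue. b0 x = indicator K' x * \<beta>0 x"
    by (rule L2_loc_borel_version[OF VL L2(4) K' K'V]) (rule that, simp_all)
  obtain b1 where b1: "sq_int b1" "integrable lborel b1" "\<And>x. x \<notin> K' \<Longrightarrow> b1 x = 0"
    "\<And>\<psi>. \<psi> \<in> borel_measurable borel \<Longrightarrow> (\<And>x. x \<notin> K' \<Longrightarrow> \<psi> x = 0) \<Longrightarrow> (LINT x|lebesgue_on V. \<beta>1 x * \<psi> x) = (\<integral>x. b1 x * \<psi> x \<partial>lborel)"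
    "AE x in lebesgue. b1 x = indicator K' x * \<beta>1 x"
    by (rule L2_loc_borel_version[OF VL L2(5) K' K'V]) (rule that, simp_all)
  have mtest: "\<psi> \<in> borel_measurable borel" if "test_function W \<psi>" for W and \<psi> :: "'a \<Rightarrow> real"
    using test_function_continuous[OF that, of UNIV] by (simp add: borel_measurable_continuous_onI)
  have off: "\<phi> x = 0" "fd \<phi> x v = 0" if "x \<notin> K'" for x v
  proof -
    have "x \<notin> tsupp \<phi>" using that KK by blast
    then show "\<phi> x = 0" "fd \<phi> x v = 0" using tsupp_zero[of x \<phi>] fd_tsupp_zero[of x \<phi>] by auto
  qed
  have sqm: "sq_int (\<lambda>x. f x * \<psi> x)" if f: "sq_int f" and \<psi>: "test_function W \<psi>" for f W and \<psi> :: "'a \<Rightarrow> real"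
  proof -
    obtain B where "\<And>x. \<bar>\<psi> x\<bar> \<le> B" by (rule test_function_bounded[OF \<psi>]) blast
    then show ?thesis using sq_int_mult_bounded[OF f mtest[OF \<psi>]] by blast
  qed
  note t0 = test_function_fd[OF \<phi>, of v0] and t1 = test_function_fd[OF \<phi>, of v1]
  have s: "sq_int (\<lambda>x. b1 x * \<phi> x)" "sq_int (\<lambda>x. b0 x * \<phi> x)"
     "sq_int (\<lambda>x. b1 x * fd \<phi> x v0)" "sq_int (\<lambda>x. b0 x * fd \<phi> x v1)"
    using sqm[OF b1(1) \<phi>] sqm[OF b0(1) \<phi>] sqm[OF b1(1) t0] sqm[OF b0(1) t1] by auto
  let ?P = "\<lambda>f G. \<integral>x. f x * G x \<partial>lborel"
  let ?lim = "?P (\<lambda>x. b1 x * \<phi> x) e0 + ?P (\<lambda>x. b1 x * fd \<phi> x v0) g - ?P (\<lambda>x. b0 x * \<phi> x) e1 - ?P (\<lambda>x. b0 x * fd \<phi> x v1) g"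
  have mol: "?P (\<lambda>x. b1 x * \<phi> x) (conv e0 (mollifier h)) + ?P (\<lambda>x. b1 x * fd \<phi> x v0) (conv g (mollifier h)) =
       ?P (\<lambda>x. b0 x * \<phi> x) (conv e1 (mollifier h)) + ?P (\<lambda>x. b0 x * fd \<phi> x v1) (conv g (mollifier h))"
    if h: "0 < h" "h < r" for h
  proof -
    let ?m = "mollifier h :: 'a \<Rightarrow> real"
    note m = mollifier_props[OF h(1), where 'a = 'a]
    note gs = conv_smooth[OF g(2) m(1)]
    have ck: "conv e ?m x = conv g (\<lambda>z. fd ?m z v) x"
      if x: "x \<in> ?K" and e: "\<And>\<psi>. \<psi> \<in> borel_measurable borel \<Longrightarrow> (\<And>x. x \<notin> K' \<Longrightarrow> \<psi> x = 0) \<Longrightarrow> (LINT x|lebesgue_on V. eps x * \<psi> x) = (\<integral>x. e x * \<psi> x \<partial>lborel)"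
        and d: "\<And>\<phi>. test_function V \<phi> \<Longrightarrow> (LINT x|lebesgue_on V. eps x * \<phi> x) = - (LINT x|lebesgue_on V. \<gamma> x * fd \<phi> x v)"
      for x v e eps
    proof -
      let ?\<psi> = "\<lambda>y. ?m (x - y)"
      have out: "x - y \<notin> cball 0 h" if "y \<notin> K'" for y
        using near[OF x, of "y - x"] that h by (auto simp: norm_minus_commute)
      have der: "(?\<psi> has_derivative (\<lambda>v. - fd ?m (x - y) v)) (at y)" for y
      proof -
        have "(?\<psi> has_derivative (\<lambda>v. fd ?m (x - y) (- v))) (at y)"
          by (rule has_derivative_compose[where f = "\<lambda>y. x - y" and g = ?m])
             (auto intro!: derivative_eq_intros fd_has_derivative test_function_differentiable[OF m(1)])
        then show ?thesis
          using linear_neg[OF fd_linear[OF test_function_differentiable[OF m(1)]]] by simp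
      qed
      have smooth: "smooth_on UNIV ?\<psi>"
      proof -
        have "Ck_on n UNIV (\<lambda>y. k (x - y))" if "test_function UNIV k" for n and k :: "'a \<Rightarrow> real"
          using that
        proof (induction n arbitrary: k)
          case 0
          have "continuous_on UNIV (\<lambda>y. k (x - y))"
            by (rule continuous_on_compose2[OF test_function_continuous[OF 0, of UNIV]]) (auto intro!: continuous_intros)
          then show ?case by simp
        next
          case (Suc n)
          have "((\<lambda>y. k (x - y)) has_derivative (\<lambda>v. fd k (x - y) (- v))) (at y)" for y
            by (rule has_derivative_compose[where f = "\<lambda>y. x - y" and g = k])
               (auto intro!: derivative_eq_intros fd_has_derivative test_function_differentiable[OF Suc.prems])
          moreover have "\<forall>v. Ck_on n UNIV (\<lambda>y. fd k (x - y) (- v))" using Suc.IH[OF test_function_fd[OF Suc.prems]] by blast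
          ultimately show ?case unfolding Ck_on.simps by (intro exI[of _ "\<lambda>y v. fd k (x - y) (- v)"]) simp
        qed
        then show ?thesis using m(1) unfolding smooth_on_def by blast
      qed
      have z: "?\<psi> y = 0" if "y \<notin> K'" for y using m(4)[OF out[OF that]] .
      have t: "test_function V ?\<psi>" by (rule test_functionI[OF smooth K' K'V z])
      have zd: "fd ?\<psi> y v = 0" if "y \<notin> K'" for y
      proof -
        have "y \<notin> tsupp ?\<psi>" unfolding tsupp_def
          using closure_minimal[of "{y. ?\<psi> y \<noteq> 0}" K'] z K' that compact_imp_closed by blast
        then show ?thesis by (simp add: fd_tsupp_zero)
      qed
      have "conv e ?m x = (LINT y|lebesgue_on V. eps y * ?\<psi> y)"
        unfolding conv_def by (rule e[symmetric]) (use mtest[OF t] z in auto)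
      also have "\<dots> = - (LINT y|lebesgue_on V. \<gamma> y * fd ?\<psi> y v)" by (rule d[OF t])
      also have "(LINT y|lebesgue_on V. \<gamma> y * fd ?\<psi> y v) = (\<integral>y. g y * fd ?\<psi> y v \<partial>lborel)"
        by (rule g(4)) (use mtest[OF test_function_fd[OF t]] zd in auto)
      also have "\<dots> = - (\<integral>y. g y * fd ?m (x - y) v \<partial>lborel)" by (simp add: fd_eq[OF der])
      finally show ?thesis by (simp add: conv_def)
    qed
    have t\<phi>: "test_function V (\<lambda>x. \<phi> x * conv g ?m x)" by (rule test_function_mult[OF \<phi> gs])
    have fdp: "fd (\<lambda>x. \<phi> x * conv g ?m x) x v = \<phi> x * conv g (\<lambda>z. fd ?m z v) x + fd \<phi> x v * conv g ?m x" for x v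
      using fd_eq[OF has_derivative_mult[OF fd_has_derivative[OF test_function_differentiable[OF \<phi>]] conv_has_derivative[OF g(2) m(1)]]]
      by simp
    have bd: "integrable lborel (\<lambda>x. f x * conv e ?m x)" if "sq_int f" "\<And>x. x \<notin> K' \<Longrightarrow> f x = 0" "integrable lborel e" for f e
    proof -
      have c: "continuous_on UNIV (conv e ?m)" by (rule smooth_on_continuous[OF conv_smooth[OF that(3) m(1)]])
      have "integrable lborel (\<lambda>x. f x * (indicator K' x * conv e ?m x))"
      proof (rule sq_int_mult_integrable[OF that(1)])
        have "integrable lborel (\<lambda>x. indicator K' x *\<^sub>R (conv e ?m x)\<^sup>2)"
          by (rule borel_integrable_compact[OF K']) (intro continuous_intros continuous_on_subset[OF c], simp)
        moreover have "(\<lambda>x. indicator K' x *\<^sub>R (conv e ?m x)\<^sup>2) = (\<lambda>x. (indicator K' x * conv e ?m x)\<^sup>2)"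
          by (auto simp: indicator_def)
        moreover have "(\<lambda>x. indicator K' x * conv e ?m x) \<in> borel_measurable borel"
          using borel_compact[OF K'] borel_measurable_continuous_onI[OF c] by measurable
        ultimately show "sq_int (\<lambda>x. indicator K' x * conv e ?m x)" by (simp add: sq_int_def)
      qed
      moreover have "(\<lambda>x. f x * (indicator K' x * conv e ?m x)) = (\<lambda>x. f x * conv e ?m x)"
        using that(2) by (auto simp: indicator_def fun_eq_iff)
      ultimately show ?thesis by simp
    qed
    have side: "(LINT x|lebesgue_on V. \<beta> x * fd (\<lambda>x. \<phi> x * conv g ?m x) x v) =
        ?P (\<lambda>x. b x * \<phi> x) (conv e ?m) + ?P (\<lambda>x. b x * fd \<phi> x v) (conv g ?m)"
      if b: "sq_int b" "\<And>x. x \<notin> K' \<Longrightarrow> b x = 0" "\<And>\<psi>. \<psi> \<in> borel_measurable borel \<Longrightarrow> (\<And>x. x \<notin> K' \<Longrightarrow> \<psi> x = 0) \<Longrightarrow> (LINT x|lebesgue_on V. \<beta> x * \<psi> x) = (\<integral>x. b x * \<psi> x \<partial>lborel)"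
        and e: "integrable lborel e" "\<And>x. x \<in> ?K \<Longrightarrow> conv e ?m x = conv g (\<lambda>z. fd ?m z v) x"
      for b \<beta> e v
    proof -
      have "(LINT x|lebesgue_on V. \<beta> x * fd (\<lambda>x. \<phi> x * conv g ?m x) x v) = (\<integral>x. b x * fd (\<lambda>x. \<phi> x * conv g ?m x) x v \<partial>lborel)"
        by (rule b(3)[OF mtest[OF test_function_fd[OF t\<phi>]]]) (simp add: fdp off)
      also have "\<dots> = (\<integral>x. (b x * \<phi> x) * conv e ?m x + (b x * fd \<phi> x v) * conv g ?m x \<partial>lborel)"
      proof (rule Bochner_Integration.integral_cong[OF refl])
        fix x
        have "\<phi> x * conv g (\<lambda>z. fd ?m z v) x = \<phi> x * conv e ?m x"
          using e(2)[of x] tsupp_zero[of x \<phi>] by (cases "x \<in> ?K") auto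
        then show "b x * fd (\<lambda>x. \<phi> x * conv g ?m x) x v = (b x * \<phi> x) * conv e ?m x + (b x * fd \<phi> x v) * conv g ?m x"
          by (simp only: fdp distrib_left mult.assoc)
      qed
      also have "\<dots> = ?P (\<lambda>x. b x * \<phi> x) (conv e ?m) + ?P (\<lambda>x. b x * fd \<phi> x v) (conv g ?m)"
        by (rule Bochner_Integration.integral_add)
           (intro bd sqm[OF b(1) \<phi>] sqm[OF b(1) test_function_fd[OF \<phi>]] e(1) g(2); simp add: off)+
      finally show ?thesis .
    qed
    have "(LINT x|lebesgue_on V. \<beta>1 x * fd (\<lambda>x. \<phi> x * conv g ?m x) x v0) =
        ?P (\<lambda>x. b1 x * \<phi> x) (conv e0 ?m) + ?P (\<lambda>x. b1 x * fd \<phi> x v0) (conv g ?m)"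
    proof (rule side[OF b1(1) _ _ e0(2)])
      show "conv e0 ?m x = conv g (\<lambda>z. fd ?m z v0) x" if "x \<in> ?K" for x
      proof (rule ck[OF that])
        show "(LINT x|lebesgue_on V. \<epsilon>0 x * \<phi> x) = - (LINT x|lebesgue_on V. \<gamma> x * fd \<phi> x v0)" if "test_function V \<phi>" for \<phi>
          using d0[OF that] .
      qed (simp add: e0(4))
    qed (simp_all add: b1(3,4))
    moreover have "(LINT x|lebesgue_on V. \<beta>0 x * fd (\<lambda>x. \<phi> x * conv g ?m x) x v1) =
        ?P (\<lambda>x. b0 x * \<phi> x) (conv e1 ?m) + ?P (\<lambda>x. b0 x * fd \<phi> x v1) (conv g ?m)"
    proof (rule side[OF b0(1) _ _ e1(2)])
      show "conv e1 ?m x = conv g (\<lambda>z. fd ?m z v1) x" if "x \<in> ?K" for x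
      proof (rule ck[OF that])
        show "(LINT x|lebesgue_on V. \<epsilon>1 x * \<phi> x) = - (LINT x|lebesgue_on V. \<gamma> x * fd \<phi> x v1)" if "test_function V \<phi>" for \<phi>
          using d1[OF that] .
      qed (simp add: e1(4))
    qed (simp_all add: b0(3,4))
    ultimately show ?thesis using cl[OF t\<phi>] by simp
  qed
  have "\<bar>?lim\<bar> \<le> 0 + e" if e: "e > 0" for e
  proof -
    have e4: "e / 4 > 0" using e by simp
    have ex: "\<exists>r>0. \<forall>h. 0 < h \<and> h < r \<longrightarrow> \<bar>?P f (conv G (mollifier h)) - ?P f G\<bar> < e / 4"
      if fG: "sq_int f" "sq_int G" for f G
      by (rule mollifier_pairing[OF fG e4]) blast
    obtain r1 where r1: "r1 > 0" "\<forall>h. 0 < h \<and> h < r1 \<longrightarrow> \<bar>?P (\<lambda>x. b1 x * \<phi> x) (conv e0 (mollifier h)) - ?P (\<lambda>x. b1 x * \<phi> x) e0\<bar> < e / 4"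
      using ex[OF s(1) e0(1)] by (elim exE conjE)
    obtain r2 where r2: "r2 > 0" "\<forall>h. 0 < h \<and> h < r2 \<longrightarrow> \<bar>?P (\<lambda>x. b1 x * fd \<phi> x v0) (conv g (mollifier h)) - ?P (\<lambda>x. b1 x * fd \<phi> x v0) g\<bar> < e / 4"
      using ex[OF s(3) g(1)] by (elim exE conjE)
    obtain r3 where r3: "r3 > 0" "\<forall>h. 0 < h \<and> h < r3 \<longrightarrow> \<bar>?P (\<lambda>x. b0 x * \<phi> x) (conv e1 (mollifier h)) - ?P (\<lambda>x. b0 x * \<phi> x) e1\<bar> < e / 4"
      using ex[OF s(2) e1(1)] by (elim exE conjE)
    obtain r4 where r4: "r4 > 0" "\<forall>h. 0 < h \<and> h < r4 \<longrightarrow> \<bar>?P (\<lambda>x. b0 x * fd \<phi> x v1) (conv g (mollifier h)) - ?P (\<lambda>x. b0 x * fd \<phi> x v1) g\<bar> < e / 4"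
      using ex[OF s(4) g(1)] by (elim exE conjE)
    define h where "h = min (min r1 r2) (min (min r3 r4) r) / 2"
    have h: "0 < h" "h < r1" "h < r2" "h < r3" "h < r4" "h < r"
      using r1(1) r2(1) r3(1) r4(1) r(1) unfolding h_def by linarith+
    show ?thesis
      using mol[OF h(1,6)] r1(2)[rule_format, OF conjI[OF h(1,2)]] r2(2)[rule_format, OF conjI[OF h(1,3)]]
        r3(2)[rule_format, OF conjI[OF h(1,4)]] r4(2)[rule_format, OF conjI[OF h(1,5)]] by linarith
  qed
  then have "\<bar>?lim\<bar> \<le> 0" by (rule field_le_epsilon)
  then have lim: "?lim = 0" by linarith
  have pair: "(LINT x|lebesgue_on V. f x * k x * \<psi> x) = (\<integral>x. (f' x * \<psi> x) * k' x \<partial>lborel)"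
    if f: "L2_loc V f" "sq_int f'" "AE x in lebesgue. f' x = indicator K' x * f x"
      and k: "L2_loc V k" "sq_int k'" "AE x in lebesgue. k' x = indicator K' x * k x"
      and \<psi>: "test_function V \<psi>" "\<And>x. x \<notin> K' \<Longrightarrow> \<psi> x = 0" for f f' k k' \<psi>
  proof -
    have [measurable]: "f' \<in> borel_measurable borel" "k' \<in> borel_measurable borel" "\<psi> \<in> borel_measurable borel"
      using f(2) k(2) mtest[OF \<psi>(1)] by (auto simp: sq_int_def)
    have "(LINT x|lebesgue_on V. f x * k x * \<psi> x) = (LINT x|lebesgue. indicator V x * (f x * k x * \<psi> x))"
      by (rule lebesgue_on_integral(1)[OF VL])
    also have "\<dots> = (LINT x|lebesgue. (f' x * \<psi> x) * k' x)"
    proof (rule integral_cong_AE)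
      show "(\<lambda>x. indicator V x * (f x * k x * \<psi> x)) \<in> borel_measurable lebesgue"
        using L2_loc_mult_integrable[OF VL f(1) k(1) \<psi>(1)] lebesgue_on_integral(2)[OF VL] borel_measurable_integrable by blast
      show "(\<lambda>x. (f' x * \<psi> x) * k' x) \<in> borel_measurable lebesgue" by (rule measurable_completion) simp
      show "AE x in lebesgue. indicator V x * (f x * k x * \<psi> x) = (f' x * \<psi> x) * k' x"
        using f(3) k(3) by eventually_elim (use \<psi>(2) K'V in \<open>auto simp: indicator_def\<close>)
    qed
    also have "\<dots> = (\<integral>x. (f' x * \<psi> x) * k' x \<partial>lborel)" by (rule lebesgue_integral_eq_lborel) simp
    finally show ?thesis .
  qed
  have "(LINT x|lebesgue_on V. (\<epsilon>0 x * \<beta>1 x - \<epsilon>1 x * \<beta>0 x) * \<phi> x) =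
      (LINT x|lebesgue_on V. \<beta>1 x * \<epsilon>0 x * \<phi> x) - (LINT x|lebesgue_on V. \<beta>0 x * \<epsilon>1 x * \<phi> x)"
    using L2_loc_mult_integrable[OF VL L2(5,2) \<phi>] L2_loc_mult_integrable[OF VL L2(4,3) \<phi>]
    by (simp add: algebra_simps)
  also have "\<dots> = ?P (\<lambda>x. b1 x * \<phi> x) e0 - ?P (\<lambda>x. b0 x * \<phi> x) e1"
    using pair[OF L2(5) b1(1,5) L2(2) e0(1,5) \<phi> off(1)] pair[OF L2(4) b0(1,5) L2(3) e1(1,5) \<phi> off(1)] by simp
  also have "\<dots> = - (?P (\<lambda>x. b1 x * fd \<phi> x v0) g - ?P (\<lambda>x. b0 x * fd \<phi> x v1) g)"
    using lim by linarith
  also have "\<dots> = - ((LINT x|lebesgue_on V. \<beta>1 x * \<gamma> x * fd \<phi> x v0) - (LINT x|lebesgue_on V. \<beta>0 x * \<gamma> x * fd \<phi> x v1))"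
    using pair[OF L2(5) b1(1,5) L2(1) g(1,5) t0 off(2)] pair[OF L2(4) b0(1,5) L2(1) g(1,5) t1 off(2)] by simp
  finally show ?thesis by (simp add: mult_ac)
qed

section \<open>Complex hyperbolic geometry in horospherical coordinates\<close>

subsection \<open>The volume density\<close>

lemma gram_det_4:
  fixes b :: "'a::euclidean_space \<Rightarrow> 'a \<Rightarrow> real"
  assumes "Basis = {w, x, y, z}" "distinct [w, x, y, z]"
  shows "gram_det b = b w w * b x x * b y y * b z z
     - b w w * b x x * b y z * b z y
     - b w w * b x y * b y x * b z z
     + b w w * b x y * b y z * b z x
     + b w w * b x z * b y x * b z y
     - b w w * b x z * b y y * b z x
     - b w x * b x w * b y y * b z z
     + b w x * b x w * b y z * b z y
     + b w x * b x y * b y w * b z z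
     - b w x * b x y * b y z * b z w
     - b w x * b x z * b y w * b z y
     + b w x * b x z * b y y * b z w
     + b w y * b x w * b y x * b z z
     - b w y * b x w * b y z * b z x
     - b w y * b x x * b y w * b z z
     + b w y * b x x * b y z * b z w
     + b w y * b x z * b y w * b z x
     - b w y * b x z * b y x * b z w
     - b w z * b x w * b y x * b z y
     + b w z * b x w * b y y * b z x
     + b w z * b x x * b y w * b z y
     - b w z * b x x * b y y * b z w
     - b w z * b x y * b y w * b z x
     + b w z * b x y * b y x * b z w"
proof -
  have d: "w \<noteq> x" "w \<noteq> y" "w \<noteq> z" "x \<noteq> y" "x \<noteq> z" "y \<noteq> z" "x \<noteq> w" "y \<noteq> w" "z \<noteq> w" "y \<noteq> x" "z \<noteq> x" "z \<noteq> y"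
    using assms(2) by auto
  have s: "sum f {p. p permutes {z}} = f id" for f :: "('a \<Rightarrow> 'a) \<Rightarrow> real" by simp
  have nots: "y \<notin> {z}" "x \<notin> {y, z}" "w \<notin> {x, y, z}" using d by auto
  have fin: "finite {z}" "finite {y, z}" "finite {x, y, z}" by auto
  show ?thesis
    unfolding gram_det_def assms(1)
    unfolding sum_over_permutations_insert[OF fin(3) nots(3)] sum_over_permutations_insert[OF fin(2) nots(2)]
      sum_over_permutations_insert[OF fin(1) nots(1)] s
    using d
    by (simp add: sign_compose permutation_compose permutation_swap_id sign_swap_id sign_id transpose_def algebra_simps)
qed

lemma Basis_C2: "(Basis :: C2 set) = {(1, 0), (\<i>, 0), (0, 1), (0, \<i>)}"
  by (auto simp: Basis_prod_def Basis_complex_def)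

lemma gram_det_CH2: 
  fixes z :: C2
  assumes "norm z < 1"
  shows "gram_det (CH2_metric z) = 1 / (1 - (norm z)\<^sup>2) ^ 6"
proof -
  define D where "D = 1 - (norm z)\<^sup>2"
  define A where "A = (Re (fst z))\<^sup>2 + (Im (fst z))\<^sup>2"
  define B where "B = (Re (snd z))\<^sup>2 + (Im (snd z))\<^sup>2"
  define C where "C = Re (fst z) * Re (snd z) + Im (fst z) * Im (snd z)"
  define S where "S = Re (fst z) * Im (snd z) - Im (fst z) * Re (snd z)"
  have nz: "(norm z)\<^sup>2 = A + B"
    by (simp add: A_def B_def norm_prod_def norm_Pair real_sqrt_pow2 cmod_power2 split: prod.split)
  have D: "D > 0" using assms by (simp add: D_def power2_norm_eq_inner[symmetric] abs_square_less_1)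
  have DAB: "D + A + B = 1" by (simp add: D_def nz)
  have hz: "1 - hermitian z z = complex_of_real D"
    unfolding D_def nz by (simp add: complex_eq_iff hermitian_def A_def B_def power2_eq_square)
  have CS: "C\<^sup>2 + S\<^sup>2 = A * B" by (simp add: A_def B_def C_def S_def power2_eq_square algebra_simps)
  let ?b = "CH2_metric z"
  let ?w = "(1, 0) :: C2" and ?x = "(\<i>, 0) :: C2" and ?y = "(0, 1) :: C2" and ?z = "(0, \<i>) :: C2"
  have e: "?b ?w ?w = (D + A) / D\<^sup>2" "?b ?x ?x = (D + A) / D\<^sup>2" "?b ?y ?y = (D + B) / D\<^sup>2" "?b ?z ?z = (D + B) / D\<^sup>2"
    "?b ?w ?x = 0" "?b ?x ?w = 0" "?b ?y ?z = 0" "?b ?z ?y = 0"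
    "?b ?w ?y = C / D\<^sup>2" "?b ?y ?w = C / D\<^sup>2" "?b ?w ?z = S / D\<^sup>2" "?b ?z ?w = S / D\<^sup>2"
    "?b ?x ?y = - S / D\<^sup>2" "?b ?y ?x = - S / D\<^sup>2" "?b ?x ?z = C / D\<^sup>2" "?b ?z ?x = C / D\<^sup>2"
    unfolding CH2_metric_def hz D_def[symmetric]
    by (simp_all add: hermitian_def A_def B_def C_def S_def power2_eq_square algebra_simps)
  have "gram_det ?b = ((D + A) * (D + B) - (C\<^sup>2 + S\<^sup>2))\<^sup>2 / D ^ 8"
    by (subst gram_det_4[OF Basis_C2]) (use D in \<open>simp_all add: e field_simps power2_eq_square eval_nat_numeral\<close>)
  also have "(D + A) * (D + B) - (C\<^sup>2 + S\<^sup>2) = D * (D + A + B)" unfolding CS by (simp add: algebra_simps)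
  also have "(D * (D + A + B))\<^sup>2 / D ^ 8 = 1 / D ^ 6" unfolding DAB using D by (simp add: field_simps power_def) 
  finally show ?thesis by (simp add: D_def)
qed

subsection \<open>Complex-valued smooth functions\<close>

definition csmooth_on :: "'a::euclidean_space set \<Rightarrow> ('a \<Rightarrow> complex) \<Rightarrow> bool" where
  "csmooth_on S f \<longleftrightarrow> smooth_on S (\<lambda>x. Re (f x)) \<and> smooth_on S (\<lambda>x. Im (f x))"

lemma csmooth_on_const: "csmooth_on S (\<lambda>x. c)"
  and csmooth_on_add: "csmooth_on S f \<Longrightarrow> csmooth_on S g \<Longrightarrow> csmooth_on S (\<lambda>x. f x + g x)"
  by (auto simp: csmooth_on_def intro: smooth_on_const smooth_on_add)

lemma csmooth_on_diff: "open S \<Longrightarrow> csmooth_on S f \<Longrightarrow> csmooth_on S g \<Longrightarrow> csmooth_on S (\<lambda>x. f x - g x)"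
  and csmooth_on_mult: "open S \<Longrightarrow> csmooth_on S f \<Longrightarrow> csmooth_on S g \<Longrightarrow> csmooth_on S (\<lambda>x. f x * g x)"
  and csmooth_on_cnj: "open S \<Longrightarrow> csmooth_on S f \<Longrightarrow> csmooth_on S (\<lambda>x. cnj (f x))"
  by (auto simp: csmooth_on_def intro!: smooth_on_diff smooth_on_mult smooth_on_add smooth_on_minus)

lemma csmooth_on_norm_square:
  "open S \<Longrightarrow> csmooth_on S f \<Longrightarrow> smooth_on S (\<lambda>x. (cmod (f x))\<^sup>2)"
  unfolding cmod_power2 csmooth_on_def by (auto intro!: smooth_on_add smooth_on_power)

lemma csmooth_on_inverse:
  assumes "open S" "csmooth_on S f" "\<And>x. x \<in> S \<Longrightarrow> f x \<noteq> 0"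
  shows "csmooth_on S (\<lambda>x. inverse (f x))"
proof -
  have "smooth_on S (\<lambda>x. inverse ((cmod (f x))\<^sup>2))"
    by (rule smooth_on_compose[OF assms(1) _ smooth_on_inverse csmooth_on_norm_square[OF assms(1,2)]])
       (use assms(3) in auto)
  moreover have "Re (inverse (f x)) = Re (f x) * inverse ((cmod (f x))\<^sup>2)"
    "Im (inverse (f x)) = - (Im (f x) * inverse ((cmod (f x))\<^sup>2))" for x
    by (simp_all add: cmod_power2 divide_inverse)
  ultimately show ?thesis using assms(1,2)
    by (simp add: csmooth_on_def smooth_on_mult smooth_on_minus del: inverse_complex.simps)
qed

lemma csmooth_on_linear: "linear f \<Longrightarrow> csmooth_on S f"
  unfolding csmooth_on_def
  by (auto intro!: smooth_on_linear linearI simp: linear_add linear_cmul)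

subsection \<open>Horospherical coordinates\<close>

definition cscale :: "complex \<Rightarrow> C2 \<Rightarrow> C2" where
  "cscale c v = (c * fst v, c * snd v)"

lemma hermitian_add: "hermitian (u + v) z = hermitian u z + hermitian v z" "hermitian z (u + v) = hermitian z u + hermitian z v"
  and hermitian_diff: "hermitian (u - v) z = hermitian u z - hermitian v z"
  and hermitian_cscale: "hermitian (cscale c v) z = c * hermitian v z" "hermitian z (cscale c v) = cnj c * hermitian z v"
  and hermitian_scaleR: "hermitian (r *\<^sub>R v) z = of_real r * hermitian v z"
  and hermitian_cnj: "cnj (hermitian u v) = hermitian v u"
  by (simp_all add: hermitian_def cscale_def algebra_simps scaleR_conv_of_real)

lemma hermitian_self: "hermitian z z = of_real ((norm z)\<^sup>2)"
  by (simp add: hermitian_def norm_prod_def complex_norm_square[symmetric] real_sqrt_pow2 flip: of_real_add of_real_power)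

lemma linear_hermitian: "linear (\<lambda>v. hermitian v z)"
  by (rule linearI) (simp_all add: hermitian_add hermitian_scaleR scaleR_conv_of_real)

lemma hermitian_has_derivative: "((\<lambda>v. hermitian v z) has_derivative (\<lambda>v. hermitian v z)) F"
  using linear_hermitian linear_conv_bounded_linear bounded_linear_imp_has_derivative by blast

text \<open>\<open>(hermitian z ep, hermitian z \<eta>)\<close> are unitary coordinates with \<open>\<eta> = (0, 1)\<close>. The pair \<open>(w, n)\<close> below
  is a projective change of these that sends \<open>\<eta>\<close> to infinity and the ball to the Siegel domain
  \<open>\<rho> > 0\<close>; \<open>dw\<close> and \<open>dn\<close> are the differentials of \<open>w\<close> and \<open>n\<close>, and \<open>2 Re th = d\<rho>\<close>.\<close>

locale boundary_point =
  fixes \<eta> :: C2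
  assumes norm_eta: "norm \<eta> = 1"
begin

definition ep :: C2 where "ep = (- cnj (snd \<eta>), cnj (fst \<eta>))"

definition nu :: "C2 \<Rightarrow> complex" where "nu z = 1 - hermitian z \<eta>"

definition wc :: "C2 \<Rightarrow> complex" where "wc z = hermitian z ep / nu z"

definition nc :: "C2 \<Rightarrow> complex" where "nc z = 1 / nu z"

definition dw :: "C2 \<Rightarrow> C2 \<Rightarrow> complex" where
  "dw z v = (hermitian v ep + wc z * hermitian v \<eta>) / nu z"

definition dn :: "C2 \<Rightarrow> C2 \<Rightarrow> complex" where
  "dn z v = hermitian v \<eta> / (nu z)\<^sup>2"

definition th :: "C2 \<Rightarrow> C2 \<Rightarrow> complex" where
  "th z v = dn z v - cnj (wc z) * dw z v"

definition rho :: "C2 \<Rightarrow> real" where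
  "rho z = 2 * Re (nc z) - 1 - (cmod (wc z))\<^sup>2"

definition ss :: "C2 \<Rightarrow> real" where "ss z = Im (nc z)"

text \<open>The vector with \<open>dw = a\<close> and \<open>th = c\<close>.\<close>

definition frame :: "C2 \<Rightarrow> complex \<Rightarrow> complex \<Rightarrow> C2" where
  "frame z a c = cscale (nu z * a - hermitian z ep * nu z * (a * cnj (wc z) + c)) ep
     + cscale ((nu z)\<^sup>2 * (a * cnj (wc z) + c)) \<eta>"

definition S0 :: "C2 set" where "S0 = {z. nu z \<noteq> 0}"

lemma herm_eta: "hermitian \<eta> \<eta> = 1" "hermitian ep ep = 1" "hermitian \<eta> ep = 0" "hermitian ep \<eta> = 0"
proof -
  show 1: "hermitian \<eta> \<eta> = 1" using norm_eta by (simp add: hermitian_self)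
  then show "hermitian ep ep = 1" by (simp add: hermitian_def ep_def algebra_simps)
  show "hermitian \<eta> ep = 0" "hermitian ep \<eta> = 0" by (simp_all add: hermitian_def ep_def)
qed

lemma frame_expansion: "v = cscale (hermitian v ep) ep + cscale (hermitian v \<eta>) \<eta>"
proof -
  have 1: "fst \<eta> * cnj (fst \<eta>) + snd \<eta> * cnj (snd \<eta>) = 1" using herm_eta(1) by (simp add: hermitian_def)
  have "fst v = fst v * (fst \<eta> * cnj (fst \<eta>) + snd \<eta> * cnj (snd \<eta>))"
    "snd v = snd v * (fst \<eta> * cnj (fst \<eta>) + snd \<eta> * cnj (snd \<eta>))" by (simp_all add: 1)
  then show ?thesis by (intro prod_eqI) (simp_all add: cscale_def hermitian_def ep_def algebra_simps)
qed

lemma C2_eqI: "hermitian u ep = hermitian v ep \<Longrightarrow> hermitian u \<eta> = hermitian v \<eta> \<Longrightarrow> u = v"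
  using frame_expansion[of u] frame_expansion[of v] by simp

lemma hermitian_expansion: "hermitian u v = hermitian u ep * cnj (hermitian v ep) + hermitian u \<eta> * cnj (hermitian v \<eta>)"
  by (subst frame_expansion[of u], subst frame_expansion[of v])
     (simp add: hermitian_add hermitian_cscale herm_eta algebra_simps)

lemma norm_expansion: "(norm z)\<^sup>2 = (cmod (hermitian z ep))\<^sup>2 + (cmod (hermitian z \<eta>))\<^sup>2"
proof -
  have "of_real ((norm z)\<^sup>2) = (of_real ((cmod (hermitian z ep))\<^sup>2 + (cmod (hermitian z \<eta>))\<^sup>2) :: complex)"
    unfolding hermitian_self[symmetric] by (subst hermitian_expansion) (simp only: of_real_add complex_norm_square)
  then show ?thesis by (simp only: of_real_eq_iff)
qed

lemma open_S0: "open S0"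
proof -
  have "continuous_on UNIV nu" unfolding nu_def[abs_def]
    by (intro continuous_intros linear_continuous_on linear_hermitian[unfolded linear_conv_bounded_linear])
  then show ?thesis unfolding S0_def by (intro open_Collect_neq) (auto intro!: continuous_intros)
qed

lemma nu_nonzero: assumes "norm z \<le> 1" "z \<noteq> \<eta>" shows "nu z \<noteq> 0"
proof
  assume "nu z = 0"
  then have h: "hermitian z \<eta> = 1" by (simp add: nu_def)
  then have "hermitian z ep = 0" using norm_expansion[of z] assms(1) power_mono[of "norm z" 1 2] by simp
  then show False using C2_eqI[of z \<eta>] h herm_eta assms(2) by simp
qed

lemma ball_S0: "CH2 \<subseteq> S0"
proof
  fix z assume "z \<in> CH2"
  then have "norm z < 1" by (simp add: CH2_def)
  then show "z \<in> S0" using nu_nonzero[of z] norm_eta by (cases "z = \<eta>") (auto simp: S0_def)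
qed

lemma rho_eq: "nu z \<noteq> 0 \<Longrightarrow> 1 - (norm z)\<^sup>2 = rho z * (cmod (nu z))\<^sup>2"
proof -
  assume n: "nu z \<noteq> 0"
  have h: "hermitian z \<eta> = 1 - nu z" by (simp add: nu_def)
  have 1: "Re (nc z) * (cmod (nu z))\<^sup>2 = Re (nu z)"
    using n by (simp add: nc_def Re_divide cmod_power2)
  have 2: "(cmod (wc z))\<^sup>2 * (cmod (nu z))\<^sup>2 = (cmod (hermitian z ep))\<^sup>2"
    using n by (simp add: wc_def norm_divide power_divide)
  have "rho z * (cmod (nu z))\<^sup>2 = 2 * Re (nu z) - (cmod (nu z))\<^sup>2 - (cmod (hermitian z ep))\<^sup>2"
    using 1 2 by (simp add: rho_def left_diff_distrib)
  moreover have "(cmod (1 - nu z))\<^sup>2 = 1 - 2 * Re (nu z) + (cmod (nu z))\<^sup>2"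
    unfolding cmod_power2 by (simp add: power2_eq_square algebra_simps)
  ultimately show ?thesis by (simp add: norm_expansion h)
qed

lemma rho_pos: "z \<in> CH2 \<Longrightarrow> rho z > 0"
proof -
  assume z: "z \<in> CH2"
  then have n: "nu z \<noteq> 0" using ball_S0 by (auto simp: S0_def)
  have "1 - (norm z)\<^sup>2 > 0" using z by (simp add: CH2_def abs_square_less_1)
  then show ?thesis using rho_eq[OF n] n by (simp add: zero_less_mult_iff)
qed

lemma metric_polynomial:
  fixes a b p n :: complex
  defines "D \<equiv> n + cnj n - n * cnj n - p * cnj p"
  shows "D * ((a * n + p * b) * cnj (a * n + p * b)) + (b * (cnj n - p * cnj p) - cnj p * a * n) * cnj (b * (cnj n - p * cnj p) - cnj p * a * n)
    = n * cnj n * (D * (a * cnj a + b * cnj b) + (a * cnj p + b * (1 - cnj n)) * cnj (a * cnj p + b * (1 - cnj n)))"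
  unfolding D_def by (simp add: algebra_simps)

text \<open>Unit vectors thus have \<open>dw\<close> of order \<open>\<rho>\<^sup>1\<^sup>/\<^sup>2\<close> and \<open>th\<close> of order \<open>\<rho>\<close>. This gap between the two
  exponents is the source of both the vanishing and the non-vanishing of the cup-products.\<close>

lemma metric_eq:
  assumes z: "z \<in> CH2"
  shows "CH2_metric z v v = (cmod (dw z v))\<^sup>2 / rho z + (cmod (th z v))\<^sup>2 / (rho z)\<^sup>2"
proof -
  define a where "a = hermitian v ep"
  define b where "b = hermitian v \<eta>"
  define p where "p = hermitian z ep"
  define n where "n = nu z"
  define D where "D = 1 - (norm z)\<^sup>2"
  have n: "n \<noteq> 0" using z ball_S0 by (auto simp: S0_def n_def)
  have D: "D = rho z * (cmod n)\<^sup>2" unfolding D_def n_def by (rule rho_eq) (use n n_def in simp)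
  have D0: "D > 0" using rho_pos[OF z] n by (simp add: D)
  have q: "hermitian z \<eta> = 1 - n" by (simp add: n_def nu_def)
  have Dc: "complex_of_real D = n + cnj n - n * cnj n - p * cnj p"
    unfolding D_def of_real_diff hermitian_self[symmetric] by (subst hermitian_expansion) (simp add: q p_def algebra_simps)
  have dw: "dw z v = (a * n + p * b) / n\<^sup>2" using n
    by (simp add: dw_def wc_def a_def b_def p_def n_def field_simps power2_eq_square)
  have th: "th z v = (b * (cnj n - p * cnj p) - cnj p * a * n) / (n\<^sup>2 * cnj n)" using n
    by (simp add: th_def dn_def dw wc_def a_def b_def p_def n_def field_simps power2_eq_square)
  let ?P = "(cmod (a * n + p * b))\<^sup>2" and ?Q = "(cmod (b * (cnj n - p * cnj p) - cnj p * a * n))\<^sup>2"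
  let ?H = "(cmod a)\<^sup>2 + (cmod b)\<^sup>2" and ?K = "(cmod (a * cnj p + b * (1 - cnj n)))\<^sup>2"
  have "complex_of_real (D * ?P + ?Q) = complex_of_real ((cmod n)\<^sup>2 * (D * ?H + ?K))"
    unfolding of_real_add of_real_mult complex_norm_square Dc by (rule metric_polynomial)
  then have id: "D * ?P + ?Q = (cmod n)\<^sup>2 * (D * ?H + ?K)" by (simp only: of_real_eq_iff)
  have hvz: "hermitian v z = a * cnj p + b * (1 - cnj n)"
    by (subst hermitian_expansion) (simp add: q a_def b_def p_def)
  have "hermitian v z * hermitian z v = of_real ?K"
    unfolding hvz[symmetric] by (simp only: complex_norm_square hermitian_cnj)
  moreover have "hermitian v v = of_real ?H"
    unfolding hermitian_self norm_expansion by (simp add: a_def b_def)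
  moreover have "1 - hermitian z z = of_real D" by (simp add: hermitian_self D_def)
  ultimately have "CH2_metric z v v = (D * ?H + ?K) / D\<^sup>2"
    unfolding CH2_metric_def D_def[symmetric] by (simp flip: of_real_mult of_real_add)
  also have "\<dots> = (D * ?P + ?Q) / ((cmod n)\<^sup>2 * D\<^sup>2)" unfolding id using n by simp
  also have "\<dots> = (cmod (dw z v))\<^sup>2 / rho z + (cmod (th z v))\<^sup>2 / (rho z)\<^sup>2"
  proof -
    have r: "rho z = D / (cmod n)\<^sup>2" using D n by simp
    have "(cmod (dw z v))\<^sup>2 = ?P / ((cmod n)\<^sup>2)\<^sup>2" by (simp add: dw norm_divide norm_power power_divide)
    moreover have "(cmod (th z v))\<^sup>2 = ?Q / ((cmod n)\<^sup>2) ^ 3"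
      by (simp add: th norm_divide norm_mult norm_power power_divide power_mult_distrib power_mult[symmetric] flip: power_add)
    ultimately show ?thesis unfolding r using n D0
      by (simp add: field_simps power2_eq_square power3_eq_cube)
  qed
  finally show ?thesis .
qed

lemma frame_coords:
  "hermitian (frame z a c) ep = nu z * a - hermitian z ep * nu z * (a * cnj (wc z) + c)"
  "hermitian (frame z a c) \<eta> = (nu z)\<^sup>2 * (a * cnj (wc z) + c)"
  by (simp_all add: frame_def hermitian_add hermitian_cscale herm_eta)

lemma dw_frame: "nu z \<noteq> 0 \<Longrightarrow> dw z (frame z a c) = a"
  and dn_frame: "nu z \<noteq> 0 \<Longrightarrow> dn z (frame z a c) = a * cnj (wc z) + c"
  and th_frame: "nu z \<noteq> 0 \<Longrightarrow> th z (frame z a c) = c"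
proof -
  assume n: "nu z \<noteq> 0"
  show 1: "dw z (frame z a c) = a" unfolding dw_def frame_coords using n
    by (simp add: wc_def field_simps power2_eq_square)
  show 2: "dn z (frame z a c) = a * cnj (wc z) + c" unfolding dn_def frame_coords using n by simp
  show "th z (frame z a c) = c" unfolding th_def 1 2 by simp
qed

lemma frame_dw_th: "nu z \<noteq> 0 \<Longrightarrow> frame z (dw z v) (th z v) = v"
proof (rule C2_eqI)
  assume n: "nu z \<noteq> 0"
  have e: "dw z v * cnj (wc z) + th z v = dn z v" by (simp add: th_def)
  show "hermitian (frame z (dw z v) (th z v)) \<eta> = hermitian v \<eta>"
    unfolding frame_coords e using n by (simp add: dn_def)
  show "hermitian (frame z (dw z v) (th z v)) ep = hermitian v ep"
    unfolding frame_coords e using n by (simp add: dn_def dw_def wc_def field_simps power2_eq_square)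
qed

lemma wc_has_derivative: "nu z \<noteq> 0 \<Longrightarrow> (wc has_derivative dw z) (at z)"
proof -
  assume n: "nu z \<noteq> 0"
  have d: "(nu has_derivative (\<lambda>v. - hermitian v \<eta>)) (at z)" unfolding nu_def[abs_def]
    by (auto intro!: derivative_eq_intros hermitian_has_derivative)
  have "((\<lambda>z. hermitian z ep / nu z) has_derivative (\<lambda>v. (hermitian v ep * nu z - hermitian z ep * (- hermitian v \<eta>)) / (nu z * nu z))) (at z)"
    by (rule has_derivative_divide'[OF hermitian_has_derivative d n])
  moreover have "(\<lambda>v. (hermitian v ep * nu z - hermitian z ep * (- hermitian v \<eta>)) / (nu z * nu z)) = dw z"
    using n by (simp add: fun_eq_iff dw_def wc_def field_simps)
  ultimately show ?thesis unfolding wc_def[abs_def] by simp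
qed

lemma nc_has_derivative: "nu z \<noteq> 0 \<Longrightarrow> (nc has_derivative dn z) (at z)"
proof -
  assume n: "nu z \<noteq> 0"
  have d: "(nu has_derivative (\<lambda>v. - hermitian v \<eta>)) (at z)" unfolding nu_def[abs_def]
    by (auto intro!: derivative_eq_intros hermitian_has_derivative)
  have "((\<lambda>z. 1 / nu z) has_derivative (\<lambda>v. (0 * nu z - 1 * (- hermitian v \<eta>)) / (nu z * nu z))) (at z)"
    by (rule has_derivative_divide'[OF has_derivative_const d n])
  moreover have "(\<lambda>v. (0 * nu z - 1 * (- hermitian v \<eta>)) / (nu z * nu z)) = dn z"
    by (simp add: fun_eq_iff dn_def power2_eq_square)
  ultimately show ?thesis unfolding nc_def[abs_def] by simp
qed

lemma csmooth_nu: "open S \<Longrightarrow> csmooth_on S nu"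
  unfolding nu_def[abs_def] by (intro csmooth_on_diff csmooth_on_const csmooth_on_linear linear_hermitian)

lemma csmooth_nc: "csmooth_on S0 nc"
  unfolding nc_def[abs_def] using csmooth_on_inverse[OF open_S0 csmooth_nu[OF open_S0]] by (simp add: S0_def divide_inverse)

lemma csmooth_wc: "csmooth_on S0 wc"
proof -
  have "csmooth_on S0 (\<lambda>z. hermitian z ep * nc z)"
    by (intro csmooth_on_mult open_S0 csmooth_nc csmooth_on_linear linear_hermitian)
  then show ?thesis by (simp add: wc_def[abs_def] nc_def)
qed

lemma smooth_rho: "smooth_on S0 rho"
  unfolding rho_def[abs_def] using csmooth_nc csmooth_on_norm_square[OF open_S0 csmooth_wc]
  by (auto simp: csmooth_on_def intro!: smooth_on_diff smooth_on_cmul open_S0 smooth_on_const)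

lemma smooth_xx: "smooth_on S0 (\<lambda>z. Re (wc z))"
  and smooth_yy: "smooth_on S0 (\<lambda>z. Im (wc z))"
  and smooth_ss: "smooth_on S0 ss"
  using csmooth_wc csmooth_nc by (auto simp: csmooth_on_def ss_def[abs_def])

lemma rho_has_derivative: "nu z \<noteq> 0 \<Longrightarrow> (rho has_derivative (\<lambda>v. 2 * Re (th z v))) (at z)"
proof -
  assume n: "nu z \<noteq> 0"
  have "((\<lambda>z. 2 * Re (nc z) - 1 - ((Re (wc z))\<^sup>2 + (Im (wc z))\<^sup>2)) has_derivative
      (\<lambda>v. 2 * Re (dn z v) - 0 - (2 * Re (wc z) * Re (dw z v) + 2 * Im (wc z) * Im (dw z v)))) (at z)"
    by (auto intro!: derivative_eq_intros has_derivative_Re has_derivative_Im wc_has_derivative[OF n] nc_has_derivative[OF n])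
  moreover have "(\<lambda>v. 2 * Re (dn z v) - 0 - (2 * Re (wc z) * Re (dw z v) + 2 * Im (wc z) * Im (dw z v))) = (\<lambda>v. 2 * Re (th z v))"
    by (simp add: th_def fun_eq_iff algebra_simps)
  ultimately show ?thesis unfolding rho_def[abs_def] cmod_power2 by simp
qed

end

section \<open>Geodesics and cones\<close>

subsection \<open>The geodesic equation\<close>

lemma inner_hermitian: "u \<bullet> v = Re (hermitian u v)"
  by (simp add: inner_prod_def inner_complex_def hermitian_def)

lemma hermitian_has_derivative_right: "((\<lambda>v. hermitian z v) has_derivative (\<lambda>v. hermitian z v)) F"
proof -
  have "linear (\<lambda>v. hermitian z v)"
    by (rule linearI) (simp_all add: hermitian_def algebra_simps scaleR_conv_of_real)
  then show ?thesis using linear_conv_bounded_linear bounded_linear_imp_has_derivative by blast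
qed

lemma fd_CH2_metric:
  assumes x: "x \<in> CH2"
  defines "D \<equiv> 1 - (norm x)\<^sup>2"
  shows "fd (\<lambda>y. CH2_metric y v w) x d =
    Re (- of_real (2 * Re (hermitian d x)) * hermitian v w + hermitian v d * hermitian x w + hermitian v x * hermitian d w) / D\<^sup>2
    + 4 * Re (hermitian d x) * Re (of_real D * hermitian v w + hermitian v x * hermitian x w) / D ^ 3"
proof -
  have D: "D > 0" using x by (simp add: CH2_def D_def abs_square_less_1)
  have eq: "CH2_metric y v w = Re (of_real (1 - y \<bullet> y) * hermitian v w + hermitian v y * hermitian y w) / (1 - y \<bullet> y)\<^sup>2" for y
    unfolding CH2_metric_def by (simp add: hermitian_self power2_norm_eq_inner)
  have Dx: "1 - x \<bullet> x = D" by (simp add: D_def power2_norm_eq_inner)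
  have N: "((\<lambda>y. Re (of_real (1 - y \<bullet> y) * hermitian v w + hermitian v y * hermitian y w)) has_derivative
     (\<lambda>d. Re (- of_real (2 * (x \<bullet> d)) * hermitian v w + (hermitian v x * hermitian d w + hermitian v d * hermitian x w)))) (at x)"
    by (rule has_derivative_Re)
       (auto intro!: derivative_eq_intros hermitian_has_derivative hermitian_has_derivative_right simp: fun_eq_iff inner_commute algebra_simps)
  have Q: "((\<lambda>y. (1 - y \<bullet> y)\<^sup>2) has_derivative (\<lambda>d. - 4 * D * (x \<bullet> d))) (at x)"
    by (auto intro!: derivative_eq_intros simp: Dx fun_eq_iff inner_commute)
  have "((\<lambda>y. CH2_metric y v w) has_derivative
     (\<lambda>d. (Re (- of_real (2 * (x \<bullet> d)) * hermitian v w + (hermitian v x * hermitian d w + hermitian v d * hermitian x w)) * D\<^sup>2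
       - Re (of_real D * hermitian v w + hermitian v x * hermitian x w) * (- 4 * D * (x \<bullet> d))) / (D\<^sup>2 * D\<^sup>2))) (at x)"
    unfolding eq using has_derivative_divide'[OF N Q] D by (simp add: Dx)
  from fd_eq[OF this] have "fd (\<lambda>y. CH2_metric y v w) x d =
     (Re (- of_real (2 * (x \<bullet> d)) * hermitian v w + (hermitian v x * hermitian d w + hermitian v d * hermitian x w)) * D\<^sup>2
       - Re (of_real D * hermitian v w + hermitian v x * hermitian x w) * (- 4 * D * (x \<bullet> d))) / (D\<^sup>2 * D\<^sup>2)" by simp
  moreover have "x \<bullet> d = Re (hermitian d x)" by (simp add: inner_commute inner_hermitian[symmetric])
  ultimately have e: "fd (\<lambda>y. CH2_metric y v w) x d =
     (Re (- of_real (2 * Re (hermitian d x)) * hermitian v w + (hermitian v x * hermitian d w + hermitian v d * hermitian x w)) * D\<^sup>2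
       - Re (of_real D * hermitian v w + hermitian v x * hermitian x w) * (- 4 * D * Re (hermitian d x))) / (D\<^sup>2 * D\<^sup>2)"
    by (simp only:)
  have div: "(A * D\<^sup>2 - B * (- 4 * D * r)) / (D\<^sup>2 * D\<^sup>2) = A / D\<^sup>2 + 4 * r * B / D ^ 3" for A B r
    using D by (simp add: field_simps power2_eq_square power3_eq_cube)
  show ?thesis unfolding e div by (simp add: algebra_simps)
qed

text \<open>In these coordinates \<open>\<nabla>\<^sub>u u = 2 h(u, x) / (1 - |x|\<^sup>2) u\<close>, a complex multiple of \<open>u\<close>: geodesics
  lie in complex lines.\<close>

lemma levi_civita_CH2:
  assumes x: "x \<in> CH2"
  shows "levi_civita CH2_metric x u u w = CH2_metric x (cscale (2 * hermitian u x / of_real (1 - (norm x)\<^sup>2)) u) w"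
proof -
  define D where "D = 1 - (norm x)\<^sup>2"
  have D: "D > 0" using x by (simp add: CH2_def D_def abs_square_less_1)
  define A where "A = hermitian u x"
  define B where "B = hermitian w x"
  define c where "c = hermitian u w"
  define s where "s = (norm u)\<^sup>2"
  have h: "hermitian x u = cnj A" "hermitian x w = cnj B" "hermitian w u = cnj c" "hermitian u u = of_real s"
    by (simp_all add: A_def B_def c_def s_def hermitian_cnj hermitian_self)
  have "levi_civita CH2_metric x u u w = 
     (2 * (Re (- of_real (2 * Re A) * c + of_real s * cnj B + A * c) / D\<^sup>2 + 4 * Re A * Re (of_real D * c + A * cnj B) / D ^ 3)
      - (Re (- of_real (2 * Re B) * of_real s + c * cnj A + A * cnj c) / D\<^sup>2 + 4 * Re B * Re (of_real D * of_real s + A * cnj A) / D ^ 3)) / 2"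
    unfolding levi_civita_def fd_CH2_metric[OF x] D_def[symmetric] by (simp add: h A_def[symmetric] B_def[symmetric] c_def[symmetric])
  also have "\<dots> = Re (of_real D * (2 * A / of_real D * c) + 2 * A / of_real D * A * cnj B) / D\<^sup>2"
    using D by (simp add: field_simps power2_eq_square power3_eq_cube Re_divide Im_divide)
  also have "\<dots> = CH2_metric x (cscale (2 * A / of_real D) u) w"
    unfolding CH2_metric_def D_def[symmetric] hermitian_self
    by (simp add: hermitian_cscale h A_def[symmetric] B_def[symmetric] c_def[symmetric] D_def[symmetric] flip: of_real_diff[of 1, simplified])
  finally show ?thesis by (simp add: A_def D_def)
qed

lemma CH2_metric_add: "CH2_metric x (u + v) w = CH2_metric x u w + CH2_metric x v w"
  by (simp add: CH2_metric_def hermitian_add algebra_simps add_divide_distrib diff_divide_distrib)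

lemma CH2_metric_eq_0: 
  assumes "x \<in> CH2" "CH2_metric x v v = 0" shows "v = 0"
proof -
  define D where "D = 1 - (norm x)\<^sup>2"
  have D: "D > 0" using assms by (simp add: CH2_def D_def abs_square_less_1)
  have "hermitian v x * hermitian x v = of_real ((cmod (hermitian v x))\<^sup>2)"
    by (simp only: complex_norm_square hermitian_cnj)
  then have "CH2_metric x v v = (D * (norm v)\<^sup>2 + (cmod (hermitian v x))\<^sup>2) / D\<^sup>2"
    unfolding CH2_metric_def D_def[symmetric] hermitian_self by (simp add: D_def)
  then have "D * (norm v)\<^sup>2 + (cmod (hermitian v x))\<^sup>2 = 0" using D assms(2) by simp
  then have "D * (norm v)\<^sup>2 \<le> 0" by (smt (verit) zero_le_power2)
  then show ?thesis using D by (simp add: mult_le_0_iff)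
qed

lemma geodesic_equation_CH2:
  assumes x: "x \<in> CH2"
  shows "(\<forall>w. CH2_metric x a w + levi_civita CH2_metric x v v w = 0) \<longleftrightarrow>
    a = cscale (- (2 * hermitian v x / of_real (1 - (norm x)\<^sup>2))) v"
proof -
  define l where "l = 2 * hermitian v x / of_real (1 - (norm x)\<^sup>2)"
  have neg: "cscale (- l) v = - cscale l v" by (simp add: cscale_def prod_eq_iff)
  have e: "CH2_metric x a w + levi_civita CH2_metric x v v w = CH2_metric x (a + cscale l v) w" for w
    unfolding levi_civita_CH2[OF x] CH2_metric_add l_def ..
  have "(\<forall>w. CH2_metric x (a + cscale l v) w = 0) \<longleftrightarrow> a + cscale l v = 0"
  proof
    assume "\<forall>w. CH2_metric x (a + cscale l v) w = 0"
    then show "a + cscale l v = 0" using CH2_metric_eq_0[OF x] by blast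
  next
    assume a: "a + cscale l v = 0"
    show "\<forall>w. CH2_metric x (a + cscale l v) w = 0" unfolding a by (simp add: CH2_metric_def hermitian_def)
  qed
  then show ?thesis unfolding e l_def[symmetric] neg by (simp add: eq_neg_iff_add_eq_0)
qed

subsection \<open>Geodesics issuing from the vertex\<close>

lemma exponential_derivative_bound:
  fixes f :: "real \<Rightarrow> 'a::real_normed_vector"
  assumes a: "a > 0" and f: "\<And>t. (f has_vector_derivative f' t) (at t)"
    and b: "\<And>t. t \<le> t0 \<Longrightarrow> norm (f' t) \<le> K * exp (a * (t - t0))" and t: "t \<le> t0" and K: "K \<ge> 0"
  shows "norm (f t) \<le> norm (f t0) + K / a"
proof (cases "t = t0")
  case False
  let ?\<phi> = "\<lambda>t. K / a * exp (a * (t - t0))"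
  have "norm (f t0 - f t) \<le> ?\<phi> t0 - ?\<phi> t"
  proof (rule differentiable_bound_general[where f' = f' and \<phi>' = "\<lambda>t. K * exp (a * (t - t0))"])
    show "continuous_on {t..t0} f"
      by (intro continuous_at_imp_continuous_on ballI has_vector_derivative_continuous[OF f])
    show "(?\<phi> has_vector_derivative K * exp (a * (x - t0))) (at x)" for x
    proof -
      have "(?\<phi> has_real_derivative K / a * (exp (a * (x - t0)) * a)) (at x)"
        by (auto intro!: derivative_eq_intros)
      then show ?thesis using a by (simp add: has_real_derivative_iff_has_vector_derivative mult_ac)
    qed
  qed (use t False f b a in \<open>auto intro!: continuous_intros\<close>)
  also have "\<dots> \<le> K / a" using a K by simp
  finally show ?thesis using norm_triangle_sub[of "f t" "f t0"] by (simp add: norm_minus_commute)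
qed (use a K in simp)

lemma rotating_constant_norm:
  assumes "\<And>t. (f has_vector_derivative \<i> * of_real (r t) * f t) (at t)"
  shows "cmod (f t) = cmod (f s)"
proof -
  have "((\<lambda>t. (Re (f t))\<^sup>2 + (Im (f t))\<^sup>2) has_real_derivative 0) (at t)" for t
  proof -
    have d: "((\<lambda>t. Re (f t)) has_real_derivative - (r t * Im (f t))) (at t)"
      "((\<lambda>t. Im (f t)) has_real_derivative r t * Re (f t)) (at t)"
      using bounded_linear.has_vector_derivative[OF bounded_linear_Re assms[of t]]
        bounded_linear.has_vector_derivative[OF bounded_linear_Im assms[of t]]
      by (simp_all add: has_real_derivative_iff_has_vector_derivative)
    show ?thesis using DERIV_add[OF DERIV_power[OF d(1), of 2] DERIV_power[OF d(2), of 2]] by simp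
  qed
  then have "(cmod (f t))\<^sup>2 = (cmod (f s))\<^sup>2" unfolding cmod_power2
    using DERIV_const_ratio_const[of t s "\<lambda>t. (Re (f t))\<^sup>2 + (Im (f t))\<^sup>2" 0] by (cases "s = t") auto
  then show ?thesis by (simp only: power2_eq_iff_nonneg norm_ge_zero)
qed

text \<open>\<open>ln R\<close> is concave, with derivative \<open>A\<close>. If \<open>A\<close> were never positive, \<open>R\<close> would stay away from
  \<open>0\<close> in the past, and \<open>A\<close> would grow linearly there. So \<open>A > 0\<close> somewhere, hence in the past,
  \<open>R\<close> decays exponentially and all coordinates stay bounded.\<close>

lemma past_bounded:
  fixes R A S :: "real \<Rightarrow> real" and W :: "real \<Rightarrow> complex"
  assumes R: "\<And>t. R t > 0" "\<And>t. (R has_real_derivative A t * R t) (at t)"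
    and A: "\<And>t. (A has_real_derivative - (c\<^sup>2 * (R t)\<^sup>2 + 2 * C\<^sup>2 * R t)) (at t)"
    and W: "\<And>t. (W has_vector_derivative W' t) (at t)" "\<And>t. cmod (W' t) = C * R t"
    and S: "\<And>t. (S has_real_derivative c * (R t)\<^sup>2 / 2 + Im (cnj (W t) * W' t)) (at t)"
    and C: "C \<ge> 0" and nz: "c \<noteq> 0 \<or> C \<noteq> 0"
  obtains t0 B where "\<And>t. t \<le> t0 \<Longrightarrow> R t \<le> B \<and> cmod (W t) \<le> B \<and> \<bar>S t\<bar> \<le> B"
proof -
  have A_anti: "A t \<le> A s" if "s \<le> t" for s t
  proof (rule DERIV_nonpos_imp_nonincreasing[OF that])
    fix x
    have "0 \<le> c\<^sup>2 * (R x)\<^sup>2 + 2 * C\<^sup>2 * R x" using R(1)[of x] by simp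
    then show "\<exists>y. (A has_real_derivative y) (at x) \<and> y \<le> 0" using A[of x] by (meson neg_le_0_iff_le)
  qed
  have "\<exists>t0. A t0 > 0"
  proof (rule ccontr)
    assume "\<not> ?thesis"
    then have An: "A t \<le> 0" for t by (simp add: not_less)
    define m where "m = c\<^sup>2 * (R 0)\<^sup>2 + 2 * C\<^sup>2 * R 0"
    have "c\<^sup>2 * (R 0)\<^sup>2 \<ge> 0" "2 * C\<^sup>2 * R 0 \<ge> 0" "c\<^sup>2 * (R 0)\<^sup>2 > 0 \<or> 2 * C\<^sup>2 * R 0 > 0"
      using nz R(1)[of 0] by auto
    then have m: "m > 0" unfolding m_def by linarith
    have R_anti: "R t \<le> R s" if "s \<le> t" for s t
      by (rule DERIV_nonpos_imp_nonincreasing[OF that]) (use R An in \<open>auto intro!: exI mult_nonpos_nonneg simp: less_imp_le\<close>)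
    have low: "A t + m * t \<ge> A 0 + m * 0" if "t \<le> 0" for t
    proof (rule DERIV_nonpos_imp_nonincreasing[OF that, of "\<lambda>t. A t + m * t"])
      fix x :: real assume x: "t \<le> x" "x \<le> 0"
      have "((\<lambda>t. A t + m * t) has_real_derivative - (c\<^sup>2 * (R x)\<^sup>2 + 2 * C\<^sup>2 * R x) + m) (at x)"
        by (auto intro!: derivative_eq_intros A)
      moreover have "m \<le> c\<^sup>2 * (R x)\<^sup>2 + 2 * C\<^sup>2 * R x" unfolding m_def
        using R_anti[OF x(2)] R(1)[of 0] by (intro add_mono mult_left_mono power_mono) auto
      ultimately show "\<exists>y. ((\<lambda>t. A t + m * t) has_real_derivative y) (at x) \<and> y \<le> 0" by (intro exI conjI) auto
    qed
    define t where "t = (A 0 - 1) / m"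
    have "t \<le> 0" unfolding t_def using An[of 0] m by (simp add: divide_nonpos_pos)
    from low[OF this] have "A t \<ge> A 0 - m * t" by simp
    also have "m * t = A 0 - 1" unfolding t_def using m by simp
    finally show False using An[of t] by simp
  qed
  then obtain t0 where t0: "A t0 > 0" by blast
  define a where "a = A t0"
  have a: "a > 0" using t0 by (simp add: a_def)
  define R0 where "R0 = R t0"
  have R0: "R0 > 0" using R(1) by (simp add: R0_def)
  have Rle: "R t \<le> R0 * exp (a * (t - t0))" if "t \<le> t0" for t
  proof -
    have "R t * exp (- a * (t - t0)) \<le> R t0 * exp (- a * (t0 - t0))"
    proof (rule DERIV_nonneg_imp_nondecreasing[OF that])
      fix x assume x: "t \<le> x" "x \<le> t0"
      have "((\<lambda>t. R t * exp (- a * (t - t0))) has_real_derivative (A x - a) * R x * exp (- a * (x - t0))) (at x)"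
        by (auto intro!: derivative_eq_intros R(2) simp: algebra_simps)
      moreover have "(A x - a) * R x * exp (- a * (x - t0)) \<ge> 0"
        using A_anti[OF x(2)] R(1)[of x] by (simp add: a_def)
      ultimately show "\<exists>y. ((\<lambda>t. R t * exp (- a * (t - t0))) has_real_derivative y) (at x) \<and> 0 \<le> y" by blast
    qed
    then have "R t * exp (- a * (t - t0)) * exp (a * (t - t0)) \<le> R0 * exp (a * (t - t0))"
      by (intro mult_right_mono) (simp_all add: R0_def)
    then show ?thesis by (simp only: mult.assoc exp_add[symmetric]) simp
  qed
  have e1: "exp (a * (t - t0)) \<le> 1" if "t \<le> t0" for t using that a by (simp add: mult_nonneg_nonpos)
  have RR: "R t \<le> R0" if "t \<le> t0" for t
    using order_trans[OF Rle[OF that] mult_left_mono[OF e1[OF that] less_imp_le[OF R0]]] by simp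
  have Wb: "cmod (W t) \<le> cmod (W t0) + C * R0 / a" if "t \<le> t0" for t
    by (rule exponential_derivative_bound[OF a W(1) _ that])
       (use W(2) C R0 Rle in \<open>auto simp: mult.assoc intro!: mult_left_mono\<close>)
  define K where "K = \<bar>c\<bar> * R0 * R0 / 2 + (cmod (W t0) + C * R0 / a) * (C * R0)"
  have Sb: "norm (S t) \<le> norm (S t0) + K / a" if "t \<le> t0" for t
  proof (rule exponential_derivative_bound[OF a _ _ that])
    show "(S has_vector_derivative c * (R t)\<^sup>2 / 2 + Im (cnj (W t) * W' t)) (at t)" for t
      using S by (simp add: has_real_derivative_iff_has_vector_derivative)
    show "norm (c * (R t)\<^sup>2 / 2 + Im (cnj (W t) * W' t)) \<le> K * exp (a * (t - t0))" if t: "t \<le> t0" for t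
    proof -
      have 1: "\<bar>c * (R t)\<^sup>2 / 2\<bar> \<le> \<bar>c\<bar> * (R0 * (R0 * exp (a * (t - t0)))) / 2"
        unfolding abs_mult abs_divide power2_eq_square using RR[OF t] Rle[OF t] R(1)[of t]
        by (auto intro!: divide_right_mono mult_left_mono mult_mono)
      have "\<bar>Im (cnj (W t) * W' t)\<bar> \<le> cmod (W t) * (C * R t)"
        using abs_Im_le_cmod[of "cnj (W t) * W' t"] by (simp add: norm_mult W(2))
      also have "\<dots> \<le> (cmod (W t0) + C * R0 / a) * (C * (R0 * exp (a * (t - t0))))"
        using Wb[OF t] Rle[OF t] C R(1)[of t] R0 a by (intro mult_mono mult_left_mono) auto
      finally have "\<bar>c * (R t)\<^sup>2 / 2\<bar> + \<bar>Im (cnj (W t) * W' t)\<bar> \<le> K * exp (a * (t - t0))"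
        using 1 unfolding K_def by (simp add: algebra_simps)
      then show ?thesis by simp
    qed
    show "K \<ge> 0" unfolding K_def using R0 C a by auto
  qed
  show ?thesis
  proof (rule that[of t0 "max R0 (max (cmod (W t0) + C * R0 / a) (norm (S t0) + K / a))"])
    fix t assume "t \<le> t0"
    from RR[OF this] Wb[OF this] Sb[OF this] 
    show "R t \<le> max R0 (max (cmod (W t0) + C * R0 / a) (norm (S t0) + K / a)) \<and>
      cmod (W t) \<le> max R0 (max (cmod (W t0) + C * R0 / a) (norm (S t0) + K / a)) \<and>
      \<bar>S t\<bar> \<le> max R0 (max (cmod (W t0) + C * R0 / a) (norm (S t0) + K / a))"
      by (auto simp: le_max_iff_disj)
  qed
qed

context boundary_point
begin

lemma acceleration_identity:
  assumes z: "z \<in> CH2"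
  shows "- (2 * hermitian v z / of_real (1 - (norm z)\<^sup>2)) + 2 * hermitian v \<eta> / nu z = 2 * th z v / of_real (rho z)"
proof -
  define a where "a = hermitian v ep"
  define b where "b = hermitian v \<eta>"
  define p where "p = hermitian z ep"
  define n where "n = nu z"
  define D where "D = complex_of_real (1 - (norm z)\<^sup>2)"
  have n: "n \<noteq> 0" using z ball_S0 by (auto simp: S0_def n_def)
  have D0: "D \<noteq> 0" unfolding D_def of_real_eq_0_iff using z by (auto simp: CH2_def abs_square_eq_1)
  have q: "hermitian z \<eta> = 1 - n" by (simp add: n_def nu_def)
  have D: "D = n + cnj n - n * cnj n - p * cnj p"
    unfolding D_def of_real_diff hermitian_self[symmetric] by (subst hermitian_expansion) (simp add: q p_def algebra_simps)
  have "D = of_real (rho z) * (n * cnj n)"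
    unfolding D_def rho_eq[OF n[unfolded n_def]] of_real_mult complex_norm_square n_def ..
  then have r: "of_real (rho z) = D / (n * cnj n)" using n by (simp add: field_simps)
  have dw: "dw z v = (a * n + p * b) / n\<^sup>2" using n
    by (simp add: dw_def wc_def a_def b_def p_def n_def field_simps power2_eq_square)
  have th: "th z v = (b * (cnj n - p * cnj p) - cnj p * a * n) / (n\<^sup>2 * cnj n)" using n
    by (simp add: th_def dn_def dw wc_def a_def b_def p_def n_def field_simps power2_eq_square)
  have hvz: "hermitian v z = a * cnj p + b * (1 - cnj n)"
    by (subst hermitian_expansion) (simp add: q a_def b_def p_def)
  have key: "- (n * (a * cnj p + b * (1 - cnj n))) + b * D = b * (cnj n - p * cnj p) - cnj p * a * n"
    unfolding D by (simp add: algebra_simps)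
  have "2 * th z v / of_real (rho z) = 2 * (b * (cnj n - p * cnj p) - cnj p * a * n) / (n * D)"
    unfolding th r using n D0 by (simp add: field_simps power2_eq_square)
  also have "\<dots> = - (2 * hermitian v z / D) + 2 * b / n"
    unfolding key[symmetric] hvz using n D0 by (simp add: field_simps)
  finally show ?thesis by (simp add: b_def n_def D_def)
qed

lemma rho_continuous: "continuous_on S0 rho" and wc_continuous: "continuous_on S0 wc" and nc_continuous: "continuous_on S0 nc"
  unfolding S0_def
  by (auto intro!: continuous_at_imp_continuous_on has_derivative_continuous[OF rho_has_derivative]
     has_derivative_continuous[OF wc_has_derivative] has_derivative_continuous[OF nc_has_derivative])

text \<open>Along a geodesic, \<open>T = c \<rho>\<^sup>2\<close> and \<open>|w'| = C \<rho>\<close> for constants \<open>c\<close> and \<open>C\<close>, where \<open>\<rho>' + \<i> T =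
  2 (n' - cnj w w')\<close>. Both vanish for a geodesic issuing from the vertex, which is the point where
  \<open>n\<close> is infinite.\<close>

lemma geodesic_from_vertex:
  assumes geo: "complete_geodesic CH2_metric CH2 \<gamma>" and bot: "(\<gamma> \<longlongrightarrow> \<eta>) at_bot"
  shows "wc (\<gamma> t) = wc (\<gamma> s)" "ss (\<gamma> t) = ss (\<gamma> s)"
proof -
  obtain v a where g: "\<And>t. \<gamma> t \<in> CH2" "\<And>t. (\<gamma> has_vector_derivative v t) (at t)" "\<And>t. (v has_vector_derivative a t) (at t)"
     "\<And>t. \<forall>w. CH2_metric (\<gamma> t) (a t) w + levi_civita CH2_metric (\<gamma> t) (v t) (v t) w = 0"
    using geo unfolding complete_geodesic_def by blast
  define l where "l t = - (2 * hermitian (v t) (\<gamma> t) / of_real (1 - (norm (\<gamma> t))\<^sup>2))" for t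
  have a: "a t = cscale (l t) (v t)" for t
    using g(4)[of t] unfolding geodesic_equation_CH2[OF g(1)] l_def .
  have n: "nu (\<gamma> t) \<noteq> 0" for t using g(1)[of t] ball_S0 by (auto simp: S0_def)
  define R where "R t = rho (\<gamma> t)" for t
  define W where "W t = wc (\<gamma> t)" for t
  define N where "N t = nc (\<gamma> t)" for t
  define W' where "W' t = dw (\<gamma> t) (v t)" for t
  define N' where "N' t = dn (\<gamma> t) (v t)" for t
  define \<sigma> where "\<sigma> t = 2 * th (\<gamma> t) (v t)" for t
  have R0: "R t > 0" for t unfolding R_def by (rule rho_pos[OF g(1)])
  have chain: "((\<lambda>t. f (\<gamma> t)) has_vector_derivative f' (v t)) (at t)"
    if "(f has_derivative f') (at (\<gamma> t))" for f :: "C2 \<Rightarrow> 'b::real_normed_vector" and f' t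
    using vector_derivative_diff_chain_within[OF g(2)[of t], of f f'] that has_derivative_at_withinI[OF that]
    by (simp add: o_def)
  have dW: "(W has_vector_derivative W' t) (at t)" for t
    unfolding W_def[abs_def] W'_def by (rule chain[OF wc_has_derivative[OF n]])
  have dN: "(N has_vector_derivative N' t) (at t)" for t
    unfolding N_def[abs_def] N'_def by (rule chain[OF nc_has_derivative[OF n]])
  have dR: "(R has_real_derivative Re (\<sigma> t)) (at t)" for t
    using chain[OF rho_has_derivative[OF n, of t]] unfolding R_def[abs_def] \<sigma>_def
    by (simp add: has_real_derivative_iff_has_vector_derivative)
  have dh: "((\<lambda>t. hermitian (v t) e) has_vector_derivative l t * hermitian (v t) e) (at t)" for e t
  proof -
    have "((\<lambda>t. hermitian (v t) e) has_vector_derivative hermitian (a t) e) (at t)"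
      using vector_derivative_diff_chain_within[OF g(3)[of t], of "\<lambda>v. hermitian v e" "\<lambda>v. hermitian v e"] hermitian_has_derivative
      by (simp add: o_def)
    then show ?thesis by (simp add: a hermitian_cscale)
  qed
  have dnu: "((\<lambda>t. nu (\<gamma> t)) has_vector_derivative - hermitian (v t) \<eta>) (at t)" for t
    by (rule chain) (auto intro!: derivative_eq_intros hermitian_has_derivative simp: nu_def[abs_def])
  define \<mu> where "\<mu> t = \<sigma> t / of_real (R t)" for t
  have mu: "\<mu> t = l t + 2 * hermitian (v t) \<eta> / nu (\<gamma> t)" for t
    using acceleration_identity[OF g(1)[of t], of "v t"] unfolding \<mu>_def \<sigma>_def R_def l_def by simp
  have dnc: "(N has_vector_derivative hermitian (v t) \<eta> * (N t)\<^sup>2) (at t)" for t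
    using dN[of t] by (simp add: N'_def N_def dn_def nc_def power_divide)
  have W'_eq: "W' t = (hermitian (v t) ep + W t * hermitian (v t) \<eta>) * N t" for t
    by (simp add: W'_def dw_def W_def N_def nc_def)
  have N'_eq: "N' t = hermitian (v t) \<eta> * (N t * N t)" for t
    by (simp add: N'_def dn_def N_def nc_def power2_eq_square)
  have bN: "2 * (hermitian (v t) \<eta> * N t) = \<mu> t - l t" for t by (simp add: mu N_def nc_def)
  have ddW: "(W' has_vector_derivative \<mu> t * W' t) (at t)" for t
  proof -
    let ?a = "hermitian (v t) ep" and ?b = "hermitian (v t) \<eta>"
    have "((\<lambda>t. (hermitian (v t) ep + W t * hermitian (v t) \<eta>) * N t) has_vector_derivative
       (?a + W t * ?b) * (?b * (N t)\<^sup>2) + (l t * ?a + (W t * (l t * ?b) + W' t * ?b)) * N t) (at t)"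
      by (intro has_vector_derivative_mult has_vector_derivative_add dh dW dnc)
    moreover have "(?a + W t * ?b) * (?b * (N t)\<^sup>2) + (l t * ?a + (W t * (l t * ?b) + W' t * ?b)) * N t
       = l t * W' t + 2 * (?b * N t) * W' t"
      by (simp add: W'_eq power2_eq_square algebra_simps)
    moreover have "l t * W' t + 2 * (?b * N t) * W' t = \<mu> t * W' t" unfolding bN by (simp add: algebra_simps)
    ultimately show ?thesis unfolding W'_eq[abs_def] by simp
  qed
  have ddN: "(N' has_vector_derivative \<mu> t * N' t) (at t)" for t
  proof -
    let ?b = "hermitian (v t) \<eta>"
    have "((\<lambda>t. hermitian (v t) \<eta> * (N t * N t)) has_vector_derivative
       ?b * (N t * (?b * (N t)\<^sup>2) + ?b * (N t)\<^sup>2 * N t) + l t * ?b * (N t * N t)) (at t)"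
      by (intro has_vector_derivative_mult dh dnc)
    moreover have "?b * (N t * (?b * (N t)\<^sup>2) + ?b * (N t)\<^sup>2 * N t) + l t * ?b * (N t * N t) = l t * N' t + 2 * (?b * N t) * N' t"
      by (simp add: N'_eq power2_eq_square algebra_simps)
    moreover have "l t * N' t + 2 * (?b * N t) * N' t = \<mu> t * N' t" unfolding bN by (simp add: algebra_simps)
    ultimately show ?thesis unfolding N'_eq[abs_def] by simp
  qed
  have \<sigma>_eq: "\<sigma> t = 2 * (N' t - cnj (W t) * W' t)" for t by (simp add: \<sigma>_def th_def N'_def W_def W'_def)
  have d\<sigma>: "(\<sigma> has_vector_derivative \<mu> t * \<sigma> t - 2 * of_real ((cmod (W' t))\<^sup>2)) (at t)" for t
  proof -
    have "((\<lambda>t. 2 * (N' t - cnj (W t) * W' t)) has_vector_derivative 2 * (\<mu> t * N' t - (cnj (W t) * (\<mu> t * W' t) + cnj (W' t) * W' t))) (at t)"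
      by (intro has_vector_derivative_mult_right has_vector_derivative_diff has_vector_derivative_mult has_vector_derivative_cnj ddN ddW dW)
    moreover have "2 * (\<mu> t * N' t - (cnj (W t) * (\<mu> t * W' t) + cnj (W' t) * W' t)) = \<mu> t * \<sigma> t - 2 * of_real ((cmod (W' t))\<^sup>2)"
      unfolding complex_norm_square by (simp add: \<sigma>_eq algebra_simps)
    ultimately show ?thesis unfolding \<sigma>_eq[abs_def] by simp
  qed
  define T where "T t = Im (\<sigma> t)" for t
  define P where "P t = Re (\<sigma> t)" for t
  have re\<sigma>: "\<sigma> t = Complex (P t) (T t)" for t by (simp add: P_def T_def)
  have dP: "(P has_real_derivative ((P t)\<^sup>2 - (T t)\<^sup>2) / R t - 2 * (cmod (W' t))\<^sup>2) (at t)" for t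
    using bounded_linear.has_vector_derivative[OF bounded_linear_Re d\<sigma>[of t]] R0[of t] unfolding P_def[abs_def] T_def \<mu>_def
    by (simp add: has_real_derivative_iff_has_vector_derivative power2_eq_square Re_divide Im_divide diff_divide_distrib)
  have dT: "(T has_real_derivative 2 * P t * T t / R t) (at t)" for t
    using bounded_linear.has_vector_derivative[OF bounded_linear_Im d\<sigma>[of t]] R0[of t] unfolding T_def[abs_def] P_def \<mu>_def
    by (simp add: has_real_derivative_iff_has_vector_derivative power2_eq_square Re_divide Im_divide add_divide_distrib mult_ac)
  have const: "f t = f s" if "\<And>t. (f has_real_derivative 0) (at t)" for f :: "real \<Rightarrow> real" and s t
    using DERIV_const_ratio_const[of t s f 0] that by (cases "s = t") auto
  define c where "c = T 0 / (R 0)\<^sup>2"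
  have Tc: "T t = c * (R t)\<^sup>2" for t
  proof -
    have "((\<lambda>t. T t / (R t)\<^sup>2) has_real_derivative 0) (at t)" for t
    proof -
      have "((\<lambda>t. T t / (R t)\<^sup>2) has_real_derivative (2 * P t * T t / R t * (R t)\<^sup>2 - T t * (2 * (R t) * P t)) / ((R t)\<^sup>2 * (R t)\<^sup>2)) (at t)"
        using R0[of t] by (auto intro!: derivative_eq_intros dT dR[folded P_def])
      then show ?thesis using R0[of t] by (simp add: power2_eq_square)
    qed
    from const[OF this, of t 0] show ?thesis using R0[of t] by (simp add: c_def field_simps)
  qed
  define C where "C = cmod (W' 0) / R 0"
  have WC: "cmod (W' t) = C * R t" for t
  proof -
    let ?f = "\<lambda>t. W' t * of_real (inverse (R t))"
    have "(?f has_vector_derivative \<i> * of_real (T t * inverse (R t)) * ?f t) (at t)" for t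
    proof -
      have "((\<lambda>t. inverse (R t)) has_real_derivative - (P t * (inverse (R t))\<^sup>2)) (at t)"
        using R0[of t] by (auto intro!: derivative_eq_intros dR[folded P_def] simp: power2_eq_square)
      then have "((\<lambda>t. complex_of_real (inverse (R t))) has_vector_derivative of_real (- (P t * (inverse (R t))\<^sup>2))) (at t)"
        by (intro has_vector_derivative_of_real) (simp add: has_real_derivative_iff_has_vector_derivative)
      then have "(?f has_vector_derivative W' t * of_real (- (P t * (inverse (R t))\<^sup>2)) + \<mu> t * W' t * of_real (inverse (R t))) (at t)"
        by (intro has_vector_derivative_mult ddW)
      moreover have "W' t * of_real (- (P t * (inverse (R t))\<^sup>2)) + \<mu> t * W' t * of_real (inverse (R t)) = \<i> * of_real (T t * inverse (R t)) * ?f t"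
        using R0[of t] by (simp add: \<mu>_def re\<sigma> complex_eq_iff field_simps power2_eq_square Re_divide Im_divide)
      ultimately show ?thesis by simp
    qed
    from rotating_constant_norm[OF this] have "cmod (?f t) = cmod (?f 0)" .
    then show ?thesis using R0[of t] R0[of 0] by (simp add: C_def norm_mult norm_divide field_simps)
  qed
  have C0: "C \<ge> 0" using R0[of 0] by (simp add: C_def)
  define A where "A t = P t / R t" for t
  have dA: "(A has_real_derivative - (c\<^sup>2 * (R t)\<^sup>2 + 2 * C\<^sup>2 * R t)) (at t)" for t
  proof -
    have "(A has_real_derivative ((((P t)\<^sup>2 - (T t)\<^sup>2) / R t - 2 * (cmod (W' t))\<^sup>2) * R t - P t * P t) / (R t * R t)) (at t)"
      unfolding A_def[abs_def] using R0[of t] by (intro DERIV_divide dP dR[folded P_def]) simp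
    moreover have "((((P t)\<^sup>2 - (T t)\<^sup>2) / R t - 2 * (cmod (W' t))\<^sup>2) * R t - P t * P t) / (R t * R t) = - (c\<^sup>2 * (R t)\<^sup>2 + 2 * C\<^sup>2 * R t)"
      unfolding Tc WC using R0[of t] by (simp add: field_simps power2_eq_square)
    ultimately show ?thesis by simp
  qed
  have dR': "(R has_real_derivative A t * R t) (at t)" for t
    using dR[of t] R0[of t] by (simp add: A_def P_def)
  define S where "S t = Im (N t)" for t
  have N'_im: "Im (N' t) = c * (R t)\<^sup>2 / 2 + Im (cnj (W t) * W' t)" for t
    using \<sigma>_eq[of t] Tc[of t] by (simp add: T_def)
  have dS: "(S has_real_derivative c * (R t)\<^sup>2 / 2 + Im (cnj (W t) * W' t)) (at t)" for t
    using bounded_linear.has_vector_derivative[OF bounded_linear_Im dN[of t]] unfolding S_def[abs_def] N'_im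
    by (simp add: has_real_derivative_iff_has_vector_derivative)
  have "c = 0 \<and> C = 0"
  proof (rule ccontr)
    assume "\<not> (c = 0 \<and> C = 0)"
    then have "c \<noteq> 0 \<or> C \<noteq> 0" by blast
    from past_bounded[OF R0 dR' dA dW WC dS C0 this]
    obtain t0 B where B: "\<forall>t. t \<le> t0 \<longrightarrow> R t \<le> B \<and> cmod (W t) \<le> B \<and> \<bar>S t\<bar> \<le> B" by metis
    have Nb: "cmod (N t) \<le> (1 + B + B\<^sup>2) + B" if "t \<le> t0" for t
    proof -
      have b: "R t \<le> B" "cmod (W t) \<le> B" "\<bar>S t\<bar> \<le> B" using B that by auto
      have "Re (N t) = (R t + 1 + (cmod (W t))\<^sup>2) / 2" by (simp add: R_def rho_def N_def W_def)
      moreover have "(cmod (W t))\<^sup>2 \<le> B\<^sup>2" using b(2) by (intro power_mono) auto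
      moreover have "(cmod (W t))\<^sup>2 \<ge> 0" "B\<^sup>2 \<ge> 0" by auto
      moreover have "0 \<le> x" "x \<le> 1 + B + Q" if "x = (R t + 1 + y) / 2" "y \<le> Q" "0 \<le> y" "0 \<le> Q" for x y Q
        using that b(1) R0[of t] by (auto simp: field_simps)
      ultimately have "0 \<le> Re (N t)" "Re (N t) \<le> 1 + B + B\<^sup>2" by blast+
      then have "\<bar>Re (N t)\<bar> \<le> 1 + B + B\<^sup>2" by simp
      then show ?thesis using cmod_le[of "N t"] b(3) by (simp add: S_def)
    qed
    have "((\<lambda>t. nu (\<gamma> t)) \<longlongrightarrow> nu \<eta>) at_bot"
      unfolding nu_def by (intro tendsto_intros bounded_linear.tendsto[OF linear_hermitian[unfolded linear_conv_bounded_linear] bot])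
    then have "((\<lambda>t. nu (\<gamma> t)) \<longlongrightarrow> 0) at_bot" by (simp add: nu_def herm_eta)
    define M where "M = (1 + B + B\<^sup>2) + B"
    have M: "M > 0" using Nb[of t0] n[of t0] by (simp add: M_def N_def nc_def norm_divide) (smt (verit) divide_pos_pos norm_le_zero_iff zero_less_divide_1_iff zero_less_norm_iff)
    have "\<forall>\<^sub>F t in at_bot. dist (nu (\<gamma> t)) 0 < 1 / M"
      using tendstoD[OF \<open>((\<lambda>t. nu (\<gamma> t)) \<longlongrightarrow> 0) at_bot\<close>, of "1 / M"] M by simp
    then obtain t1 where t1: "\<And>t. t \<le> t1 \<Longrightarrow> cmod (nu (\<gamma> t)) < 1 / M"
      unfolding eventually_at_bot_linorder by auto
    define t where "t = min t0 t1"
    have "cmod (N t) \<le> M" using Nb[of t] by (simp add: M_def t_def)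
    then have "1 \<le> M * cmod (nu (\<gamma> t))" using n[of t] by (simp add: N_def nc_def norm_divide field_simps)
    moreover have "cmod (nu (\<gamma> t)) < 1 / M" using t1[of t] by (simp add: t_def)
    ultimately show False using M by (simp add: field_simps)
  qed
  then have c0: "c = 0" and "C = 0" by auto
  then have W'0: "W' t = 0" for t using WC[of t] by simp
  have "(W has_vector_derivative 0) (at t)" for t using dW[of t] by (simp add: W'0)
  then have "W t = W s" for s t
    using has_derivative_zero_unique[of UNIV W s t] by (auto simp: has_vector_derivative_def)
  then show "wc (\<gamma> t) = wc (\<gamma> s)" by (simp add: W_def)
  have "(S has_real_derivative 0) (at t)" for t using dS[of t] by (simp add: c0 W'0)
  from const[OF this, of t s] show "ss (\<gamma> t) = ss (\<gamma> s)" by (simp add: S_def N_def ss_def)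
qed

subsection \<open>The cone\<close>

text \<open>The endpoint of the vertical geodesic through \<open>z\<close>: the same \<open>w\<close> and \<open>Im n\<close>, but \<open>\<rho> = 0\<close>.\<close>

definition nbd :: "C2 \<Rightarrow> complex" where
  "nbd z = Complex ((1 + (cmod (wc z))\<^sup>2) / 2) (ss z)"

definition bd :: "C2 \<Rightarrow> C2" where
  "bd z = \<eta> + cscale (1 / nbd z) (cscale (wc z) ep - \<eta>)"

lemma nbd_nonzero: "nbd z \<noteq> 0"
proof
  assume "nbd z = 0"
  then have "(1 + (cmod (wc z))\<^sup>2) / 2 = 0" by (simp add: nbd_def complex_eq_iff)
  moreover have "(1 + (cmod (wc z))\<^sup>2) / 2 > 0" by (intro divide_pos_pos add_pos_nonneg) auto
  ultimately show False by simp
qed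

lemma nc_nbd: "nc z = nbd z + of_real (rho z / 2)"
  by (simp add: nbd_def rho_def complex_eq_iff ss_def field_simps)

lemma vertical_coords:
  fixes w :: complex
  assumes "n \<noteq> 0"
  defines "z \<equiv> \<eta> + cscale (1 / n) (cscale w ep - \<eta>)"
  shows "nu z = 1 / n" "nc z = n" "wc z = w"
proof -
  have h: "hermitian z ep = w / n" "hermitian z \<eta> = 1 - 1 / n"
    unfolding z_def by (simp_all add: hermitian_add hermitian_diff hermitian_cscale herm_eta)
  show n: "nu z = 1 / n" by (simp add: nu_def h)
  show "nc z = n" "wc z = w" using assms(1) by (simp_all add: nc_def wc_def n h)
qed

lemma coords_determine: "nu z \<noteq> 0 \<Longrightarrow> z = \<eta> + cscale (1 / nc z) (cscale (wc z) ep - \<eta>)"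
  by (rule C2_eqI)
     (simp_all add: hermitian_add hermitian_diff hermitian_cscale herm_eta nc_def wc_def, simp add: nu_def)

lemma bd_sphere: "bd z \<in> CH2_infinity"
proof -
  note c = vertical_coords[OF nbd_nonzero, of z "wc z", folded bd_def]
  have n: "nu (bd z) \<noteq> 0" using nbd_nonzero by (simp add: c(1))
  have "rho (bd z) = 0" unfolding rho_def c(2,3) by (simp add: nbd_def field_simps)
  then have "(norm (bd z))\<^sup>2 = 1" using rho_eq[OF n] by simp
  then show ?thesis using norm_ge_zero[of "bd z"] by (simp add: CH2_infinity_def power2_eq_1_iff)
qed

lemma bd_eqI:
  assumes "norm \<xi> = 1" "\<xi> \<noteq> \<eta>" "wc z = wc \<xi>" "ss z = ss \<xi>"
  shows "bd z = \<xi>"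
proof -
  have n: "nu \<xi> \<noteq> 0" using nu_nonzero assms by simp
  have "rho \<xi> = 0" using rho_eq[OF n] n assms(1) by simp
  then have "nc \<xi> = nbd \<xi>" by (simp add: nc_nbd)
  also have "nbd \<xi> = nbd z" using assms by (simp add: nbd_def)
  finally show ?thesis using coords_determine[OF n] assms(3) by (simp add: bd_def)
qed

text \<open>Along the curve with \<open>w\<close> and \<open>Im n\<close> constant and \<open>\<rho> = exp (- 2 t)\<close> the acceleration is a multiple of
  the velocity, and it is the multiple required by the geodesic equation.\<close>

lemma vertical_geodesic:
  assumes z: "z \<in> CH2"
  obtains \<gamma> t where "complete_geodesic CH2_metric CH2 \<gamma>" "\<gamma> t = z" "(\<gamma> \<longlongrightarrow> \<eta>) at_bot" "(\<gamma> \<longlongrightarrow> bd z) at_top"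
proof -
  define m where "m t = nbd z + of_real (exp (- 2 * t) / 2)" for t
  define p where "p = cscale (wc z) ep - \<eta>"
  define f where "f t = 1 / m t" for t
  define \<gamma> where "\<gamma> t = \<eta> + cscale (f t) p" for t
  have m0: "m t \<noteq> 0" for t
  proof
    assume "m t = 0"
    then have "(1 + (cmod (wc z))\<^sup>2) / 2 + exp (- 2 * t) / 2 = 0" by (simp add: m_def nbd_def complex_eq_iff)
    moreover have "(1 + (cmod (wc z))\<^sup>2) / 2 + exp (- 2 * t) / 2 > 0"
      by (intro add_pos_pos divide_pos_pos add_pos_nonneg) auto
    ultimately show False by simp
  qed
  have c: "nu (\<gamma> t) = f t" "nc (\<gamma> t) = m t" "wc (\<gamma> t) = wc z" for t
    using vertical_coords[OF m0[of t], of "wc z"] by (simp_all add: \<gamma>_def f_def p_def)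
  have f0: "f t \<noteq> 0" for t using m0 by (simp add: f_def)
  have r: "rho (\<gamma> t) = exp (- 2 * t)" for t by (simp add: rho_def c m_def nbd_def add_divide_distrib)
  have inC: "\<gamma> t \<in> CH2" for t
  proof -
    have "1 - (norm (\<gamma> t))\<^sup>2 > 0" using rho_eq[of "\<gamma> t"] f0 by (simp add: c r)
    then show ?thesis by (simp add: CH2_def abs_square_less_1)
  qed
  have dm: "(m has_vector_derivative of_real (- exp (- 2 * t))) (at t)" for t
  proof -
    have "((\<lambda>t. exp (- 2 * t) / 2) has_real_derivative - exp (- 2 * t)) (at t)"
      by (auto intro!: derivative_eq_intros)
    then show ?thesis unfolding m_def[abs_def]
      by (auto intro!: derivative_eq_intros has_vector_derivative_of_real simp: has_real_derivative_iff_has_vector_derivative)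
  qed
  define f' where "f' t = of_real (exp (- 2 * t)) * (f t * f t)" for t
  have df: "(f has_vector_derivative f' t) (at t)" for t
  proof -
    have "(f has_vector_derivative (- of_real (- exp (- 2 * t)) / (m t * m t))) (at t)"
      unfolding f_def[abs_def] using m0[of t] has_derivative_divide'[OF has_derivative_const[of 1] dm[of t, unfolded has_vector_derivative_def] m0[of t]]
      by (simp add: has_vector_derivative_def scaleR_conv_of_real)
    then show ?thesis by (simp add: f'_def f_def)
  qed
  define l where "l t = - 2 + 2 * of_real (exp (- 2 * t)) * f t" for t
  have df': "(f' has_vector_derivative l t * f' t) (at t)" for t
  proof -
    have e: "((\<lambda>t. complex_of_real (exp (- 2 * t))) has_vector_derivative of_real (- 2 * exp (- 2 * t))) (at t)"
    proof -
      have "((\<lambda>t. exp (- 2 * t)) has_real_derivative - 2 * exp (- 2 * t)) (at t)" by (auto intro!: derivative_eq_intros)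
      then show ?thesis by (rule has_vector_derivative_of_real)
    qed
    have "(f' has_vector_derivative of_real (exp (- 2 * t)) * (f t * f' t + f' t * f t) + of_real (- 2 * exp (- 2 * t)) * (f t * f t)) (at t)"
      unfolding f'_def[abs_def] by (intro has_vector_derivative_mult e df[unfolded f'_def])
    then show ?thesis by (simp add: l_def f'_def algebra_simps)
  qed
  have lin: "linear (\<lambda>c. cscale c p)" by (rule linearI) (simp_all add: cscale_def prod_eq_iff algebra_simps scaleR_conv_of_real)
  have dcs: "((\<lambda>t. cscale (g t) p) has_vector_derivative cscale g' p) (at t)" if "(g has_vector_derivative g') (at t)" for g g' t
    using bounded_linear.has_vector_derivative[OF lin[unfolded linear_conv_bounded_linear] that] .
  have d1: "(\<gamma> has_vector_derivative cscale (f' t) p) (at t)" for t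
    using has_vector_derivative_add[OF has_vector_derivative_const dcs[OF df]] by (simp add: \<gamma>_def[abs_def])
  have d2: "((\<lambda>t. cscale (f' t) p) has_vector_derivative cscale (l t * f' t) p) (at t)" for t by (rule dcs[OF df'])
  have geo: "complete_geodesic CH2_metric CH2 \<gamma>"
    unfolding complete_geodesic_def
  proof (rule exI[of _ "\<lambda>t. cscale (f' t) p"], rule exI[of _ "\<lambda>t. cscale (l t * f' t) p"], rule allI, intro conjI inC d1 d2)
    fix t
    let ?v = "cscale (f' t) p"
    have hv: "hermitian ?v ep = f' t * wc z" "hermitian ?v \<eta> = - f' t"
      by (simp_all add: p_def hermitian_cscale hermitian_diff herm_eta)
    have "dw (\<gamma> t) ?v = 0" by (simp add: dw_def hv c)
    moreover have "dn (\<gamma> t) ?v = - of_real (exp (- 2 * t))"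
      unfolding dn_def hv(2) c power2_eq_square using f0[of t] by (simp add: f'_def)
    ultimately have "th (\<gamma> t) ?v = - of_real (exp (- 2 * t))" by (simp add: th_def)
    then have "- (2 * hermitian ?v (\<gamma> t) / of_real (1 - (norm (\<gamma> t))\<^sup>2)) + 2 * - f' t / f t = - 2"
      using acceleration_identity[OF inC, of ?v t] by (simp add: hv c r)
    then have "l t = - (2 * hermitian ?v (\<gamma> t) / of_real (1 - (norm (\<gamma> t))\<^sup>2))"
      using f0[of t] by (simp add: l_def f'_def algebra_simps)
    then show "\<forall>w. CH2_metric (\<gamma> t) (cscale (l t * f' t) p) w + levi_civita CH2_metric (\<gamma> t) ?v ?v w = 0"
      unfolding geodesic_equation_CH2[OF inC] by (simp add: cscale_def mult.assoc)
  qed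
  define t where "t = - ln (rho z) / 2"
  have "exp (- 2 * t) = rho z" using rho_pos[OF z] by (simp add: t_def)
  then have "m t = nc z" by (simp add: m_def nc_nbd)
  then have gt: "\<gamma> t = z" using coords_determine[of z] z ball_S0 by (auto simp: \<gamma>_def f_def p_def S0_def)
  have "filterlim (\<lambda>t::real. - 2 * t) at_bot at_top"
    unfolding filterlim_at_bot eventually_at_top_linorder 
  proof
    fix Z :: real
    show "\<exists>N. \<forall>n\<ge>N. - 2 * n \<le> Z" by (rule exI[of _ "- Z / 2"]) auto
  qed
  from tendsto_divide[OF filterlim_compose[OF exp_at_bot this] tendsto_const[of 2]]
  have "((\<lambda>t. exp (- 2 * t) / 2) \<longlongrightarrow> (0::real)) at_top" by simp
  then have "(m \<longlongrightarrow> nbd z + of_real 0) at_top" unfolding m_def[abs_def] by (intro tendsto_intros)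
  then have "(f \<longlongrightarrow> 1 / nbd z) at_top" unfolding f_def[abs_def] using nbd_nonzero by (intro tendsto_intros) auto
  then have top: "(\<gamma> \<longlongrightarrow> bd z) at_top" unfolding \<gamma>_def[abs_def] bd_def p_def[symmetric]
    by (intro tendsto_intros bounded_linear.tendsto[OF lin[unfolded linear_conv_bounded_linear]])
  have "filterlim (\<lambda>t::real. - 2 * t) at_top at_bot"
    unfolding filterlim_at_top eventually_at_bot_linorder 
  proof
    fix Z :: real
    show "\<exists>N. \<forall>n\<le>N. Z \<le> - 2 * n" by (rule exI[of _ "- Z / 2"]) auto
  qed
  from filterlim_compose[OF exp_at_top this]
  have "filterlim (\<lambda>t. (1 / 2) * exp (- 2 * t) :: real) at_top at_bot"
    by (intro filterlim_tendsto_pos_mult_at_top[OF tendsto_const]) auto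
  then have "filterlim (\<lambda>t. complex_of_real (exp (- 2 * t) / 2)) at_infinity at_bot"
    by (simp add: filterlim_at_infinity_conv_norm_at_top norm_of_real[of "exp _ / 2"] del: of_real_divide)
  then have "filterlim m at_infinity at_bot" unfolding m_def[abs_def]
    by (intro tendsto_add_filterlim_at_infinity[OF tendsto_const])
  then have "(f \<longlongrightarrow> 0) at_bot" unfolding f_def[abs_def] by (intro tendsto_divide_0[OF tendsto_const])
  then have "(\<gamma> \<longlongrightarrow> \<eta> + cscale 0 p) at_bot" unfolding \<gamma>_def[abs_def]
    by (intro tendsto_intros bounded_linear.tendsto[OF lin[unfolded linear_conv_bounded_linear]])
  then have bot: "(\<gamma> \<longlongrightarrow> \<eta>) at_bot" by (simp add: cscale_def zero_prod_def[symmetric])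
  show ?thesis by (rule that[OF geo gt bot top])
qed

lemma cone_eq:
  assumes U: "U \<subseteq> CH2_infinity" "\<eta> \<notin> U"
  shows "CH2_cone \<eta> U = {z \<in> CH2. bd z \<in> U}"
proof (intro equalityI subsetI)
  fix z assume "z \<in> CH2_cone \<eta> U"
  then obtain \<gamma> t \<xi> where g: "complete_geodesic CH2_metric CH2 \<gamma>" "(\<gamma> \<longlongrightarrow> \<eta>) at_bot" "\<xi> \<in> U" "(\<gamma> \<longlongrightarrow> \<xi>) at_top" "z = \<gamma> t"
    unfolding CH2_cone_def by blast
  have \<xi>: "norm \<xi> = 1" "\<xi> \<noteq> \<eta>" using U g(3) by (auto simp: CH2_infinity_def)
  have n: "nu \<xi> \<noteq> 0" using nu_nonzero \<xi> by simp
  have iw: "isCont wc \<xi>" and iss: "isCont ss \<xi>"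
    using has_derivative_continuous[OF wc_has_derivative[OF n]] has_derivative_continuous[OF nc_has_derivative[OF n]]
    by (auto simp: ss_def[abs_def])
  have "((\<lambda>s. wc (\<gamma> s)) \<longlongrightarrow> wc \<xi>) at_top" by (rule isCont_tendsto_compose[OF iw g(4)])
  moreover have "(\<lambda>s. wc (\<gamma> s)) = (\<lambda>s. wc z)" using geodesic_from_vertex(1)[OF g(1,2)] g(5) by auto
  ultimately have w: "wc z = wc \<xi>" by (simp add: tendsto_const_iff)
  have "((\<lambda>s. ss (\<gamma> s)) \<longlongrightarrow> ss \<xi>) at_top" by (rule isCont_tendsto_compose[OF iss g(4)])
  moreover have "(\<lambda>s. ss (\<gamma> s)) = (\<lambda>s. ss z)" using geodesic_from_vertex(2)[OF g(1,2)] g(5) by auto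
  ultimately have "ss z = ss \<xi>" by (simp add: tendsto_const_iff)
  then have "bd z = \<xi>" using bd_eqI[OF \<xi> w] by simp
  moreover have "z \<in> CH2" using g(1,5) unfolding complete_geodesic_def by blast
  ultimately show "z \<in> {z \<in> CH2. bd z \<in> U}" using g(3) by simp
next
  fix z assume z: "z \<in> {z \<in> CH2. bd z \<in> U}"
  then obtain \<gamma> t where "complete_geodesic CH2_metric CH2 \<gamma>" "\<gamma> t = z" "(\<gamma> \<longlongrightarrow> \<eta>) at_bot" "(\<gamma> \<longlongrightarrow> bd z) at_top"
    using vertical_geodesic by blast
  then show "z \<in> CH2_cone \<eta> U" unfolding CH2_cone_def using z by blast
qed

lemma bd_continuous: "continuous_on S0 bd"
proof -
  have "continuous_on S0 ss" unfolding ss_def[abs_def] using nc_continuous by (intro continuous_intros)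
  then have "continuous_on S0 (\<lambda>z. of_real ((1 + (cmod (wc z))\<^sup>2) / 2) + \<i> * of_real (ss z))"
    by (intro continuous_intros wc_continuous) auto
  moreover have "(\<lambda>z. of_real ((1 + (cmod (wc z))\<^sup>2) / 2) + \<i> * of_real (ss z)) = nbd"
    by (simp add: fun_eq_iff nbd_def complex_eq_iff)
  ultimately have "continuous_on S0 nbd" by (simp only:)
  then show ?thesis unfolding bd_def[abs_def] cscale_def using nbd_nonzero
    by (intro continuous_intros wc_continuous) auto
qed

lemma cone_open:
  assumes "openin (top_of_set CH2_infinity) U" "\<eta> \<notin> U"
  shows "open (CH2_cone \<eta> U)"
proof -
  obtain O' where O: "open O'" "U = CH2_infinity \<inter> O'" using assms(1) by (auto simp: openin_open)
  have "CH2_cone \<eta> U = CH2 \<inter> bd -` O'" using cone_eq[of U] assms(2) O bd_sphere by auto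
  moreover have "open (CH2 \<inter> bd -` O')"
    using continuous_open_preimage[OF continuous_on_subset[OF bd_continuous ball_S0] _ O(1)] by (simp add: CH2_def)
  ultimately show ?thesis by simp
qed

text \<open>\<open>|\<xi> - \<eta>|\<^sup>2 = 2 Re (1 / n(\<xi>))\<close> on the sphere, so a positive distance from the vertex bounds \<open>n\<close>.\<close>

lemma cone_bounded:
  assumes U: "U \<subseteq> CH2_infinity" "\<eta> \<notin> closure U"
  obtains B where "B \<ge> 1" "\<And>z. z \<in> CH2_cone \<eta> U \<Longrightarrow> cmod (wc z) \<le> B \<and> \<bar>ss z\<bar> \<le> B"
proof -
  obtain d where d: "d > 0" "\<And>\<xi>. \<xi> \<in> U \<Longrightarrow> d \<le> dist \<xi> \<eta>"
    using U(2) unfolding closure_approachable by (auto simp: not_less)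
  define B where "B = max 1 (4 / d\<^sup>2)"
  have "cmod (wc z) \<le> B \<and> \<bar>ss z\<bar> \<le> B" if "z \<in> CH2_cone \<eta> U" for z
  proof -
    have b: "bd z \<in> U" using that cone_eq[OF U(1)] U(2) closure_subset[of U] by auto
    have "norm (bd z) = 1" using b U(1) by (auto simp: CH2_infinity_def)
    moreover have "(norm (bd z - \<eta>))\<^sup>2 = (norm (bd z))\<^sup>2 - 2 * (bd z \<bullet> \<eta>) + (norm \<eta>)\<^sup>2"
      by (simp add: power2_norm_eq_inner inner_diff_left inner_diff_right inner_commute)
    ultimately have "(norm (bd z - \<eta>))\<^sup>2 = 2 * Re (nu (bd z))"
      by (simp add: norm_eta nu_def inner_hermitian)
    moreover have "d\<^sup>2 \<le> (norm (bd z - \<eta>))\<^sup>2" using d(2)[OF b] d(1) by (intro power_mono) (auto simp: dist_norm)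
    moreover have "nu (bd z) = 1 / nbd z" using vertical_coords(1)[OF nbd_nonzero, of z "wc z"] by (simp add: bd_def)
    ultimately have "d\<^sup>2 \<le> 2 * cmod (1 / nbd z)" using complex_Re_le_cmod[of "1 / nbd z"] by simp
    then have nb: "cmod (nbd z) \<le> 2 / d\<^sup>2" using d(1) nbd_nonzero[of z] by (simp add: norm_divide field_simps)
    have "\<bar>ss z\<bar> \<le> 2 / d\<^sup>2" using abs_Im_le_cmod[of "nbd z"] nb by (simp add: nbd_def)
    then have s: "\<bar>ss z\<bar> \<le> B" using d(1) unfolding B_def by (smt (verit) divide_right_mono zero_le_power2)
    have "1 + (cmod (wc z))\<^sup>2 \<le> 4 / d\<^sup>2" using complex_Re_le_cmod[of "nbd z"] nb by (simp add: nbd_def)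
    then have w: "1 + (cmod (wc z))\<^sup>2 \<le> B" by (simp add: B_def)
    have "0 \<le> (cmod (wc z) - 1)\<^sup>2" by simp
    then have "2 * cmod (wc z) \<le> 1 + (cmod (wc z))\<^sup>2" by (simp add: power2_diff)
    then have "cmod (wc z) \<le> B" using w norm_ge_zero[of "wc z"] by linarith
    with s show ?thesis by simp
  qed
  then show ?thesis using that[of B] by (simp add: B_def)
qed

end

section \<open>\<open>L\<^sup>p\<close>-forms on domains of the complex hyperbolic plane\<close>

subsection \<open>Pointwise norms\<close>

definition ev1 :: "((nat \<Rightarrow> 'a) \<Rightarrow> real) \<Rightarrow> 'a \<Rightarrow> real" where
  "ev1 L a = L (\<lambda>_. a)"

definition ev2 :: "((nat \<Rightarrow> 'a) \<Rightarrow> real) \<Rightarrow> 'a \<Rightarrow> 'a \<Rightarrow> real" where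
  "ev2 L a b = L (\<lambda>i. if i = 0 then a else b)"

lemma alternating_cong:
  assumes "alternating k L" "\<And>i. i < k \<Longrightarrow> v i = w i" shows "L v = L w"
proof -
  have *: "\<forall>v w. (\<forall>i<k. v i = w i) \<longrightarrow> L v = L w" using assms(1) unfolding alternating_def by (elim conjE)
  show ?thesis by (rule *[rule_format]) (rule assms(2))
qed

lemma alternating_linear:
  assumes "alternating k L" "i < k" shows "linear (\<lambda>a. L (v(i := a)))"
  using assms unfolding alternating_def by simp

lemma alternating_zero:
  assumes "alternating k L" "i < j" "j < k" "v i = v j" shows "L v = 0"
proof -
  have *: "\<forall>v i j. i < j \<and> j < k \<and> v i = v j \<longrightarrow> L v = 0" using assms(1) unfolding alternating_def by (elim conjE)
  show ?thesis by (rule *[rule_format]) (use assms(2-4) in auto)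
qed

lemma alternatingI:
  assumes "\<And>v w. (\<And>i. i < k \<Longrightarrow> v i = w i) \<Longrightarrow> L v = L w" "\<And>v i. i < k \<Longrightarrow> linear (\<lambda>a. L (v(i := a)))"
    "\<And>v i j. i < j \<Longrightarrow> j < k \<Longrightarrow> v i = v j \<Longrightarrow> L v = 0"
  shows "alternating k L"
  unfolding alternating_def
proof (intro conjI allI impI)
  show "L v = L w" if "\<forall>i<k. v i = w i" for v w by (rule assms(1)) (use that in simp)
  show "linear (\<lambda>a. L (v(i := a)))" if "i < k" for v i by (rule assms(2)[OF that])
  show "L v = 0" if "i < j \<and> j < k \<and> v i = v j" for v i j by (rule assms(3)[of i j]) (use that in auto)
qed

lemma alternating_0: "alternating 0 L \<longleftrightarrow> (\<forall>v w. L v = L w)"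
  by (simp add: alternating_def)

lemma alternating_1: "alternating (Suc 0) L \<longleftrightarrow> (\<forall>v. L v = ev1 L (v 0)) \<and> linear (ev1 L)"
proof
  assume a: "alternating (Suc 0) L"
  have 1: "L v = L w" if "v 0 = w 0" for v w by (rule alternating_cong[OF a]) (use that in simp)
  have "linear (\<lambda>x. L ((\<lambda>_. 0)(0 := x)))" by (rule alternating_linear[OF a]) simp
  moreover have "(\<lambda>x. L ((\<lambda>_. 0)(0 := x))) = ev1 L" unfolding ev1_def by (rule ext, rule 1) simp
  ultimately have l: "linear (ev1 L)" by simp
  have e: "L v = ev1 L (v 0)" for v unfolding ev1_def by (rule 1) simp
  show "(\<forall>v. L v = ev1 L (v 0)) \<and> linear (ev1 L)" by (intro conjI allI e l)
next
  assume a: "(\<forall>v. L v = ev1 L (v 0)) \<and> linear (ev1 L)"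
  then have 1: "L v = ev1 L (v 0)" for v by blast
  have l: "linear (\<lambda>x. L (v(0 := x)))" for v unfolding 1[of "v(0 := x)" for x] using a by simp
  show "alternating (Suc 0) L"
    by (rule alternatingI) (use l in \<open>auto simp: 1[of "_ :: nat \<Rightarrow> _"]\<close>)
qed

lemma alternating_2: "alternating (Suc (Suc 0)) L \<longleftrightarrow> (\<forall>v. L v = ev2 L (v 0) (v 1)) \<and>
    (\<forall>b. linear (\<lambda>a. ev2 L a b)) \<and> (\<forall>a. linear (ev2 L a)) \<and> (\<forall>a. ev2 L a a = 0)"
proof
  assume a: "alternating (Suc (Suc 0)) L"
  have 1: "L v = L w" if "v 0 = w 0" "v 1 = w 1" for v w
    by (rule alternating_cong[OF a]) (use that in \<open>auto simp: less_Suc_eq\<close>)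
  have l: "linear (\<lambda>x. L (v(i := x)))" if "i < 2" for v i by (rule alternating_linear[OF a]) (use that in simp)
  have "(\<lambda>x. L ((\<lambda>_. b)(0 := x))) = (\<lambda>a. ev2 L a b)" for b unfolding ev2_def by (rule ext, rule 1) auto
  moreover have "(\<lambda>x. L ((\<lambda>_. a)(1 := x))) = ev2 L a" for a unfolding ev2_def by (rule ext, rule 1) auto
  moreover have "ev2 L b b = 0" for b
    unfolding ev2_def by (rule alternating_zero[OF a, of 0 1]) auto
  moreover have "L v = ev2 L (v 0) (v 1)" for v unfolding ev2_def by (rule 1) auto
  ultimately show "(\<forall>v. L v = ev2 L (v 0) (v 1)) \<and>
    (\<forall>b. linear (\<lambda>a. ev2 L a b)) \<and> (\<forall>a. linear (ev2 L a)) \<and> (\<forall>a. ev2 L a a = 0)"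
  proof (intro conjI allI)
    show "linear (\<lambda>a. ev2 L a b)" for b
      using l[of 0 "\<lambda>_. b"] \<open>\<And>b. (\<lambda>x. L ((\<lambda>_. b)(0 := x))) = (\<lambda>a. ev2 L a b)\<close>[of b] by simp
    show "linear (ev2 L a)" for a
      using l[of 1 "\<lambda>_. a"] \<open>\<And>a. (\<lambda>x. L ((\<lambda>_. a)(1 := x))) = ev2 L a\<close>[of a] by simp
  qed
next
  assume a: "(\<forall>v. L v = ev2 L (v 0) (v 1)) \<and>
    (\<forall>b. linear (\<lambda>a. ev2 L a b)) \<and> (\<forall>a. linear (ev2 L a)) \<and> (\<forall>a. ev2 L a a = 0)"
  then have 1: "L v = ev2 L (v 0) (v 1)" for v by blast
  show "alternating (Suc (Suc 0)) L"
  proof (rule alternatingI)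
    show "L v = L w" if "\<And>i. i < Suc (Suc 0) \<Longrightarrow> v i = w i" for v w
      unfolding 1[of v] 1[of w] using that[of 0] that[of 1] by simp
    show "linear (\<lambda>x. L (v(i := x)))" if "i < Suc (Suc 0)" for v i
      using that a unfolding 1[of "v(i := x)" for x] by (auto simp: less_Suc_eq)
    show "L v = 0" if "i < j" "j < Suc (Suc 0)" "v i = v j" for v i j
      using that a 1[of v] by (auto simp: less_Suc_eq)
  qed
qed

lemma alternating_1D:
  assumes "alternating 1 L" shows "L v = ev1 L (v 0)" "linear (ev1 L)"
proof -
  have *: "(\<forall>v. L v = ev1 L (v 0)) \<and> linear (ev1 L)" using alternating_1[THEN iffD1, OF assms[unfolded One_nat_def]] .
  show "linear (ev1 L)" by (rule conjunct2[OF *])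
  show "L v = ev1 L (v 0)" by (rule spec[OF conjunct1[OF *]])
qed

lemma alternating_2D:
  assumes "alternating 2 L"
  shows "L v = ev2 L (v 0) (v 1)" "linear (\<lambda>a. ev2 L a b)" "linear (ev2 L a)" "ev2 L a a = 0"
proof -
  have *: "(\<forall>v. L v = ev2 L (v 0) (v 1)) \<and>
    (\<forall>b. linear (\<lambda>a. ev2 L a b)) \<and> (\<forall>a. linear (ev2 L a)) \<and> (\<forall>a. ev2 L a a = 0)"
    using alternating_2[THEN iffD1, OF assms[unfolded numeral_2_eq_2]] .
  show "L v = ev2 L (v 0) (v 1)" by (rule spec[OF conjunct1[OF *]])
  show "linear (\<lambda>a. ev2 L a b)" by (rule spec[OF conjunct1[OF conjunct2[OF *]]])
  show "linear (ev2 L a)" by (rule spec[OF conjunct1[OF conjunct2[OF conjunct2[OF *]]]])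
  show "ev2 L a a = 0" by (rule spec[OF conjunct2[OF conjunct2[OF conjunct2[OF *]]]])
qed

lemma permutations_of_two: "{\<sigma>. \<sigma> permutes {..<Suc (Suc 0)}} = {id, Transposition.transpose 0 1}"
proof -
  have "{..<Suc (Suc 0)} = {0, 1}" by auto
  then show ?thesis by (auto simp: permutes_doubleton_iff)
qed

lemma wedge_1_1:
  fixes \<alpha> \<beta> :: "'a::real_vector form"
  assumes "alternating 1 (\<alpha> x)" "alternating 1 (\<beta> x)"
  shows "wedge 1 1 \<alpha> \<beta> x v = ev1 (\<alpha> x) (v 0) * ev1 (\<beta> x) (v 1) - ev1 (\<alpha> x) (v 1) * ev1 (\<beta> x) (v 0)"
proof -
  note a = alternating_1D(1)[OF assms(1)] alternating_1D(1)[OF assms(2)]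
  have ne: "id \<noteq> Transposition.transpose (0::nat) 1" by (metis id_apply transpose_apply_first zero_neq_one)
  show ?thesis unfolding wedge_def
    using ne by (simp add: permutations_of_two sign_swap_id a[of "\<lambda>i. v (f i)" for f] sign_id)
qed

locale cone_domain = boundary_point +
  fixes V :: "C2 set"
  assumes open_V: "open V" and V_CH2: "V \<subseteq> CH2"
begin

lemma V_sets: "V \<in> sets lebesgue"
  using open_V by (simp add: borel_open)

lemma V_nu: "x \<in> V \<Longrightarrow> nu x \<noteq> 0"
  using V_CH2 ball_S0 by (auto simp: S0_def)

lemma V_rho: "x \<in> V \<Longrightarrow> rho x > 0"
  using V_CH2 rho_pos by blast

definition orthoframe :: "C2 \<Rightarrow> C2 \<Rightarrow> C2" where
  "orthoframe z y = frame z (of_real (sqrt (rho z)) * fst y) (of_real (rho z) * snd y)"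

lemma linear_frame: "linear (\<lambda>y. frame z (k * fst y) (l * snd y))"
  by (rule linearI) (simp_all add: frame_def cscale_def prod_eq_iff algebra_simps scaleR_conv_of_real)

lemma linear_orthoframe: "linear (orthoframe z)"
  unfolding orthoframe_def[abs_def] by (rule linear_frame)

lemma metric_orthoframe:
  assumes "z \<in> CH2" shows "CH2_metric z (orthoframe z y) (orthoframe z y) = (norm y)\<^sup>2"
proof -
  have n: "nu z \<noteq> 0" using assms ball_S0 by (auto simp: S0_def)
  note r = rho_pos[OF assms]
  have "(norm y)\<^sup>2 = (cmod (fst y))\<^sup>2 + (cmod (snd y))\<^sup>2" by (simp add: norm_prod_def)
  then show ?thesis unfolding metric_eq[OF assms] orthoframe_def dw_frame[OF n] th_frame[OF n]
    using r by (simp add: norm_mult power_mult_distrib power2_eq_square[of "rho z"])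
qed

lemma orthoframe_surj:
  assumes "z \<in> CH2" obtains y where "v = orthoframe z y"
proof -
  have n: "nu z \<noteq> 0" using assms ball_S0 by (auto simp: S0_def)
  note r = rho_pos[OF assms]
  have "v = orthoframe z (dw z v / of_real (sqrt (rho z)), th z v / of_real (rho z))"
    using r frame_dw_th[OF n, of v] by (simp add: orthoframe_def)
  then show ?thesis using that by blast
qed

lemma orthoframe_continuous: "continuous_on V (\<lambda>x. orthoframe x y)"
proof -
  have sub: "V \<subseteq> S0" using V_CH2 ball_S0 by blast
  have 1: "continuous_on V nu" unfolding nu_def[abs_def]
    by (intro continuous_intros linear_continuous_on linear_hermitian[unfolded linear_conv_bounded_linear])
  have 2: "continuous_on V (\<lambda>x. hermitian x ep)"
    by (intro linear_continuous_on linear_hermitian[unfolded linear_conv_bounded_linear])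
  note 3 = continuous_on_subset[OF rho_continuous sub] continuous_on_subset[OF wc_continuous sub]
  show ?thesis unfolding orthoframe_def frame_def cscale_def by (intro continuous_intros 1 2 3)
qed

definition frame_norm :: "nat \<Rightarrow> C2 \<Rightarrow> ((nat \<Rightarrow> C2) \<Rightarrow> real) \<Rightarrow> real" where
  "frame_norm k z L = (if k = 0 then \<bar>L (\<lambda>_. 0)\<bar>
     else if k = 1 then \<Sum>e\<in>Basis. \<bar>ev1 L (orthoframe z e)\<bar>
     else \<Sum>e\<in>Basis. \<Sum>f\<in>Basis. \<bar>ev2 L (orthoframe z e) (orthoframe z f)\<bar>)"

lemma linear_orthoframe_bound:
  assumes A: "linear (A :: C2 \<Rightarrow> real)" and y: "norm y \<le> 1"
  shows "\<bar>A (orthoframe z y)\<bar> \<le> (\<Sum>e\<in>Basis. \<bar>A (orthoframe z e)\<bar>)"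
proof -
  have l: "linear (\<lambda>y. A (orthoframe z y))" using linear_compose[OF linear_orthoframe A] by (simp add: o_def)
  have "A (orthoframe z y) = A (orthoframe z (\<Sum>e\<in>Basis. (y \<bullet> e) *\<^sub>R e))" by (simp add: euclidean_representation)
  also have "\<dots> = (\<Sum>e\<in>Basis. (y \<bullet> e) * A (orthoframe z e))"
    by (simp add: linear_sum[OF l] linear_cmul[OF l])
  also have "\<bar>\<dots>\<bar> \<le> (\<Sum>e\<in>Basis. \<bar>A (orthoframe z e)\<bar>)"
  proof (rule order_trans[OF sum_abs sum_mono])
    fix e :: C2 assume "e \<in> Basis"
    then have "\<bar>y \<bullet> e\<bar> \<le> 1" using Basis_le_norm[of e y] y by linarith
    then show "\<bar>(y \<bullet> e) * A (orthoframe z e)\<bar> \<le> \<bar>A (orthoframe z e)\<bar>"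
      by (simp add: abs_mult mult_left_le_one_le)
  qed
  finally show ?thesis .
qed

text \<open>The norm of a form is comparable to the sum of its absolute values on an orthonormal frame;
  the latter is measurable in the base point and shows that the supremum is finite.\<close>

lemma frame_norm_bound:
  assumes z: "z \<in> CH2" and k: "k \<le> 2" and L: "alternating k L" and v: "\<forall>i<k. CH2_metric z (v i) (v i) \<le> 1"
  shows "\<bar>L v\<bar> \<le> frame_norm k z L"
proof -
  have unit: "\<exists>y. v i = orthoframe z y \<and> norm y \<le> 1" if "i < k" for i
  proof -
    obtain y where y: "v i = orthoframe z y" using orthoframe_surj[OF z] .
    then have "(norm y)\<^sup>2 \<le> 1" using v that metric_orthoframe[OF z, of y] by auto
    then have "norm y \<le> 1" by (simp add: abs_square_le_1)
    then show ?thesis using y by blast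
  qed
  consider "k = 0" | "k = 1" | "k = 2" using k by linarith
  then show ?thesis
  proof cases
    case 1
    then show ?thesis using L alternating_0[of L] by (simp add: frame_norm_def) (metis order_refl)
  next
    case 2
    then have a: "L v = ev1 L (v 0)" "linear (ev1 L)" using L alternating_1D[of L] by auto
    obtain y where "v 0 = orthoframe z y" "norm y \<le> 1" using unit[of 0] 2 by auto
    then show ?thesis using linear_orthoframe_bound[OF a(2)] 2 by (simp add: a(1) frame_norm_def)
  next
    case 3
    then have a: "L v = ev2 L (v 0) (v 1)" "\<And>b. linear (\<lambda>a. ev2 L a b)" "\<And>a. linear (ev2 L a)"
      using alternating_2D[of L] L by auto
    obtain y y' where y: "v 0 = orthoframe z y" "norm y \<le> 1" "v 1 = orthoframe z y'" "norm y' \<le> 1"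
      using unit[of 0] unit[of 1] 3 by auto
    have "\<bar>L v\<bar> \<le> (\<Sum>e\<in>Basis. \<bar>ev2 L (orthoframe z e) (orthoframe z y')\<bar>)"
      unfolding a(1) y using linear_orthoframe_bound[OF a(2) y(2)] .
    also have "\<dots> \<le> (\<Sum>e\<in>Basis. \<Sum>f\<in>Basis. \<bar>ev2 L (orthoframe z e) (orthoframe z f)\<bar>)"
      by (rule sum_mono) (rule linear_orthoframe_bound[OF a(3) y(4)])
    finally show ?thesis using 3 by (simp add: frame_norm_def)
  qed
qed

lemma form_norm_upper:
  assumes z: "z \<in> CH2" and k: "k \<le> 2" and L: "alternating k L" and v: "\<forall>i<k. CH2_metric z (v i) (v i) \<le> 1"
  shows "\<bar>L v\<bar> \<le> form_norm (CH2_metric z) k L"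
  unfolding form_norm_def
proof (rule cSUP_upper)
  show "v \<in> {v. \<forall>i<k. CH2_metric z (v i) (v i) \<le> 1}" using v by simp
  show "bdd_above ((\<lambda>v. \<bar>L v\<bar>) ` {v. \<forall>i<k. CH2_metric z (v i) (v i) \<le> 1})"
    by (rule bdd_aboveI2[where M = "frame_norm k z L"], rule frame_norm_bound[OF z k L]) simp
qed

lemma form_norm_least:
  assumes "\<And>v. \<forall>i<k. CH2_metric z (v i) (v i) \<le> 1 \<Longrightarrow> \<bar>L v\<bar> \<le> M"
  shows "form_norm (CH2_metric z) k L \<le> M"
  unfolding form_norm_def
proof (rule cSUP_least)
  have "(\<lambda>_. 0) \<in> {v. \<forall>i<k. CH2_metric z (v i) (v i) \<le> 1}" by (simp add: CH2_metric_def hermitian_def)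
  then show "{v. \<forall>i<k. CH2_metric z (v i) (v i) \<le> 1} \<noteq> {}" by (rule ex_in_conv[THEN iffD1, OF exI])
qed (use assms in auto)

lemma form_norm_nonneg:
  assumes "z \<in> CH2" "k \<le> 2" "alternating k L" shows "0 \<le> form_norm (CH2_metric z) k L"
proof -
  have "\<bar>L (\<lambda>_. 0)\<bar> \<le> form_norm (CH2_metric z) k L"
    by (rule form_norm_upper[OF assms]) (simp add: CH2_metric_def hermitian_def)
  then show ?thesis by linarith
qed

lemma form_norm_frame_norm:
  assumes "z \<in> CH2" "k \<le> 2" "alternating k L"
  shows "form_norm (CH2_metric z) k L \<le> frame_norm k z L" "frame_norm k z L \<le> 16 * form_norm (CH2_metric z) k L"
proof -
  show "form_norm (CH2_metric z) k L \<le> frame_norm k z L"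
    by (rule form_norm_least) (rule frame_norm_bound[OF assms])
  let ?N = "form_norm (CH2_metric z) k L"
  note N = form_norm_nonneg[OF assms]
  have c: "card (Basis :: C2 set) = 4" by (simp add: Basis_C2)
  have g: "CH2_metric z (orthoframe z e) (orthoframe z e) \<le> 1" if "e \<in> Basis" for e
    using that by (simp add: metric_orthoframe[OF assms(1)])
  consider "k = 0" | "k = 1" | "k = 2" using assms(2) by linarith
  then show "frame_norm k z L \<le> 16 * ?N"
  proof cases
    case 1
    then have "\<bar>L (\<lambda>_. 0)\<bar> \<le> ?N" using form_norm_upper[OF assms, of "\<lambda>_. 0"] by simp
    then show ?thesis using 1 N by (simp add: frame_norm_def)
  next
    case 2
    have "(\<Sum>e\<in>(Basis :: C2 set). \<bar>ev1 L (orthoframe z e)\<bar>) \<le> (\<Sum>e\<in>(Basis :: C2 set). ?N)"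
      unfolding ev1_def by (rule sum_mono) (rule form_norm_upper[OF assms], use g in auto)
    then show ?thesis using 2 N c by (simp add: frame_norm_def)
  next
    case 3
    have "(\<Sum>e\<in>(Basis :: C2 set). \<Sum>f\<in>(Basis :: C2 set). \<bar>ev2 L (orthoframe z e) (orthoframe z f)\<bar>) \<le> (\<Sum>e\<in>(Basis :: C2 set). \<Sum>f\<in>(Basis :: C2 set). ?N)"
      unfolding ev2_def by (intro sum_mono) (rule form_norm_upper[OF assms], use g in auto)
    then show ?thesis using 3 N c by (simp add: frame_norm_def)
  qed
qed

lemma form_norm_scaled_bound:
  assumes z: "z \<in> CH2" and k: "k \<le> 2" and L: "alternating k L"
  shows "\<bar>L v\<bar> \<le> (1 + CH2_metric z (v 0) (v 0) + CH2_metric z (v 1) (v 1))\<^sup>2 * form_norm (CH2_metric z) k L"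
proof -
  define s where "s = 1 + CH2_metric z (v 0) (v 0) + CH2_metric z (v 1) (v 1)"
  have g0: "CH2_metric z u u \<ge> 0" for u unfolding metric_eq[OF z] using rho_pos[OF z] by simp
  have s1: "s \<ge> 1" using g0 by (simp add: s_def)
  have sg: "CH2_metric z (v i) (v i) \<le> s\<^sup>2" if "i < 2" for i
  proof -
    have "s * 1 \<le> s * s" using s1 by (intro mult_left_mono) auto
    moreover have "CH2_metric z (v i) (v i) \<le> s" using that g0[of "v 0"] g0[of "v 1"] by (auto simp: s_def less_2_cases_iff)
    ultimately show "CH2_metric z (v i) (v i) \<le> s\<^sup>2" by (simp add: power2_eq_square)
  qed
  define w where "w i = (1 / s) *\<^sub>R v i" for i
  have sc: "CH2_metric z (c *\<^sub>R u) (c *\<^sub>R u) = c\<^sup>2 * CH2_metric z u u" for c u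
    by (simp add: CH2_metric_def hermitian_def power2_eq_square algebra_simps)
  have w1: "\<forall>i<k. CH2_metric z (w i) (w i) \<le> 1"
    using sg k s1 by (auto simp: w_def sc power_divide divide_le_eq)
  have N: "\<bar>L w\<bar> \<le> form_norm (CH2_metric z) k L" by (rule form_norm_upper[OF z k L w1])
  have vw: "v i = s *\<^sub>R w i" for i using s1 by (simp add: w_def)
  have "\<bar>L v\<bar> \<le> s\<^sup>2 * \<bar>L w\<bar>"
  proof -
    have s2: "1 \<le> s\<^sup>2" "s \<le> s\<^sup>2" 
      using s1 mult_mono[of 1 s 1 s] mult_left_mono[of 1 s s] by (simp_all add: power2_eq_square)
    consider "k = 0" | "k = 1" | "k = 2" using k by linarith
    then show ?thesis
    proof cases
      case 1
      then have "L v = L w" using L by (auto simp: alternating_0)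
      then show ?thesis using s2 mult_right_mono[OF s2(1), of "\<bar>L w\<bar>"] by simp
    next
      case 2
      then have l: "linear (ev1 L)" and e: "\<And>v. L v = ev1 L (v 0)" using L alternating_1D[of L] by auto
      have "L v = s * L w" unfolding e[of v] e[of w] vw using linear_cmul[OF l, of s] by simp
      then show ?thesis using s2 s1 mult_right_mono[OF s2(2), of "\<bar>L w\<bar>"] by (simp add: abs_mult)
    next
      case 3
      then have l: "\<And>b. linear (\<lambda>a. ev2 L a b)" "\<And>a. linear (ev2 L a)" and e: "\<And>v. L v = ev2 L (v 0) (v 1)"
        using L alternating_2D[of L] by auto
      have "L v = s * (s * L w)" unfolding e[of v] e[of w] vw
        using linear_cmul[OF l(1), of s] linear_cmul[OF l(2), of _ s] by simp
      then show ?thesis using s1 by (simp add: abs_mult power2_eq_square)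
    qed
  qed
  also have "\<dots> \<le> s\<^sup>2 * form_norm (CH2_metric z) k L" using N by (intro mult_left_mono) auto
  finally show ?thesis by (simp add: s_def)
qed

subsection \<open>Membership criteria\<close>

definition vol :: "C2 \<Rightarrow> real" where "vol x = sqrt (gram_det (CH2_metric x))"

lemma vol_eq: "x \<in> CH2 \<Longrightarrow> vol x = 1 / (1 - (norm x)\<^sup>2) ^ 3"
proof -
  assume x: "x \<in> CH2"
  have D: "1 - (norm x)\<^sup>2 > 0" using x by (simp add: CH2_def abs_square_less_1)
  have "gram_det (CH2_metric x) = (1 / (1 - (norm x)\<^sup>2) ^ 3)\<^sup>2"
    using gram_det_CH2[of x] x by (simp add: CH2_def power_divide power_mult[symmetric])
  then show ?thesis using D by (simp add: vol_def)
qed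

lemma vol_ge_1: "x \<in> CH2 \<Longrightarrow> vol x \<ge> 1"
proof -
  assume x: "x \<in> CH2"
  have D: "1 - (norm x)\<^sup>2 > 0" using x by (simp add: CH2_def abs_square_less_1)
  then have "(1 - (norm x)\<^sup>2) ^ 3 \<le> 1" by (intro power_le_one) auto
  then show ?thesis using D by (simp add: vol_eq[OF x])
qed

lemma vol_measurable: "vol \<in> borel_measurable (lebesgue_on V)"
proof -
  have "continuous_on V (\<lambda>x. 1 / (1 - (norm x)\<^sup>2) ^ 3 :: real)"
    using V_CH2 by (intro continuous_intros) (auto simp: CH2_def abs_square_eq_1)
  then have "(\<lambda>x. 1 / (1 - (norm x)\<^sup>2) ^ 3 :: real) \<in> borel_measurable (lebesgue_on V)"
    by (rule continuous_imp_measurable_on_sets_lebesgue[OF _ V_sets])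
  then show ?thesis by (rule measurable_cong[THEN iffD1, rotated]) (use V_CH2 vol_eq in \<open>auto simp: space_restrict_space\<close>)
qed

lemma linear_form_measurable:
  fixes A :: "C2 \<Rightarrow> C2 \<Rightarrow> real" and Y :: "C2 \<Rightarrow> C2"
  assumes A: "\<And>x. x \<in> V \<Longrightarrow> linear (A x)" and m: "\<And>a. (\<lambda>x. A x a) \<in> borel_measurable (lebesgue_on V)"
    and Y: "continuous_on V Y"
  shows "(\<lambda>x. A x (Y x)) \<in> borel_measurable (lebesgue_on V)"
proof -
  have "(\<lambda>x. \<Sum>e\<in>Basis. (Y x \<bullet> e) * A x e) \<in> borel_measurable (lebesgue_on V)"
    by (intro borel_measurable_sum borel_measurable_times m continuous_imp_measurable_on_sets_lebesgue[OF _ V_sets] continuous_intros Y)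
  moreover have "A x (Y x) = (\<Sum>e\<in>Basis. (Y x \<bullet> e) * A x e)" if "x \<in> V" for x
  proof -
    have "A x (Y x) = A x (\<Sum>e\<in>Basis. (Y x \<bullet> e) *\<^sub>R e)" by (simp add: euclidean_representation)
    then show ?thesis by (simp add: linear_sum[OF A[OF that]] linear_cmul[OF A[OF that]])
  qed
  ultimately show ?thesis by (subst measurable_cong) (auto simp: space_restrict_space)
qed

lemma frame_norm_measurable:
  assumes k: "k \<le> 2" and L: "\<And>x. x \<in> V \<Longrightarrow> alternating k (\<omega> x)" and m: "\<And>v. (\<lambda>x. \<omega> x v) \<in> borel_measurable (lebesgue_on V)"
  shows "(\<lambda>x. frame_norm k x (\<omega> x)) \<in> borel_measurable (lebesgue_on V)"
proof -
  consider "k = 0" | "k = 1" | "k = 2" using k by linarith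
  then show ?thesis
  proof cases
    case 1
    then show ?thesis using m by (simp add: frame_norm_def)
  next
    case 2
    have "(\<lambda>x. ev1 (\<omega> x) (orthoframe x e)) \<in> borel_measurable (lebesgue_on V)" for e
    proof (rule linear_form_measurable[where A = "\<lambda>x. ev1 (\<omega> x)", OF _ _ orthoframe_continuous])
      show "linear (ev1 (\<omega> x))" if "x \<in> V" for x using alternating_1D(2)[OF L[OF that, unfolded 2]] .
      show "(\<lambda>x. ev1 (\<omega> x) a) \<in> borel_measurable (lebesgue_on V)" for a unfolding ev1_def by (rule m)
    qed
    then show ?thesis using 2 by (simp add: frame_norm_def)
  next
    case 3
    have l: "linear (\<lambda>a. ev2 (\<omega> x) a b)" "linear (ev2 (\<omega> x) a)" if "x \<in> V" for x a b
      using alternating_2D(2,3)[OF L[OF that, unfolded 3]] by auto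
    have "(\<lambda>x. ev2 (\<omega> x) (orthoframe x e) (orthoframe x f)) \<in> borel_measurable (lebesgue_on V)" for e f
    proof (rule linear_form_measurable[where A = "\<lambda>x. ev2 (\<omega> x) (orthoframe x e)", OF _ _ orthoframe_continuous])
      show "(\<lambda>x. ev2 (\<omega> x) (orthoframe x e) a) \<in> borel_measurable (lebesgue_on V)" for a
      proof (rule linear_form_measurable[where A = "\<lambda>x b. ev2 (\<omega> x) b a", OF _ _ orthoframe_continuous])
        show "(\<lambda>x. ev2 (\<omega> x) b a) \<in> borel_measurable (lebesgue_on V)" for b unfolding ev2_def by (rule m)
      qed (rule l(1))
    qed (rule l(2))
    then show ?thesis using 3 by (simp add: frame_norm_def)
  qed
qed

abbreviation "Lp \<equiv> lp_forms CH2_metric V"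

lemma LpD:
  assumes "\<omega> \<in> Lp k p"
  shows "x \<in> V \<Longrightarrow> alternating k (\<omega> x)" "(\<lambda>x. \<omega> x v) \<in> borel_measurable (lebesgue_on V)"
    "(\<integral>\<^sup>+ x. ennreal (form_norm (CH2_metric x) k (\<omega> x) powr p * vol x) \<partial>lebesgue_on V) < \<infinity>"
  using assms unfolding lp_forms_def vol_def by auto

lemma Lp_frame_norm:
  assumes k: "k \<le> 2" and w: "\<omega> \<in> Lp k p" and p: "p \<ge> 0"
  shows "(\<integral>\<^sup>+ x. ennreal (frame_norm k x (\<omega> x) powr p * vol x) \<partial>lebesgue_on V) < \<infinity>"
    "(\<lambda>x. ennreal (frame_norm k x (\<omega> x) powr p * vol x)) \<in> borel_measurable (lebesgue_on V)"
proof -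
  have fm: "(\<lambda>x. frame_norm k x (\<omega> x)) \<in> borel_measurable (lebesgue_on V)"
    by (rule frame_norm_measurable[OF k LpD(1,2)[OF w]])
  show "(\<lambda>x. ennreal (frame_norm k x (\<omega> x) powr p * vol x)) \<in> borel_measurable (lebesgue_on V)"
    using fm vol_measurable by measurable
  have "(\<integral>\<^sup>+ x. ennreal (frame_norm k x (\<omega> x) powr p * vol x) \<partial>lebesgue_on V)
     \<le> (\<integral>\<^sup>+ x. ennreal (frame_norm k x (\<omega> x) powr p * vol x) \<partial>lebesgue_on V)" by simp
  let ?F = "\<lambda>x. ennreal ((frame_norm k x (\<omega> x) / 16) powr p * vol x)"
  have le: "(\<integral>\<^sup>+ x. ?F x \<partial>lebesgue_on V) \<le> (\<integral>\<^sup>+ x. ennreal (form_norm (CH2_metric x) k (\<omega> x) powr p * vol x) \<partial>lebesgue_on V)"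
  proof (rule nn_integral_mono)
    fix x assume "x \<in> space (lebesgue_on V)"
    then have x: "x \<in> V" "x \<in> CH2" using V_CH2 by (auto simp: space_restrict_space)
    have "frame_norm k x (\<omega> x) / 16 \<le> form_norm (CH2_metric x) k (\<omega> x)"
      using form_norm_frame_norm(2)[OF x(2) k LpD(1)[OF w x(1)]] by simp
    moreover have "0 \<le> frame_norm k x (\<omega> x)" by (simp add: frame_norm_def sum_nonneg)
    ultimately show "?F x \<le> ennreal (form_norm (CH2_metric x) k (\<omega> x) powr p * vol x)"
      using vol_ge_1[OF x(2)] p by (intro ennreal_leI mult_right_mono powr_mono2) auto
  qed
  have "ennreal (frame_norm k x (\<omega> x) powr p * vol x) = ennreal (16 powr p) * ?F x" for x
    by (simp add: frame_norm_def sum_nonneg powr_divide ennreal_mult'[symmetric])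
  then have "(\<integral>\<^sup>+ x. ennreal (frame_norm k x (\<omega> x) powr p * vol x) \<partial>lebesgue_on V) = ennreal (16 powr p) * (\<integral>\<^sup>+ x. ?F x \<partial>lebesgue_on V)"
    using fm vol_measurable by (simp add: nn_integral_cmult)
  also have "\<dots> < \<infinity>" using le_less_trans[OF le LpD(3)[OF w]] by (simp add: ennreal_mult_less_top)
  finally show "(\<integral>\<^sup>+ x. ennreal (frame_norm k x (\<omega> x) powr p * vol x) \<partial>lebesgue_on V) < \<infinity>" .
qed

lemma LpI_dominated:
  assumes "k \<le> 2" "k1 \<le> 2" "k2 \<le> 2" and a: "\<alpha> \<in> Lp k1 q" and b: "\<beta> \<in> Lp k2 q" and q: "q \<ge> 0" and C: "C \<ge> 0"
    and alt: "\<And>x. x \<in> V \<Longrightarrow> alternating k (\<omega> x)" and m: "\<And>v. (\<lambda>x. \<omega> x v) \<in> borel_measurable (lebesgue_on V)"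
    and bound: "\<And>x. x \<in> V \<Longrightarrow> form_norm (CH2_metric x) k (\<omega> x) powr p \<le>
      C * (form_norm (CH2_metric x) k1 (\<alpha> x) powr q + form_norm (CH2_metric x) k2 (\<beta> x) powr q)"
  shows "\<omega> \<in> Lp k p"
proof -
  let ?a = "\<lambda>x. ennreal (frame_norm k1 x (\<alpha> x) powr q * vol x)" and ?b = "\<lambda>x. ennreal (frame_norm k2 x (\<beta> x) powr q * vol x)"
  note A = Lp_frame_norm[OF assms(2) a q] and B = Lp_frame_norm[OF assms(3) b q]
  have "(\<integral>\<^sup>+ x. ennreal (form_norm (CH2_metric x) k (\<omega> x) powr p * vol x) \<partial>lebesgue_on V)
    \<le> (\<integral>\<^sup>+ x. ennreal C * (?a x + ?b x) \<partial>lebesgue_on V)"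
  proof (rule nn_integral_mono)
    fix x assume "x \<in> space (lebesgue_on V)"
    then have x: "x \<in> V" "x \<in> CH2" using V_CH2 by (auto simp: space_restrict_space)
    note v = vol_ge_1[OF x(2)]
    have "form_norm (CH2_metric x) k1 (\<alpha> x) powr q \<le> frame_norm k1 x (\<alpha> x) powr q"
      using form_norm_frame_norm(1)[OF x(2) assms(2) LpD(1)[OF a x(1)]] form_norm_nonneg[OF x(2) assms(2) LpD(1)[OF a x(1)]] q
      by (intro powr_mono2) auto
    moreover have "form_norm (CH2_metric x) k2 (\<beta> x) powr q \<le> frame_norm k2 x (\<beta> x) powr q"
      using form_norm_frame_norm(1)[OF x(2) assms(3) LpD(1)[OF b x(1)]] form_norm_nonneg[OF x(2) assms(3) LpD(1)[OF b x(1)]] q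
      by (intro powr_mono2) auto
    ultimately have "form_norm (CH2_metric x) k (\<omega> x) powr p \<le> C * (frame_norm k1 x (\<alpha> x) powr q + frame_norm k2 x (\<beta> x) powr q)"
      using order_trans[OF bound[OF x(1)] mult_left_mono[OF add_mono C]] by blast
    then have "form_norm (CH2_metric x) k (\<omega> x) powr p * vol x \<le> C * (frame_norm k1 x (\<alpha> x) powr q + frame_norm k2 x (\<beta> x) powr q) * vol x"
      using v by (intro mult_right_mono) auto
    also have "\<dots> = C * (frame_norm k1 x (\<alpha> x) powr q * vol x + frame_norm k2 x (\<beta> x) powr q * vol x)" by (simp add: algebra_simps)
    finally have "ennreal (form_norm (CH2_metric x) k (\<omega> x) powr p * vol x) \<le> ennreal \<dots>" by (rule ennreal_leI)
    also have "\<dots> = ennreal C * (?a x + ?b x)" using v C by (simp add: ennreal_mult' ennreal_plus mult_nonneg_nonneg)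
    finally show "ennreal (form_norm (CH2_metric x) k (\<omega> x) powr p * vol x) \<le> ennreal C * (?a x + ?b x)" .
  qed
  also have "\<dots> = ennreal C * ((\<integral>\<^sup>+ x. ?a x \<partial>lebesgue_on V) + (\<integral>\<^sup>+ x. ?b x \<partial>lebesgue_on V))"
    using A(2) B(2) by (simp add: nn_integral_cmult nn_integral_add)
  also have "\<dots> < \<infinity>" using A(1) B(1) by (simp add: ennreal_mult_less_top)
  finally show ?thesis using alt m unfolding lp_forms_def vol_def by auto
qed

lemma Lp_lincomb:
  assumes k: "k \<le> 2" and a: "\<alpha> \<in> Lp k p" and b: "\<beta> \<in> Lp k p" and p: "p > 0"
  shows "(\<lambda>x v. \<alpha> x v + c * \<beta> x v) \<in> Lp k p"
proof (rule LpI_dominated[OF k k k a b])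
  let ?C = "(2 * (1 + \<bar>c\<bar>)) powr p"
  show "0 \<le> ?C" "0 \<le> p" using p by auto
  show "(\<lambda>x. \<alpha> x v + c * \<beta> x v) \<in> borel_measurable (lebesgue_on V)" for v
    using LpD(2)[OF a] LpD(2)[OF b] by simp
  fix x assume x: "x \<in> V"
  then have xC: "x \<in> CH2" using V_CH2 by blast
  note A = LpD(1)[OF a x] and B = LpD(1)[OF b x]
  show alt: "alternating k (\<lambda>v. \<alpha> x v + c * \<beta> x v)"
  proof (rule alternatingI)
    fix v w :: "nat \<Rightarrow> C2" assume "\<And>i. i < k \<Longrightarrow> v i = w i"
    then show "\<alpha> x v + c * \<beta> x v = \<alpha> x w + c * \<beta> x w"
      using alternating_cong[OF A, of v w] alternating_cong[OF B, of v w] by simp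
  next
    fix v :: "nat \<Rightarrow> C2" and i assume i: "i < k"
    note l = alternating_linear[OF A i, of v] alternating_linear[OF B i, of v]
    show "linear (\<lambda>a. \<alpha> x (v(i := a)) + c * \<beta> x (v(i := a)))"
      by (rule linearI) (simp_all add: linear_add[OF l(1)] linear_add[OF l(2)] linear_cmul[OF l(1)] linear_cmul[OF l(2)] algebra_simps)
  next
    fix v :: "nat \<Rightarrow> C2" and i j assume "i < j" "j < k" "v i = v j"
    then show "\<alpha> x v + c * \<beta> x v = 0" using alternating_zero[OF A] alternating_zero[OF B] by simp
  qed
  let ?n = "form_norm (CH2_metric x) k"
  have N: "0 \<le> ?n (\<alpha> x)" "0 \<le> ?n (\<beta> x)" using form_norm_nonneg[OF xC k A] form_norm_nonneg[OF xC k B] by auto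
  have "?n (\<lambda>v. \<alpha> x v + c * \<beta> x v) \<le> ?n (\<alpha> x) + \<bar>c\<bar> * ?n (\<beta> x)"
  proof (rule form_norm_least)
    fix v assume v: "\<forall>i<k. CH2_metric x (v i) (v i) \<le> 1"
    have "\<bar>\<alpha> x v + c * \<beta> x v\<bar> \<le> \<bar>\<alpha> x v\<bar> + \<bar>c\<bar> * \<bar>\<beta> x v\<bar>" by (metis abs_mult abs_triangle_ineq)
    also have "\<dots> \<le> ?n (\<alpha> x) + \<bar>c\<bar> * ?n (\<beta> x)"
      using form_norm_upper[OF xC k A v] form_norm_upper[OF xC k B v] by (intro add_mono mult_left_mono) auto
    finally show "\<bar>\<alpha> x v + c * \<beta> x v\<bar> \<le> ?n (\<alpha> x) + \<bar>c\<bar> * ?n (\<beta> x)" .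
  qed
  also have "\<dots> \<le> 2 * (1 + \<bar>c\<bar>) * max (?n (\<alpha> x)) (?n (\<beta> x))"
  proof -
    let ?M = "max (?n (\<alpha> x)) (?n (\<beta> x))"
    have "?n (\<alpha> x) + \<bar>c\<bar> * ?n (\<beta> x) \<le> ?M + \<bar>c\<bar> * ?M" by (intro add_mono mult_left_mono) auto
    also have "\<dots> = (1 + \<bar>c\<bar>) * ?M" by (simp add: algebra_simps)
    also have "\<dots> \<le> 2 * ((1 + \<bar>c\<bar>) * ?M)" using N by (simp add: zero_le_mult_iff le_max_iff_disj)
    finally show ?thesis by (simp only: mult.assoc)
  qed
  finally have "?n (\<lambda>v. \<alpha> x v + c * \<beta> x v) powr p \<le> (2 * (1 + \<bar>c\<bar>) * max (?n (\<alpha> x)) (?n (\<beta> x))) powr p"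
    using p form_norm_nonneg[OF xC k alt] by (intro powr_mono2) auto
  also have "\<dots> = ?C * max (?n (\<alpha> x)) (?n (\<beta> x)) powr p" by (rule powr_mult)
  also have "\<dots> \<le> ?C * (?n (\<alpha> x) powr p + ?n (\<beta> x) powr p)" by (intro mult_left_mono) (auto simp: max_def)
  finally show "?n (\<lambda>v. \<alpha> x v + c * \<beta> x v) powr p \<le> ?C * (?n (\<alpha> x) powr p + ?n (\<beta> x) powr p)" .
qed

lemma Lp_zero: "p > 0 \<Longrightarrow> zero_form \<in> Lp k p"
proof -
  assume p: "p > 0"
  have "form_norm (CH2_metric x) k (\<lambda>v. 0) = 0" for x
  proof -
    have "(\<lambda>_. 0) \<in> {v. \<forall>i<k. CH2_metric x (v i) (v i) \<le> 1}" by (simp add: CH2_metric_def hermitian_def)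
    then have "{v. \<forall>i<k. CH2_metric x (v i) (v i) \<le> 1} \<noteq> {}" by (rule ex_in_conv[THEN iffD1, OF exI])
    then show ?thesis unfolding form_norm_def by simp
  qed
  then show ?thesis using p by (auto simp: lp_forms_def zero_form_def alternating_def intro!: linearI)
qed

text \<open>The exponents \<open>q\<close> and \<open>r\<close> are both \<open>2 p\<close>, so Hoelder's inequality reduces to \<open>2 a b \<le> a\<^sup>2 + b\<^sup>2\<close>.\<close>

lemma powr_mult_le:
  fixes a b :: real assumes "0 \<le> a" "0 \<le> b" "p > 0"
  shows "(a * b) powr p \<le> a powr (2 * p) + b powr (2 * p)"
proof -
  have "(a * b) powr p \<le> (max a b * max a b) powr p" using assms by (intro powr_mono2 mult_mono) auto
  also have "\<dots> = max a b powr (2 * p)" using assms by (simp add: powr_mult powr_add[symmetric])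
  also have "\<dots> \<le> a powr (2 * p) + b powr (2 * p)" by (auto simp: max_def)
  finally show ?thesis .
qed

lemma wedge_alternating:
  assumes "alternating 1 (\<alpha> x)" "alternating 1 (\<beta> x)" shows "alternating 2 (wedge 1 1 \<alpha> \<beta> x)"
proof -
  note l = alternating_1D(2)[OF assms(1)] alternating_1D(2)[OF assms(2)]
  have e: "ev2 (wedge 1 1 \<alpha> \<beta> x) a b = ev1 (\<alpha> x) a * ev1 (\<beta> x) b - ev1 (\<alpha> x) b * ev1 (\<beta> x) a" for a b
    unfolding ev2_def wedge_1_1[of \<alpha> x \<beta>, OF assms] by simp
  show ?thesis unfolding numeral_2_eq_2 alternating_2 e unfolding wedge_1_1[of \<alpha> x \<beta>, OF assms]
    by (auto intro!: linearI simp: linear_add[OF l(1)] linear_add[OF l(2)] linear_cmul[OF l(1)] linear_cmul[OF l(2)] algebra_simps)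
qed

lemma Lp_wedge:
  assumes a: "\<alpha> \<in> Lp 1 (2 * p)" and b: "\<beta> \<in> Lp 1 (2 * p)" and p: "p > 0"
  shows "wedge 1 1 \<alpha> \<beta> \<in> Lp 2 p"
proof (rule LpI_dominated[OF _ _ _ a b, where C = "2 powr p"])
  fix x assume x: "x \<in> V"
  then have xC: "x \<in> CH2" using V_CH2 by blast
  note A = LpD(1)[OF a x] and B = LpD(1)[OF b x]
  show alt: "alternating 2 (wedge 1 1 \<alpha> \<beta> x)" by (rule wedge_alternating[of \<alpha> x \<beta>, OF A B])
  let ?n = "form_norm (CH2_metric x)"
  have N: "0 \<le> ?n 1 (\<alpha> x)" "0 \<le> ?n 1 (\<beta> x)" using form_norm_nonneg[OF xC _ A] form_norm_nonneg[OF xC _ B] by auto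
  have "?n 2 (wedge 1 1 \<alpha> \<beta> x) \<le> 2 * (?n 1 (\<alpha> x) * ?n 1 (\<beta> x))"
  proof (rule form_norm_least)
    fix v :: "nat \<Rightarrow> C2" assume v: "\<forall>i<2. CH2_metric x (v i) (v i) \<le> 1"
    have e: "\<bar>ev1 (\<alpha> x) (v i)\<bar> \<le> ?n 1 (\<alpha> x)" "\<bar>ev1 (\<beta> x) (v i)\<bar> \<le> ?n 1 (\<beta> x)" if "i < 2" for i
      unfolding ev1_def using form_norm_upper[OF xC _ A, of "\<lambda>_. v i"] form_norm_upper[OF xC _ B, of "\<lambda>_. v i"] v that by auto
    have "\<bar>ev1 (\<alpha> x) (v i) * ev1 (\<beta> x) (v j)\<bar> \<le> ?n 1 (\<alpha> x) * ?n 1 (\<beta> x)" if "i < 2" "j < 2" for i j :: nat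
      unfolding abs_mult using e[OF that(1)] e[OF that(2)] N by (intro mult_mono) auto
    from this[of 0 1] this[of 1 0] show "\<bar>wedge 1 1 \<alpha> \<beta> x v\<bar> \<le> 2 * (?n 1 (\<alpha> x) * ?n 1 (\<beta> x))"
      unfolding wedge_1_1[of \<alpha> x \<beta>, OF A B] by linarith
  qed
  then have "?n 2 (wedge 1 1 \<alpha> \<beta> x) powr p \<le> (2 * (?n 1 (\<alpha> x) * ?n 1 (\<beta> x))) powr p"
    using p form_norm_nonneg[OF xC _ alt] by (intro powr_mono2) auto
  also have "\<dots> = 2 powr p * (?n 1 (\<alpha> x) * ?n 1 (\<beta> x)) powr p" by (rule powr_mult)
  also have "\<dots> \<le> 2 powr p * (?n 1 (\<alpha> x) powr (2 * p) + ?n 1 (\<beta> x) powr (2 * p))"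
    using powr_mult_le[OF N p] by (intro mult_left_mono) auto
  finally show "?n 2 (wedge 1 1 \<alpha> \<beta> x) powr p \<le> 2 powr p * (?n 1 (\<alpha> x) powr (2 * p) + ?n 1 (\<beta> x) powr (2 * p))" .
next
  fix v :: "nat \<Rightarrow> C2"
  have "(\<lambda>x. ev1 (\<alpha> x) (v 0) * ev1 (\<beta> x) (v 1) - ev1 (\<alpha> x) (v 1) * ev1 (\<beta> x) (v 0)) \<in> borel_measurable (lebesgue_on V)"
    unfolding ev1_def using LpD(2)[OF a] LpD(2)[OF b] by simp
  moreover have "wedge 1 1 \<alpha> \<beta> x v = ev1 (\<alpha> x) (v 0) * ev1 (\<beta> x) (v 1) - ev1 (\<alpha> x) (v 1) * ev1 (\<beta> x) (v 0)"
    if "x \<in> V" for x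
    by (rule wedge_1_1[of \<alpha> x \<beta>, OF LpD(1)[OF a that] LpD(1)[OF b that]])
  ultimately show "(\<lambda>x. wedge 1 1 \<alpha> \<beta> x v) \<in> borel_measurable (lebesgue_on V)"
    by (subst measurable_cong) (simp_all add: space_restrict_space)
qed (use p in auto)

lemma Lp_function_mult:
  assumes a: "\<gamma> \<in> Lp 0 (2 * p)" and b: "\<beta> \<in> Lp 1 (2 * p)" and p: "p > 0"
  shows "(\<lambda>x v. \<gamma> x (\<lambda>_. 0) * \<beta> x v) \<in> Lp 1 p"
proof (rule LpI_dominated[OF _ _ _ a b, where C = 1])
  fix x assume x: "x \<in> V"
  then have xC: "x \<in> CH2" using V_CH2 by blast
  note A = LpD(1)[OF a x] and B = LpD(1)[OF b x]
  show alt: "alternating 1 (\<lambda>v. \<gamma> x (\<lambda>_. 0) * \<beta> x v)"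
  proof (rule alternatingI)
    show "\<gamma> x (\<lambda>_. 0) * \<beta> x v = \<gamma> x (\<lambda>_. 0) * \<beta> x w" if "\<And>i. i < 1 \<Longrightarrow> v i = w i" for v w :: "nat \<Rightarrow> C2"
      using alternating_cong[OF B that] by simp
    show "linear (\<lambda>a. \<gamma> x (\<lambda>_. 0) * \<beta> x (v(i := a)))" if "i < 1" for v :: "nat \<Rightarrow> C2" and i
      using linear_compose[OF alternating_linear[OF B that, of v], of "\<lambda>t. \<gamma> x (\<lambda>_. 0) * t"]
      by (simp add: o_def linearI algebra_simps)
  qed simp
  let ?n = "form_norm (CH2_metric x)"
  have N: "0 \<le> ?n 0 (\<gamma> x)" "0 \<le> ?n 1 (\<beta> x)" using form_norm_nonneg[OF xC _ A] form_norm_nonneg[OF xC _ B] by auto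
  have "?n 1 (\<lambda>v. \<gamma> x (\<lambda>_. 0) * \<beta> x v) \<le> ?n 0 (\<gamma> x) * ?n 1 (\<beta> x)"
  proof (rule form_norm_least)
    fix v :: "nat \<Rightarrow> C2" assume v: "\<forall>i<1. CH2_metric x (v i) (v i) \<le> 1"
    show "\<bar>\<gamma> x (\<lambda>_. 0) * \<beta> x v\<bar> \<le> ?n 0 (\<gamma> x) * ?n 1 (\<beta> x)"
      unfolding abs_mult using form_norm_upper[OF xC _ A] form_norm_upper[OF xC _ B v] N by (intro mult_mono) auto
  qed
  then have "?n 1 (\<lambda>v. \<gamma> x (\<lambda>_. 0) * \<beta> x v) powr p \<le> (?n 0 (\<gamma> x) * ?n 1 (\<beta> x)) powr p"
    using p form_norm_nonneg[OF xC _ alt] by (intro powr_mono2) auto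
  also have "\<dots> \<le> ?n 0 (\<gamma> x) powr (2 * p) + ?n 1 (\<beta> x) powr (2 * p)" by (rule powr_mult_le[OF N p])
  finally show "?n 1 (\<lambda>v. \<gamma> x (\<lambda>_. 0) * \<beta> x v) powr p \<le> 1 * (?n 0 (\<gamma> x) powr (2 * p) + ?n 1 (\<beta> x) powr (2 * p))" by simp
qed (use p LpD(2)[OF a] LpD(2)[OF b] in auto)

lemma CH2_metric_continuous: "continuous_on V (\<lambda>x. CH2_metric x u v)"
proof -
  have "continuous_on V (\<lambda>x. Re ((1 - of_real ((norm x)\<^sup>2)) * hermitian u v + hermitian u x * hermitian x v) / (1 - (norm x)\<^sup>2)\<^sup>2)"
    using V_CH2 unfolding hermitian_def by (intro continuous_intros) (auto simp: CH2_def abs_square_eq_1)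
  then show ?thesis unfolding CH2_metric_def hermitian_self .
qed

text \<open>On a compact set the metric is comparable to the Euclidean one, and \<open>t\<^sup>2 \<le> 1 + t\<^sup>p\<close>. This makes the
  products with weakly differentiable factors integrable against test functions.\<close>

lemma Lp_L2_loc:
  assumes k: "k \<le> 2" and w: "\<omega> \<in> Lp k p" and p: "p \<ge> 2"
  shows "L2_loc V (\<lambda>x. \<omega> x v)"
  unfolding L2_loc_def
proof (intro conjI allI impI)
  show m: "(\<lambda>x. \<omega> x v) \<in> borel_measurable (lebesgue_on V)" by (rule LpD(2)[OF w])
  fix K assume K: "compact K" "K \<subseteq> V"
  define S where "S x = (1 + CH2_metric x (v 0) (v 0) + CH2_metric x (v 1) (v 1))\<^sup>2" for x
  have "continuous_on K S" unfolding S_def[abs_def]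
    by (intro continuous_intros continuous_on_subset[OF CH2_metric_continuous K(2)])
  then have "bounded (S ` K)" using compact_continuous_image[OF _ K(1)] compact_imp_bounded by blast
  then obtain M where M: "M > 0" "\<And>x. x \<in> K \<Longrightarrow> \<bar>S x\<bar> \<le> M" unfolding bounded_pos by auto
  let ?F = "\<lambda>x. frame_norm k x (\<omega> x) powr p * vol x"
  have bd: "(\<omega> x v)\<^sup>2 \<le> M\<^sup>2 * (1 + ?F x)" if x: "x \<in> K" for x
  proof -
    have xV: "x \<in> V" "x \<in> CH2" using x K V_CH2 by auto
    note alt = LpD(1)[OF w xV(1)]
    let ?n = "frame_norm k x (\<omega> x)"
    have n0: "0 \<le> form_norm (CH2_metric x) k (\<omega> x)" by (rule form_norm_nonneg[OF xV(2) k alt])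
    have n: "form_norm (CH2_metric x) k (\<omega> x) \<le> ?n" by (rule form_norm_frame_norm(1)[OF xV(2) k alt])
    have "\<bar>\<omega> x v\<bar> \<le> S x * form_norm (CH2_metric x) k (\<omega> x)"
      using form_norm_scaled_bound[OF xV(2) k alt] by (simp add: S_def)
    also have "\<dots> \<le> M * ?n" using M(2)[OF x] n n0 M(1) by (intro mult_mono) auto
    finally have "\<bar>\<omega> x v\<bar>\<^sup>2 \<le> (M * ?n)\<^sup>2" by (intro power_mono) auto
    also have "\<dots> = M\<^sup>2 * ?n\<^sup>2" by (simp add: power_mult_distrib)
    also have "?n\<^sup>2 \<le> 1 + ?F x"
    proof (cases "?n \<le> 1")
      case True
      then have "?n\<^sup>2 \<le> 1" using n n0 by (intro power_le_one) auto
      moreover have "0 \<le> ?F x" using vol_ge_1[OF xV(2)] by simp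
      ultimately show ?thesis by linarith
    next
      case False
      then have "?n\<^sup>2 = ?n powr 2" by (simp add: powr_numeral)
      also have "\<dots> \<le> ?n powr p" using False p by (intro powr_mono) auto
      also have "\<dots> \<le> ?F x" using mult_left_mono[OF vol_ge_1[OF xV(2)], of "?n powr p"] by simp
      finally show ?thesis by simp
    qed
    finally show ?thesis using M(1) by (simp add: mult_left_mono)
  qed
  have Km: "K \<in> sets lebesgue" using K(1) by (simp add: borel_compact)
  have "(\<lambda>x. if x \<in> V then \<omega> x v else 0) \<in> borel_measurable lebesgue" using m borel_measurable_if[OF V_sets, of "\<lambda>x. \<omega> x v"] by simp
  then have "(\<lambda>x. indicator K x * (if x \<in> V then \<omega> x v else 0)\<^sup>2) \<in> borel_measurable lebesgue"
    using Km by measurable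
  moreover have "(\<lambda>x. indicator K x * (if x \<in> V then \<omega> x v else 0)\<^sup>2) = (\<lambda>x. indicator K x * (\<omega> x v)\<^sup>2)"
    using K(2) by (auto simp: indicator_def fun_eq_iff)
  ultimately have meas: "(\<lambda>x. indicator K x * (\<omega> x v)\<^sup>2) \<in> borel_measurable lebesgue" by simp
  show "integrable lebesgue (\<lambda>x. indicator K x * (\<omega> x v)\<^sup>2)"
  proof (rule integrableI_bounded[OF meas])
    note F = Lp_frame_norm[OF k w, of] 
    have Fm: "(\<lambda>x. ennreal (?F x)) \<in> borel_measurable (lebesgue_on V)" and Ff: "(\<integral>\<^sup>+ x. ennreal (?F x) \<partial>lebesgue_on V) < \<infinity>"
      using Lp_frame_norm[OF k w] p by auto
    have "(\<integral>\<^sup>+ x. ennreal (norm (indicator K x * (\<omega> x v)\<^sup>2)) \<partial>lebesgue) = (\<integral>\<^sup>+ x. ennreal (norm (indicator K x * (\<omega> x v)\<^sup>2)) * indicator V x \<partial>lebesgue)"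
      using K(2) by (intro nn_integral_cong) (auto simp: indicator_def)
    also have "\<dots> = (\<integral>\<^sup>+ x. ennreal (norm (indicator K x * (\<omega> x v)\<^sup>2)) \<partial>lebesgue_on V)"
      using nn_integral_restrict_space[of V lebesgue] V_sets by simp
    also have "\<dots> \<le> (\<integral>\<^sup>+ x. ennreal (M\<^sup>2) * (indicator K x + ennreal (?F x)) \<partial>lebesgue_on V)"
    proof (rule nn_integral_mono)
      fix x assume "x \<in> space (lebesgue_on V)"
      then have v: "0 \<le> vol x" using vol_ge_1[of x] V_CH2 by (auto simp: space_restrict_space)
      show "ennreal (norm (indicator K x * (\<omega> x v)\<^sup>2)) \<le> ennreal (M\<^sup>2) * (indicator K x + ennreal (?F x))"
      proof (cases "x \<in> K")
        case True
        have "ennreal ((\<omega> x v)\<^sup>2) \<le> ennreal (M\<^sup>2 * (1 + ?F x))" by (rule ennreal_leI[OF bd[OF True]])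
        also have "\<dots> = ennreal (M\<^sup>2) * (1 + ennreal (?F x))" using v by (simp add: ennreal_mult)
        finally show ?thesis using True by simp
      qed simp
    qed
    also have "\<dots> = ennreal (M\<^sup>2) * ((\<integral>\<^sup>+ x. indicator K x \<partial>lebesgue_on V) + (\<integral>\<^sup>+ x. ennreal (?F x) \<partial>lebesgue_on V))"
    proof -
      have "(indicator K :: C2 \<Rightarrow> ennreal) \<in> borel_measurable (lebesgue_on V)"
        using Km by (intro measurable_restrict_space1 borel_measurable_indicator)
      then show ?thesis using Fm by (simp add: nn_integral_cmult nn_integral_add)
    qed
    also have "\<dots> < \<infinity>"
    proof -
      have "(\<integral>\<^sup>+ x. indicator K x \<partial>lebesgue_on V) = (\<integral>\<^sup>+ x. indicator K x * indicator V x \<partial>lebesgue)"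
        using nn_integral_restrict_space[of V lebesgue] V_sets by simp
      also have "\<dots> \<le> (\<integral>\<^sup>+ x. indicator K x \<partial>lebesgue)" by (intro nn_integral_mono) (auto simp: indicator_def)
      also have "\<dots> = emeasure lebesgue K" using Km by simp
      also have "\<dots> = emeasure lborel K" using K(1) by (simp add: borel_compact)
      also have "\<dots> < \<infinity>" using emeasure_bounded_finite[OF compact_imp_bounded[OF K(1)]] by simp
      finally show ?thesis using Ff by (simp add: ennreal_mult_less_top)
    qed
    finally show "(\<integral>\<^sup>+ x. ennreal (norm (indicator K x * (\<omega> x v)\<^sup>2)) \<partial>lebesgue) < \<infinity>" .
  qed
qed

end

section \<open>Weak exterior derivatives and cup-products\<close>

definition dform :: "('a::euclidean_space \<Rightarrow> real) \<Rightarrow> 'a form" where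
  "dform u = (\<lambda>x v. fd u x (v 0))"

lemma dform_alternating: "u differentiable at x \<Longrightarrow> alternating 1 (dform u x)"
proof -
  assume u: "u differentiable at x"
  have "ev1 (dform u x) = fd u x" by (simp add: fun_eq_iff ev1_def dform_def)
  then show ?thesis using fd_linear[OF u] by (simp add: alternating_1 dform_def)
qed

lemma ev1_dform: "ev1 (dform u x) a = fd u x a"
  by (simp add: ev1_def dform_def)

lemma omit_omit:
  "omit 0 (omit (Suc 0) v) = omit 0 (omit 0 v)"
  "omit 0 (omit 2 v) = omit (Suc 0) (omit 0 v)"
  "omit (Suc 0) (omit 2 v) = omit (Suc 0) (omit (Suc 0) v)"
  by (auto simp: omit_def fun_eq_iff)

lemma omit_values: "omit 0 v 0 = v (Suc 0)" "omit (Suc 0) v 0 = v 0" "omit 2 v 0 = v 0"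
  "omit 0 v (Suc 0) = v 2" "omit (Suc 0) v (Suc 0) = v 2" "omit 2 v (Suc 0) = v (Suc 0)"
  by (auto simp: omit_def numeral_2_eq_2)

context cone_domain
begin

abbreviation "weak \<equiv> weak_ext_deriv V"

definition L2_form :: "C2 form \<Rightarrow> bool" where
  "L2_form \<omega> \<longleftrightarrow> (\<forall>v. L2_loc V (\<lambda>x. \<omega> x v))"

lemma integral_V_cong: "(\<And>x. x \<in> V \<Longrightarrow> f x = g x) \<Longrightarrow> (LINT x|lebesgue_on V. f x) = (LINT x|lebesgue_on V. g x)"
  for f g :: "C2 \<Rightarrow> real"
  by (rule Bochner_Integration.integral_cong[OF refl]) (simp add: space_restrict_space)

lemma L2_test_integrable:
  assumes "L2_loc V f" "test_function V \<phi>" shows "integrable (lebesgue_on V) (\<lambda>x. f x * \<phi> x)"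
proof -
  have "L2_loc V (\<lambda>x. 1)" by (rule L2_loc_continuous[OF V_sets]) simp
  from L2_loc_mult_integrable[OF V_sets assms(1) this assms(2)] show ?thesis by simp
qed

lemma weak_cong:
  assumes "weak k \<omega> \<psi>" "\<And>x v. x \<in> V \<Longrightarrow> \<omega>' x v = \<omega> x v" "\<And>x v. x \<in> V \<Longrightarrow> \<psi>' x v = \<psi> x v"
  shows "weak k \<omega>' \<psi>'"
  unfolding weak_ext_deriv_def
proof (intro allI impI)
  fix \<phi> :: "C2 \<Rightarrow> real" and v assume "test_function V \<phi>"
  with assms(1) have "(LINT x|lebesgue_on V. \<psi> x v * \<phi> x) = - (\<Sum>i\<le>k. (- 1) ^ i * (LINT x|lebesgue_on V. \<omega> x (omit i v) * fd \<phi> x (v i)))"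
    unfolding weak_ext_deriv_def by blast
  moreover have "(LINT x|lebesgue_on V. \<psi>' x v * \<phi> x) = (LINT x|lebesgue_on V. \<psi> x v * \<phi> x)"
    by (rule integral_V_cong) (simp add: assms(3))
  moreover have "(LINT x|lebesgue_on V. \<omega>' x (omit i v) * fd \<phi> x (v i)) = (LINT x|lebesgue_on V. \<omega> x (omit i v) * fd \<phi> x (v i))" for i
    by (rule integral_V_cong) (simp add: assms(2))
  ultimately show "(LINT x|lebesgue_on V. \<psi>' x v * \<phi> x) = - (\<Sum>i\<le>k. (- 1) ^ i * (LINT x|lebesgue_on V. \<omega>' x (omit i v) * fd \<phi> x (v i)))"
    by simp
qed

lemma weakD: "weak k \<omega> \<psi> \<Longrightarrow> test_function V \<phi> \<Longrightarrow>
    (LINT x|lebesgue_on V. \<psi> x v * \<phi> x) = - (\<Sum>i\<le>k. (- 1) ^ i * (LINT x|lebesgue_on V. \<omega> x (omit i v) * fd \<phi> x (v i)))"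
  unfolding weak_ext_deriv_def by blast

lemma weakD0: "weak 0 \<omega> \<psi> \<Longrightarrow> test_function V \<phi> \<Longrightarrow>
    (LINT x|lebesgue_on V. \<psi> x v * \<phi> x) = - (LINT x|lebesgue_on V. \<omega> x (omit 0 v) * fd \<phi> x (v 0))"
  using weakD[of 0] by simp

lemma weakD1: "weak (Suc 0) \<omega> \<psi> \<Longrightarrow> test_function V \<phi> \<Longrightarrow>
    (LINT x|lebesgue_on V. \<psi> x v * \<phi> x) = - ((LINT x|lebesgue_on V. \<omega> x (omit 0 v) * fd \<phi> x (v 0))
      - (LINT x|lebesgue_on V. \<omega> x (omit (Suc 0) v) * fd \<phi> x (v (Suc 0))))"
  using weakD[of "Suc 0"] by simp

lemma weak_lincomb:
  assumes w: "weak k \<omega> \<psi>" "weak k \<omega>' \<psi>'" and L: "L2_form \<omega>" "L2_form \<psi>" "L2_form \<omega>'" "L2_form \<psi>'"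
  shows "weak k (\<lambda>x v. \<omega> x v + c * \<omega>' x v) (\<lambda>x v. \<psi> x v + c * \<psi>' x v)"
  unfolding weak_ext_deriv_def
proof (intro allI impI)
  fix \<phi> :: "C2 \<Rightarrow> real" and v assume t: "test_function V \<phi>"
  have i: "integrable (lebesgue_on V) (\<lambda>x. \<alpha> x v * \<phi> x)" if "L2_form \<alpha>" "test_function V \<phi>" for \<alpha> v \<phi>
    using L2_test_integrable that by (simp add: L2_form_def)
  have lin: "(LINT x|lebesgue_on V. (\<alpha> x v + c * \<beta> x v) * \<phi> x) = (LINT x|lebesgue_on V. \<alpha> x v * \<phi> x) + c * (LINT x|lebesgue_on V. \<beta> x v * \<phi> x)"
    if "L2_form \<alpha>" "L2_form \<beta>" "test_function V \<phi>" for \<alpha> \<beta> v \<phi>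
    using i[OF that(1,3), of v] i[OF that(2,3), of v] by (simp add: distrib_right mult.assoc)
  show "(LINT x|lebesgue_on V. (\<psi> x v + c * \<psi>' x v) * \<phi> x) =
      - (\<Sum>j\<le>k. (- 1) ^ j * (LINT x|lebesgue_on V. (\<omega> x (omit j v) + c * \<omega>' x (omit j v)) * fd \<phi> x (v j)))"
    unfolding lin[OF L(2,4) t] lin[OF L(1,3) test_function_fd[OF t]] weakD[OF w(1) t] weakD[OF w(2) t]
    by (simp add: distrib_left sum.distrib sum_distrib_left mult.left_commute)
qed

lemma weak_dd_0: 
  assumes "weak 0 \<gamma> \<psi>" shows "weak 1 \<psi> zero_form"
  unfolding weak_ext_deriv_def
proof (intro allI impI)
  fix \<phi> :: "C2 \<Rightarrow> real" and v assume t: "test_function V \<phi>"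
  have "(LINT x|lebesgue_on V. \<psi> x (omit 0 v) * fd \<phi> x (v 0)) = (LINT x|lebesgue_on V. \<psi> x (omit (Suc 0) v) * fd \<phi> x (v (Suc 0)))"
    unfolding weakD0[OF assms test_function_fd[OF t]] omit_omit omit_values
    using mixed_partials_commute[OF open_UNIV test_functionD(1)[OF t]] by simp
  then show "(LINT x|lebesgue_on V. zero_form x v * \<phi> x) = - (\<Sum>i\<le>1. (- 1) ^ i * (LINT x|lebesgue_on V. \<psi> x (omit i v) * fd \<phi> x (v i)))"
    by (simp add: zero_form_def)
qed

lemma weak_dd_1: 
  assumes "weak 1 \<alpha> \<psi>" shows "weak 2 \<psi> zero_form"
  unfolding weak_ext_deriv_def
proof (intro allI impI)
  fix \<phi> :: "C2 \<Rightarrow> real" and v assume t: "test_function V \<phi>"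
  have c: "fd (\<lambda>y. fd \<phi> y a) x b = fd (\<lambda>y. fd \<phi> y b) x a" for a b x
    using mixed_partials_commute[OF open_UNIV test_functionD(1)[OF t]] by simp
  let ?I = "\<lambda>i. (LINT x|lebesgue_on V. \<psi> x (omit i v) * fd \<phi> x (v i))"
  have "?I 0 - ?I (Suc 0) + ?I 2 = 0"
    unfolding weakD1[OF assms[unfolded One_nat_def] test_function_fd[OF t]] omit_omit omit_values
      c[of "v 0" _ "v (Suc 0)"] c[of "v 0" _ "v 2"] c[of "v (Suc 0)" _ "v 2"] by simp
  then show "(LINT x|lebesgue_on V. zero_form x v * \<phi> x) = - (\<Sum>i\<le>2. (- 1) ^ i * ?I i)"
    by (simp add: zero_form_def numeral_2_eq_2)
qed

lemma weak_dform:
  assumes "open S" "V \<subseteq> S" "smooth_on S u"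
  shows "weak 0 (function_form u) (dform u)"
  unfolding weak_ext_deriv_def dform_def function_form_def
  using integration_by_parts[OF open_V smooth_on_subset[OF assms(3,2)]] by simp

lemma weak_leibniz:
  assumes L: "L2_form \<gamma>" "L2_form \<epsilon>" "L2_form \<beta>"
    and alt: "\<And>x. x \<in> V \<Longrightarrow> alternating 0 (\<gamma> x)" "\<And>x. x \<in> V \<Longrightarrow> alternating 1 (\<epsilon> x)" "\<And>x. x \<in> V \<Longrightarrow> alternating 1 (\<beta> x)"
    and d: "weak 0 \<gamma> \<epsilon>" and cl: "weak 1 \<beta> zero_form"
  shows "weak 1 (\<lambda>x v. \<gamma> x (\<lambda>_. 0) * \<beta> x v) (wedge 1 1 \<epsilon> \<beta>)"
  unfolding weak_ext_deriv_def
proof (intro allI impI)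
  fix \<phi> :: "C2 \<Rightarrow> real" and v :: "nat \<Rightarrow> C2" assume t: "test_function V \<phi>"
  have g: "\<gamma> x w = \<gamma> x (\<lambda>_. 0)" if "x \<in> V" for x w using alt(1)[OF that] unfolding alternating_0 by blast
  have d': "(LINT x|lebesgue_on V. ev1 (\<epsilon> x) a * \<phi> x) = - (LINT x|lebesgue_on V. \<gamma> x (\<lambda>_. 0) * fd \<phi> x a)"
    if "test_function V \<phi>" for \<phi> a
  proof -
    have "(LINT x|lebesgue_on V. ev1 (\<epsilon> x) a * \<phi> x) = - (LINT x|lebesgue_on V. \<gamma> x (omit 0 (\<lambda>_. a)) * fd \<phi> x a)"
      unfolding ev1_def using weakD0[OF d that, of "\<lambda>_. a"] by simp
    also have "(LINT x|lebesgue_on V. \<gamma> x (omit 0 (\<lambda>_. a)) * fd \<phi> x a) = (LINT x|lebesgue_on V. \<gamma> x (\<lambda>_. 0) * fd \<phi> x a)"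
      by (rule integral_V_cong) (metis g)
    finally show ?thesis .
  qed
  have b: "\<beta> x (omit 0 w) = ev1 (\<beta> x) (w 1)" "\<beta> x (omit (Suc 0) w) = ev1 (\<beta> x) (w 0)" if "x \<in> V" for x w
    using alternating_1D(1)[OF alt(3)[OF that], of "omit 0 w"] alternating_1D(1)[OF alt(3)[OF that], of "omit (Suc 0) w"]
    by (simp_all add: omit_values)
  have cl': "(LINT x|lebesgue_on V. ev1 (\<beta> x) (v 1) * fd \<phi> x (v 0)) = (LINT x|lebesgue_on V. ev1 (\<beta> x) (v 0) * fd \<phi> x (v 1))"
    if "test_function V \<phi>" for \<phi>
  proof -
    have "(LINT x|lebesgue_on V. \<beta> x (omit 0 v) * fd \<phi> x (v 0)) = (LINT x|lebesgue_on V. \<beta> x (omit (Suc 0) v) * fd \<phi> x (v (Suc 0)))"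
      using weakD1[OF cl[unfolded One_nat_def] that, of v] by (simp add: zero_form_def)
    moreover have "(LINT x|lebesgue_on V. \<beta> x (omit 0 v) * fd \<phi> x (v 0)) = (LINT x|lebesgue_on V. ev1 (\<beta> x) (v 1) * fd \<phi> x (v 0))"
      by (rule integral_V_cong) (simp add: b)
    moreover have "(LINT x|lebesgue_on V. \<beta> x (omit (Suc 0) v) * fd \<phi> x (v (Suc 0))) = (LINT x|lebesgue_on V. ev1 (\<beta> x) (v 0) * fd \<phi> x (v 1))"
      by (rule integral_V_cong) (simp add: b)
    ultimately show ?thesis by simp
  qed
  have L': "L2_loc V (\<lambda>x. \<gamma> x (\<lambda>_. 0))" "L2_loc V (\<lambda>x. ev1 (\<epsilon> x) a)" "L2_loc V (\<lambda>x. ev1 (\<beta> x) a)" for a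
    using L by (auto simp: L2_form_def ev1_def)
  have "(LINT x|lebesgue_on V. wedge 1 1 \<epsilon> \<beta> x v * \<phi> x) =
      (LINT x|lebesgue_on V. (ev1 (\<epsilon> x) (v 0) * ev1 (\<beta> x) (v 1) - ev1 (\<epsilon> x) (v 1) * ev1 (\<beta> x) (v 0)) * \<phi> x)"
    by (rule integral_V_cong) (simp only: wedge_1_1 alt)
  also have "\<dots> = - ((LINT x|lebesgue_on V. \<gamma> x (\<lambda>_. 0) * ev1 (\<beta> x) (v 1) * fd \<phi> x (v 0))
      - (LINT x|lebesgue_on V. \<gamma> x (\<lambda>_. 0) * ev1 (\<beta> x) (v 0) * fd \<phi> x (v 1)))"
    by (rule weak_leibniz_components[OF open_V L'(1) L'(2) L'(2) L'(3) L'(3) d' d' cl' t])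
  also have "(LINT x|lebesgue_on V. \<gamma> x (\<lambda>_. 0) * ev1 (\<beta> x) (v 1) * fd \<phi> x (v 0)) = (LINT x|lebesgue_on V. \<gamma> x (\<lambda>_. 0) * \<beta> x (omit 0 v) * fd \<phi> x (v 0))"
    by (rule integral_V_cong) (simp add: b)
  also have "(LINT x|lebesgue_on V. \<gamma> x (\<lambda>_. 0) * ev1 (\<beta> x) (v 0) * fd \<phi> x (v 1)) = (LINT x|lebesgue_on V. \<gamma> x (\<lambda>_. 0) * \<beta> x (omit 1 v) * fd \<phi> x (v 1))"
    by (rule integral_V_cong) (simp add: b)
  finally show "(LINT x|lebesgue_on V. wedge 1 1 \<epsilon> \<beta> x v * \<phi> x) =
      - (\<Sum>i\<le>1. (- 1) ^ i * (LINT x|lebesgue_on V. \<gamma> x (\<lambda>_. 0) * \<beta> x (omit i v) * fd \<phi> x (v i)))"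
    by simp
qed

subsection \<open>Cohomology classes\<close>

lemma Lp_L2_form: "k \<le> 2 \<Longrightarrow> \<omega> \<in> Lp k p \<Longrightarrow> p \<ge> 2 \<Longrightarrow> L2_form \<omega>"
  using Lp_L2_loc by (simp add: L2_form_def)

lemma L2_form_zero: "L2_form zero_form"
  unfolding L2_form_def zero_form_def by (intro allI L2_loc_continuous[OF V_sets] continuous_on_const)

lemma weak_zero: "weak k zero_form zero_form"
  by (simp add: weak_ext_deriv_def zero_form_def)

lemma closed_iff:
  assumes "p > 0" shows "\<omega> \<in> lp_closed CH2_metric V k p \<longleftrightarrow> \<omega> \<in> Lp k p \<and> weak k \<omega> zero_form"
  using Lp_zero[OF assms, of "Suc k"] by (auto simp: lp_closed_def lp_Omega_def)

lemma exact_iff: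
  assumes p: "p > 0" and m: "m \<le> 1"
  shows "\<omega> \<in> lp_exact CH2_metric V (Suc m) p \<longleftrightarrow> \<omega> \<in> Lp (Suc m) p \<and> (\<exists>\<alpha>\<in>Lp m p. weak m \<alpha> \<omega>)"
proof
  assume "\<omega> \<in> lp_exact CH2_metric V (Suc m) p"
  then show "\<omega> \<in> Lp (Suc m) p \<and> (\<exists>\<alpha>\<in>Lp m p. weak m \<alpha> \<omega>)" by (auto simp: lp_exact_def lp_Omega_def)
next
  assume a: "\<omega> \<in> Lp (Suc m) p \<and> (\<exists>\<alpha>\<in>Lp m p. weak m \<alpha> \<omega>)"
  then obtain \<alpha> where \<alpha>: "\<alpha> \<in> Lp m p" "weak m \<alpha> \<omega>" by blast
  have "m = 0 \<or> m = 1" using m by auto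
  then have "weak (Suc m) \<omega> zero_form" using weak_dd_0 weak_dd_1 \<alpha>(2) by (auto simp: numeral_2_eq_2)
  then have "\<omega> \<in> lp_Omega CH2_metric V (Suc m) p" using a Lp_zero[OF p] by (auto simp: lp_Omega_def)
  moreover have "\<alpha> \<in> lp_Omega CH2_metric V m p" using \<alpha> a by (auto simp: lp_Omega_def)
  ultimately show "\<omega> \<in> lp_exact CH2_metric V (Suc m) p" using \<alpha>(2) by (auto simp: lp_exact_def)
qed

lemma cohomologous_iff:
  assumes p: "p > 0" and m: "m \<le> 1"
  shows "(a, b) \<in> cohomologous CH2_metric V (Suc m) p \<longleftrightarrow>
    a \<in> lp_closed CH2_metric V (Suc m) p \<and> b \<in> lp_closed CH2_metric V (Suc m) p \<and>
    (\<exists>\<alpha>\<in>Lp m p. weak m \<alpha> (\<lambda>x v. b x v - a x v))"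
proof -
  have "(\<lambda>x v. b x v - a x v) \<in> Lp (Suc m) p" if "a \<in> lp_closed CH2_metric V (Suc m) p" "b \<in> lp_closed CH2_metric V (Suc m) p"
    using Lp_lincomb[of "Suc m" b p a "- 1"] that m p by (simp add: closed_iff[OF p])
  then show ?thesis unfolding cohomologous_def using exact_iff[OF p m] by auto
qed

lemma cohomologous_equiv:
  assumes p: "p \<ge> 2" and m: "m \<le> 1"
  shows "equiv (lp_closed CH2_metric V (Suc m) p) (cohomologous CH2_metric V (Suc m) p)"
proof (rule equivI)
  have p0: "p > 0" using p by simp
  note coh = cohomologous_iff[OF p0 m]
  have L2: "L2_form (\<lambda>x v. b x v - a x v)"
    if "a \<in> lp_closed CH2_metric V (Suc m) p" "b \<in> lp_closed CH2_metric V (Suc m) p" for a b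
    using Lp_lincomb[of "Suc m" b p a "- 1"] that m p Lp_L2_form[of "Suc m" "\<lambda>x v. b x v - a x v" p] by (simp add: closed_iff[OF p0])
  have L2m: "L2_form \<alpha>" if "\<alpha> \<in> Lp m p" for \<alpha> using Lp_L2_form[OF _ that p] m by simp
  show "cohomologous CH2_metric V (Suc m) p \<subseteq> lp_closed CH2_metric V (Suc m) p \<times> lp_closed CH2_metric V (Suc m) p"
    by (auto simp: cohomologous_def)
  have "(a, a) \<in> cohomologous CH2_metric V (Suc m) p" if "a \<in> lp_closed CH2_metric V (Suc m) p" for a
  proof -
    have "weak m zero_form (\<lambda>x v. a x v - a x v)" by (rule weak_cong[OF weak_zero]) (auto simp: zero_form_def)
    then show ?thesis unfolding coh using that Lp_zero[OF p0] by blast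
  qed
  then show "refl_on (lp_closed CH2_metric V (Suc m) p) (cohomologous CH2_metric V (Suc m) p)"
    by (rule refl_onI)
  show "sym (cohomologous CH2_metric V (Suc m) p)"
  proof (rule symI)
    fix a b assume ab: "(a, b) \<in> cohomologous CH2_metric V (Suc m) p"
    then obtain \<alpha> where c: "a \<in> lp_closed CH2_metric V (Suc m) p" "b \<in> lp_closed CH2_metric V (Suc m) p"
      and \<alpha>: "\<alpha> \<in> Lp m p" "weak m \<alpha> (\<lambda>x v. b x v - a x v)" unfolding coh by blast
    have "weak m (\<lambda>x v. zero_form x v + (- 1) * \<alpha> x v) (\<lambda>x v. zero_form x v + (- 1) * (b x v - a x v))"
      by (rule weak_lincomb[OF weak_zero \<alpha>(2) L2_form_zero L2_form_zero L2m[OF \<alpha>(1)] L2[OF c]])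
    then have "weak m (\<lambda>x v. zero_form x v + (- 1) * \<alpha> x v) (\<lambda>x v. a x v - b x v)" by (simp add: zero_form_def)
    moreover have "(\<lambda>x v. zero_form x v + (- 1) * \<alpha> x v) \<in> Lp m p"
      by (rule Lp_lincomb[OF _ Lp_zero[OF p0] \<alpha>(1) p0]) (use m in simp)
    ultimately show "(b, a) \<in> cohomologous CH2_metric V (Suc m) p" unfolding coh using c by blast
  qed
  show "trans (cohomologous CH2_metric V (Suc m) p)"
  proof (rule transI)
    fix a b c assume "(a, b) \<in> cohomologous CH2_metric V (Suc m) p" "(b, c) \<in> cohomologous CH2_metric V (Suc m) p"
    then obtain \<alpha> \<beta> where cl: "a \<in> lp_closed CH2_metric V (Suc m) p" "b \<in> lp_closed CH2_metric V (Suc m) p" "c \<in> lp_closed CH2_metric V (Suc m) p"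
      and \<alpha>: "\<alpha> \<in> Lp m p" "weak m \<alpha> (\<lambda>x v. b x v - a x v)" and \<beta>: "\<beta> \<in> Lp m p" "weak m \<beta> (\<lambda>x v. c x v - b x v)"
      unfolding coh by blast
    have "weak m (\<lambda>x v. \<alpha> x v + 1 * \<beta> x v) (\<lambda>x v. (b x v - a x v) + 1 * (c x v - b x v))"
      by (rule weak_lincomb[OF \<alpha>(2) \<beta>(2) L2m[OF \<alpha>(1)] L2[OF cl(1,2)] L2m[OF \<beta>(1)] L2[OF cl(2,3)]])
    then have "weak m (\<lambda>x v. \<alpha> x v + 1 * \<beta> x v) (\<lambda>x v. c x v - a x v)" by simp
    moreover have "(\<lambda>x v. \<alpha> x v + 1 * \<beta> x v) \<in> Lp m p" by (rule Lp_lincomb[OF _ \<alpha>(1) \<beta>(1) p0]) (use m in simp)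
    ultimately show "(a, c) \<in> cohomologous CH2_metric V (Suc m) p" unfolding coh using cl by blast
  qed
qed

lemma lp_class_eq_iff:
  assumes "p \<ge> 2" "m \<le> 1" "a \<in> lp_closed CH2_metric V (Suc m) p" "b \<in> lp_closed CH2_metric V (Suc m) p"
  shows "lp_class CH2_metric V (Suc m) p a = lp_class CH2_metric V (Suc m) p b \<longleftrightarrow> (a, b) \<in> cohomologous CH2_metric V (Suc m) p"
  unfolding lp_class_def by (rule eq_equiv_class_iff[OF cohomologous_equiv[OF assms(1,2)] assms(3,4)])

lemma L2_form_dform:
  assumes "open S" "V \<subseteq> S" "smooth_on S u" shows "L2_form (dform u)" "L2_form (function_form u)"
  unfolding L2_form_def dform_def function_form_def
  by (intro allI L2_loc_continuous[OF V_sets] continuous_on_subset[OF smooth_on_continuous assms(2)] smooth_on_fd assms)+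

lemma dform_alternating_on:
  assumes "open S" "V \<subseteq> S" "smooth_on S u" "x \<in> V" shows "alternating 1 (dform u x)"
  by (rule dform_alternating[OF smooth_on_differentiable[OF assms(1,3)]]) (use assms in auto)

lemma weak_function_dform:
  assumes S: "open S" "V \<subseteq> S" and a: "smooth_on S a" and b: "smooth_on S b"
  shows "weak 1 (\<lambda>x v. a x * dform b x v) (wedge 1 1 (dform a) (dform b))"
proof -
  have "weak 1 (\<lambda>x v. function_form a x (\<lambda>_. 0) * dform b x v) (wedge 1 1 (dform a) (dform b))"
    by (rule weak_leibniz[OF L2_form_dform(2)[OF S a] L2_form_dform(1)[OF S a] L2_form_dform(1)[OF S b] _
        dform_alternating_on[OF S a] dform_alternating_on[OF S b] weak_dform[OF S a] weak_dd_0[OF weak_dform[OF S b]]])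
       (simp_all add: alternating_0 function_form_def)
  then show ?thesis by (simp add: function_form_def)
qed

text \<open>Representatives of the two classes differ from \<open>du\<close> and \<open>dw\<close> by weak differentials \<open>d\<gamma>\<close> and
  \<open>d\<gamma>'\<close>, and \<open>\<alpha> \<and> \<beta> - du \<and> dw = d(\<gamma> \<beta> - \<gamma>' du)\<close>.\<close>

lemma wedge_representatives:
  assumes p: "p \<ge> 1" and S: "open S" "V \<subseteq> S" and u: "smooth_on S u" and w: "smooth_on S w"
    and du: "dform u \<in> Lp 1 (2 * p)" and dw: "dform w \<in> Lp 1 (2 * p)"
    and \<alpha>: "\<alpha> \<in> Lp 1 (2 * p)" and \<beta>: "\<beta> \<in> Lp 1 (2 * p)"
    and \<gamma>: "\<gamma> \<in> Lp 0 (2 * p)" "weak 0 \<gamma> (\<lambda>x v. \<alpha> x v - dform u x v)"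
    and \<gamma>': "\<gamma>' \<in> Lp 0 (2 * p)" "weak 0 \<gamma>' (\<lambda>x v. \<beta> x v - dform w x v)"
    and \<beta>cl: "weak 1 \<beta> zero_form"
  defines "P \<equiv> \<lambda>x v. \<gamma> x (\<lambda>_. 0) * \<beta> x v + (- 1) * (\<gamma>' x (\<lambda>_. 0) * dform u x v)"
  shows "P \<in> Lp 1 p" "weak 1 P (\<lambda>x v. wedge 1 1 \<alpha> \<beta> x v - wedge 1 1 (dform u) (dform w) x v)"
proof -
  have p0: "p > 0" "2 * p > 0" "2 * p \<ge> 2" using p by auto
  let ?a = "\<lambda>x v. \<alpha> x v - dform u x v" and ?b = "\<lambda>x v. \<beta> x v - dform w x v"
  have aL: "?a \<in> Lp 1 (2 * p)" using Lp_lincomb[OF _ \<alpha> du p0(2), of "- 1"] by simp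
  have bL: "?b \<in> Lp 1 (2 * p)" using Lp_lincomb[OF _ \<beta> dw p0(2), of "- 1"] by simp
  note L2 = Lp_L2_form[OF _ _ p0(3)]
  have 1: "(\<lambda>x v. \<gamma> x (\<lambda>_. 0) * \<beta> x v) \<in> Lp 1 p" by (rule Lp_function_mult[OF \<gamma>(1) \<beta> p0(1)])
  have 2: "(\<lambda>x v. \<gamma>' x (\<lambda>_. 0) * dform u x v) \<in> Lp 1 p" by (rule Lp_function_mult[OF \<gamma>'(1) du p0(1)])
  show "P \<in> Lp 1 p" unfolding P_def by (rule Lp_lincomb[OF _ 1 2 p0(1)]) simp
  have w1: "weak 1 (\<lambda>x v. \<gamma> x (\<lambda>_. 0) * \<beta> x v) (wedge 1 1 ?a \<beta>)"
    by (rule weak_leibniz[OF L2[OF _ \<gamma>(1)] L2[OF _ aL] L2[OF _ \<beta>] LpD(1)[OF \<gamma>(1)] LpD(1)[OF aL] LpD(1)[OF \<beta>] \<gamma>(2) \<beta>cl]) auto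
  have w2: "weak 1 (\<lambda>x v. \<gamma>' x (\<lambda>_. 0) * dform u x v) (wedge 1 1 ?b (dform u))"
    by (rule weak_leibniz[OF L2[OF _ \<gamma>'(1)] L2[OF _ bL] L2[OF _ du] LpD(1)[OF \<gamma>'(1)] LpD(1)[OF bL] LpD(1)[OF du] \<gamma>'(2)
        weak_dd_0[OF weak_dform[OF S u]]]) auto
  have L2loc: "L2_loc V (\<lambda>x. f x v)" if "L2_form f" for f v using that by (simp add: L2_form_def)
  have int: "integrable (lebesgue_on V) (\<lambda>x. \<gamma> x (\<lambda>_. 0) * \<beta> x v * \<phi> x)"
     "integrable (lebesgue_on V) (\<lambda>x. \<gamma>' x (\<lambda>_. 0) * dform u x v * \<phi> x)" if "test_function V \<phi>" for v \<phi>
    by (rule L2_loc_mult_integrable[OF V_sets L2loc L2loc that]; rule L2; (rule \<gamma> \<gamma>' \<beta> du)?; simp)+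
  have intw: "integrable (lebesgue_on V) (\<lambda>x. wedge 1 1 f k x v * \<phi> x)"
    if f: "f \<in> Lp 1 (2 * p)" and k: "k \<in> Lp 1 (2 * p)" and t: "test_function V \<phi>" for f k v \<phi>
  proof -
    have i: "integrable (lebesgue_on V) (\<lambda>x. ev1 (f x) a * ev1 (k x) b * \<phi> x)" for a b
      unfolding ev1_def by (rule L2_loc_mult_integrable[OF V_sets L2loc L2loc t]; rule L2; (rule f k)?; simp)
    have "integrable (lebesgue_on V) (\<lambda>x. ev1 (f x) (v 0) * ev1 (k x) (v 1) * \<phi> x - ev1 (f x) (v 1) * ev1 (k x) (v 0) * \<phi> x)"
      by (intro Bochner_Integration.integrable_diff i)
    moreover have "wedge 1 1 f k x v * \<phi> x = ev1 (f x) (v 0) * ev1 (k x) (v 1) * \<phi> x - ev1 (f x) (v 1) * ev1 (k x) (v 0) * \<phi> x"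
      if "x \<in> V" for x
      unfolding wedge_1_1[of f x k, OF LpD(1)[OF f that] LpD(1)[OF k that]] by (simp add: left_diff_distrib)
    ultimately show ?thesis
      by (subst Bochner_Integration.integrable_cong[OF refl]) (simp_all add: space_restrict_space)
  qed
  show "weak 1 P (\<lambda>x v. wedge 1 1 \<alpha> \<beta> x v - wedge 1 1 (dform u) (dform w) x v)"
    unfolding weak_ext_deriv_def
  proof (intro allI impI)
    fix \<phi> :: "C2 \<Rightarrow> real" and v assume t: "test_function V \<phi>"
    have "(LINT x|lebesgue_on V. (wedge 1 1 \<alpha> \<beta> x v - wedge 1 1 (dform u) (dform w) x v) * \<phi> x) =
       (LINT x|lebesgue_on V. wedge 1 1 ?a \<beta> x v * \<phi> x - wedge 1 1 ?b (dform u) x v * \<phi> x)"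
    proof (rule integral_V_cong)
      fix x assume x: "x \<in> V"
      have e: "ev1 (?a x) c = ev1 (\<alpha> x) c - ev1 (dform u x) c" "ev1 (?b x) c = ev1 (\<beta> x) c - ev1 (dform w x) c" for c
        by (simp_all add: ev1_def)
      show "(wedge 1 1 \<alpha> \<beta> x v - wedge 1 1 (dform u) (dform w) x v) * \<phi> x = wedge 1 1 ?a \<beta> x v * \<phi> x - wedge 1 1 ?b (dform u) x v * \<phi> x"
        unfolding wedge_1_1[of \<alpha> x \<beta>, OF LpD(1)[OF \<alpha> x] LpD(1)[OF \<beta> x]] wedge_1_1[of "dform u" x "dform w", OF LpD(1)[OF du x] LpD(1)[OF dw x]]
          wedge_1_1[of ?a x \<beta>, OF LpD(1)[OF aL x] LpD(1)[OF \<beta> x]] wedge_1_1[of ?b x "dform u", OF LpD(1)[OF bL x] LpD(1)[OF du x]] e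
        by (simp add: algebra_simps)
    qed
    also have "\<dots> = (LINT x|lebesgue_on V. wedge 1 1 ?a \<beta> x v * \<phi> x) - (LINT x|lebesgue_on V. wedge 1 1 ?b (dform u) x v * \<phi> x)"
      by (rule Bochner_Integration.integral_diff[OF intw[OF aL \<beta> t] intw[OF bL du t]])
    also have "\<dots> = - (\<Sum>i\<le>1. (- 1) ^ i * (LINT x|lebesgue_on V. P x (omit i v) * fd \<phi> x (v i)))"
    proof -
      have lin: "(LINT x|lebesgue_on V. P x y * fd \<phi> x a) = (LINT x|lebesgue_on V. \<gamma> x (\<lambda>_. 0) * \<beta> x y * fd \<phi> x a)
         - (LINT x|lebesgue_on V. \<gamma>' x (\<lambda>_. 0) * dform u x y * fd \<phi> x a)" for y a
        using int[OF test_function_fd[OF t, of a], of y] by (simp add: P_def left_diff_distrib)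
      show ?thesis unfolding lin weakD[OF w1 t, of v] weakD[OF w2 t, of v]
        by (simp add: right_diff_distrib sum_subtractf)
    qed
    finally show "(LINT x|lebesgue_on V. (wedge 1 1 \<alpha> \<beta> x v - wedge 1 1 (dform u) (dform w) x v) * \<phi> x) =
       - (\<Sum>i\<le>1. (- 1) ^ i * (LINT x|lebesgue_on V. P x (omit i v) * fd \<phi> x (v i)))" .
  qed
qed

lemma dform_closed:
  assumes "p > 0" "open S" "V \<subseteq> S" "smooth_on S u" "dform u \<in> Lp 1 p"
  shows "dform u \<in> lp_closed CH2_metric V 1 p"
  using closed_iff[OF assms(1)] weak_dd_0[OF weak_dform[OF assms(2-4)]] assms(5) by blast

lemma wedge_dform_closed:
  assumes p: "p \<ge> 1" and S: "open S" "V \<subseteq> S" and u: "smooth_on S u" and w: "smooth_on S w"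
    and du: "dform u \<in> Lp 1 (2 * p)" and dw: "dform w \<in> Lp 1 (2 * p)"
  shows "wedge 1 1 (dform u) (dform w) \<in> lp_closed CH2_metric V 2 p"
  using closed_iff[of p "wedge 1 1 (dform u) (dform w)" 2] p Lp_wedge[OF du dw] weak_dd_1[OF weak_function_dform[OF S u w]] by simp

lemma cup_product_eq:
  assumes p: "p \<ge> 2" and S: "open S" "V \<subseteq> S" and u: "smooth_on S u" and w: "smooth_on S w"
    and du: "dform u \<in> Lp 1 (2 * p)" and dw: "dform w \<in> Lp 1 (2 * p)"
  shows "cup_product CH2_metric V 1 1 p (lp_class CH2_metric V 1 (2 * p) (royden_differential CH2_metric V (2 * p) u))
      (lp_class CH2_metric V 1 (2 * p) (dform w)) = lp_class CH2_metric V 2 p (wedge 1 1 (dform u) (dform w))"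
proof -
  have p1: "p \<ge> 1" "p > 0" "2 * p > 0" "2 * p \<ge> 2" using p by auto
  define \<psi> where "\<psi> = royden_differential CH2_metric V (2 * p) u"
  have \<psi>: "\<psi> \<in> Lp 1 (2 * p)" "weak 0 (function_form u) \<psi>"
    using someI[of "\<lambda>\<psi>. \<psi> \<in> Lp 1 (2 * p) \<and> weak 0 (function_form u) \<psi>" "dform u"] du weak_dform[OF S u]
    unfolding \<psi>_def royden_differential_def by auto
  have \<psi>cl: "\<psi> \<in> lp_closed CH2_metric V 1 (2 * p)" using closed_iff[OF p1(3)] \<psi>(1) weak_dd_0[OF \<psi>(2)] by blast
  note dwcl = dform_closed[OF p1(3) S w dw]
  have coh: "(a, b) \<in> cohomologous CH2_metric V 1 (2 * p) \<longleftrightarrow>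
    a \<in> lp_closed CH2_metric V 1 (2 * p) \<and> b \<in> lp_closed CH2_metric V 1 (2 * p) \<and> (\<exists>\<alpha>\<in>Lp 0 (2 * p). weak 0 \<alpha> (\<lambda>x v. b x v - a x v))" for a b
    using cohomologous_iff[OF p1(3), of 0] by simp
  have refl: "a \<in> lp_class CH2_metric V 1 (2 * p) a" if "a \<in> lp_closed CH2_metric V 1 (2 * p)" for a
    using equiv_class_self[OF cohomologous_equiv[OF p1(4), of 0], of a] that by (simp add: lp_class_def)
  have key: "lp_class CH2_metric V 2 p (wedge 1 1 \<alpha> \<beta>) = lp_class CH2_metric V 2 p (wedge 1 1 (dform u) (dform w))"
    if a: "\<alpha> \<in> lp_class CH2_metric V 1 (2 * p) \<psi>" and b: "\<beta> \<in> lp_class CH2_metric V 1 (2 * p) (dform w)" for \<alpha> \<beta>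
  proof -
    obtain \<gamma> where \<gamma>: "\<gamma> \<in> Lp 0 (2 * p)" "weak 0 \<gamma> (\<lambda>x v. \<alpha> x v - \<psi> x v)" and \<alpha>cl: "\<alpha> \<in> lp_closed CH2_metric V 1 (2 * p)"
      using a coh[of \<psi> \<alpha>] unfolding lp_class_def by blast
    obtain \<gamma>' where \<gamma>': "\<gamma>' \<in> Lp 0 (2 * p)" "weak 0 \<gamma>' (\<lambda>x v. \<beta> x v - dform w x v)" and \<beta>cl: "\<beta> \<in> lp_closed CH2_metric V 1 (2 * p)"
      using b coh[of "dform w" \<beta>] unfolding lp_class_def by blast
    have \<alpha>: "\<alpha> \<in> Lp 1 (2 * p)" and \<beta>: "\<beta> \<in> Lp 1 (2 * p)" "weak 1 \<beta> zero_form"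
      using \<alpha>cl \<beta>cl closed_iff[OF p1(3)] by auto
    note L2 = Lp_L2_form[OF _ _ p1(4)]
    have ap: "(\<lambda>x v. \<alpha> x v - \<psi> x v) \<in> Lp 1 (2 * p)" using Lp_lincomb[OF _ \<alpha> \<psi>(1) p1(3), of "- 1"] by simp
    have pu: "(\<lambda>x v. \<psi> x v + (- 1) * dform u x v) \<in> Lp 1 (2 * p)" by (rule Lp_lincomb[OF _ \<psi>(1) du p1(3)]) simp
    have "weak 0 (\<lambda>x v. function_form u x v + (- 1) * function_form u x v) (\<lambda>x v. \<psi> x v + (- 1) * dform u x v)"
      by (rule weak_lincomb[OF \<psi>(2) weak_dform[OF S u] L2_form_dform(2)[OF S u] L2[OF _ \<psi>(1)] L2_form_dform(2)[OF S u] L2[OF _ du]]) auto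
    then have "weak 0 zero_form (\<lambda>x v. \<psi> x v + (- 1) * dform u x v)" by (simp add: zero_form_def)
    from weak_lincomb[OF \<gamma>(2) this L2[OF _ \<gamma>(1)] L2[OF _ ap] L2_form_zero L2[OF _ pu], of 1]
    have \<gamma>u: "weak 0 \<gamma> (\<lambda>x v. \<alpha> x v - dform u x v)" by (simp add: zero_form_def)
    note P = wedge_representatives[OF p1(1) S u w du dw \<alpha> \<beta>(1) \<gamma>(1) \<gamma>u \<gamma>' \<beta>(2)]
    note cl = wedge_dform_closed[OF p1(1) S u w du dw]
    have wab: "wedge 1 1 \<alpha> \<beta> \<in> Lp 2 p" and wuw: "wedge 1 1 (dform u) (dform w) \<in> Lp 2 p"
      by (rule Lp_wedge[OF \<alpha> \<beta>(1) p1(2)], rule Lp_wedge[OF du dw p1(2)])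
    have dL: "(\<lambda>x v. wedge 1 1 \<alpha> \<beta> x v - wedge 1 1 (dform u) (dform w) x v) \<in> Lp 2 p"
      using Lp_lincomb[OF _ wab wuw p1(2), of "- 1"] by simp
    have "weak 2 (\<lambda>x v. wedge 1 1 (dform u) (dform w) x v + 1 * (wedge 1 1 \<alpha> \<beta> x v - wedge 1 1 (dform u) (dform w) x v)) (\<lambda>x v. zero_form x v + 1 * zero_form x v)"
      by (rule weak_lincomb[OF _ weak_dd_1[OF P(2)] Lp_L2_form[OF _ wuw p] L2_form_zero Lp_L2_form[OF _ dL p] L2_form_zero])
         (use cl closed_iff[OF p1(2)] in auto)
    then have "weak 2 (wedge 1 1 \<alpha> \<beta>) zero_form" by (simp add: zero_form_def)
    then have cl': "wedge 1 1 \<alpha> \<beta> \<in> lp_closed CH2_metric V 2 p" using wab closed_iff[OF p1(2)] by blast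
    have "(wedge 1 1 (dform u) (dform w), wedge 1 1 \<alpha> \<beta>) \<in> cohomologous CH2_metric V (Suc 1) p"
      using cohomologous_iff[OF p1(2), of 1] P cl cl' by (auto simp: numeral_2_eq_2)
    then show ?thesis using lp_class_eq_iff[OF p, of 1 "wedge 1 1 (dform u) (dform w)" "wedge 1 1 \<alpha> \<beta>"] cl cl' by (simp add: numeral_2_eq_2)
  qed
  show ?thesis unfolding cup_product_def \<psi>_def[symmetric] one_add_one
    using key refl[OF \<psi>cl] refl[OF dwcl] by blast
qed

end

section \<open>The function, the form and the primitive\<close>

subsection \<open>Volume near the sphere\<close>

lemma shell_measure:
  assumes "0 \<le> r" "r \<le> 1"
  shows "measure lborel {x::'a::euclidean_space. 1 - r \<le> norm x \<and> norm x < 1} \<le> DIM('a) * unit_ball_vol (real DIM('a)) * r"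
proof -
  have e: "{x::'a. 1 - r \<le> norm x \<and> norm x < 1} = ball 0 1 - ball 0 (1 - r)" by auto
  have "measure lborel (ball (0::'a) 1 - ball 0 (1 - r)) = measure lborel (ball (0::'a) 1) - measure lborel (ball (0::'a) (1 - r))"
    by (rule measure_Diff) (use assms emeasure_bounded_finite[OF bounded_ball, of "0::'a" 1] in auto)
  also have "\<dots> = unit_ball_vol (real DIM('a)) * (1 - (1 - r) ^ DIM('a))"
    using content_ball[of 1 "0::'a"] content_ball[of "1 - r" "0::'a"] assms by (simp add: right_diff_distrib)
  also have "\<dots> \<le> unit_ball_vol (real DIM('a)) * (DIM('a) * r)"
    using Bernoulli_inequality[of "- r" "DIM('a)"] assms by (intro mult_left_mono) auto
  finally show ?thesis by (simp add: e mult_ac)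
qed

text \<open>Sum over the shells \<open>1 - |x| \<approx> 2\<^sup>-\<^sup>n\<close>, whose volume is \<open>O(2\<^sup>-\<^sup>n)\<close>.\<close>

lemma ball_boundary_integral:
  assumes s: "0 \<le> s" "s < 1"
  shows "(\<integral>\<^sup>+ x. ennreal ((1 - (norm (x::'a::euclidean_space))\<^sup>2) powr (- s)) * indicator (ball 0 1) x \<partial>lborel) < \<infinity>"
proof -
  define c where "c = DIM('a) * unit_ball_vol (real DIM('a))"
  have c: "c \<ge> 0" by (simp add: c_def)
  define A where "A n = {x::'a. 1 - (1 / 2) ^ n \<le> norm x \<and> norm x < 1 - (1 / 2) ^ Suc n}" for n
  have mA[measurable]: "A n \<in> sets borel" for n unfolding A_def by measurable
  define h where "h n = 2 powr (s * real (Suc n))" for n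
  have le: "ennreal ((1 - (norm x)\<^sup>2) powr (- s)) * indicator (ball 0 1) x \<le> (\<Sum>n. ennreal (h n) * indicator (A n) x)" for x :: 'a
  proof (cases "norm x < 1")
    case True
    have "\<exists>n. (1 / 2 :: real) ^ n < 1 - norm x" using real_arch_pow_inv[of "1 - norm x" "1 / 2"] True by simp
    then obtain n where n: "(1 / 2 :: real) ^ Suc n < 1 - norm x" "1 - norm x \<le> (1 / 2) ^ n"
    proof -
      define N where "N = (LEAST n. (1 / 2 :: real) ^ n < 1 - norm x)"
      have N: "(1 / 2 :: real) ^ N < 1 - norm x" unfolding N_def by (rule LeastI_ex) fact
      have "N \<noteq> 0" using N by (intro notI) simp
      then obtain m where m: "N = Suc m" using not0_implies_Suc by blast
      have "\<not> (1 / 2 :: real) ^ m < 1 - norm x" using not_less_Least[of m "\<lambda>n. (1 / 2 :: real) ^ n < 1 - norm x"] m unfolding N_def by simp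
      then show ?thesis using that[of m] N m by simp
    qed
    have xA: "x \<in> A n" using n by (simp add: A_def)
    have "(1 / 2 :: real) ^ Suc n \<le> 1 - (norm x)\<^sup>2"
    proof -
      have "(norm x)\<^sup>2 \<le> norm x" using True by (simp add: power2_eq_square mult_left_le)
      then show ?thesis using n(1) by linarith
    qed
    then have "(1 - (norm x)\<^sup>2) powr (- s) \<le> ((1 / 2) ^ Suc n) powr (- s)" using s by (intro powr_mono2') auto
    also have "\<dots> = h n"
      by (simp add: h_def powr_realpow[symmetric] powr_powr powr_divide powr_minus_divide mult.commute del: power_Suc)
    finally have "ennreal ((1 - (norm x)\<^sup>2) powr (- s)) * indicator (ball 0 1) x \<le> ennreal (h n) * indicator (A n) x"
      using xA True by (simp add: ennreal_leI)
    also have "\<dots> \<le> (\<Sum>n. ennreal (h n) * indicator (A n) x)"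
    proof -
      have "F n \<le> suminf F" for F :: "nat \<Rightarrow> ennreal" using sum_le_suminf[OF summableI, of "{n}" F] by simp
      then show ?thesis .
    qed
    finally show ?thesis .
  qed simp
  have em: "emeasure lborel (A n) \<le> ennreal (c * (1 / 2) ^ n)" for n
  proof -
    let ?S = "{x::'a. 1 - (1 / 2) ^ n \<le> norm x \<and> norm x < 1}"
    have "A n \<subseteq> ?S"
    proof
      fix x assume "x \<in> A n"
      then have "1 - (1 / 2) ^ n \<le> norm x" "norm x < 1 - (1 / 2) ^ Suc n" unfolding A_def by blast+
      moreover have "(0::real) < (1 / 2) ^ Suc n" by simp
      ultimately have "1 - (1 / 2) ^ n \<le> norm x" "norm x < 1" by linarith+
      then show "x \<in> ?S" by blast
    qed
    moreover have "?S \<in> sets lborel" by measurable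
    ultimately have "emeasure lborel (A n) \<le> emeasure lborel ?S" by (intro emeasure_mono)
    also have "emeasure lborel ?S = ennreal (measure lborel ?S)"
    proof (rule emeasure_eq_ennreal_measure)
      have "bounded ?S" by (rule bounded_subset[OF bounded_ball[of 0 1]]) auto
      then show "emeasure lborel ?S \<noteq> top" using emeasure_bounded_finite[of ?S] by simp
    qed
    also have "\<dots> \<le> ennreal (c * (1 / 2) ^ n)"
      unfolding c_def by (intro ennreal_leI shell_measure) (auto simp: power_le_one)
    finally show ?thesis .
  qed
  define r where "r = 2 powr s / 2"
  have "2 powr s < 2 powr 1" using s by (intro powr_less_mono) auto
  then have r: "0 \<le> r" "r < 1" by (auto simp: r_def)
  have hr: "h n * (c * (1 / 2) ^ n) = 2 powr s * c * r ^ n" for n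
  proof -
    have "h n = 2 powr s * (2 powr s) ^ n"
      by (simp add: h_def powr_realpow[symmetric] powr_powr powr_add[symmetric] algebra_simps)
    then show ?thesis by (simp add: r_def power_divide)
  qed
  have "(\<integral>\<^sup>+ x. ennreal ((1 - (norm (x::'a))\<^sup>2) powr (- s)) * indicator (ball 0 1) x \<partial>lborel)
    \<le> (\<integral>\<^sup>+ x. (\<Sum>n. ennreal (h n) * indicator (A n) x) \<partial>lborel)" by (rule nn_integral_mono) (rule le)
  also have "\<dots> = (\<Sum>n. \<integral>\<^sup>+ x. ennreal (h n) * indicator (A n) x \<partial>lborel)" by (rule nn_integral_suminf) simp
  also have "\<dots> = (\<Sum>n. ennreal (h n) * emeasure lborel (A n))" by (simp add: nn_integral_cmult_indicator)
  also have "\<dots> \<le> (\<Sum>n. ennreal (2 powr s * c * r ^ n))"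
  proof (rule suminf_le)
    fix n
    have "ennreal (h n) * emeasure lborel (A n) \<le> ennreal (h n) * ennreal (c * (1 / 2) ^ n)" by (intro mult_left_mono em) simp
    also have "\<dots> = ennreal (2 powr s * c * r ^ n)" unfolding hr[symmetric] by (simp add: ennreal_mult' h_def)
    finally show "ennreal (h n) * emeasure lborel (A n) \<le> ennreal (2 powr s * c * r ^ n)" .
  qed auto
  also have "\<dots> < \<infinity>"
    using summable_mult[OF summable_geometric[of r], of "2 powr s * c"] r c
    by (subst suminf_ennreal2) (auto simp: mult.assoc)
  finally show ?thesis .
qed

lemma poly_exp_bound: "t \<ge> 0 \<Longrightarrow> (1 + t)\<^sup>2 * exp (- t) \<le> (4::real)"
proof -
  assume t: "t \<ge> 0"
  have "1 + t / 2 \<le> exp (t / 2)" by (rule exp_ge_add_one_self)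
  then have "1 + t \<le> 2 * exp (t / 2)" by linarith
  then have "(1 + t)\<^sup>2 \<le> (2 * exp (t / 2))\<^sup>2" using t by (intro power_mono) auto
  also have "\<dots> = 4 * exp t" by (simp add: power_mult_distrib exp_double[symmetric])
  finally have "(1 + t)\<^sup>2 * exp (- t) \<le> 4 * exp t * exp (- t)" by (rule mult_right_mono) simp
  then show ?thesis by (simp only: mult.assoc exp_add[symmetric]) simp
qed

context boundary_point
begin

text \<open>On the sphere \<open>u\<close> and \<open>wfun\<close> are the coordinates \<open>x = Re w\<close> and \<open>y = Im w\<close>. The factor
  \<open>exp (- \<rho>)\<close> makes everything decay towards the vertex.\<close>

definition u :: "C2 \<Rightarrow> real" where "u z = Re (wc z) * exp (- rho z)"

definition wfun :: "C2 \<Rightarrow> real" where "wfun z = Im (wc z) * exp (- rho z)"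

definition phi :: "C2 \<Rightarrow> real" where "phi z = ss z * exp (- 2 * rho z) / 2"

definition al0 :: "C2 form" where
  "al0 z v = (u z * dform wfun z v - wfun z * dform u z v) / 2 - dform phi z v"

lemma smooth_exp_rho: "smooth_on S0 (\<lambda>z. exp (c * rho z))"
  by (rule smooth_on_compose[OF open_S0 open_UNIV smooth_on_exp]) (auto intro: smooth_on_cmul open_S0 smooth_rho)

lemma smooth_u: "smooth_on S0 u" and smooth_wfun: "smooth_on S0 wfun" and smooth_phi: "smooth_on S0 phi"
proof -
  show "smooth_on S0 u" "smooth_on S0 wfun" unfolding u_def[abs_def] wfun_def[abs_def]
    using smooth_on_mult[OF open_S0 smooth_xx smooth_exp_rho[of "- 1"]] smooth_on_mult[OF open_S0 smooth_yy smooth_exp_rho[of "- 1"]]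
    by auto
  have "smooth_on S0 (\<lambda>z. 1 / 2 * (ss z * exp (- 2 * rho z)))"
    by (intro smooth_on_cmul smooth_on_mult open_S0 smooth_ss smooth_exp_rho)
  then show "smooth_on S0 phi" unfolding phi_def[abs_def] by simp
qed

lemma fd_mult_exp_rho:
  assumes "nu z \<noteq> 0" "(f has_derivative f') (at z)"
  shows "fd (\<lambda>z. f z * exp (c * rho z)) z v = exp (c * rho z) * (f' v + 2 * c * f z * Re (th z v))"
proof -
  have "((\<lambda>z. f z * exp (c * rho z)) has_derivative
      (\<lambda>v. f z * (exp (c * rho z) * (c * (2 * Re (th z v)))) + f' v * exp (c * rho z))) (at z)"
    by (auto intro!: derivative_eq_intros assms(2) rho_has_derivative[OF assms(1)])
  from fd_eq[OF this] show ?thesis by (simp add: algebra_simps)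
qed

lemma fd_u: "nu z \<noteq> 0 \<Longrightarrow> fd u z v = exp (- rho z) * (Re (dw z v) - 2 * Re (wc z) * Re (th z v))"
  using fd_mult_exp_rho[OF _ has_derivative_Re[OF wc_has_derivative], of z "- 1" v] by (simp add: u_def[abs_def])

lemma fd_wfun: "nu z \<noteq> 0 \<Longrightarrow> fd wfun z v = exp (- rho z) * (Im (dw z v) - 2 * Im (wc z) * Re (th z v))"
  using fd_mult_exp_rho[OF _ has_derivative_Im[OF wc_has_derivative], of z "- 1" v] by (simp add: wfun_def[abs_def])

lemma fd_phi: "nu z \<noteq> 0 \<Longrightarrow> fd phi z v = exp (- 2 * rho z) * (Im (dn z v) / 2 - 2 * ss z * Re (th z v))"
proof -
  assume n: "nu z \<noteq> 0"
  have "((\<lambda>z. ss z / 2) has_derivative (\<lambda>v. Im (dn z v) / 2)) (at z)"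
    unfolding ss_def[abs_def] by (auto intro!: derivative_eq_intros has_derivative_Im nc_has_derivative[OF n])
  from fd_mult_exp_rho[OF n this, of "- 2" v] show ?thesis by (simp add: phi_def[abs_def])
qed

text \<open>The primitive of \<open>du \<and> dw\<close> is vertical, a combination of \<open>d\<rho>\<close> and of the contact form
  \<open>2 Im (dn - cnj w dw)\<close>, so it decays twice as fast as \<open>du\<close> and \<open>dw\<close>.\<close>

lemma al0_eq: "nu z \<noteq> 0 \<Longrightarrow> al0 z v = exp (- 2 * rho z) * (2 * ss z * Re (th z (v 0)) - Im (th z (v 0)) / 2)"
proof -
  assume n: "nu z \<noteq> 0"
  have e: "exp (- 2 * rho z) = exp (- rho z) * exp (- rho z)" by (simp add: exp_add[symmetric])
  have i: "Im (th z w) = Im (dn z w) - (Re (wc z) * Im (dw z w) - Im (wc z) * Re (dw z w))" for w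
    by (simp add: th_def)
  show ?thesis unfolding al0_def dform_def fd_u[OF n] fd_wfun[OF n] fd_phi[OF n] e i u_def wfun_def
    by (simp add: field_simps)
qed

end

text \<open>The cones in question are of this kind, because their bases stay away from the vertex.\<close>

locale bounded_cone_domain = cone_domain +
  fixes B :: real
  assumes B1: "B \<ge> 1" and wc_bound: "\<And>z. z \<in> V \<Longrightarrow> cmod (wc z) \<le> B" and ss_bound: "\<And>z. z \<in> V \<Longrightarrow> \<bar>ss z\<bar> \<le> B"
begin

lemma V_S0: "V \<subseteq> S0"
  using V_CH2 ball_S0 by blast

text \<open>The volume density is \<open>(1 - |x|\<^sup>2)\<^sup>-\<^sup>3\<close>, and \<open>(1 - |x|\<^sup>2)\<^sup>e\<^sup>p\<^sup>-\<^sup>3\<close> is integrable over the ball if \<open>e p > 2\<close>.\<close>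

lemma LpI_decay:
  assumes k: "k \<le> 2" and alt: "\<And>x. x \<in> V \<Longrightarrow> alternating k (\<omega> x)" and m: "\<And>v. continuous_on V (\<lambda>x. \<omega> x v)"
    and C: "C \<ge> 0" and e: "e * p > 2" and p: "p > 0"
    and bound: "\<And>x v. x \<in> V \<Longrightarrow> \<forall>i<k. CH2_metric x (v i) (v i) \<le> 1 \<Longrightarrow> \<bar>\<omega> x v\<bar> \<le> C * (1 - (norm x)\<^sup>2) powr e"
  shows "\<omega> \<in> Lp k p"
proof -
  define s where "s = max 0 (3 - e * p)"
  have s: "0 \<le> s" "s < 1" "- s \<le> e * p - 3" using e by (auto simp: s_def)
  have pt: "form_norm (CH2_metric x) k (\<omega> x) powr p * vol x \<le> C powr p * (1 - (norm x)\<^sup>2) powr (- s)" if x: "x \<in> V" for x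
  proof -
    have xC: "x \<in> CH2" using x V_CH2 by blast
    let ?D = "1 - (norm x)\<^sup>2"
    have D: "?D > 0" "?D \<le> 1" using xC by (auto simp: CH2_def abs_square_less_1)
    have "form_norm (CH2_metric x) k (\<omega> x) \<le> C * ?D powr e" by (rule form_norm_least) (rule bound[OF x])
    then have "form_norm (CH2_metric x) k (\<omega> x) powr p \<le> (C * ?D powr e) powr p"
      using p form_norm_nonneg[OF xC k alt[OF x]] by (intro powr_mono2) auto
    also have "\<dots> = C powr p * ?D powr (e * p)" by (simp add: powr_mult powr_powr)
    finally have "form_norm (CH2_metric x) k (\<omega> x) powr p * vol x \<le> C powr p * ?D powr (e * p) * vol x"
      using vol_ge_1[OF xC] by (intro mult_right_mono) auto
    also have "C powr p * ?D powr (e * p) * vol x = C powr p * ?D powr (e * p - 3)"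
    proof -
      have "vol x = ?D powr (- 3)" using D by (simp add: vol_eq[OF xC] powr_minus powr_numeral divide_inverse)
      then show ?thesis by (simp add: powr_add[symmetric] mult.assoc)
    qed
    also have "\<dots> \<le> C powr p * ?D powr (- s)" using D s by (intro mult_left_mono powr_mono') auto
    finally show ?thesis .
  qed
  have "(\<integral>\<^sup>+ x. ennreal (form_norm (CH2_metric x) k (\<omega> x) powr p * vol x) \<partial>lebesgue_on V)
    \<le> (\<integral>\<^sup>+ x. ennreal (C powr p) * ennreal ((1 - (norm x)\<^sup>2) powr (- s)) \<partial>lebesgue_on V)"
    by (rule nn_integral_mono) (auto simp: space_restrict_space ennreal_mult'[symmetric] intro!: ennreal_leI pt)
  also have "\<dots> = (\<integral>\<^sup>+ x. ennreal (C powr p) * ennreal ((1 - (norm x)\<^sup>2) powr (- s)) * indicator V x \<partial>lebesgue)"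
    using nn_integral_restrict_space[of V lebesgue] V_sets by simp
  also have "\<dots> = (\<integral>\<^sup>+ x. ennreal (C powr p) * ennreal ((1 - (norm x)\<^sup>2) powr (- s)) * indicator V x \<partial>lborel)"
    by (rule nn_integral_completion)
  also have "\<dots> \<le> (\<integral>\<^sup>+ x. ennreal (C powr p) * (ennreal ((1 - (norm (x::C2))\<^sup>2) powr (- s)) * indicator (ball 0 1) x) \<partial>lborel)"
  proof (rule nn_integral_mono)
    fix x :: C2
    show "ennreal (C powr p) * ennreal ((1 - (norm x)\<^sup>2) powr (- s)) * indicator V x \<le>
      ennreal (C powr p) * (ennreal ((1 - (norm x)\<^sup>2) powr (- s)) * indicator (ball 0 1) x)"
      using V_CH2 by (cases "x \<in> V") (auto simp: CH2_def)
  qed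
  also have "\<dots> = ennreal (C powr p) * (\<integral>\<^sup>+ x. ennreal ((1 - (norm (x::C2))\<^sup>2) powr (- s)) * indicator (ball 0 1) x \<partial>lborel)"
  proof (rule nn_integral_cmult)
    have [measurable]: "ball (0::C2) 1 \<in> sets borel" by simp
    show "(\<lambda>x. ennreal ((1 - (norm (x::C2))\<^sup>2) powr (- s)) * indicator (ball 0 1) x) \<in> borel_measurable lborel"
      by measurable
  qed
  also have "\<dots> < \<infinity>" using ball_boundary_integral[OF s(1,2), where 'a = C2] by (simp add: ennreal_mult_less_top)
  finally show ?thesis
    using alt continuous_imp_measurable_on_sets_lebesgue[OF m V_sets] unfolding lp_forms_def vol_def by auto
qed

lemma unit_bounds:
  assumes z: "z \<in> V" and v: "CH2_metric z v v \<le> 1"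
  shows "cmod (dw z v) \<le> sqrt (rho z)" "cmod (th z v) \<le> rho z"
proof -
  have zC: "z \<in> CH2" using z V_CH2 by blast
  note r = rho_pos[OF zC]
  have nn: "(cmod (dw z v))\<^sup>2 / rho z \<ge> 0" "(cmod (th z v))\<^sup>2 / (rho z)\<^sup>2 \<ge> 0" using r by auto
  have "(cmod (dw z v))\<^sup>2 / rho z \<le> 1" "(cmod (th z v))\<^sup>2 / (rho z)\<^sup>2 \<le> 1" using v nn unfolding metric_eq[OF zC] by linarith+
  then have "(cmod (dw z v))\<^sup>2 \<le> rho z" "(cmod (th z v))\<^sup>2 \<le> (rho z)\<^sup>2" using r by (simp_all add: divide_le_eq)
  from real_le_rsqrt[OF this(1)] power2_le_imp_le[OF this(2) less_imp_le[OF r]]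
  show "cmod (dw z v) \<le> sqrt (rho z)" "cmod (th z v) \<le> rho z" .
qed

definition K where "K = 1 + B\<^sup>2 + B"

lemma K_pos: "K \<ge> 1"
  using B1 by (simp add: K_def)

text \<open>\<open>\<rho> = (1 - |z|\<^sup>2) |n|\<^sup>2\<close>, and \<open>|n|\<close> is bounded in terms of \<open>\<rho>\<close> when \<open>w\<close> and \<open>s\<close> are bounded. The factors
  \<open>1 + \<rho>\<close> that arise near the vertex are absorbed by \<open>exp (- \<rho>)\<close>.\<close>

lemma rho_le: "z \<in> V \<Longrightarrow> rho z \<le> (1 - (norm z)\<^sup>2) * (K * (1 + rho z))\<^sup>2"
proof -
  assume z: "z \<in> V"
  note n = V_nu[OF z] and r = V_rho[OF z]
  have "cmod (nbd z) \<le> (1 + (cmod (wc z))\<^sup>2) / 2 + B"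
    using cmod_le[of "nbd z"] ss_bound[OF z] by (simp add: nbd_def)
  also have "(cmod (wc z))\<^sup>2 \<le> B\<^sup>2" using wc_bound[OF z] by (intro power_mono) auto
  finally have "cmod (nbd z) \<le> (1 + B\<^sup>2) / 2 + B" by simp
  moreover have "cmod (nc z) \<le> cmod (nbd z) + rho z / 2"
    unfolding nc_nbd using norm_triangle_ineq[of "nbd z" "of_real (rho z / 2)"] r by (simp add: norm_divide)
  ultimately have "cmod (nc z) \<le> (1 + B\<^sup>2) / 2 + B + rho z / 2" by linarith
  also have "\<dots> \<le> K + K * rho z"
  proof -
    have "(1 + B\<^sup>2) / 2 + B \<le> K" unfolding K_def by (simp add: field_simps)
    moreover have "1 / 2 * rho z \<le> K * rho z" using K_pos r by (intro mult_right_mono) auto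
    ultimately show ?thesis by simp
  qed
  finally have nK: "cmod (nc z) \<le> K * (1 + rho z)" by (simp add: algebra_simps)
  have "rho z = (1 - (norm z)\<^sup>2) * (cmod (nc z))\<^sup>2"
    using rho_eq[OF n] n by (simp add: nc_def norm_divide power_divide)
  also have "\<dots> \<le> (1 - (norm z)\<^sup>2) * (K * (1 + rho z))\<^sup>2"
    using nK rho_eq[OF n] r by (intro mult_left_mono power_mono) auto
  finally show ?thesis .
qed

lemma decay_2: "z \<in> V \<Longrightarrow> rho z * exp (- rho z) \<le> 4 * K\<^sup>2 * (1 - (norm z)\<^sup>2) powr 1"
proof -
  assume z: "z \<in> V"
  have D: "1 - (norm z)\<^sup>2 > 0" using z V_CH2 by (auto simp: CH2_def abs_square_less_1)
  have "rho z * exp (- rho z) \<le> (1 - (norm z)\<^sup>2) * (K * (1 + rho z))\<^sup>2 * exp (- rho z)"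
    using rho_le[OF z] by (intro mult_right_mono) auto
  also have "\<dots> = (1 - (norm z)\<^sup>2) * K\<^sup>2 * ((1 + rho z)\<^sup>2 * exp (- rho z))" by (simp add: power_mult_distrib)
  also have "\<dots> \<le> (1 - (norm z)\<^sup>2) * K\<^sup>2 * 4" using poly_exp_bound[of "rho z"] V_rho[OF z] D by (intro mult_left_mono) auto
  finally show ?thesis using D by (simp add: mult_ac)
qed

lemma decay_1: "z \<in> V \<Longrightarrow> (sqrt (rho z) + rho z) * exp (- rho z) \<le> 8 * K * (1 - (norm z)\<^sup>2) powr (1 / 2)"
proof -
  assume z: "z \<in> V"
  define D where "D = 1 - (norm z)\<^sup>2"
  have D: "D > 0" using z V_CH2 by (auto simp: D_def CH2_def abs_square_less_1)
  note r = V_rho[OF z]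
  have "sqrt (rho z) \<le> sqrt (D * (K * (1 + rho z))\<^sup>2)" using rho_le[OF z] by (simp add: D_def)
  also have "\<dots> = sqrt D * (K * (1 + rho z))" using K_pos r by (simp add: real_sqrt_mult)
  finally have 1: "sqrt (rho z) \<le> sqrt D * (K * (1 + rho z))" .
  have "sqrt (rho z) \<le> 1 + rho z"
  proof (rule real_le_lsqrt)
    show "rho z \<le> (1 + rho z)\<^sup>2" using r by (simp add: power2_sum)
  qed (use r in auto)
  then have 2: "1 + sqrt (rho z) \<le> 2 * (1 + rho z)" using r by simp
  have "sqrt (rho z) + rho z = sqrt (rho z) * (1 + sqrt (rho z))" using r by (simp add: algebra_simps)
  also have "\<dots> \<le> sqrt D * (K * (1 + rho z)) * (2 * (1 + rho z))" using 1 2 r D K_pos by (intro mult_mono) auto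
  finally have "(sqrt (rho z) + rho z) * exp (- rho z) \<le> sqrt D * (K * (1 + rho z)) * (2 * (1 + rho z)) * exp (- rho z)"
    by (intro mult_right_mono) auto
  also have "\<dots> = 2 * K * sqrt D * ((1 + rho z)\<^sup>2 * exp (- rho z))" by (simp add: power2_eq_square)
  also have "\<dots> \<le> 2 * K * sqrt D * 4" using poly_exp_bound[of "rho z"] r D K_pos by (intro mult_left_mono) auto
  finally show ?thesis using D by (simp add: D_def powr_half_sqrt)
qed

lemma dform_Lp:
  assumes f: "smooth_on S0 f" and M: "M \<ge> 0" and q: "q > 4"
    and bound: "\<And>z v. z \<in> V \<Longrightarrow> \<bar>fd f z v\<bar> \<le> M * ((cmod (dw z v) + cmod (th z v)) * exp (- rho z))"
  shows "dform f \<in> Lp 1 q"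
proof (rule LpI_decay[where e = "1 / 2" and C = "M * (8 * K)"])
  show "alternating 1 (dform f x)" if "x \<in> V" for x by (rule dform_alternating_on[OF open_S0 V_S0 f that])
  show "continuous_on V (\<lambda>x. dform f x v)" for v
    unfolding dform_def using smooth_on_continuous[OF smooth_on_fd[OF open_S0 f]] continuous_on_subset[OF _ V_S0] by blast
  fix x and v :: "nat \<Rightarrow> C2" assume x: "x \<in> V" and v: "\<forall>i<1. CH2_metric x (v i) (v i) \<le> 1"
  have "\<bar>dform f x v\<bar> \<le> M * ((cmod (dw x (v 0)) + cmod (th x (v 0))) * exp (- rho x))" unfolding dform_def by (rule bound[OF x])
  also have "\<dots> \<le> M * ((sqrt (rho x) + rho x) * exp (- rho x))"
    using unit_bounds[OF x, of "v 0"] v M by (intro mult_left_mono mult_right_mono add_mono) auto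
  also have "\<dots> \<le> M * (8 * K * (1 - (norm x)\<^sup>2) powr (1 / 2))" using decay_1[OF x] M by (intro mult_left_mono)
  finally show "\<bar>dform f x v\<bar> \<le> M * (8 * K) * (1 - (norm x)\<^sup>2) powr (1 / 2)" by (simp add: mult.assoc)
qed (use q M K_pos in auto)

lemma re_im_bound:
  assumes "z \<in> V" "\<bar>a\<bar> \<le> cmod (dw z v)" "\<bar>b\<bar> \<le> B"
  shows "\<bar>exp (- rho z) * (a - 2 * b * Re (th z v))\<bar> \<le> 2 * B * ((cmod (dw z v) + cmod (th z v)) * exp (- rho z))"
proof -
  have "\<bar>a - 2 * b * Re (th z v)\<bar> \<le> \<bar>a\<bar> + 2 * (\<bar>b\<bar> * \<bar>Re (th z v)\<bar>)"
    using abs_triangle_ineq4[of a "2 * b * Re (th z v)"] by (simp add: abs_mult)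
  also have "\<bar>a\<bar> \<le> (2 * B) * cmod (dw z v)"
    using assms(2) B1 mult_right_mono[of 1 "2 * B" "cmod (dw z v)"] by simp
  also have "\<bar>b\<bar> * \<bar>Re (th z v)\<bar> \<le> B * cmod (th z v)" using assms(3) B1 abs_Re_le_cmod by (intro mult_mono) auto
  finally have "\<bar>a - 2 * b * Re (th z v)\<bar> \<le> 2 * B * (cmod (dw z v) + cmod (th z v))" by (simp add: algebra_simps)
  then have "exp (- rho z) * \<bar>a - 2 * b * Re (th z v)\<bar> \<le> exp (- rho z) * (2 * B * (cmod (dw z v) + cmod (th z v)))"
    by (intro mult_left_mono) auto
  then show ?thesis by (simp add: abs_mult mult_ac)
qed

lemma fd_u_bound: "z \<in> V \<Longrightarrow> \<bar>fd u z v\<bar> \<le> 2 * B * ((cmod (dw z v) + cmod (th z v)) * exp (- rho z))"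
  and fd_wfun_bound: "z \<in> V \<Longrightarrow> \<bar>fd wfun z v\<bar> \<le> 2 * B * ((cmod (dw z v) + cmod (th z v)) * exp (- rho z))"
  using re_im_bound[of z "Re (dw z v)" v "Re (wc z)"] re_im_bound[of z "Im (dw z v)" v "Im (wc z)"]
    order_trans[OF abs_Re_le_cmod wc_bound] order_trans[OF abs_Im_le_cmod wc_bound]
  by (auto simp: fd_u[OF V_nu] fd_wfun[OF V_nu] abs_Re_le_cmod abs_Im_le_cmod)

lemma u_bound: "z \<in> V \<Longrightarrow> \<bar>u z\<bar> \<le> B"
proof -
  assume z: "z \<in> V"
  have "\<bar>Re (wc z)\<bar> * exp (- rho z) \<le> B * 1"
    using order_trans[OF abs_Re_le_cmod wc_bound[OF z]] V_rho[OF z] B1 by (intro mult_mono) auto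
  then show ?thesis by (simp add: u_def abs_mult)
qed

lemma fd_u_square: "z \<in> V \<Longrightarrow> fd (\<lambda>x. (u x)\<^sup>2) z v = 2 * u z * fd u z v"
proof -
  assume "z \<in> V"
  then have "z \<in> S0" using V_S0 by blast
  from fd_eq[OF has_derivative_power[OF smooth_on_has_derivative[OF open_S0 smooth_u this], of 2]]
  show ?thesis by simp
qed

lemma dform_u_Lp: "q > 4 \<Longrightarrow> dform u \<in> Lp 1 q"
  by (rule dform_Lp[OF smooth_u _ _ fd_u_bound]) (use B1 in auto)

lemma dform_wfun_Lp: "q > 4 \<Longrightarrow> dform wfun \<in> Lp 1 q"
  by (rule dform_Lp[OF smooth_wfun _ _ fd_wfun_bound]) (use B1 in auto)

lemma dform_u_square_Lp: "q > 4 \<Longrightarrow> dform (\<lambda>x. (u x)\<^sup>2) \<in> Lp 1 q"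
proof (rule dform_Lp[where M = "2 * B * (2 * B)"])
  fix z v assume z: "z \<in> V"
  have "\<bar>fd (\<lambda>x. (u x)\<^sup>2) z v\<bar> = 2 * \<bar>u z\<bar> * \<bar>fd u z v\<bar>" by (simp add: fd_u_square[OF z] abs_mult)
  also have "\<dots> \<le> (2 * B) * (2 * B * ((cmod (dw z v) + cmod (th z v)) * exp (- rho z)))"
    using u_bound[OF z] fd_u_bound[OF z] B1 by (intro mult_mono) auto
  finally show "\<bar>fd (\<lambda>x. (u x)\<^sup>2) z v\<bar> \<le> 2 * B * (2 * B) * ((cmod (dw z v) + cmod (th z v)) * exp (- rho z))" by (simp only: mult.assoc)
qed (use B1 in \<open>auto intro: smooth_on_power open_S0 smooth_u\<close>)

lemma smooth_continuous_V: "smooth_on S0 f \<Longrightarrow> continuous_on V f"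
  using smooth_on_continuous continuous_on_subset V_S0 by blast

lemma smooth_dform_continuous: "smooth_on S0 f \<Longrightarrow> continuous_on V (\<lambda>x. dform f x v)"
  unfolding dform_def by (intro smooth_continuous_V smooth_on_fd open_S0)

lemma al0_continuous: "continuous_on V (\<lambda>x. al0 x v)"
  unfolding al0_def by (intro continuous_intros smooth_dform_continuous smooth_continuous_V smooth_u smooth_wfun smooth_phi) auto

lemma al0_bound:
  assumes x: "x \<in> V" and v: "CH2_metric x (v 0) (v 0) \<le> 1"
  shows "\<bar>al0 x v\<bar> \<le> 3 * B * (4 * K\<^sup>2) * (1 - (norm x)\<^sup>2) powr 1"
proof -
  have "\<bar>2 * ss x * Re (th x (v 0)) - Im (th x (v 0)) / 2\<bar> \<le> 2 * (\<bar>ss x\<bar> * \<bar>Re (th x (v 0))\<bar>) + \<bar>Im (th x (v 0))\<bar> / 2"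
    using abs_triangle_ineq4[of "2 * ss x * Re (th x (v 0))" "Im (th x (v 0)) / 2"] by (simp add: abs_mult)
  also have "\<bar>ss x\<bar> * \<bar>Re (th x (v 0))\<bar> \<le> B * rho x"
    using ss_bound[OF x] order_trans[OF abs_Re_le_cmod unit_bounds(2)[OF x v]] B1 by (intro mult_mono) auto
  also have "\<bar>Im (th x (v 0))\<bar> \<le> rho x" using order_trans[OF abs_Im_le_cmod unit_bounds(2)[OF x v]] .
  also have "rho x / 2 \<le> B * rho x" using B1 V_rho[OF x] mult_right_mono[of "1/2" B "rho x"] by simp
  finally have 1: "\<bar>2 * ss x * Re (th x (v 0)) - Im (th x (v 0)) / 2\<bar> \<le> 3 * B * rho x" by simp
  have "\<bar>al0 x v\<bar> = exp (- 2 * rho x) * \<bar>2 * ss x * Re (th x (v 0)) - Im (th x (v 0)) / 2\<bar>"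
    by (simp add: al0_eq[OF V_nu[OF x]] abs_mult)
  also have "\<dots> \<le> exp (- rho x) * (3 * B * rho x)" using 1 V_rho[OF x] by (intro mult_mono) auto
  also have "\<dots> = 3 * B * (rho x * exp (- rho x))" by simp
  also have "\<dots> \<le> 3 * B * (4 * K\<^sup>2 * (1 - (norm x)\<^sup>2) powr 1)" using decay_2[OF x] B1 by (intro mult_left_mono) auto
  finally show ?thesis by (simp add: mult.assoc)
qed

lemma ev1_al0: "x \<in> V \<Longrightarrow> linear (ev1 (al0 x)) \<and> (\<forall>v. al0 x v = ev1 (al0 x) (v 0))"
proof
  assume x: "x \<in> V"
  show "\<forall>v. al0 x v = ev1 (al0 x) (v 0)" by (simp add: ev1_def al0_eq[OF V_nu[OF x]])
  have l: "linear (fd f x)" if "smooth_on S0 f" for f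
    by (rule fd_linear[OF smooth_on_differentiable[OF open_S0 that]]) (use x V_S0 in auto)
  have "ev1 (al0 x) = (\<lambda>a. (u x * fd wfun x a - wfun x * fd u x a) / 2 - fd phi x a)"
    by (simp add: fun_eq_iff ev1_def al0_def dform_def)
  then show "linear (ev1 (al0 x))"
    using linear_add[OF l[OF smooth_u]] linear_add[OF l[OF smooth_wfun]] linear_add[OF l[OF smooth_phi]]
      linear_cmul[OF l[OF smooth_u]] linear_cmul[OF l[OF smooth_wfun]] linear_cmul[OF l[OF smooth_phi]]
    by (auto intro!: linearI simp: algebra_simps add_divide_distrib diff_divide_distrib)
qed

lemma al0_alternating: "x \<in> V \<Longrightarrow> alternating 1 (al0 x)"
  using ev1_al0 by (simp add: alternating_1)

lemma al0_Lp: "p > 2 \<Longrightarrow> al0 \<in> Lp 1 p"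
  by (rule LpI_decay[where e = 1, OF _ al0_alternating al0_continuous _ _ _ al0_bound]) (use B1 in auto)

lemma u_al0_Lp: "p > 2 \<Longrightarrow> (\<lambda>x v. u x * al0 x v) \<in> Lp 1 p"
proof (rule LpI_decay[where e = 1])
  show "alternating 1 (\<lambda>v. u x * al0 x v)" if "x \<in> V" for x
  proof -
    have e: "ev1 (\<lambda>v. u x * al0 x v) a = u x * ev1 (al0 x) a" for a by (simp add: ev1_def)
    have l: "linear (ev1 (al0 x))" using ev1_al0[OF that] by blast
    have "linear (ev1 (\<lambda>v. u x * al0 x v))"
      by (rule linearI) (simp_all only: e linear_add[OF l] linear_cmul[OF l] distrib_left real_scaleR_def mult.left_commute)
    moreover have "u x * al0 x v = ev1 (\<lambda>v. u x * al0 x v) (v 0)" for v unfolding e using ev1_al0[OF that] by (metis (no_types))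
    ultimately show ?thesis unfolding One_nat_def alternating_1 by blast
  qed
  show "continuous_on V (\<lambda>x. u x * al0 x v)" for v by (intro continuous_intros al0_continuous smooth_continuous_V smooth_u)
  fix x and v :: "nat \<Rightarrow> C2" assume x: "x \<in> V" and v: "\<forall>i<1. CH2_metric x (v i) (v i) \<le> 1"
  have "\<bar>u x * al0 x v\<bar> \<le> B * (3 * B * (4 * K\<^sup>2) * (1 - (norm x)\<^sup>2) powr 1)"
    unfolding abs_mult using u_bound[OF x] al0_bound[OF x, of v] v B1 by (intro mult_mono) auto
  then show "\<bar>u x * al0 x v\<bar> \<le> B * (3 * B * (4 * K\<^sup>2)) * (1 - (norm x)\<^sup>2) powr 1" by (simp add: mult.assoc)
qed (use B1 in auto)

lemma L2_form_continuous: "(\<And>v. continuous_on V (\<lambda>x. \<omega> x v)) \<Longrightarrow> L2_form \<omega>"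
  unfolding L2_form_def using L2_loc_continuous[OF V_sets] by blast

lemma wedge_dform: 
  assumes "smooth_on S0 a" "smooth_on S0 b" "x \<in> V"
  shows "wedge 1 1 (dform a) (dform b) x v = fd a x (v 0) * fd b x (v 1) - fd a x (v 1) * fd b x (v 0)"
  using wedge_1_1[of "dform a" x "dform b", OF dform_alternating_on[OF open_S0 V_S0 assms(1,3)] dform_alternating_on[OF open_S0 V_S0 assms(2,3)]]
  by (simp add: ev1_dform)

text \<open>Both \<open>al0\<close> and \<open>2 u al0\<close> are sums of three such terms, so their weak differentials can be read off
  from the Leibniz rule.\<close>

lemma weak_function_dform3:
  assumes s: "smooth_on S0 a" "smooth_on S0 b" "smooth_on S0 a'" "smooth_on S0 b'" "smooth_on S0 a''" "smooth_on S0 b''"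
  shows "weak 1 (\<lambda>x v. a x * dform b x v + c * (a' x * dform b' x v) + c' * (a'' x * dform b'' x v))
    (\<lambda>x v. wedge 1 1 (dform a) (dform b) x v + c * wedge 1 1 (dform a') (dform b') x v + c' * wedge 1 1 (dform a'') (dform b'') x v)"
proof -
  note w = weak_function_dform[OF open_S0 V_S0]
  have cf: "continuous_on V (\<lambda>x. a x * dform b x v)" if "smooth_on S0 a" "smooth_on S0 b" for a b v
    by (intro continuous_intros smooth_dform_continuous smooth_continuous_V that)
  have cw: "continuous_on V (\<lambda>x. wedge 1 1 (dform a) (dform b) x v)" if "smooth_on S0 a" "smooth_on S0 b" for a b v
  proof -
    have "continuous_on V (\<lambda>x. fd a x (v 0) * fd b x (v 1) - fd a x (v 1) * fd b x (v 0))"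
      by (intro continuous_intros smooth_continuous_V smooth_on_fd open_S0 that)
    then show ?thesis by (rule continuous_on_cong[THEN iffD1, OF refl, rotated]) (rule wedge_dform[OF that, symmetric])
  qed
  have Lf: "L2_form (\<lambda>x v. a x * dform b x v)" if "smooth_on S0 a" "smooth_on S0 b" for a b by (rule L2_form_continuous[OF cf[OF that]])
  have Lw: "L2_form (wedge 1 1 (dform a) (dform b))" if "smooth_on S0 a" "smooth_on S0 b" for a b by (rule L2_form_continuous[OF cw[OF that]])
  have L: "L2_form (\<lambda>x v. a x * dform b x v + c * (a' x * dform b' x v))"
    by (intro L2_form_continuous continuous_on_add continuous_on_mult_left cf s)
  have L': "L2_form (\<lambda>x v. wedge 1 1 (dform a) (dform b) x v + c * wedge 1 1 (dform a') (dform b') x v)"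
    by (intro L2_form_continuous continuous_on_add continuous_on_mult_left cw s)
  show ?thesis
    by (rule weak_lincomb[OF weak_lincomb[OF w[OF s(1,2)] w[OF s(3,4)] Lf[OF s(1,2)] Lw[OF s(1,2)] Lf[OF s(3,4)] Lw[OF s(3,4)]]
          w[OF s(5,6)] L L' Lf[OF s(5,6)] Lw[OF s(5,6)]])
qed

lemma weak_al0: "weak 1 al0 (wedge 1 1 (dform u) (dform wfun))"
proof (rule weak_cong[OF weak_function_dform3[of "\<lambda>x. u x / 2" wfun "\<lambda>x. wfun x / 2" u "\<lambda>x. 1" phi "- 1" "- 1"]])
  have h: "smooth_on S0 (\<lambda>x. f x / 2)" if "smooth_on S0 f" for f
    using smooth_on_cmul[OF open_S0 that, of "1 / 2"] by simp
  show s: "smooth_on S0 (\<lambda>x. u x / 2)" "smooth_on S0 (\<lambda>x. wfun x / 2)" by (intro h smooth_u smooth_wfun)+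
  show "al0 x v = u x / 2 * dform wfun x v + - 1 * (wfun x / 2 * dform u x v) + - 1 * (1 * dform phi x v)" for x v
    by (simp add: al0_def diff_divide_distrib)
  fix x v assume x: "x \<in> V"
  have d: "fd (\<lambda>x. f x / 2) x a = fd f x a / 2" if "smooth_on S0 f" for f a
  proof -
    have "(f has_derivative fd f x) (at x)" by (rule smooth_on_has_derivative[OF open_S0 that]) (use x V_S0 in auto)
    then have "((\<lambda>x. f x / 2) has_derivative (\<lambda>a. fd f x a / 2)) (at x)" by (auto intro!: derivative_eq_intros)
    then show ?thesis by (simp add: fd_eq)
  qed
  have c: "fd (\<lambda>x. 1) x a = 0" for a :: C2 by (simp add: fd_eq[OF has_derivative_const])
  show "wedge 1 1 (dform u) (dform wfun) x v = wedge 1 1 (dform (\<lambda>x. u x / 2)) (dform wfun) x v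
     + - 1 * wedge 1 1 (dform (\<lambda>x. wfun x / 2)) (dform u) x v + - 1 * wedge 1 1 (dform (\<lambda>x. 1)) (dform phi) x v"
    unfolding wedge_dform[OF smooth_u smooth_wfun x] wedge_dform[OF s(1) smooth_wfun x] wedge_dform[OF s(2) smooth_u x]
      wedge_dform[OF smooth_on_const smooth_phi x] d[OF smooth_u] d[OF smooth_wfun] c
    by (simp add: field_simps)
qed (auto intro: smooth_on_const smooth_u smooth_wfun smooth_phi)

lemma weak_u_al0:
  "weak 1 (\<lambda>x v. 2 * (u x * al0 x v)) (\<lambda>x v. wedge 1 1 (dform (\<lambda>x. (u x)\<^sup>2)) (dform wfun) x v + 2 * wedge 1 1 (dform u) al0 x v)"
proof (rule weak_cong[OF weak_function_dform3[of "\<lambda>x. (u x)\<^sup>2" wfun "\<lambda>x. u x * wfun x" u u phi "- 1" "- 2"]])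
  show s: "smooth_on S0 (\<lambda>x. (u x)\<^sup>2)" "smooth_on S0 (\<lambda>x. u x * wfun x)"
    by (intro smooth_on_power smooth_on_mult open_S0 smooth_u smooth_wfun)+
  show "2 * (u x * al0 x v) = (u x)\<^sup>2 * dform wfun x v + - 1 * (u x * wfun x * dform u x v) + - 2 * (u x * dform phi x v)" for x v
    by (simp add: al0_def field_simps power2_eq_square)
  fix x v assume x: "x \<in> V"
  have xS: "x \<in> S0" using x V_S0 by blast
  have d: "fd (\<lambda>x. u x * wfun x) x a = u x * fd wfun x a + fd u x a * wfun x" for a
    using fd_eq[OF has_derivative_mult[OF smooth_on_has_derivative[OF open_S0 smooth_u xS] smooth_on_has_derivative[OF open_S0 smooth_wfun xS]]]
    by simp
  have e: "ev1 (al0 x) a = (u x * fd wfun x a - wfun x * fd u x a) / 2 - fd phi x a" for a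
    by (simp add: ev1_def al0_def dform_def)
  show "wedge 1 1 (dform (\<lambda>x. (u x)\<^sup>2)) (dform wfun) x v + 2 * wedge 1 1 (dform u) al0 x v =
    wedge 1 1 (dform (\<lambda>x. (u x)\<^sup>2)) (dform wfun) x v + - 1 * wedge 1 1 (dform (\<lambda>x. u x * wfun x)) (dform u) x v + - 2 * wedge 1 1 (dform u) (dform phi) x v"
    unfolding wedge_dform[OF s(2) smooth_u x] wedge_dform[OF smooth_u smooth_phi x] d
      wedge_1_1[of "dform u" x al0, OF dform_alternating_on[OF open_S0 V_S0 smooth_u x] al0_alternating[OF x]] ev1_dform e
    by (simp add: field_simps)
qed (auto intro: smooth_on_const smooth_u smooth_wfun smooth_phi)

end

section \<open>Pairing weak derivatives with vector fields\<close>

lemma hermitian_basis_sum: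
  "(\<Sum>e\<in>Basis. hermitian e a * cnj (hermitian e b)) = 2 * hermitian b a"
  "(\<Sum>e\<in>Basis. cnj (hermitian e a) * cnj (hermitian e b)) = 0"
  by (simp_all add: Basis_C2 hermitian_def algebra_simps)

lemma linear_basis_sum: "linear f \<Longrightarrow> f x = (\<Sum>i\<in>Basis. (x \<bullet> i) * f i)"
  for f :: "'a::euclidean_space \<Rightarrow> real"
  by (subst euclidean_representation[of x, symmetric], subst linear_sum) (simp_all add: linear_cmul)

lemma divergence_product:
  fixes f g D :: "'a::euclidean_space \<Rightarrow> real"
  assumes "linear f" "linear g"
  shows "(\<Sum>i\<in>Basis. D i * c + m * (A \<bullet> i) * (f i * b + s * g i)) = (\<Sum>i\<in>Basis. D i) * c + m * (f A * b + s * g A)"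
  unfolding linear_basis_sum[OF assms(1), of A] linear_basis_sum[OF assms(2), of A]
  by (simp add: sum.distrib sum_distrib_left sum_distrib_right algebra_simps)

lemma cscale_has_derivative:
  assumes "(f has_derivative f') (at z)" shows "((\<lambda>z. cscale (f z) p) has_derivative (\<lambda>v. cscale (f' v) p)) (at z)"
proof -
  have "linear (\<lambda>c. cscale c p)" by (rule linearI) (simp_all add: cscale_def prod_eq_iff algebra_simps scaleR_conv_of_real)
  from bounded_linear.has_derivative[OF this[unfolded linear_conv_bounded_linear] assms] show ?thesis .
qed

context boundary_point
begin

definition frame_deriv :: "complex \<Rightarrow> complex \<Rightarrow> C2 \<Rightarrow> C2 \<Rightarrow> C2" where
  "frame_deriv a c z v =
     cscale (- (hermitian v \<eta> * a) - hermitian v ep * nu z * (a * cnj (wc z) + c) + hermitian z ep * hermitian v \<eta> * (a * cnj (wc z) + c)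
       - hermitian z ep * nu z * (a * cnj (dw z v))) ep
     + cscale ((nu z)\<^sup>2 * (a * cnj (dw z v)) - 2 * nu z * hermitian v \<eta> * (a * cnj (wc z) + c)) \<eta>"

lemma frame_has_derivative:
  assumes n: "nu z \<noteq> 0" shows "((\<lambda>z. frame z a c) has_derivative frame_deriv a c z) (at z)"
proof -
  have d: "(nu has_derivative (\<lambda>v. - hermitian v \<eta>)) (at z)" unfolding nu_def[abs_def]
    by (auto intro!: derivative_eq_intros hermitian_has_derivative)
  have b: "((\<lambda>z. a * cnj (wc z) + c) has_derivative (\<lambda>v. a * cnj (dw z v))) (at z)"
    by (auto intro!: derivative_eq_intros has_derivative_cnj wc_has_derivative[OF n])
  have "((\<lambda>z. frame z a c) has_derivative (\<lambda>v.
     cscale ((- hermitian v \<eta>) * a - ((hermitian z ep * nu z) * (a * cnj (dw z v)) + (hermitian z ep * (- hermitian v \<eta>) + hermitian v ep * nu z) * (a * cnj (wc z) + c))) ep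
     + cscale ((nu z * nu z) * (a * cnj (dw z v)) + (nu z * (- hermitian v \<eta>) + (- hermitian v \<eta>) * nu z) * (a * cnj (wc z) + c)) \<eta>)) (at z)"
    unfolding frame_def power2_eq_square
    by (intro has_derivative_add cscale_has_derivative has_derivative_diff has_derivative_mult has_derivative_mult_left d b hermitian_has_derivative)
  moreover have "(\<lambda>v.
     cscale ((- hermitian v \<eta>) * a - ((hermitian z ep * nu z) * (a * cnj (dw z v)) + (hermitian z ep * (- hermitian v \<eta>) + hermitian v ep * nu z) * (a * cnj (wc z) + c))) ep
     + cscale ((nu z * nu z) * (a * cnj (dw z v)) + (nu z * (- hermitian v \<eta>) + (- hermitian v \<eta>) * nu z) * (a * cnj (wc z) + c)) \<eta>) = frame_deriv a c z"
    by (simp add: fun_eq_iff frame_deriv_def power2_eq_square algebra_simps)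
  ultimately show ?thesis by simp
qed

text \<open>The fields with \<open>dw = a\<close> and \<open>dn - cnj w dw = c\<close>, for constant \<open>a\<close> and \<open>c\<close>, form the Lie
  algebra of the product of the Heisenberg group and the line.\<close>

lemma frame_commutator:
  assumes n: "nu z \<noteq> 0"
  shows "frame_deriv a' c' z (frame z a c) - frame_deriv a c z (frame z a' c') = frame z 0 (a' * cnj a - a * cnj a')"
  by (rule C2_eqI)
     (simp_all add: hermitian_diff frame_deriv_def hermitian_add hermitian_cscale herm_eta frame_coords dw_frame[OF n] power2_eq_square algebra_simps)

text \<open>The trace of a real-linear map of \<open>\<complex>\<^sup>2\<close> is twice the real part of the complex trace of its
  complex-linear part; the conjugate-linear part, which comes from \<open>cnj w\<close>, does not contribute.\<close>

lemma frame_divergence: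
  assumes n: "nu z \<noteq> 0"
  shows "(\<Sum>e\<in>Basis. frame_deriv a c z e \<bullet> e) = - 6 * Re (nu z * (a * cnj (wc z) + c))"
proof -
  define b where "b = a * cnj (wc z) + c"
  define z1 where "z1 = hermitian z ep"
  let ?h1 = "\<lambda>e. hermitian e ep" and ?h2 = "\<lambda>e. hermitian e \<eta>"
  have "hermitian (frame_deriv a c z e) e = (- nu z * b) * (?h1 e * cnj (?h1 e)) + (- a + z1 * b) * (?h2 e * cnj (?h1 e))
      + (- z1 * nu z * a / cnj (nu z)) * (cnj (?h1 e) * cnj (?h1 e)) + (- z1 * nu z * a * cnj (wc z) / cnj (nu z)) * (cnj (?h2 e) * cnj (?h1 e))
      + (- 2 * nu z * b) * (?h2 e * cnj (?h2 e)) + ((nu z)\<^sup>2 * a / cnj (nu z)) * (cnj (?h1 e) * cnj (?h2 e))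
      + ((nu z)\<^sup>2 * a * cnj (wc z) / cnj (nu z)) * (cnj (?h2 e) * cnj (?h2 e))" for e
    unfolding frame_deriv_def b_def[symmetric] z1_def[symmetric] dw_def hermitian_add hermitian_cscale hermitian_cnj[symmetric, of _ e]
    using n by (simp add: field_simps)
  then have "(\<Sum>e\<in>Basis. hermitian (frame_deriv a c z e) e) = - 6 * (nu z * b)"
    by (simp only: sum.distrib sum_distrib_left[symmetric] hermitian_basis_sum herm_eta) simp
  then have "Re (\<Sum>e\<in>Basis. hermitian (frame_deriv a c z e) e) = - 6 * Re (nu z * b)" by simp
  then show ?thesis by (simp add: inner_hermitian b_def)
qed

text \<open>The density with respect to Lebesgue measure of the volume of the Heisenberg group times
  the line: it makes these fields divergence free.\<close>

definition weight :: "C2 \<Rightarrow> real" where "weight z = ((cmod (nc z))\<^sup>2) ^ 3"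

lemma smooth_weight: "smooth_on S0 weight"
  unfolding weight_def[abs_def] by (intro smooth_on_power open_S0 csmooth_on_norm_square csmooth_nc)

lemma fd_weight_frame:
  assumes n: "nu z \<noteq> 0"
  shows "fd weight z (frame z a c) = 6 * weight z * Re (nu z * (a * cnj (wc z) + c))"
proof -
  have d: "(weight has_derivative (\<lambda>v. 3 * (2 * Re (nc z) * Re (dn z v) + 2 * Im (nc z) * Im (dn z v)) * ((Re (nc z))\<^sup>2 + (Im (nc z))\<^sup>2)\<^sup>2)) (at z)"
    unfolding weight_def[abs_def] cmod_power2
    by (auto intro!: derivative_eq_intros has_derivative_Re has_derivative_Im nc_has_derivative[OF n] simp: power2_eq_square)
  define m where "m = nc z"
  define b where "b = a * cnj (wc z) + c"
  have m0: "m \<noteq> 0" and nm: "nu z = 1 / m" using n by (auto simp: m_def nc_def)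
  have q: "(Re m)\<^sup>2 + (Im m)\<^sup>2 \<noteq> 0" using m0 by (auto simp: complex_eq_iff sum_power2_eq_zero_iff)
  have "Re (nu z * b) = (Re b * Re m + Im b * Im m) / ((Re m)\<^sup>2 + (Im m)\<^sup>2)"
    unfolding nm using q by (simp add: Re_divide Im_divide field_simps)
  then have r: "Re (nu z * b) * ((Re m)\<^sup>2 + (Im m)\<^sup>2) = Re b * Re m + Im b * Im m" using q by simp
  have e: "6 * Q ^ 3 * r = 6 * Q\<^sup>2 * (r * Q)" for Q r :: real by (simp add: power2_eq_square power3_eq_cube)
  show ?thesis unfolding fd_eq[OF d] dn_frame[OF n] b_def[symmetric] weight_def cmod_power2 m_def[symmetric] e r by (simp add: algebra_simps)
qed

lemma csmooth_frame: "smooth_on S0 (\<lambda>x. frame x a c \<bullet> i)"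
proof -
  have "csmooth_on S0 (\<lambda>x. (nu x * a - hermitian x ep * nu x * (a * cnj (wc x) + c)) * hermitian ep i
      + ((nu x * nu x) * (a * cnj (wc x) + c)) * hermitian \<eta> i)"
    by (intro csmooth_on_add csmooth_on_mult csmooth_on_diff csmooth_on_const csmooth_on_cnj open_S0 csmooth_nu csmooth_wc
        csmooth_on_linear linear_hermitian)
  then show ?thesis by (simp add: csmooth_on_def inner_hermitian frame_def hermitian_add hermitian_cscale power2_eq_square)
qed

lemma weighted_frame_derivative:
  assumes "nu z \<noteq> 0"
  shows "((\<lambda>x. weight x * (frame x a c \<bullet> i)) has_derivative (\<lambda>v. fd weight z v * (frame z a c \<bullet> i) + weight z * (frame_deriv a c z v \<bullet> i))) (at z)"
proof -
  have "z \<in> S0" using assms by (simp add: S0_def)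
  from has_derivative_mult[OF smooth_on_has_derivative[OF open_S0 smooth_weight this] has_derivative_inner_left[OF frame_has_derivative[OF assms]]]
  show ?thesis by (simp add: add.commute)
qed

lemma weighted_frame_divergence:
  assumes n: "nu z \<noteq> 0"
  shows "(\<Sum>e\<in>Basis. fd (\<lambda>x. weight x * (frame x a c \<bullet> e)) z e) = 0"
proof -
  have l: "linear (fd weight z)"
    by (rule fd_linear[OF smooth_on_differentiable[OF open_S0 smooth_weight]]) (use n in \<open>simp add: S0_def\<close>)
  have "(\<Sum>e\<in>Basis. fd (\<lambda>x. weight x * (frame x a c \<bullet> e)) z e)
      = (\<Sum>e\<in>Basis. (frame z a c \<bullet> e) * fd weight z e) + weight z * (\<Sum>e\<in>Basis. frame_deriv a c z e \<bullet> e)"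
    by (simp add: fd_eq[OF weighted_frame_derivative[OF n]] sum.distrib sum_distrib_left mult.commute)
  also have "(\<Sum>e\<in>Basis. (frame z a c \<bullet> e) * fd weight z e) = fd weight z (frame z a c)" by (rule linear_basis_sum[OF l, symmetric])
  finally show ?thesis unfolding fd_weight_frame[OF n] frame_divergence[OF n] by (simp add: algebra_simps)
qed

end

context cone_domain
begin

text \<open>The distributional form of \<open>d\<alpha>(A, B) = A \<alpha>(B) - B \<alpha>(A) - \<alpha>([A, B])\<close>, tested against \<open>weight \<cdot> \<psi>\<close>.
  The fields are not constant, so their coefficients are moved into the test functions; the terms
  with a derivative of \<open>weight\<close> add up to a divergence that vanishes.\<close>

lemma weak_pairing:
  fixes a c a' c' :: complex
  assumes w: "weak 1 \<alpha> \<Phi>" and alt: "\<And>x. x \<in> V \<Longrightarrow> alternating 1 (\<alpha> x)" "\<And>x. x \<in> V \<Longrightarrow> alternating 2 (\<Phi> x)"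
    and L2: "L2_form \<alpha>" "L2_form \<Phi>"
    and \<psi>: "smooth_on S0 \<psi>" and K: "compact K" "K \<subseteq> V" "\<And>x. x \<in> S0 \<Longrightarrow> x \<notin> K \<Longrightarrow> \<psi> x = 0"
  defines "F \<equiv> \<lambda>x. weight x * (\<psi> x * ev2 (\<Phi> x) (frame x a c) (frame x a' c'))"
    and "G \<equiv> \<lambda>x. weight x * (fd \<psi> x (frame x a c) * ev1 (\<alpha> x) (frame x a' c') - fd \<psi> x (frame x a' c') * ev1 (\<alpha> x) (frame x a c)
        + \<psi> x * ev1 (\<alpha> x) (frame x 0 (a' * cnj a - a * cnj a')))"
  shows "integrable (lebesgue_on V) F" "integrable (lebesgue_on V) G" "(LINT x|lebesgue_on V. F x) = - (LINT x|lebesgue_on V. G x)"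
proof -
  have sub: "V \<subseteq> S0" using V_CH2 ball_S0 by blast
  define A where "A x = frame x a c" for x
  define B where "B x = frame x a' c'" for x
  define P where "P i j x = (weight x * (A x \<bullet> i)) * (\<psi> x * (B x \<bullet> j))" for i j x
  define T where "T i j x = (if x \<in> S0 then P i j x else 0)" for i j x
  define v where "v i j k = (if k = (0::nat) then i else j)" for i j :: C2 and k
  have sA: "smooth_on S0 (\<lambda>x. A x \<bullet> i)" and sB: "smooth_on S0 (\<lambda>x. B x \<bullet> i)" for i
    unfolding A_def B_def by (rule csmooth_frame)+
  have T: "test_function V (T i j)" for i j
  proof -
    have "smooth_on S0 (P i j)" unfolding P_def[abs_def] by (intro smooth_on_mult open_S0 smooth_weight \<psi> sA sB)
    from test_function_extend_zero[OF open_S0 this K(1) order_trans[OF K(2) sub] K(2)] show ?thesis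
      unfolding T_def[abs_def] using K(3) by (simp add: P_def)
  qed
  have fdT: "fd (T i j) x e = fd (\<lambda>x. weight x * (A x \<bullet> i)) x e * (\<psi> x * (B x \<bullet> j)) + weight x * (A x \<bullet> i) * (fd \<psi> x e * (B x \<bullet> j) + \<psi> x * (frame_deriv a' c' x e \<bullet> j))"
      "fd (T i j) x e = fd (\<lambda>x. weight x * (B x \<bullet> j)) x e * (\<psi> x * (A x \<bullet> i)) + weight x * (B x \<bullet> j) * (fd \<psi> x e * (A x \<bullet> i) + \<psi> x * (frame_deriv a c x e \<bullet> i))"
    if x: "x \<in> V" for i j x e
  proof -
    note n = V_nu[OF x]
    have xS: "x \<in> S0" using x sub by blast
    have d\<psi>: "(\<psi> has_derivative fd \<psi> x) (at x)" by (rule smooth_on_has_derivative[OF open_S0 \<psi> xS])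
    have dw: "((\<lambda>x. weight x * (A x \<bullet> i)) has_derivative fd (\<lambda>x. weight x * (A x \<bullet> i)) x) (at x)"
        "((\<lambda>x. weight x * (B x \<bullet> j)) has_derivative fd (\<lambda>x. weight x * (B x \<bullet> j)) x) (at x)"
      by (rule smooth_on_has_derivative[OF open_S0 _ xS], intro smooth_on_mult open_S0 smooth_weight sA sB)+
    have dA: "((\<lambda>x. A x \<bullet> i) has_derivative (\<lambda>e. frame_deriv a c x e \<bullet> i)) (at x)"
        and dB: "((\<lambda>x. B x \<bullet> j) has_derivative (\<lambda>e. frame_deriv a' c' x e \<bullet> j)) (at x)"
      unfolding A_def B_def by (intro has_derivative_inner_left frame_has_derivative n)+
    have tr: "(T i j has_derivative f) (at x)" if "(P i j has_derivative f) (at x)" for f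
      by (rule has_derivative_transform_within_open[OF that open_S0 xS]) (simp add: T_def)
    have 1: "(P i j has_derivative (\<lambda>e. (weight x * (A x \<bullet> i)) * (\<psi> x * (frame_deriv a' c' x e \<bullet> j) + fd \<psi> x e * (B x \<bullet> j))
        + fd (\<lambda>x. weight x * (A x \<bullet> i)) x e * (\<psi> x * (B x \<bullet> j)))) (at x)"
      unfolding P_def[abs_def] by (intro has_derivative_mult dw d\<psi> dB)
    have P2: "P i j = (\<lambda>x. (weight x * (B x \<bullet> j)) * (\<psi> x * (A x \<bullet> i)))" by (simp add: fun_eq_iff P_def)
    have 2: "(P i j has_derivative (\<lambda>e. (weight x * (B x \<bullet> j)) * (\<psi> x * (frame_deriv a c x e \<bullet> i) + fd \<psi> x e * (A x \<bullet> i))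
        + fd (\<lambda>x. weight x * (B x \<bullet> j)) x e * (\<psi> x * (A x \<bullet> i)))) (at x)"
      unfolding P2 by (intro has_derivative_mult dw d\<psi> dA)
    show "fd (T i j) x e = fd (\<lambda>x. weight x * (A x \<bullet> i)) x e * (\<psi> x * (B x \<bullet> j)) + weight x * (A x \<bullet> i) * (fd \<psi> x e * (B x \<bullet> j) + \<psi> x * (frame_deriv a' c' x e \<bullet> j))"
      unfolding fd_eq[OF tr[OF 1]] by (simp only: add.commute)
    show "fd (T i j) x e = fd (\<lambda>x. weight x * (B x \<bullet> j)) x e * (\<psi> x * (A x \<bullet> i)) + weight x * (B x \<bullet> j) * (fd \<psi> x e * (A x \<bullet> i) + \<psi> x * (frame_deriv a c x e \<bullet> i))"
      unfolding fd_eq[OF tr[OF 2]] by (simp only: add.commute)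
  qed
  define f where "f i j x = \<Phi> x (v i j) * T i j x" for i j x
  define g where "g i j x = \<alpha> x (omit 0 (v i j)) * fd (T i j) x i - \<alpha> x (omit (Suc 0) (v i j)) * fd (T i j) x j" for i j x
  have if': "integrable (lebesgue_on V) (f i j)" for i j
    unfolding f_def by (rule L2_test_integrable[OF _ T]) (use L2 in \<open>simp add: L2_form_def\<close>)
  have ia: "integrable (lebesgue_on V) (\<lambda>x. \<alpha> x u * fd (T i j) x e)" for u i j e
    by (rule L2_test_integrable[OF _ test_function_fd[OF T]]) (use L2 in \<open>simp add: L2_form_def\<close>)
  have ig: "integrable (lebesgue_on V) (g i j)" for i j
    unfolding g_def by (intro Bochner_Integration.integrable_diff ia)
  have fg: "(LINT x|lebesgue_on V. f i j x) = - (LINT x|lebesgue_on V. g i j x)" for i j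
    unfolding f_def g_def weakD1[OF w[unfolded One_nat_def] T] Bochner_Integration.integral_diff[OF ia ia] by (simp add: v_def)
  have F: "(\<Sum>i\<in>Basis. \<Sum>j\<in>Basis. f i j x) = F x" if x: "x \<in> V" for x
  proof -
    note l = alternating_2D[OF alt(2)[OF x]]
    have xS: "x \<in> S0" using x sub by blast
    have "ev2 (\<Phi> x) (A x) (B x) = (\<Sum>i\<in>Basis. (A x \<bullet> i) * (\<Sum>j\<in>Basis. (B x \<bullet> j) * ev2 (\<Phi> x) i j))"
      by (subst linear_basis_sum[OF l(2)], subst linear_basis_sum[OF l(3)]) simp
    moreover have "f i j x = weight x * \<psi> x * ((A x \<bullet> i) * ((B x \<bullet> j) * ev2 (\<Phi> x) i j))" for i j
      using l(1)[of "v i j"] xS by (simp add: f_def T_def P_def v_def)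
    ultimately show ?thesis unfolding F_def A_def[symmetric] B_def[symmetric] by (simp add: sum_distrib_left mult_ac)
  qed
  have G: "(\<Sum>i\<in>Basis. \<Sum>j\<in>Basis. g i j x) = G x" if x: "x \<in> V" for x
  proof -
    note l = alternating_1D(2)[OF alt(1)[OF x]] and n = V_nu[OF x]
    have xS: "x \<in> S0" using x sub by blast
    have lp: "linear (fd \<psi> x)" by (rule fd_linear[OF smooth_on_differentiable[OF open_S0 \<psi> xS]])
    have ld: "linear (\<lambda>e. frame_deriv a c x e \<bullet> i)" for a c i
      by (rule has_derivative_linear[OF has_derivative_inner_left[OF frame_has_derivative[OF n]]])
    have 1: "(\<Sum>i\<in>Basis. fd (T i j) x i) = weight x * (fd \<psi> x (A x) * (B x \<bullet> j) + \<psi> x * (frame_deriv a' c' x (A x) \<bullet> j))" for j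
      unfolding fdT(1)[OF x] divergence_product[OF lp ld] weighted_frame_divergence[OF n, of a c, folded A_def] by simp
    have 2: "(\<Sum>j\<in>Basis. fd (T i j) x j) = weight x * (fd \<psi> x (B x) * (A x \<bullet> i) + \<psi> x * (frame_deriv a c x (B x) \<bullet> i))" for i
      unfolding fdT(2)[OF x] divergence_product[OF lp ld] weighted_frame_divergence[OF n, of a' c', folded B_def] by simp
    have lin: "(\<Sum>j\<in>Basis. ev1 (\<alpha> x) j * (k * (b * (Y \<bullet> j) + s * (Z \<bullet> j)))) = k * (b * ev1 (\<alpha> x) Y + s * ev1 (\<alpha> x) Z)" for k b s Y Z
      unfolding linear_basis_sum[OF l, of Y] linear_basis_sum[OF l, of Z]
      by (simp add: sum.distrib sum_distrib_left sum_distrib_right algebra_simps)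
    have ge: "g i j x = ev1 (\<alpha> x) j * fd (T i j) x i - ev1 (\<alpha> x) i * fd (T i j) x j" for i j
      unfolding g_def alternating_1D(1)[OF alt(1)[OF x], of "omit _ _"] by (simp add: omit_values v_def)
    have "(\<Sum>i\<in>Basis. \<Sum>j\<in>Basis. g i j x) = (\<Sum>i\<in>Basis. \<Sum>j\<in>Basis. ev1 (\<alpha> x) j * fd (T i j) x i) - (\<Sum>i\<in>Basis. \<Sum>j\<in>Basis. ev1 (\<alpha> x) i * fd (T i j) x j)"
      unfolding ge by (simp add: sum_subtractf)
    also have "(\<Sum>i\<in>Basis. \<Sum>j\<in>Basis. ev1 (\<alpha> x) j * fd (T i j) x i) = (\<Sum>j\<in>Basis. ev1 (\<alpha> x) j * (\<Sum>i\<in>Basis. fd (T i j) x i))"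
      by (subst sum.swap) (simp add: sum_distrib_left)
    also have "(\<Sum>i\<in>Basis. \<Sum>j\<in>Basis. ev1 (\<alpha> x) i * fd (T i j) x j) = (\<Sum>i\<in>Basis. ev1 (\<alpha> x) i * (\<Sum>j\<in>Basis. fd (T i j) x j))"
      by (simp add: sum_distrib_left)
    finally have e: "(\<Sum>i\<in>Basis. \<Sum>j\<in>Basis. g i j x) = weight x * (fd \<psi> x (A x) * ev1 (\<alpha> x) (B x) + \<psi> x * ev1 (\<alpha> x) (frame_deriv a' c' x (A x)))
      - weight x * (fd \<psi> x (B x) * ev1 (\<alpha> x) (A x) + \<psi> x * ev1 (\<alpha> x) (frame_deriv a c x (B x)))"
      unfolding 1 2 lin .
    show ?thesis unfolding e G_def A_def[symmetric] B_def[symmetric] frame_commutator[OF n, where a = a and c = c and a' = a' and c' = c', symmetric] linear_diff[OF l]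
      by (simp add: A_def B_def algebra_simps)
  qed
  have cF: "integrable (lebesgue_on V) F \<longleftrightarrow> integrable (lebesgue_on V) (\<lambda>x. \<Sum>i\<in>Basis. \<Sum>j\<in>Basis. f i j x)"
    by (rule Bochner_Integration.integrable_cong[OF refl]) (simp add: space_restrict_space F)
  have cG: "integrable (lebesgue_on V) G \<longleftrightarrow> integrable (lebesgue_on V) (\<lambda>x. \<Sum>i\<in>Basis. \<Sum>j\<in>Basis. g i j x)"
    by (rule Bochner_Integration.integrable_cong[OF refl]) (simp add: space_restrict_space G)
  show "integrable (lebesgue_on V) F" unfolding cF by (intro Bochner_Integration.integrable_sum if')
  show "integrable (lebesgue_on V) G" unfolding cG by (intro Bochner_Integration.integrable_sum ig)
  have "(LINT x|lebesgue_on V. F x) = (LINT x|lebesgue_on V. (\<Sum>i\<in>Basis. \<Sum>j\<in>Basis. f i j x))"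
    by (rule integral_V_cong) (simp add: F)
  also have "\<dots> = (\<Sum>i\<in>Basis. \<Sum>j\<in>Basis. (LINT x|lebesgue_on V. f i j x))"
    by (simp add: Bochner_Integration.integral_sum Bochner_Integration.integrable_sum if')
  also have "\<dots> = - (\<Sum>i\<in>Basis. \<Sum>j\<in>Basis. (LINT x|lebesgue_on V. g i j x))" unfolding fg by (simp add: sum_negf)
  also have "(\<Sum>i\<in>Basis. \<Sum>j\<in>Basis. (LINT x|lebesgue_on V. g i j x)) = (LINT x|lebesgue_on V. (\<Sum>i\<in>Basis. \<Sum>j\<in>Basis. g i j x))"
    by (simp add: Bochner_Integration.integral_sum Bochner_Integration.integrable_sum ig)
  also have "\<dots> = (LINT x|lebesgue_on V. G x)"
    by (rule integral_V_cong) (simp add: G)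
  finally show "(LINT x|lebesgue_on V. F x) = - (LINT x|lebesgue_on V. G x)" .
qed

end

section \<open>The obstruction\<close>

subsection \<open>Measure of the part of a Euclidean cone between two spheres\<close>

text \<open>By scaling. This gives lower bounds for volumes near a boundary point without any change of
  variables to horospherical coordinates.\<close>

lemma linear_cone_shell:
  fixes W :: "'a::euclidean_space set"
  assumes W: "open W" "\<And>x t. t > 0 \<Longrightarrow> x \<in> W \<Longrightarrow> t *\<^sub>R x \<in> W" and s: "0 < s" "s \<le> t"
  shows "{x \<in> W. s \<le> norm x \<and> norm x < t} \<in> lmeasurable"
    "measure lebesgue {x \<in> W. s \<le> norm x \<and> norm x < t} = (t ^ DIM('a) - s ^ DIM('a)) * measure lebesgue (W \<inter> ball 0 1)"
proof -
  have im: "W \<inter> ball 0 r = (\<lambda>x. r *\<^sub>R x + 0) ` (W \<inter> ball 0 1)" if r: "r > 0" for r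
  proof (intro equalityI subsetI)
    fix x assume x: "x \<in> W \<inter> ball 0 r"
    then have "(1 / r) *\<^sub>R x \<in> W \<inter> ball 0 1" using W(2)[of "1 / r" x] r by (simp add: divide_less_eq)
    moreover have "x = r *\<^sub>R ((1 / r) *\<^sub>R x) + 0" using r by simp
    ultimately show "x \<in> (\<lambda>x. r *\<^sub>R x + 0) ` (W \<inter> ball 0 1)" by (rule rev_image_eqI)
  next
    fix x assume "x \<in> (\<lambda>x. r *\<^sub>R x + 0) ` (W \<inter> ball 0 1)"
    then obtain y where "y \<in> W" "norm y < 1" "x = r *\<^sub>R y" by auto
    then show "x \<in> W \<inter> ball 0 r" using W(2)[OF r, of y] r by simp
  qed
  have m: "measure lebesgue (W \<inter> ball 0 r) = r ^ DIM('a) * measure lebesgue (W \<inter> ball 0 1)" if "r > 0" for r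
    unfolding im[OF that] using measure_lebesgue_affine[of r 0 "W \<inter> ball 0 1"] that by simp
  have l: "W \<inter> ball 0 r \<in> lmeasurable" for r using W(1) by (intro lmeasurable_open) (auto intro: bounded_subset[OF bounded_ball])
  have e: "{x \<in> W. s \<le> norm x \<and> norm x < t} = W \<inter> ball 0 t - W \<inter> ball 0 s" by auto
  show "{x \<in> W. s \<le> norm x \<and> norm x < t} \<in> lmeasurable" unfolding e using l by (intro fmeasurable.Diff) auto
  have "measure lebesgue (W \<inter> ball 0 t - W \<inter> ball 0 s) = measure lebesgue (W \<inter> ball 0 t) - measure lebesgue (W \<inter> ball 0 s)"
    by (rule measurable_measure_Diff[OF l]) (use l s in \<open>auto dest: fmeasurableD\<close>)
  then show "measure lebesgue {x \<in> W. s \<le> norm x \<and> norm x < t} = (t ^ DIM('a) - s ^ DIM('a)) * measure lebesgue (W \<inter> ball 0 1)"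
    unfolding e using m[of t] m[of s] s by (simp add: left_diff_distrib)
qed

text \<open>Young's inequality in elementary form: compare \<open>N\<close> with \<open>e\<^sup>a\<^sup>/\<^sup>(\<^sup>p\<^sup>-\<^sup>1\<^sup>)\<close>.\<close>

lemma young_split:
  fixes N :: real
  assumes "N \<ge> 0" "e > 0" "p > 1" shows "N \<le> e powr (- a) * N powr p + e powr (a / (p - 1))"
proof (cases "N \<le> e powr (a / (p - 1))")
  case True
  have "0 \<le> e powr (- a) * N powr p" by simp
  with True show ?thesis by linarith
next
  case False
  have t: "e powr (a / (p - 1)) > 0" using assms by simp
  have N: "N > 0" using False t by linarith
  have "N = N powr p * N powr (1 - p)" using N by (simp add: powr_add[symmetric])
  also have "\<dots> \<le> N powr p * (e powr (a / (p - 1))) powr (1 - p)"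
    using False assms t by (intro mult_left_mono powr_mono2') auto
  also have "(e powr (a / (p - 1))) powr (1 - p) = e powr (- a)"
  proof -
    have "a / (p - 1) * (1 - p) = - a" using assms by (simp add: field_simps)
    then show ?thesis by (simp add: powr_powr)
  qed
  finally have "N \<le> e powr (- a) * N powr p" by (simp add: mult.commute)
  then show ?thesis using t by linarith
qed

lemma fd_zero_on_open:
  assumes "open S" "x \<in> S" "\<And>y. y \<in> S \<Longrightarrow> f y = 0" shows "fd f x v = 0"
proof -
  have "(f has_derivative (\<lambda>_. 0)) (at x)"
    by (rule has_derivative_transform_within_open[OF has_derivative_const assms(1,2)]) (simp add: assms(3))
  from fd_eq[OF this] show ?thesis by simp
qed

lemma fd_mult_on:
  assumes "open S" "smooth_on S f" "smooth_on S g" "x \<in> S"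
  shows "fd (\<lambda>x. f x * g x) x v = f x * fd g x v + fd f x v * g x"
  using fd_eq[OF has_derivative_mult[OF smooth_on_has_derivative[OF assms(1,2,4)] smooth_on_has_derivative[OF assms(1,3,4)]]] by simp

lemma alternating_cmul: "alternating k f \<Longrightarrow> alternating k (\<lambda>v. c * f v)"
  unfolding alternating_def by (auto simp: linear_iff algebra_simps)

context boundary_point
begin

text \<open>The point with horospherical coordinates \<open>(w, s, \<rho>)\<close>; for \<open>\<rho> = 0\<close> it lies on the sphere.\<close>

definition chart :: "complex \<times> real \<times> real \<Rightarrow> C2" where
  "chart y = \<eta> + cscale (1 / Complex ((1 + (cmod (fst y))\<^sup>2 + snd (snd y)) / 2) (fst (snd y))) (cscale (fst y) ep - \<eta>)"

lemma chart_denominator: "r \<ge> 0 \<Longrightarrow> Complex ((1 + (cmod w)\<^sup>2 + r) / 2) s \<noteq> 0"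
proof
  assume r: "r \<ge> 0" and "Complex ((1 + (cmod w)\<^sup>2 + r) / 2) s = 0"
  then have "(1 + (cmod w)\<^sup>2 + r) / 2 = 0" by (simp add: complex_eq_iff)
  moreover have "(1 + (cmod w)\<^sup>2 + r) / 2 > 0" using r by (intro divide_pos_pos add_pos_nonneg) auto
  ultimately show False by simp
qed

lemma chart_coords:
  assumes "r \<ge> 0"
  shows "nu (chart (w, s, r)) \<noteq> 0" "wc (chart (w, s, r)) = w" "ss (chart (w, s, r)) = s" "rho (chart (w, s, r)) = r"
    "nc (chart (w, s, r)) = Complex ((1 + (cmod w)\<^sup>2 + r) / 2) s"
proof -
  note c = vertical_coords[OF chart_denominator[OF assms], of w s w]
  have e: "chart (w, s, r) = \<eta> + cscale (1 / Complex ((1 + (cmod w)\<^sup>2 + r) / 2) s) (cscale w ep - \<eta>)" by (simp add: chart_def)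
  show "nu (chart (w, s, r)) \<noteq> 0" unfolding e c(1) using chart_denominator[OF assms] by simp
  show 1: "wc (chart (w, s, r)) = w" unfolding e by (rule c(3))
  show 2: "nc (chart (w, s, r)) = Complex ((1 + (cmod w)\<^sup>2 + r) / 2) s" unfolding e by (rule c(2))
  show "ss (chart (w, s, r)) = s" "rho (chart (w, s, r)) = r" unfolding ss_def rho_def 1 2 by (simp_all add: field_simps)
qed

lemma chart_surj: "nu z \<noteq> 0 \<Longrightarrow> chart (wc z, ss z, rho z) = z"
proof -
  assume n: "nu z \<noteq> 0"
  have "Complex ((1 + (cmod (wc z))\<^sup>2 + rho z) / 2) (ss z) = nc z" by (simp add: complex_eq_iff rho_def ss_def)
  then show ?thesis using coords_determine[OF n] by (simp add: chart_def)
qed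

lemma chart_CH2: "r > 0 \<Longrightarrow> chart (w, s, r) \<in> CH2"
proof -
  assume r: "r > 0"
  have "1 - (norm (chart (w, s, r)))\<^sup>2 > 0"
    using rho_eq[OF chart_coords(1), of r w s] chart_coords(1,4)[of r w s] r by simp
  then show ?thesis by (simp add: CH2_def abs_square_less_1)
qed

lemma chart_continuous: "continuous_on {y. snd (snd y) \<ge> 0} chart"
proof -
  let ?S = "{y :: complex \<times> real \<times> real. snd (snd y) \<ge> 0}"
  have e: "Complex a b = of_real a + \<i> * of_real b" for a b by (simp add: complex_eq_iff)
  have nz: "of_real ((1 + (cmod (fst y))\<^sup>2 + snd (snd y)) / 2) + \<i> * of_real (fst (snd y)) \<noteq> 0" if "y \<in> ?S" for y
    unfolding e[symmetric] by (rule chart_denominator) (use that in simp)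
  define g where "g y = 1 / (complex_of_real ((1 + (cmod (fst y))\<^sup>2 + snd (snd y)) / 2) + \<i> * of_real (fst (snd y)))" for y :: "complex \<times> real \<times> real"
  have "continuous_on ?S (\<lambda>y. complex_of_real ((1 + (cmod (fst y))\<^sup>2 + snd (snd y)) / 2) + \<i> * of_real (fst (snd y)))"
    by (intro continuous_intros) auto
  from continuous_on_divide[OF continuous_on_const this ballI[OF nz]] have g: "continuous_on ?S g" unfolding g_def[abs_def] .
  show "continuous_on ?S chart" unfolding chart_def[abs_def] e cscale_def g_def[symmetric] by (intro continuous_intros g)
qed

lemma chart_compact:
  assumes "compact K" "\<And>y. y \<in> K \<Longrightarrow> snd (snd y) \<ge> 0" shows "compact (chart ` K)"
  by (rule compact_continuous_image[OF continuous_on_subset[OF chart_continuous] assms(1)]) (use assms(2) in auto)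

lemma smooth_fd_frame: "smooth_on S0 f \<Longrightarrow> smooth_on S0 (\<lambda>z. fd f z (frame z a c))"
proof -
  assume f: "smooth_on S0 f"
  have "smooth_on S0 (\<lambda>z. \<Sum>i\<in>Basis. (frame z a c \<bullet> i) * fd f z i)"
    by (intro smooth_on_sum smooth_on_mult open_S0 csmooth_frame smooth_on_fd f) auto
  moreover have "fd f z (frame z a c) = (\<Sum>i\<in>Basis. (frame z a c \<bullet> i) * fd f z i)" if "z \<in> S0" for z
    by (rule linear_basis_sum[OF fd_linear[OF smooth_on_differentiable[OF open_S0 f that]]])
  ultimately show ?thesis by (subst smooth_on_cong[OF open_S0]) auto
qed

text \<open>A smooth cutoff to \<open>e < \<rho> < 2 e\<close>. A function of \<open>\<rho>\<close> is annihilated by the fields with imaginary \<open>c\<close>,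
  so it costs nothing in the integration by parts.\<close>

definition slab :: "real \<Rightarrow> C2 \<Rightarrow> real" where
  "slab e z = flat_exp (1 / e\<^sup>2 * ((rho z - e) * (2 * e - rho z)))"

lemma smooth_slab: "smooth_on S0 (slab e)"
  and fd_slab: "nu z \<noteq> 0 \<Longrightarrow> Re c = 0 \<Longrightarrow> fd (slab e) z (frame z a c) = 0"
proof -
  define h where "h r = flat_exp (1 / e\<^sup>2 * ((r - e) * (2 * e - r)))" for r
  have i: "smooth_on UNIV (\<lambda>r::real. r)" by (rule smooth_on_linear[OF linear_ident])
  have "smooth_on UNIV (\<lambda>r. 1 / e\<^sup>2 * ((r - e) * (2 * e - r)))"
    by (intro smooth_on_mult smooth_on_diff smooth_on_const i open_UNIV)
  from smooth_on_compose[OF open_UNIV open_UNIV smooth_on_flat_exp this] have h: "smooth_on UNIV h" by (simp add: h_def[abs_def])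
  have e: "slab e = (\<lambda>z. h (rho z))" by (simp add: fun_eq_iff slab_def h_def)
  show "smooth_on S0 (slab e)" unfolding e by (rule smooth_on_compose[OF open_S0 open_UNIV h smooth_rho]) simp
  assume n: "nu z \<noteq> 0" and c: "Re c = 0"
  have dh: "(h has_derivative fd h (rho z)) (at (rho z))" by (rule smooth_on_has_derivative[OF open_UNIV h]) simp
  have "((\<lambda>z. h (rho z)) has_derivative (\<lambda>v. fd h (rho z) (2 * Re (th z v)))) (at z)"
    by (rule has_derivative_compose[OF rho_has_derivative[OF n] dh])
  from fd_eq[OF this] show "fd (slab e) z (frame z a c) = 0"
    unfolding e using c linear_0[OF has_derivative_linear[OF dh]] by (simp add: th_frame[OF n])
qed

lemma slab_support: "e > 0 \<Longrightarrow> slab e z \<noteq> 0 \<Longrightarrow> e \<le> rho z \<and> rho z \<le> 2 * e"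
proof -
  assume e: "e > 0" and "slab e z \<noteq> 0"
  then have "1 / e\<^sup>2 * ((rho z - e) * (2 * e - rho z)) > 0" using flat_exp_pos_iff flat_exp_nonneg unfolding slab_def by (metis order_le_less)
  then have "(rho z - e) * (2 * e - rho z) > 0" using e by (simp add: zero_less_divide_iff)
  then show ?thesis using e by (auto simp: zero_less_mult_iff)
qed

lemma cmod_nu_le: "z \<in> CH2 \<Longrightarrow> cmod (nu z) \<le> 2"
proof -
  assume z: "z \<in> CH2"
  have "(cmod (hermitian z \<eta>))\<^sup>2 \<le> (norm z)\<^sup>2" using norm_expansion[of z] by simp
  then have "cmod (hermitian z \<eta>) \<le> norm z" by (rule power2_le_imp_le) simp
  also have "\<dots> \<le> 1" using z by (simp add: CH2_def)
  finally show ?thesis using norm_triangle_ineq4[of 1 "hermitian z \<eta>"] by (simp add: nu_def)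
qed

lemma weight_ge: "z \<in> CH2 \<Longrightarrow> weight z \<ge> 1 / 64"
proof -
  assume z: "z \<in> CH2"
  have n: "nu z \<noteq> 0" using z ball_S0 by (auto simp: S0_def)
  have "1 / 2 \<le> 1 / cmod (nu z)" using cmod_nu_le[OF z] n by (simp add: field_simps)
  then have "(1 / 2)\<^sup>2 \<le> (cmod (nc z))\<^sup>2" unfolding nc_def norm_divide by (intro power_mono) auto
  then have "((1 / 2)\<^sup>2) ^ 3 \<le> ((cmod (nc z))\<^sup>2) ^ 3" by (intro power_mono) auto
  then show ?thesis by (simp add: weight_def power_divide)
qed

text \<open>The set \<open>A\<close> is part of a thin linear cone around the boundary point with coordinates \<open>w0, s0\<close>.
  There \<open>n\<close> is nearly constant, so \<open>\<rho> = (1 - |x|\<^sup>2) |n|\<^sup>2\<close> is controlled by the distance to the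
  sphere, and the volume is linear in the thickness.\<close>

lemma near_boundary_measure:
  assumes d: "d > 0"
  obtains c e0 where "c > 0" "0 < e0" "e0 \<le> 1" "\<And>e. 0 < e \<Longrightarrow> e < e0 \<Longrightarrow> \<exists>A\<in>lmeasurable. A \<subseteq> CH2 \<and> c * e \<le> measure lebesgue A \<and>
    (\<forall>x\<in>A. cmod (wc x - w0) \<le> d / 2 \<and> \<bar>ss x - s0\<bar> \<le> d / 2 \<and> 5 / 4 * e \<le> rho x \<and> rho x \<le> 7 / 4 * e)"
proof -
  define \<xi> where "\<xi> = chart (w0, s0, 0)"
  have x: "nu \<xi> \<noteq> 0" "wc \<xi> = w0" "ss \<xi> = s0" "rho \<xi> = 0" unfolding \<xi>_def by (simp_all add: chart_coords)
  define q where "q = (cmod (nc \<xi>))\<^sup>2"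
  have q: "q > 0" using x(1) by (simp add: q_def nc_def)
  have nx: "norm \<xi> = 1"
  proof -
    have "(norm \<xi>)\<^sup>2 = 1\<^sup>2" using rho_eq[OF x(1)] x(4) by simp
    then show ?thesis by (rule power2_eq_imp_eq) auto
  qed
  define f where "f x = (wc x, ss x, (cmod (nc x))\<^sup>2)" for x
  define O' where "O' = ball w0 (d / 2) \<times> {s0 - d / 2<..<s0 + d / 2} \<times> {19 / 20 * q<..<21 / 20 * q}"
  have "open O'" unfolding O'_def by (intro open_Times open_ball open_greaterThanLessThan)
  moreover have "continuous_on S0 f" unfolding f_def ss_def by (intro continuous_intros wc_continuous nc_continuous)
  ultimately have "open (S0 \<inter> f -` O')" using continuous_open_preimage[OF _ open_S0] by blast
  moreover have "\<xi> \<in> S0 \<inter> f -` O'" using x q d by (simp add: f_def O'_def S0_def q_def[symmetric])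
  ultimately obtain \<tau> where t: "\<tau> > 0" "ball \<xi> \<tau> \<subseteq> S0 \<inter> f -` O'" using openE by blast
  define W where "W = {x. norm (x - norm x *\<^sub>R \<xi>) < \<tau> / 2 * norm x}"
  have W: "open W" unfolding W_def by (intro open_Collect_less continuous_intros)
  have Wc: "r *\<^sub>R x \<in> W" if r: "r > 0" and x: "x \<in> W" for r x
  proof -
    have "r *\<^sub>R x - norm (r *\<^sub>R x) *\<^sub>R \<xi> = r *\<^sub>R (x - norm x *\<^sub>R \<xi>)" using r by (simp add: scaleR_diff_right)
    then have "norm (r *\<^sub>R x - norm (r *\<^sub>R x) *\<^sub>R \<xi>) = r * norm (x - norm x *\<^sub>R \<xi>)" using r by simp
    also have "\<dots> < r * (\<tau> / 2 * norm x)" using r x by (simp add: W_def)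
    finally show ?thesis using r by (simp add: W_def mult_ac)
  qed
  define \<mu> where "\<mu> = measure lebesgue (W \<inter> ball 0 1)"
  have \<mu>: "\<mu> > 0"
  proof -
    have "(1 / 2) *\<^sub>R \<xi> \<in> W \<inter> ball 0 1" using t nx by (simp add: W_def)
    moreover have o: "open (W \<inter> ball 0 1)" using W by auto
    ultimately have "\<not> negligible (W \<inter> ball 0 1)" using open_not_negligible by blast
    moreover have "W \<inter> ball 0 1 \<in> lmeasurable" by (rule lmeasurable_open[OF _ o]) (auto intro: bounded_subset[OF bounded_ball])
    ultimately have "\<mu> \<noteq> 0" unfolding \<mu>_def by (simp add: negligible_iff_measure)
    then show ?thesis unfolding \<mu>_def by (simp add: zero_less_measure_iff)
  qed
  define e0 where "e0 = min 1 (q * min (1 / 3) (\<tau> / 4))"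
  have e0: "0 < e0" "e0 \<le> 1" using q t by (auto simp: e0_def)
  have "\<exists>A\<in>lmeasurable. A \<subseteq> CH2 \<and> \<mu> * (15 / 100) / q * e \<le> measure lebesgue A \<and>
    (\<forall>x\<in>A. cmod (wc x - w0) \<le> d / 2 \<and> \<bar>ss x - s0\<bar> \<le> d / 2 \<and> 5 / 4 * e \<le> rho x \<and> rho x \<le> 7 / 4 * e)"
    if e: "0 < e" "e < e0" for e
  proof -
    \<comment> \<open>The margins \<open>14 / 10\<close> and \<open>155 / 100\<close> leave room for an error of \<open>1 / 20\<close> in \<open>|n|\<^sup>2\<close>, as
      \<open>14 / 10 * 19 / 20 > 5 / 4\<close> and \<open>155 / 100 * 21 / 20 < 7 / 4\<close>.\<close>
    define e' where "e' = e / q"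
    have "e < q * min (1 / 3) (\<tau> / 4)" using e by (simp add: e0_def)
    then have "e' < min (1 / 3) (\<tau> / 4)" unfolding e'_def pos_divide_less_eq[OF q] by (simp only: mult.commute)
    then have e': "0 < e'" "e' < 1 / 3" "e' < \<tau> / 4" "e = e' * q" using e q by (auto simp: e'_def)
    define s where "s = sqrt (1 - 155 / 100 * e')"
    define r where "r = sqrt (1 - 14 / 10 * e')"
    have s2: "s\<^sup>2 = 1 - 155 / 100 * e'" and r2: "r\<^sup>2 = 1 - 14 / 10 * e'" using e' by (auto simp: s_def r_def)
    have sr: "0 < s" "s \<le> r" "r \<le> 1" using e' by (auto simp: s_def r_def)
    define A where "A = {x \<in> W. s \<le> norm x \<and> norm x < r}"
    have Am: "A \<in> lmeasurable" unfolding A_def by (rule linear_cone_shell[OF W Wc sr(1,2)])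
    have "measure lebesgue A = (r ^ DIM(C2) - s ^ DIM(C2)) * \<mu>" unfolding A_def \<mu>_def by (rule linear_cone_shell(2)[OF W Wc sr(1,2)])
    also have "r ^ DIM(C2) - s ^ DIM(C2) = (r\<^sup>2)\<^sup>2 - (s\<^sup>2)\<^sup>2" by simp
    also have "\<dots> = 15 / 100 * e' * (2 - 295 / 100 * e')" unfolding s2 r2 by (simp add: power2_eq_square algebra_simps)
    finally have "measure lebesgue A = 15 / 100 * e' * (2 - 295 / 100 * e') * \<mu>" .
    moreover have "15 / 100 * e' * 1 * \<mu> \<le> 15 / 100 * e' * (2 - 295 / 100 * e') * \<mu>"
      using e' \<mu> by (intro mult_right_mono mult_left_mono) auto
    ultimately have mA: "\<mu> * (15 / 100) / q * e \<le> measure lebesgue A" by (simp add: e'_def mult_ac)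
    have AC: "A \<subseteq> CH2" using sr by (auto simp: A_def CH2_def)
    have "cmod (wc x - w0) \<le> d / 2 \<and> \<bar>ss x - s0\<bar> \<le> d / 2 \<and> 5 / 4 * e \<le> rho x \<and> rho x \<le> 7 / 4 * e" if x: "x \<in> A" for x
    proof -
      have nx1: "norm x < 1" using x sr by (auto simp: A_def)
      have D: "14 / 10 * e' \<le> 1 - (norm x)\<^sup>2" "1 - (norm x)\<^sup>2 \<le> 155 / 100 * e'"
      proof -
        have "(norm x)\<^sup>2 \<le> r\<^sup>2" using x sr by (intro power_mono) (auto simp: A_def)
        then show "14 / 10 * e' \<le> 1 - (norm x)\<^sup>2" unfolding r2 by linarith
        have "s\<^sup>2 \<le> (norm x)\<^sup>2" using x sr by (intro power_mono) (auto simp: A_def)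
        then show "1 - (norm x)\<^sup>2 \<le> 155 / 100 * e'" unfolding s2 by linarith
      qed
      have "norm x * norm x \<le> norm x" using nx1 by (simp add: mult_left_le)
      then have n1: "1 - norm x \<le> 155 / 100 * e'" using D(2) by (simp add: power2_eq_square)
      have "x - \<xi> = (x - norm x *\<^sub>R \<xi>) + (norm x - 1) *\<^sub>R \<xi>" by (simp add: scaleR_diff_left)
      then have "norm (x - \<xi>) \<le> norm (x - norm x *\<^sub>R \<xi>) + norm ((norm x - 1) *\<^sub>R \<xi>)" using norm_triangle_ineq by metis
      also have "norm ((norm x - 1) *\<^sub>R \<xi>) = 1 - norm x" using nx nx1 by simp
      also have "norm (x - norm x *\<^sub>R \<xi>) < \<tau> / 2 * norm x" using x by (simp add: A_def W_def)
      also have "\<tau> / 2 * norm x \<le> \<tau> / 2 * 1" using nx1 t by (intro mult_left_mono) auto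
      finally have "norm (x - \<xi>) < \<tau>" using n1 e' by linarith
      then have "x \<in> S0 \<inter> f -` O'" using t(2) by (auto simp: dist_norm norm_minus_commute)
      then have xS: "nu x \<noteq> 0" "cmod (wc x - w0) < d / 2" "s0 - d / 2 < ss x" "ss x < s0 + d / 2"
        "19 / 20 * q < (cmod (nc x))\<^sup>2" "(cmod (nc x))\<^sup>2 < 21 / 20 * q"
        by (auto simp: f_def O'_def S0_def dist_norm norm_minus_commute)
      have rx: "rho x = (1 - (norm x)\<^sup>2) * (cmod (nc x))\<^sup>2"
        using rho_eq[OF xS(1)] xS(1) by (simp add: nc_def norm_divide power_divide)
      have "14 / 10 * e' * (19 / 20 * q) \<le> rho x" unfolding rx using D xS q e' by (intro mult_mono) auto
      moreover have "rho x \<le> 155 / 100 * e' * (21 / 20 * q)" unfolding rx using D xS q e' by (intro mult_mono) auto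
      moreover have "e' * q > 0" using e' q by simp
      ultimately show ?thesis using xS(2,3,4) unfolding e'(4) abs_le_iff by (intro conjI) linarith+
    qed
    then show ?thesis using Am AC mA by blast
  qed
  moreover have "\<mu> * (15 / 100) / q > 0" using \<mu> q by simp
  ultimately show ?thesis using that e0 by blast
qed

end

subsection \<open>The test functions\<close>

text \<open>The base of the cone is open in the sphere, so the cone contains all points whose coordinates
  \<open>(w, s)\<close> are close to those of a given point of the base.\<close>

locale fat_cone = bounded_cone_domain +
  fixes w0 :: complex and s0 \<delta> :: real
  assumes delta: "\<delta> > 0"
    and box_V: "\<And>z. z \<in> CH2 \<Longrightarrow> cmod (wc z - w0) \<le> \<delta> \<Longrightarrow> \<bar>ss z - s0\<bar> \<le> \<delta> \<Longrightarrow> z \<in> V"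
begin

definition cylinder :: "real set \<Rightarrow> C2 set" where
  "cylinder I = chart ` (cball w0 \<delta> \<times> {s0 - \<delta>..s0 + \<delta>} \<times> I)"

lemma cylinder_compact: "compact I \<Longrightarrow> I \<subseteq> {0..} \<Longrightarrow> compact (cylinder I)"
  unfolding cylinder_def by (rule chart_compact) (auto intro!: compact_Times)

lemma cylinder_S0: "I \<subseteq> {0..} \<Longrightarrow> cylinder I \<subseteq> S0"
  using chart_coords(1) by (auto simp: cylinder_def S0_def)

lemma cylinder_subset: "I \<subseteq> {0<..} \<Longrightarrow> cylinder I \<subseteq> V"
proof
  fix z assume I: "I \<subseteq> {0<..}" and "z \<in> cylinder I"
  then obtain w s r where z: "z = chart (w, s, r)" "cmod (w0 - w) \<le> \<delta>" "s0 - \<delta> \<le> s" "s \<le> s0 + \<delta>" "r \<in> I"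
    by (auto simp: cylinder_def dist_norm)
  have r: "r > 0" using I z(5) by auto
  show "z \<in> V" unfolding z(1)
    by (rule box_V[OF chart_CH2[OF r]]) (use z r in \<open>auto simp: chart_coords norm_minus_commute\<close>)
qed

lemma cylinder_mem: "nu z \<noteq> 0 \<Longrightarrow> cmod (wc z - w0) \<le> \<delta> \<Longrightarrow> \<bar>ss z - s0\<bar> \<le> \<delta> \<Longrightarrow> rho z \<in> I \<Longrightarrow> z \<in> cylinder I"
proof -
  assume z: "nu z \<noteq> 0" "cmod (wc z - w0) \<le> \<delta>" "\<bar>ss z - s0\<bar> \<le> \<delta>" "rho z \<in> I"
  have "chart (wc z, ss z, rho z) \<in> cylinder I" unfolding cylinder_def
    by (rule imageI) (use z in \<open>auto simp: dist_norm norm_minus_commute abs_le_iff\<close>)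
  then show ?thesis by (simp only: chart_surj[OF z(1)])
qed

definition gap :: "C2 \<Rightarrow> real" where
  "gap z = \<delta>\<^sup>2 - (cmod (wc z - w0))\<^sup>2 - (ss z - s0)\<^sup>2"

definition bump :: "C2 \<Rightarrow> real" where "bump z = flat_exp (gap z)"

text \<open>With this coefficient, the terms of the pairing that contain \<open>\<alpha>(T)\<close> cancel. The bound
  for \<open>\<alpha>(T)\<close> would be too weak: it is of order \<open>\<rho>\<^sup>-\<^sup>1 |\<alpha>|\<close>, as unit vectors in the direction of \<open>T\<close> are of order \<open>\<rho>\<close>.\<close>

definition corr :: "C2 \<Rightarrow> real" where "corr z = - 1 / 4 * fd bump z (frame z 1 0)"

lemma smooth_gap: "smooth_on S0 gap"
  unfolding gap_def[abs_def]
  by (intro smooth_on_diff smooth_on_const smooth_on_power csmooth_on_norm_square csmooth_on_diff csmooth_on_const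
      csmooth_wc smooth_ss open_S0)

lemma smooth_bump: "smooth_on S0 bump"
  unfolding bump_def[abs_def] by (rule smooth_on_compose[OF open_S0 open_UNIV smooth_on_flat_exp smooth_gap]) simp

lemma smooth_corr: "smooth_on S0 corr"
  unfolding corr_def[abs_def] by (intro smooth_on_cmul open_S0 smooth_fd_frame smooth_bump)

lemma bump_support:
  assumes z: "z \<in> S0" "gap z < 0"
  shows "bump z = 0" "fd bump z v = 0" "corr z = 0" "fd corr z v = 0"
proof -
  define O' where "O' = S0 \<inter> gap -` {..<0}"
  have o: "open O'" unfolding O'_def
    by (rule continuous_open_preimage[OF smooth_on_continuous[OF smooth_gap] open_S0 open_lessThan])
  have b: "bump y = 0" if "y \<in> O'" for y using that by (simp add: O'_def bump_def flat_exp_def)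
  have fb: "fd bump y v = 0" if "y \<in> O'" for y v by (rule fd_zero_on_open[OF o that b])
  have c: "corr y = 0" if "y \<in> O'" for y by (simp add: corr_def fb[OF that])
  have zO: "z \<in> O'" using z by (simp add: O'_def)
  show "bump z = 0" "fd bump z v = 0" "corr z = 0" "fd corr z v = 0"
    using b[OF zO] fb[OF zO] c[OF zO] fd_zero_on_open[OF o zO c] by auto
qed

lemma gap_region: "0 \<le> gap z \<Longrightarrow> cmod (wc z - w0) \<le> \<delta> \<and> \<bar>ss z - s0\<bar> \<le> \<delta>"
proof -
  assume "0 \<le> gap z"
  then have "(cmod (wc z - w0))\<^sup>2 \<le> \<delta>\<^sup>2" "\<bar>ss z - s0\<bar>\<^sup>2 \<le> \<delta>\<^sup>2"
    unfolding gap_def using zero_le_power2[of "ss z - s0"] zero_le_power2[of "cmod (wc z - w0)"] unfolding power2_abs by linarith+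
  then show ?thesis using delta by (auto intro: power2_le_imp_le simp: abs_le_square_iff)
qed

text \<open>The weak differential that \<open>\<alpha> - 2 u al0\<close> must have if \<open>d\<alpha>\<close> is the product of \<open>d(u\<^sup>2)\<close> and \<open>dform wfun\<close>.\<close>

definition defect :: "C2 form" where "defect x v = - 2 * wedge 1 1 (dform u) al0 x v"

lemma defect_alternating: "x \<in> V \<Longrightarrow> alternating 2 (defect x)"
  unfolding defect_def
  by (intro alternating_cmul wedge_alternating[of "dform u" x al0] dform_alternating_on[OF open_S0 V_S0 smooth_u] al0_alternating)

lemma defect_eq: "x \<in> V \<Longrightarrow> defect x v = - 2 * (fd u x (v 0) * ev1 (al0 x) (v 1) - fd u x (v 1) * ev1 (al0 x) (v 0))"
  unfolding defect_def
  using wedge_1_1[of "dform u" x al0, OF dform_alternating_on[OF open_S0 V_S0 smooth_u] al0_alternating]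
  by (simp add: ev1_dform)

lemma L2_form_defect: "L2_form defect"
proof (rule L2_form_continuous)
  fix v :: "nat \<Rightarrow> C2"
  have "continuous_on V (\<lambda>x. - 2 * (fd u x (v 0) * ev1 (al0 x) (v 1) - fd u x (v 1) * ev1 (al0 x) (v 0)))"
    unfolding ev1_def by (intro continuous_intros smooth_continuous_V smooth_on_fd open_S0 smooth_u al0_continuous)
  then show "continuous_on V (\<lambda>x. defect x v)"
    by (rule continuous_on_cong[THEN iffD1, OF refl, rotated]) (rule defect_eq[symmetric])
qed

lemma defect_frame:
  assumes x: "x \<in> V"
  shows "ev2 (defect x) (frame x 1 0) (frame x 0 (\<i> / 2)) = exp (- 3 * rho x) / 2"
    "ev2 (defect x) (frame x 1 0) (frame x \<i> 0) = 0"
proof -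
  note n = V_nu[OF x]
  have fu: "fd u x (frame x a c) = exp (- rho x) * (Re a - 2 * Re (wc x) * Re c)" for a c
    by (simp add: fd_u[OF n] dw_frame[OF n] th_frame[OF n])
  have fa: "ev1 (al0 x) (frame x a c) = exp (- 2 * rho x) * (2 * ss x * Re c - Im c / 2)" for a c
    by (simp add: ev1_def al0_eq[OF n] th_frame[OF n])
  have e: "exp (- 3 * rho x) = exp (- rho x) * exp (- 2 * rho x)" by (simp add: exp_add[symmetric])
  show "ev2 (defect x) (frame x 1 0) (frame x 0 (\<i> / 2)) = exp (- 3 * rho x) / 2"
    "ev2 (defect x) (frame x 1 0) (frame x \<i> 0) = 0"
    unfolding ev2_def defect_eq[OF x] e by (simp_all add: fu fa)
qed

text \<open>The two sides of the pairing of \<open>defect\<close> with \<open>slab \<cdot> (bump X \<and> T + corr X \<and> Y)\<close>, where \<open>X = frame 1 0\<close>,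
  \<open>Y = frame \<i> 0\<close> and \<open>T = frame 0 (\<i> / 2)\<close>.\<close>

definition tested :: "real \<Rightarrow> C2 \<Rightarrow> real" where
  "tested e x = weight x * (slab e x * (bump x * (exp (- 3 * rho x) / 2)))"

definition remainder :: "C2 form \<Rightarrow> real \<Rightarrow> C2 \<Rightarrow> real" where
  "remainder \<alpha> e x = weight x * (slab e x * (fd corr x (frame x 1 0) * ev1 (\<alpha> x) (frame x \<i> 0)
     - (fd bump x (frame x 0 (\<i> / 2)) + fd corr x (frame x \<i> 0)) * ev1 (\<alpha> x) (frame x 1 0)))"

text \<open>\<open>[X, T] = 0\<close> and \<open>[X, Y] = 4 T\<close>, so the coefficient of \<open>\<alpha>(T)\<close> is \<open>slab \<cdot> (X bump + 4 corr) = 0\<close>.\<close>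

lemma tested_pairing:
  assumes p: "p \<ge> 2" and a: "\<alpha> \<in> Lp 1 p" and w: "weak 1 \<alpha> defect" and e: "e > 0"
  shows "integrable (lebesgue_on V) (tested e)" "integrable (lebesgue_on V) (remainder \<alpha> e)"
    "(LINT x|lebesgue_on V. tested e x) = - (LINT x|lebesgue_on V. remainder \<alpha> e x)"
proof -
  note alt = LpD(1)[OF a]
  have L2: "L2_form \<alpha>" by (rule Lp_L2_form[OF _ a p]) simp
  have K: "compact (cylinder {e..2 * e})" "cylinder {e..2 * e} \<subseteq> V"
  proof -
    show "compact (cylinder {e..2 * e})" by (rule cylinder_compact) (use e in auto)
    show "cylinder {e..2 * e} \<subseteq> V" by (rule cylinder_subset) (use e in auto)
  qed
  have sup: "slab e x * f x = 0" if f: "\<And>x. x \<in> S0 \<Longrightarrow> gap x < 0 \<Longrightarrow> f x = 0" and x: "x \<in> S0" "x \<notin> cylinder {e..2 * e}" for f x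
  proof (cases "gap x < 0 \<or> slab e x = 0")
    case True
    then show ?thesis by (elim disjE) (simp_all add: f[OF x(1)])
  next
    case False
    then have "x \<in> cylinder {e..2 * e}" using slab_support[OF e] gap_region[of x] x(1) by (intro cylinder_mem) (auto simp: S0_def)
    then show ?thesis using x(2) by blast
  qed
  have s: "smooth_on S0 (\<lambda>x. slab e x * bump x)" "smooth_on S0 (\<lambda>x. slab e x * corr x)"
    by (intro smooth_on_mult open_S0 smooth_slab smooth_bump smooth_corr)+
  have sup1: "slab e x * bump x = 0" if "x \<in> S0" "x \<notin> cylinder {e..2 * e}" for x
    by (rule sup[OF _ that]) (rule bump_support(1))
  have sup2: "slab e x * corr x = 0" if "x \<in> S0" "x \<notin> cylinder {e..2 * e}" for x
    by (rule sup[OF _ that]) (rule bump_support(3))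
  note P1 = weak_pairing[OF w alt defect_alternating L2 L2_form_defect s(1) K sup1, where a = 1 and c = 0 and a' = 0 and c' = "\<i> / 2"]
  note P2 = weak_pairing[OF w alt defect_alternating L2 L2_form_defect s(2) K sup2, where a = 1 and c = 0 and a' = \<i> and c' = 0]
  define F1 where "F1 x = weight x * (slab e x * bump x * ev2 (defect x) (frame x 1 0) (frame x 0 (\<i> / 2)))" for x
  define F2 where "F2 x = weight x * (slab e x * corr x * ev2 (defect x) (frame x 1 0) (frame x \<i> 0))" for x
  define G1 where "G1 x = weight x * (fd (\<lambda>x. slab e x * bump x) x (frame x 1 0) * ev1 (\<alpha> x) (frame x 0 (\<i> / 2))
      - fd (\<lambda>x. slab e x * bump x) x (frame x 0 (\<i> / 2)) * ev1 (\<alpha> x) (frame x 1 0)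
      + slab e x * bump x * ev1 (\<alpha> x) (frame x 0 (0 * cnj 1 - 1 * cnj 0)))" for x
  define G2 where "G2 x = weight x * (fd (\<lambda>x. slab e x * corr x) x (frame x 1 0) * ev1 (\<alpha> x) (frame x \<i> 0)
      - fd (\<lambda>x. slab e x * corr x) x (frame x \<i> 0) * ev1 (\<alpha> x) (frame x 1 0)
      + slab e x * corr x * ev1 (\<alpha> x) (frame x 0 (\<i> * cnj 1 - 1 * cnj \<i>)))" for x
  note Q1 = P1[folded F1_def G1_def] and Q2 = P2[folded F2_def G2_def]
  have F: "F1 x + F2 x = tested e x" if x: "x \<in> V" for x
    unfolding F1_def F2_def tested_def defect_frame[OF x] by simp
  have G: "G1 x + G2 x = remainder \<alpha> e x" if x: "x \<in> V" for x
  proof -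
    note n = V_nu[OF x]
    have xS: "x \<in> S0" using x V_S0 by blast
    have l: "linear (ev1 (\<alpha> x))" by (rule alternating_1D(2)[OF alt[OF x]])
    have f0: "frame x 0 (0 * cnj 1 - 1 * cnj 0) = 0" by (simp add: frame_def cscale_def zero_prod_def)
    have f4: "frame x 0 (\<i> * cnj 1 - 1 * cnj \<i>) = 4 *\<^sub>R frame x 0 (\<i> / 2)"
      by (simp add: frame_def cscale_def prod_eq_iff scaleR_conv_of_real algebra_simps)
    have d: "fd (\<lambda>x. slab e x * f x) x (frame x a c) = slab e x * fd f x (frame x a c)" if "smooth_on S0 f" "Re c = 0" for f a c
      using fd_mult_on[OF open_S0 smooth_slab that(1) xS] fd_slab[OF n that(2)] by simp
    show ?thesis unfolding G1_def G2_def remainder_def f0 f4 linear_0[OF l] linear_cmul[OF l]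
      using corr_def[of x] by (simp add: d[OF smooth_bump] d[OF smooth_corr] algebra_simps)
  qed
  have cF: "integrable (lebesgue_on V) (tested e) \<longleftrightarrow> integrable (lebesgue_on V) (\<lambda>x. F1 x + F2 x)"
    by (rule Bochner_Integration.integrable_cong[OF refl]) (simp add: space_restrict_space F)
  have cG: "integrable (lebesgue_on V) (remainder \<alpha> e) \<longleftrightarrow> integrable (lebesgue_on V) (\<lambda>x. G1 x + G2 x)"
    by (rule Bochner_Integration.integrable_cong[OF refl]) (simp add: space_restrict_space G)
  show "integrable (lebesgue_on V) (tested e)" unfolding cF by (rule Bochner_Integration.integrable_add[OF Q1(1) Q2(1)])
  show "integrable (lebesgue_on V) (remainder \<alpha> e)" unfolding cG by (rule Bochner_Integration.integrable_add[OF Q1(2) Q2(2)])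
  have "(LINT x|lebesgue_on V. tested e x) = (LINT x|lebesgue_on V. F1 x + F2 x)" by (rule integral_V_cong) (simp add: F)
  also have "\<dots> = (LINT x|lebesgue_on V. F1 x) + (LINT x|lebesgue_on V. F2 x)"
    by (rule Bochner_Integration.integral_add[OF Q1(1) Q2(1)])
  also have "\<dots> = - ((LINT x|lebesgue_on V. G1 x) + (LINT x|lebesgue_on V. G2 x))"
    using Q1(3) Q2(3) by simp
  also have "(LINT x|lebesgue_on V. G1 x) + (LINT x|lebesgue_on V. G2 x) = (LINT x|lebesgue_on V. G1 x + G2 x)"
    by (rule Bochner_Integration.integral_add[OF Q1(2) Q2(2), symmetric])
  also have "\<dots> = (LINT x|lebesgue_on V. remainder \<alpha> e x)" by (rule integral_V_cong) (simp add: G)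
  finally show "(LINT x|lebesgue_on V. tested e x) = - (LINT x|lebesgue_on V. remainder \<alpha> e x)" .
qed

subsection \<open>The two estimates\<close>

text \<open>The integrand is nonnegative, and bounded below on the set provided by \<open>near_boundary_measure\<close>.\<close>

lemma tested_lower:
  obtains k e0 where "k > 0" "e0 > 0" "\<And>e. 0 < e \<Longrightarrow> e < e0 \<Longrightarrow> integrable (lebesgue_on V) (tested e) \<Longrightarrow>
    k * e \<le> (LINT x|lebesgue_on V. tested e x)"
proof -
  obtain c e0 where c: "c > 0" "0 < e0" "e0 \<le> 1" and A: "\<And>e. 0 < e \<Longrightarrow> e < e0 \<Longrightarrow> \<exists>A\<in>lmeasurable. A \<subseteq> CH2 \<and> c * e \<le> measure lebesgue A \<and>
    (\<forall>x\<in>A. cmod (wc x - w0) \<le> \<delta> / 2 \<and> \<bar>ss x - s0\<bar> \<le> \<delta> / 2 \<and> 5 / 4 * e \<le> rho x \<and> rho x \<le> 7 / 4 * e)"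
    by (rule near_boundary_measure[OF delta, of w0 s0]) (rule that)
  define k where "k = 1 / 64 * (flat_exp (3 / 16) * (flat_exp (\<delta>\<^sup>2 / 2) * (exp (- 6) / 2)))"
  have k: "k > 0" unfolding k_def using delta by (intro mult_pos_pos) (auto simp: flat_exp_pos_iff)
  have t0: "0 \<le> tested e x" for e x
    unfolding tested_def weight_def slab_def bump_def by (intro mult_nonneg_nonneg flat_exp_nonneg) auto
  have "k * c * e \<le> (LINT x|lebesgue_on V. tested e x)" if e: "0 < e" "e < e0" and i: "integrable (lebesgue_on V) (tested e)" for e
  proof -
    obtain A where A: "A \<in> lmeasurable" "A \<subseteq> CH2" "c * e \<le> measure lebesgue A"
      "\<And>x. x \<in> A \<Longrightarrow> cmod (wc x - w0) \<le> \<delta> / 2 \<and> \<bar>ss x - s0\<bar> \<le> \<delta> / 2 \<and> 5 / 4 * e \<le> rho x \<and> rho x \<le> 7 / 4 * e"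
      using A[OF e] by blast
    have AV: "A \<subseteq> V"
    proof
      fix x assume x: "x \<in> A"
      show "x \<in> V" by (rule box_V) (use A(2) A(4)[OF x] x delta in auto)
    qed
    have low: "k \<le> tested e x" if x: "x \<in> A" for x
    proof -
      note a = A(4)[OF x]
      have xC: "x \<in> CH2" using A(2) x by blast
      have "3 / 16 \<le> 1 / e\<^sup>2 * ((rho x - e) * (2 * e - rho x))"
      proof -
        have "0 \<le> (rho x - 5 / 4 * e) * (7 / 4 * e - rho x)" using a by (intro mult_nonneg_nonneg) auto
        then have "3 / 16 * e\<^sup>2 \<le> (rho x - e) * (2 * e - rho x)" by (simp add: algebra_simps power2_eq_square)
        then show ?thesis using e by (simp add: field_simps)
      qed
      then have 1: "flat_exp (3 / 16) \<le> slab e x" unfolding slab_def by (rule flat_exp_mono)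
      have 2: "flat_exp (\<delta>\<^sup>2 / 2) \<le> bump x" unfolding bump_def gap_def
      proof (rule flat_exp_mono)
        have "(cmod (wc x - w0))\<^sup>2 \<le> (\<delta> / 2)\<^sup>2" using a by (intro power_mono) auto
        moreover have "\<bar>ss x - s0\<bar>\<^sup>2 \<le> (\<delta> / 2)\<^sup>2" using a by (intro power_mono) auto
        moreover have "(\<delta> / 2)\<^sup>2 = \<delta>\<^sup>2 / 4" by (simp add: power_divide)
        ultimately show "\<delta>\<^sup>2 / 2 \<le> \<delta>\<^sup>2 - (cmod (wc x - w0))\<^sup>2 - (ss x - s0)\<^sup>2" unfolding power2_abs by linarith
      qed
      have 3: "exp (- 6) / 2 \<le> exp (- 3 * rho x) / 2" using a e c by simp
      show ?thesis unfolding k_def tested_def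
        by (intro mult_mono 1 2 3 weight_ge[OF xC]) (auto simp: flat_exp_nonneg slab_def bump_def weight_def)
    qed
    have ind: "indicator V x * (k * indicator A x) = k * indicator A x" for x :: C2
      using AV by (auto simp: indicator_def)
    have iA: "integrable lebesgue (\<lambda>x. k * indicator A x)"
      using A(1) by (intro integrable_mult_right integrable_real_indicator) (auto simp: fmeasurable_def)
    have mA: "(LINT x|lebesgue. k * indicator A x) = k * measure lebesgue A"
      using A(1) by (simp add: fmeasurable_def)
    have "k * (c * e) \<le> k * measure lebesgue A" using A(3) k by (intro mult_left_mono) auto
    also have "\<dots> = (LINT x|lebesgue_on V. k * indicator A x)"
      by (simp only: lebesgue_on_integral(1)[OF V_sets] ind mA)
    also have "\<dots> \<le> (LINT x|lebesgue_on V. tested e x)"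
    proof (rule integral_mono[OF _ i])
      show "integrable (lebesgue_on V) (\<lambda>x. k * indicator A x)"
        using lebesgue_on_integral(2)[OF V_sets, of "\<lambda>x. k * indicator A x"] iA by (simp add: ind)
      show "k * indicator A x \<le> tested e x" for x using low[of x] t0[of e x] by (cases "x \<in> A") auto
    qed
    finally show ?thesis by (simp add: mult.assoc)
  qed
  then show ?thesis using that[of "k * c" e0] k c by simp
qed

lemma horizontal_bound:
  assumes x: "x \<in> V" and L: "alternating 1 L" and e: "0 < e" "e \<le> rho x"
  shows "\<bar>ev1 L (frame x 1 0)\<bar> + \<bar>ev1 L (frame x \<i> 0)\<bar> \<le> e powr (- 1 / 2) * frame_norm 1 x L"
proof -
  note l = alternating_1D(2)[OF L]
  have o: "orthoframe x (1, 0) = sqrt (rho x) *\<^sub>R frame x 1 0" "orthoframe x (\<i>, 0) = sqrt (rho x) *\<^sub>R frame x \<i> 0"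
    by (simp_all add: orthoframe_def frame_def cscale_def prod_eq_iff scaleR_conv_of_real algebra_simps)
  have "\<bar>ev1 L (orthoframe x (1, 0))\<bar> + \<bar>ev1 L (orthoframe x (\<i>, 0))\<bar> \<le> frame_norm 1 x L"
    by (simp add: frame_norm_def Basis_C2)
  then have "sqrt (rho x) * (\<bar>ev1 L (frame x 1 0)\<bar> + \<bar>ev1 L (frame x \<i> 0)\<bar>) \<le> frame_norm 1 x L"
    unfolding o linear_cmul[OF l] using V_rho[OF x] by (simp add: abs_mult distrib_left)
  moreover have "sqrt e * (\<bar>ev1 L (frame x 1 0)\<bar> + \<bar>ev1 L (frame x \<i> 0)\<bar>) \<le> sqrt (rho x) * (\<bar>ev1 L (frame x 1 0)\<bar> + \<bar>ev1 L (frame x \<i> 0)\<bar>)"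
    using e by (intro mult_right_mono) auto
  ultimately have "sqrt e * (\<bar>ev1 L (frame x 1 0)\<bar> + \<bar>ev1 L (frame x \<i> 0)\<bar>) \<le> frame_norm 1 x L" by linarith
  then have "e powr (- 1 / 2) * (sqrt e * (\<bar>ev1 L (frame x 1 0)\<bar> + \<bar>ev1 L (frame x \<i> 0)\<bar>)) \<le> e powr (- 1 / 2) * frame_norm 1 x L"
    by (intro mult_left_mono) auto
  moreover have "e powr (- 1 / 2) * sqrt e = 1" using e by (simp add: powr_half_sqrt[symmetric] powr_add[symmetric])
  ultimately show ?thesis by (simp only: mult.assoc[symmetric]) simp
qed

lemma coefficient_bound:
  obtains M where "M \<ge> 0" "\<And>x. x \<in> cylinder {0..1} \<Longrightarrow> \<bar>weight x * fd corr x (frame x 1 0)\<bar> \<le> M"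
    "\<And>x. x \<in> cylinder {0..1} \<Longrightarrow> \<bar>weight x * (fd bump x (frame x 0 (\<i> / 2)) + fd corr x (frame x \<i> 0))\<bar> \<le> M"
proof -
  have K: "compact (cylinder {0..1})" "cylinder {0..1} \<subseteq> S0" using cylinder_compact[of "{0..1}"] cylinder_S0[of "{0..1}"] by auto
  have bd: "\<exists>M. \<forall>x\<in>cylinder {0..1}. \<bar>f x\<bar> \<le> M" if "smooth_on S0 f" for f
  proof -
    have "compact (f ` cylinder {0..1})"
      by (rule compact_continuous_image[OF continuous_on_subset[OF smooth_on_continuous[OF that] K(2)] K(1)])
    from compact_imp_bounded[OF this] show ?thesis by (auto simp: bounded_iff)
  qed
  have "smooth_on S0 (\<lambda>x. weight x * fd corr x (frame x 1 0))"
    by (intro smooth_on_mult open_S0 smooth_weight smooth_fd_frame smooth_corr)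
  from bd[OF this] obtain M1 where 1: "\<And>x. x \<in> cylinder {0..1} \<Longrightarrow> \<bar>weight x * fd corr x (frame x 1 0)\<bar> \<le> M1" by blast
  have "smooth_on S0 (\<lambda>x. weight x * (fd bump x (frame x 0 (\<i> / 2)) + fd corr x (frame x \<i> 0)))"
    by (intro smooth_on_mult smooth_on_add open_S0 smooth_weight smooth_fd_frame smooth_corr smooth_bump)
  from bd[OF this] obtain M2 where 2: "\<And>x. x \<in> cylinder {0..1} \<Longrightarrow> \<bar>weight x * (fd bump x (frame x 0 (\<i> / 2)) + fd corr x (frame x \<i> 0))\<bar> \<le> M2" by blast
  show ?thesis
  proof (rule that[of "max 0 (max M1 M2)"])
    fix x assume x: "x \<in> cylinder {0..1}"
    show "\<bar>weight x * fd corr x (frame x 1 0)\<bar> \<le> max 0 (max M1 M2)" by (rule order_trans[OF 1[OF x]]) simp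
    show "\<bar>weight x * (fd bump x (frame x 0 (\<i> / 2)) + fd corr x (frame x \<i> 0))\<bar> \<le> max 0 (max M1 M2)" by (rule order_trans[OF 2[OF x]]) simp
  qed simp
qed

text \<open>On the slab the volume density is at least of order \<open>e\<^sup>-\<^sup>3\<close>, so the integral of \<open>|\<alpha>|\<^sup>p\<close> with respect to
  Lebesgue measure is \<open>O(e\<^sup>3)\<close>, and the slab has measure \<open>O(e)\<close>. The exponent \<open>a\<close> balances the two terms of
  Young's inequality.\<close>

lemma remainder_upper:
  assumes p: "p > 2" and a: "\<alpha> \<in> Lp 1 p"
  obtains M where "\<And>e. 0 < e \<Longrightarrow> e < 1 / 8 \<Longrightarrow> integrable (lebesgue_on V) (remainder \<alpha> e) \<Longrightarrow>
    - (LINT x|lebesgue_on V. remainder \<alpha> e x) \<le> M * (e powr (5 / 2 - a) + e powr (1 / 2 + a / (p - 1)))"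
proof -
  obtain M where M: "M \<ge> 0" "\<And>x. x \<in> cylinder {0..1} \<Longrightarrow> \<bar>weight x * fd corr x (frame x 1 0)\<bar> \<le> M"
    "\<And>x. x \<in> cylinder {0..1} \<Longrightarrow> \<bar>weight x * (fd bump x (frame x 0 (\<i> / 2)) + fd corr x (frame x \<i> 0))\<bar> \<le> M"
    by (rule coefficient_bound) (rule that)
  define N where "N x = frame_norm 1 x (\<alpha> x)" for x
  have N0: "N x \<ge> 0" for x by (simp add: N_def frame_norm_def sum_nonneg)
  have iN: "integrable (lebesgue_on V) (\<lambda>x. N x powr p * vol x)"
  proof (rule integrableI_nonneg)
    have "(\<lambda>x. frame_norm 1 x (\<alpha> x)) \<in> borel_measurable (lebesgue_on V)"
      by (rule frame_norm_measurable[OF _ LpD(1,2)[OF a]]) auto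
    then show "(\<lambda>x. N x powr p * vol x) \<in> borel_measurable (lebesgue_on V)" unfolding N_def using vol_measurable by measurable
    show "AE x in lebesgue_on V. 0 \<le> N x powr p * vol x"
      by (rule AE_I2) (use vol_ge_1 V_CH2 in \<open>force simp: space_restrict_space\<close>)
    show "(\<integral>\<^sup>+ x. ennreal (N x powr p * vol x) \<partial>lebesgue_on V) < \<infinity>"
      unfolding N_def by (rule Lp_frame_norm(1)[OF _ a]) (use p in auto)
  qed
  define J where "J = (LINT x|lebesgue_on V. N x powr p * vol x)"
  have J: "J \<ge> 0" unfolding J_def
    by (rule integral_nonneg_AE, rule AE_I2) (use vol_ge_1 V_CH2 in \<open>force simp: space_restrict_space\<close>)
  define C where "C = DIM(C2) * unit_ball_vol (real DIM(C2))"
  have C: "C \<ge> 0" by (simp add: C_def)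
  define b where "b c = c / (p - 1)" for c :: real
  have main: "- (LINT x|lebesgue_on V. remainder \<alpha> e x) \<le> M * (512 * J + 8 * C) * (e powr (5 / 2 - a) + e powr (1 / 2 + b a))"
    if e: "0 < e" "e < 1 / 8" and i: "integrable (lebesgue_on V) (remainder \<alpha> e)" for e a
  proof -
    define Sh where "Sh = {x::C2. 1 - 8 * e \<le> norm x \<and> norm x < 1}"
    define D where "D x = M * e powr (- 1 / 2) * (512 * e powr (3 - a) * (N x powr p * vol x) + e powr b a * indicator Sh x)" for x
    have Sm: "Sh \<in> sets borel" unfolding Sh_def by measurable
    have Sl: "Sh \<in> lmeasurable"
      using Sm by (intro bounded_set_imp_lmeasurable) (auto simp: Sh_def intro: bounded_subset[OF bounded_ball[of 0 1]])
    have iS: "integrable lebesgue (indicator Sh :: C2 \<Rightarrow> real)"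
      using Sl by (intro integrable_real_indicator) (auto simp: fmeasurable_def)
    have iS': "integrable lebesgue (\<lambda>x. indicator V x * indicator Sh x :: real)"
      using integrable_real_mult_indicator[OF V_sets iS] by (simp add: mult.commute)
    have iSV: "integrable (lebesgue_on V) (indicator Sh :: C2 \<Rightarrow> real)"
      using lebesgue_on_integral(2)[OF V_sets, of "indicator Sh"] iS' by simp
    have mS: "(LINT x|lebesgue_on V. indicator Sh x) \<le> C * (8 * e)"
    proof -
      have "(LINT x|lebesgue_on V. (indicator Sh x :: real)) = (LINT x|lebesgue. indicator V x * indicator Sh x)"
        by (rule lebesgue_on_integral(1)[OF V_sets])
      also have "\<dots> \<le> (LINT x|lebesgue. indicator Sh x)"
        by (rule integral_mono[OF iS' iS]) (auto simp: indicator_def)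
      also have "\<dots> = measure lborel Sh" using Sl Sm by (simp add: fmeasurable_def)
      also have "\<dots> \<le> C * (8 * e)" unfolding Sh_def C_def by (rule shell_measure) (use e in auto)
      finally show ?thesis .
    qed
    have pt: "- remainder \<alpha> e x \<le> D x" if x: "x \<in> V" for x
    proof -
      have xC: "x \<in> CH2" and xS: "x \<in> S0" using x V_CH2 V_S0 by auto
      have v: "vol x \<ge> 1" by (rule vol_ge_1[OF xC])
      have D0: "D x \<ge> 0" unfolding D_def using M(1) v by (intro mult_nonneg_nonneg add_nonneg_nonneg) auto
      show ?thesis
      proof (cases "slab e x = 0 \<or> gap x < 0")
        case True
        then have "remainder \<alpha> e x = 0" by (elim disjE) (simp_all add: remainder_def bump_support[OF xS])
        with D0 show ?thesis by simp
      next
        case False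
        then have r: "e \<le> rho x" "rho x \<le> 2 * e" using slab_support[OF e(1)] by auto
        have bx: "x \<in> cylinder {0..1}" using False gap_region[of x] r e V_nu[OF x] by (intro cylinder_mem) auto
        let ?X = "ev1 (\<alpha> x) (frame x 1 0)" and ?Y = "ev1 (\<alpha> x) (frame x \<i> 0)"
        let ?h = "weight x * fd corr x (frame x 1 0)" and ?k = "weight x * (fd bump x (frame x 0 (\<i> / 2)) + fd corr x (frame x \<i> 0))"
        have "remainder \<alpha> e x = slab e x * (?h * ?Y - ?k * ?X)" by (simp add: remainder_def algebra_simps)
        then have "- remainder \<alpha> e x \<le> \<bar>slab e x\<bar> * \<bar>?h * ?Y - ?k * ?X\<bar>" using abs_ge_minus_self[of "remainder \<alpha> e x"] by (simp add: abs_mult)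
        also have "\<dots> \<le> 1 * \<bar>?h * ?Y - ?k * ?X\<bar>"
          using flat_exp_nonneg flat_exp_le_1 by (intro mult_right_mono) (auto simp: slab_def)
        also have "\<dots> \<le> \<bar>?h\<bar> * \<bar>?Y\<bar> + \<bar>?k\<bar> * \<bar>?X\<bar>" using abs_triangle_ineq4[of "?h * ?Y" "?k * ?X"] by (simp add: abs_mult)
        also have "\<dots> \<le> M * \<bar>?Y\<bar> + M * \<bar>?X\<bar>" using M(2,3)[OF bx] by (intro add_mono mult_right_mono) auto
        also have "\<dots> = M * (\<bar>?X\<bar> + \<bar>?Y\<bar>)" by (simp add: algebra_simps)
        also have "\<dots> \<le> M * (e powr (- 1 / 2) * N x)"
          using horizontal_bound[OF x LpD(1)[OF \<open>\<alpha> \<in> Lp 1 p\<close> x] e(1) r(1)] M(1) unfolding N_def by (intro mult_left_mono)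
        also have "N x \<le> e powr (- a) * N x powr p + e powr b a" unfolding b_def by (rule young_split[OF N0 e(1)]) (use p in simp)
        finally have 1: "- remainder \<alpha> e x \<le> M * (e powr (- 1 / 2) * (e powr (- a) * N x powr p + e powr b a))"
          using M(1) by (simp add: mult_left_mono)
        have nn: "(cmod (nu x))\<^sup>2 \<le> 4" using power_mono[OF cmod_nu_le[OF xC], of 2] by simp
        have Dx: "1 - (norm x)\<^sup>2 \<le> 8 * e"
        proof -
          have "rho x * (cmod (nu x))\<^sup>2 \<le> 2 * e * 4" using r nn e V_rho[OF x] by (intro mult_mono) auto
          then show ?thesis using rho_eq[OF V_nu[OF x]] by simp
        qed
        have Dp: "1 - (norm x)\<^sup>2 > 0" using xC by (simp add: CH2_def abs_square_less_1)
        have "x \<in> Sh"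
        proof -
          have n1: "norm x < 1" using xC by (simp add: CH2_def)
          then have "norm x * norm x \<le> norm x" by (simp add: mult_left_le)
          then show ?thesis using Dx n1 by (simp add: Sh_def power2_eq_square)
        qed
        have "(1 - (norm x)\<^sup>2) ^ 3 \<le> (8 * e) ^ 3" using Dx Dp by (intro power_mono) auto
        then have "1 \<le> 512 * e ^ 3 * vol x" unfolding vol_eq[OF xC] using Dp by (simp add: power_mult_distrib field_simps)
        then have "e powr (- a) * N x powr p * 1 \<le> e powr (- a) * N x powr p * (512 * e ^ 3 * vol x)" by (intro mult_left_mono) auto
        also have "\<dots> = 512 * e powr (3 - a) * (N x powr p * vol x)"
          using e by (simp add: powr_diff powr_minus powr_numeral field_simps)
        finally have 2: "e powr (- a) * N x powr p \<le> 512 * e powr (3 - a) * (N x powr p * vol x)" by simp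
        have "M * (e powr (- 1 / 2) * (e powr (- a) * N x powr p + e powr b a)) \<le> D x"
          unfolding D_def mult.assoc[of M] using 2 M(1) \<open>x \<in> Sh\<close> by (intro mult_left_mono) auto
        with 1 show ?thesis by linarith
      qed
    qed
    have "- (LINT x|lebesgue_on V. remainder \<alpha> e x) = (LINT x|lebesgue_on V. - remainder \<alpha> e x)" by simp
    also have "\<dots> \<le> (LINT x|lebesgue_on V. D x)"
    proof (rule integral_mono)
      show "integrable (lebesgue_on V) (\<lambda>x. - remainder \<alpha> e x)" using i by simp
      show "integrable (lebesgue_on V) D" unfolding D_def
        by (intro integrable_mult_right Bochner_Integration.integrable_add iN iSV)
      show "- remainder \<alpha> e x \<le> D x" if "x \<in> space (lebesgue_on V)" for x using that pt by (simp add: space_restrict_space)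
    qed
    also have "\<dots> = M * e powr (- 1 / 2) * (512 * e powr (3 - a) * J + e powr b a * (LINT x|lebesgue_on V. indicator Sh x))"
      unfolding D_def J_def using iN iSV by simp
    also have "\<dots> \<le> M * e powr (- 1 / 2) * (512 * e powr (3 - a) * J + e powr b a * (C * (8 * e)))"
      using mS M(1) by (intro mult_left_mono add_left_mono) auto
    also have "\<dots> = M * (512 * J * e powr (5 / 2 - a) + 8 * C * e powr (1 / 2 + b a))"
    proof -
      have "e powr (- 1 / 2) * e powr (3 - a) = e powr (5 / 2 - a)" by (simp add: powr_add[symmetric])
      moreover have "e powr (- 1 / 2) * (e powr b a * e) = e powr (1 / 2 + b a)"
      proof -
        have "e powr (- 1 / 2) * (e powr b a * e powr 1) = e powr (1 / 2 + b a)" by (simp only: powr_add[symmetric]) simp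
        then show ?thesis using e by simp
      qed
      ultimately have "M * (512 * J * e powr (5 / 2 - a) + 8 * C * e powr (1 / 2 + b a)) =
          M * (512 * J * (e powr (- 1 / 2) * e powr (3 - a)) + 8 * C * (e powr (- 1 / 2) * (e powr b a * e)))" by simp
      then show ?thesis by (simp add: algebra_simps)
    qed
    also have "\<dots> \<le> M * ((512 * J + 8 * C) * e powr (5 / 2 - a) + (512 * J + 8 * C) * e powr (1 / 2 + b a))"
      using M(1) J C by (intro mult_left_mono add_mono mult_right_mono) auto
    finally show ?thesis by (simp only: distrib_left[symmetric] mult.assoc)
  qed
  show ?thesis by (rule that[of "M * (512 * J + 8 * C)"]) (rule main[unfolded b_def])
qed

text \<open>With \<open>a = (p + 2) / 4\<close> both exponents of the upper bound, \<open>5 / 2 - a\<close> and \<open>1 / 2 + a / (p - 1)\<close>,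
  exceed \<open>1\<close>, the exponent of the lower bound; this needs \<open>p < 4\<close>.\<close>

lemma nonvanishing:
  assumes p: "2 < p" "p < 4" and a: "\<alpha> \<in> Lp 1 p"
  shows "\<not> weak 1 \<alpha> (wedge 1 1 (dform (\<lambda>x. (u x)\<^sup>2)) (dform wfun))"
proof
  assume w: "weak 1 \<alpha> (wedge 1 1 (dform (\<lambda>x. (u x)\<^sup>2)) (dform wfun))"
  let ?W = "wedge 1 1 (dform (\<lambda>x. (u x)\<^sup>2)) (dform wfun)"
  define \<beta> where "\<beta> x v = \<alpha> x v + (- 2) * (u x * al0 x v)" for x v
  have \<beta>: "\<beta> \<in> Lp 1 p" unfolding \<beta>_def by (rule Lp_lincomb[OF _ a u_al0_Lp]) (use p in auto)
  have c: "continuous_on V (\<lambda>x. ?W x v)" "continuous_on V (\<lambda>x. wedge 1 1 (dform u) al0 x v)" for v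
  proof -
    have s: "smooth_on S0 (\<lambda>x. (u x)\<^sup>2)" by (intro smooth_on_power open_S0 smooth_u)
    have "continuous_on V (\<lambda>x. fd (\<lambda>x. (u x)\<^sup>2) x (v 0) * fd wfun x (v 1) - fd (\<lambda>x. (u x)\<^sup>2) x (v 1) * fd wfun x (v 0))"
      by (intro continuous_intros smooth_continuous_V smooth_on_fd open_S0 s smooth_wfun)
    then show "continuous_on V (\<lambda>x. ?W x v)"
      by (rule continuous_on_cong[THEN iffD1, OF refl, rotated]) (rule wedge_dform[OF s smooth_wfun, symmetric])
    have "continuous_on V (\<lambda>x. fd u x (v 0) * ev1 (al0 x) (v 1) - fd u x (v 1) * ev1 (al0 x) (v 0))"
      unfolding ev1_def by (intro continuous_intros smooth_continuous_V smooth_on_fd open_S0 smooth_u al0_continuous)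
    then show "continuous_on V (\<lambda>x. wedge 1 1 (dform u) al0 x v)"
      by (rule continuous_on_cong[THEN iffD1, OF refl, rotated])
         (simp only: wedge_1_1[of "dform u" _ al0, OF dform_alternating_on[OF open_S0 V_S0 smooth_u] al0_alternating] ev1_dform)
  qed
  have "weak 1 (\<lambda>x v. \<alpha> x v + (- 1) * (2 * (u x * al0 x v))) (\<lambda>x v. ?W x v + (- 1) * (?W x v + 2 * wedge 1 1 (dform u) al0 x v))"
  proof (rule weak_lincomb[OF w weak_u_al0])
    show "L2_form \<alpha>" by (rule Lp_L2_form[OF _ a]) (use p in auto)
    show "L2_form ?W" by (rule L2_form_continuous[OF c(1)])
    show "L2_form (\<lambda>x v. 2 * (u x * al0 x v))"
      by (intro L2_form_continuous continuous_intros smooth_continuous_V smooth_u al0_continuous)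
    show "L2_form (\<lambda>x v. ?W x v + 2 * wedge 1 1 (dform u) al0 x v)"
      by (intro L2_form_continuous continuous_on_add continuous_on_mult_left c)
  qed
  then have wb: "weak 1 \<beta> defect"
    by (rule weak_cong) (simp_all add: \<beta>_def defect_def)
  obtain k e0 where k: "k > 0" "e0 > 0" and low: "\<And>e. 0 < e \<Longrightarrow> e < e0 \<Longrightarrow> integrable (lebesgue_on V) (tested e) \<Longrightarrow>
      k * e \<le> (LINT x|lebesgue_on V. tested e x)"
    by (rule tested_lower) blast
  define a where "a = (p + 2) / 4"
  obtain M where up: "\<And>e. 0 < e \<Longrightarrow> e < 1 / 8 \<Longrightarrow> integrable (lebesgue_on V) (remainder \<beta> e) \<Longrightarrow>
      - (LINT x|lebesgue_on V. remainder \<beta> e x) \<le> M * (e powr (5 / 2 - a) + e powr (1 / 2 + a / (p - 1)))"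
    by (rule remainder_upper[OF p(1) \<beta>]) blast
  define r where "r = 3 / 2 - a"
  define t where "t = a / (p - 1) - 1 / 2"
  have r: "r > 0" using p by (simp add: r_def a_def field_simps)
  have t: "t > 0" using p by (simp add: t_def a_def field_simps)
  have "k \<le> M * (e powr r + e powr t)" if e: "0 < e" "e < min e0 (1 / 8)" for e
  proof -
    note P = tested_pairing[OF less_imp_le[OF p(1)] \<beta> wb e(1)]
    have "k * e \<le> M * (e powr (5 / 2 - a) + e powr (1 / 2 + a / (p - 1)))"
      using low[OF e(1) _ P(1)] up[OF e(1) _ P(2)] P(3) e(2) by simp
    also have "5 / 2 - a = r + 1" by (simp add: r_def)
    also have "1 / 2 + a / (p - 1) = t + 1" by (simp add: t_def)
    also have "M * (e powr (r + 1) + e powr (t + 1)) = M * (e powr r + e powr t) * e"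
      using e by (simp add: powr_add algebra_simps)
    finally show ?thesis using e by simp
  qed
  then have ev: "eventually (\<lambda>e. k \<le> M * (e powr r + e powr t)) (at_right 0)"
    unfolding eventually_at_right_field using k by (intro exI[of _ "min e0 (1 / 8)"]) auto
  have id: "((\<lambda>e::real. e) \<longlongrightarrow> 0) (at_right 0)" by (rule tendsto_ident_at)
  have nn: "eventually (\<lambda>e::real. 0 \<le> e) (at_right 0)"
    unfolding eventually_at_right_field by (intro exI[of _ 1]) auto
  have "((\<lambda>e::real. M * (e powr r + e powr t)) \<longlongrightarrow> M * (0 + 0)) (at_right 0)"
    by (intro tendsto_intros tendsto_zero_powrI[OF id tendsto_const nn] r t)
  then have "k \<le> M * (0 + 0)" by (rule tendsto_lowerbound[OF _ ev]) simp
  then show False using k by simp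
qed

end

section \<open>Conclusion\<close>

context bounded_cone_domain
begin

lemma u_royden: "q > 4 \<Longrightarrow> u \<in> royden_algebra CH2_metric V q"
proof -
  assume q: "q > 4"
  have "u \<in> borel_measurable (lebesgue_on V)"
    by (rule continuous_imp_measurable_on_sets_lebesgue[OF smooth_continuous_V[OF smooth_u] V_sets])
  moreover have "bounded (u ` V)" unfolding bounded_iff using u_bound by (intro exI[of _ B]) auto
  ultimately show ?thesis
    unfolding royden_algebra_def using dform_u_Lp[OF q] weak_dform[OF open_S0 V_S0 smooth_u] by blast
qed

lemma dform_wfun_Omega: "r > 4 \<Longrightarrow> dform wfun \<in> lp_Omega CH2_metric V 1 r"
  unfolding lp_Omega_def using dform_wfun_Lp Lp_zero[of r "Suc 1"] weak_dd_0[OF weak_dform[OF open_S0 V_S0 smooth_wfun]] by force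

lemma zero_closed: "p > 0 \<Longrightarrow> zero_form \<in> lp_closed CH2_metric V 2 p"
  unfolding closed_iff using Lp_zero weak_zero by blast

lemma class_eq_zero_iff:
  assumes p: "p \<ge> 2" and W: "W \<in> lp_closed CH2_metric V 2 p"
  shows "lp_class CH2_metric V 2 p W = lp_class CH2_metric V 2 p zero_form \<longleftrightarrow> (\<exists>\<alpha>\<in>Lp 1 p. weak 1 \<alpha> W)"
proof -
  have two: "(2::nat) = Suc 1" by simp
  have z: "zero_form \<in> lp_closed CH2_metric V 2 p" by (rule zero_closed) (use p in simp)
  have d: "(\<lambda>x v. W x v - zero_form x v) = W" by (simp add: zero_form_def)
  have p0: "p > 0" using p by simp
  have "lp_class CH2_metric V 2 p zero_form = lp_class CH2_metric V 2 p W \<longleftrightarrow> (zero_form, W) \<in> cohomologous CH2_metric V 2 p"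
    using lp_class_eq_iff[OF p order_refl z[unfolded two] W[unfolded two]] by (simp only: two)
  also have "\<dots> \<longleftrightarrow> (\<exists>\<alpha>\<in>Lp 1 p. weak 1 \<alpha> W)"
    using cohomologous_iff[OF p0 order_refl, of zero_form W] z W by (simp only: two d simp_thms)
  finally show ?thesis by (simp only: eq_commute[of "lp_class CH2_metric V 2 p W"])
qed

lemma cup_u_wfun:
  assumes p: "p > 2"
  shows "cup_product CH2_metric V 1 1 p (lp_class CH2_metric V 1 (2 * p) (royden_differential CH2_metric V (2 * p) u))
      (lp_class CH2_metric V 1 (2 * p) (dform wfun)) = lp_class CH2_metric V 2 p zero_form"
proof -
  have L: "dform u \<in> Lp 1 (2 * p)" "dform wfun \<in> Lp 1 (2 * p)" by (rule dform_u_Lp dform_wfun_Lp, use p in simp)+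
  have "wedge 1 1 (dform u) (dform wfun) \<in> lp_closed CH2_metric V 2 p"
    by (rule wedge_dform_closed[OF _ open_S0 V_S0 smooth_u smooth_wfun L]) (use p in simp)
  then have "lp_class CH2_metric V 2 p (wedge 1 1 (dform u) (dform wfun)) = lp_class CH2_metric V 2 p zero_form"
    using class_eq_zero_iff[of p "wedge 1 1 (dform u) (dform wfun)"] al0_Lp[OF p] weak_al0 p by auto
  with cup_product_eq[OF _ open_S0 V_S0 smooth_u smooth_wfun L] p show ?thesis by simp
qed

end

lemma (in fat_cone) cup_u_square_wfun:
  assumes p: "2 < p" "p < 4"
  shows "cup_product CH2_metric V 1 1 p (lp_class CH2_metric V 1 (2 * p) (royden_differential CH2_metric V (2 * p) (\<lambda>x. (u x)\<^sup>2)))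
      (lp_class CH2_metric V 1 (2 * p) (dform wfun)) \<in> lp_cohomology CH2_metric V 2 p - {lp_class CH2_metric V 2 p zero_form}"
proof -
  let ?W = "wedge 1 1 (dform (\<lambda>x. (u x)\<^sup>2)) (dform wfun)"
  have s: "smooth_on S0 (\<lambda>x. (u x)\<^sup>2)" by (intro smooth_on_power open_S0 smooth_u)
  have L: "dform (\<lambda>x. (u x)\<^sup>2) \<in> Lp 1 (2 * p)" "dform wfun \<in> Lp 1 (2 * p)"
    by (rule dform_u_square_Lp dform_wfun_Lp, use p in simp)+
  have W: "?W \<in> lp_closed CH2_metric V 2 p"
    by (rule wedge_dform_closed[OF _ open_S0 V_S0 s smooth_wfun L]) (use p in simp)
  have "lp_class CH2_metric V 2 p ?W \<noteq> lp_class CH2_metric V 2 p zero_form"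
    using class_eq_zero_iff[OF less_imp_le[OF p(1)] W] nonvanishing[OF p] by blast
  moreover have "lp_class CH2_metric V 2 p ?W \<in> lp_cohomology CH2_metric V 2 p"
    unfolding lp_class_def lp_cohomology_def by (rule quotientI[OF W])
  ultimately show ?thesis using cup_product_eq[OF less_imp_le[OF p(1)] open_S0 V_S0 s smooth_wfun L] by simp
qed

context boundary_point
begin

lemma dform_smooth_closed:
  assumes f: "smooth_on S0 f" shows "smooth_closed_form CH2 1 (dform f)"
  unfolding smooth_closed_form_def
proof (intro conjI ballI allI)
  fix x v assume "x \<in> CH2"
  then have x: "x \<in> S0" using ball_S0 by blast
  show "alternating 1 (dform f x)" by (rule dform_alternating[OF smooth_on_differentiable[OF open_S0 f x]])
  show "ext_deriv 1 (dform f) x v = 0"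
    using mixed_partials_commute[OF open_S0 f x, of "v 0" "v 1"] by (simp add: ext_deriv_def dform_def omit_values)
next
  show "smooth_on CH2 (\<lambda>x. dform f x v)" for v
    unfolding dform_def by (rule smooth_on_subset[OF smooth_on_fd[OF open_S0 f] ball_S0])
qed

lemma cone_contains_cylinder:
  assumes U: "openin (top_of_set CH2_infinity) U" "\<eta> \<notin> U" "\<xi> \<in> U"
  obtains \<delta> where "\<delta> > 0" "\<And>z. z \<in> CH2 \<Longrightarrow> cmod (wc z - wc \<xi>) \<le> \<delta> \<Longrightarrow> \<bar>ss z - ss \<xi>\<bar> \<le> \<delta> \<Longrightarrow> z \<in> CH2_cone \<eta> U"
proof -
  obtain O' where O: "open O'" "U = CH2_infinity \<inter> O'" using U(1) by (auto simp: openin_open)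
  have sub: "U \<subseteq> CH2_infinity" using O by blast
  have \<xi>: "norm \<xi> = 1" "\<xi> \<noteq> \<eta>" using U sub by (auto simp: CH2_infinity_def)
  define g where "g y = chart (fst y, snd y, 0)" for y
  have g: "continuous_on UNIV g" unfolding g_def
    by (rule continuous_on_compose2[OF chart_continuous]) (auto intro!: continuous_intros)
  have bd: "bd z = g (wc z, ss z)" for z by (simp add: g_def bd_def chart_def nbd_def)
  have "bd \<xi> = \<xi>" by (rule bd_eqI[OF \<xi>]) auto
  then have "(wc \<xi>, ss \<xi>) \<in> g -` O'" using U(3) O(2) bd[of \<xi>] by auto
  moreover have "open (g -` O')" by (rule open_vimage[OF O(1) g])
  ultimately obtain r where r: "r > 0" "ball (wc \<xi>, ss \<xi>) r \<subseteq> g -` O'" using openE by blast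
  have "z \<in> CH2_cone \<eta> U" if z: "z \<in> CH2" "cmod (wc z - wc \<xi>) \<le> r / 3" "\<bar>ss z - ss \<xi>\<bar> \<le> r / 3" for z
  proof -
    have "norm ((wc z, ss z) - (wc \<xi>, ss \<xi>)) \<le> cmod (wc z - wc \<xi>) + \<bar>ss z - ss \<xi>\<bar>"
      using norm_Pair_le[of "wc z - wc \<xi>" "ss z - ss \<xi>"] by simp
    then have "dist (wc \<xi>, ss \<xi>) (wc z, ss z) < r" using z r(1) unfolding dist_norm norm_minus_commute[of "(wc \<xi>, ss \<xi>)"] by linarith
    then have "(wc z, ss z) \<in> ball (wc \<xi>, ss \<xi>) r" by simp
    then have "bd z \<in> O'" using r(2) bd[of z] by auto
    then have "bd z \<in> U" using O(2) bd_sphere by blast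
    then show ?thesis unfolding cone_eq[OF sub U(2)] using z(1) by blast
  qed
  then show ?thesis using that[of "r / 3"] r(1) by simp
qed

end

theorem mainTheorem3:
  fixes p q r :: real and \<eta> :: "complex \<times> complex"
  assumes "2 < p" and "p < 4" and "q = 2 * p" and "r = 2 * p"
    and "\<eta> \<in> CH2_infinity"
  shows "\<exists>(\<omega> :: (complex \<times> complex) form) (u :: complex \<times> complex \<Rightarrow> real).
    smooth_closed_form CH2 1 \<omega> \<and>
    (\<forall>U V. openin (top_of_set CH2_infinity) U \<and> U \<noteq> {} \<and> \<eta> \<notin> closure U \<and> V = CH2_cone \<eta> U \<longrightarrow>
       \<omega> \<in> lp_Omega CH2_metric V 1 r \<and>
       u \<in> royden_algebra CH2_metric V q \<and>
       cup_product CH2_metric V 1 1 p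
         (lp_class CH2_metric V 1 q (royden_differential CH2_metric V q u))
         (lp_class CH2_metric V 1 r \<omega>)
       = lp_class CH2_metric V 2 p zero_form \<and>
       cup_product CH2_metric V 1 1 p
         (lp_class CH2_metric V 1 q (royden_differential CH2_metric V q (\<lambda>x. (u x)\<^sup>2)))
         (lp_class CH2_metric V 1 r \<omega>)
       \<in> lp_cohomology CH2_metric V 2 p - {lp_class CH2_metric V 2 p zero_form})"
proof -
  interpret boundary_point \<eta> by unfold_locales (use assms(5) in \<open>simp add: CH2_infinity_def\<close>)
  show ?thesis
  proof (rule exI[of _ "dform wfun"], rule exI[of _ u], rule conjI, rule dform_smooth_closed[OF smooth_wfun], intro allI impI)
    fix U V assume "openin (top_of_set CH2_infinity) U \<and> U \<noteq> {} \<and> \<eta> \<notin> closure U \<and> V = CH2_cone \<eta> U"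
    then have U: "openin (top_of_set CH2_infinity) U" "U \<noteq> {}" "\<eta> \<notin> closure U" and V: "V = CH2_cone \<eta> U" by blast+
    have sub: "U \<subseteq> CH2_infinity" using openin_imp_subset[OF U(1)] .
    have \<eta>: "\<eta> \<notin> U" using U(3) closure_subset by blast
    obtain B where B: "B \<ge> 1" "\<And>z. z \<in> CH2_cone \<eta> U \<Longrightarrow> cmod (wc z) \<le> B \<and> \<bar>ss z\<bar> \<le> B"
      by (rule cone_bounded[OF sub U(3)]) (rule that)
    obtain \<xi> where \<xi>: "\<xi> \<in> U" using U(2) by blast
    obtain \<delta> where \<delta>: "\<delta> > 0" "\<And>z. z \<in> CH2 \<Longrightarrow> cmod (wc z - wc \<xi>) \<le> \<delta> \<Longrightarrow> \<bar>ss z - ss \<xi>\<bar> \<le> \<delta> \<Longrightarrow> z \<in> CH2_cone \<eta> U"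
      by (rule cone_contains_cylinder[OF U(1) \<eta> \<xi>]) (rule that)
    interpret C: fat_cone \<eta> V B "wc \<xi>" "ss \<xi>" \<delta>
      using B \<delta> cone_open[OF U(1) \<eta>] cone_eq[OF sub \<eta>] by unfold_locales (auto simp: V)
    have "2 * p > 4" using assms(1) by simp
    then show "dform wfun \<in> lp_Omega CH2_metric V 1 r \<and>
       u \<in> royden_algebra CH2_metric V q \<and>
       cup_product CH2_metric V 1 1 p
         (lp_class CH2_metric V 1 q (royden_differential CH2_metric V q u))
         (lp_class CH2_metric V 1 r (dform wfun))
       = lp_class CH2_metric V 2 p zero_form \<and>
       cup_product CH2_metric V 1 1 p
         (lp_class CH2_metric V 1 q (royden_differential CH2_metric V q (\<lambda>x. (u x)\<^sup>2)))
         (lp_class CH2_metric V 1 r (dform wfun))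
       \<in> lp_cohomology CH2_metric V 2 p - {lp_class CH2_metric V 2 p zero_form}"
      unfolding assms(3,4)
      by (intro conjI C.dform_wfun_Omega C.u_royden C.cup_u_wfun C.cup_u_square_wfun assms(1,2))
  qed
qed

end
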